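(* Let $d_0,d_1,d_2\ge 2$ be integers and let $X\subseteq\mathbb{K}^3$ be the Pham--Brieskorn surface $x_0^{d_0}+x_1^{d_1}+x_2^{d_2}=0$. Put $d=\gcd(d_0,d_1,d_2)$, $d_{ij}=\gcd(d_i/d,d_j/d)$, $\tilde d=d\,d_{01}d_{02}d_{12}$, $\bar d=\mathrm{lcm}(d_0,d_1,d_2)$, $f=(\bar d/d_0,\bar d/d_1,\bar d/d_2)$, and let $s=(s_0,s_1,s_2)\in\mathbb{Z}^3$ be a vector with $s_0\bar d/d_0+s_1\bar d/d_1+s_2\bar d/d_2=1$. Let the one-dimensional torus $T=\mathbb{K}^\times$ act on $X$ by $$t\cdot(x_0,x_1,x_2)=(t^{\bar d/d_0}x_0,\,t^{\bar d/d_1}x_1,\,t^{\bar d/d_2}x_2).$$ Let $Y$ be the curve $w_0^{\tilde d/d_{12}}+w_1^{\tilde d/d_{02}}+w_2^{\tilde d/d_{01}}=0$ in the weighted projective space $\mathbb{P}(d_{12},d_{02},d_{01})$ (coordinates $w_0,w_1,w_2$ of weights $d_{12},d_{02},d_{01}$), and for $i=0,1,2$ let $D_i=Y\cap\{w_i=0\}$, regarded as a divisor on $Y$ (the sum of its points, each with coefficient one). Put $$\Delta_0=\Big[s_0\tfrac{d\,d_{01}d_{02}}{d_0},+\infty\Big),\quad \Delta_1=\Big[s_1\tfrac{d\,d_{01}d_{12}}{d_1},+\infty\Big),\quad \Delta_2=\Big[s_2\tfrac{d\,d_{02}d_{12}}{d_2},+\infty\Big)$$ (intervals in $\mathbb{Q}$).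 Then, with $\sigma=\mathbb{Q}_{\ge0}$, $$\mathfrak{D}=\Delta_0\cdot D_0+\Delta_1\cdot D_1+\Delta_2\cdot D_2$$ is a proper $\sigma$-polyhedral divisor on $Y$ corresponding to the action of $T$ on $X$.
   Context: $\mathbb{K}$ is an algebraically closed field of characteristic $0$. Here the one-parameter subgroup lattice of $T$ is $N=\mathbb{Z}$ (its generator $1$ corresponding to the vector $f$), $M=\mathrm{Hom}(N,\mathbb{Z})=\mathbb{Z}$, $N_{\mathbb{Q}}=M_{\mathbb{Q}}=\mathbb{Q}$, and $\mathbb{K}[X]$ is $M$-graded by $\deg x_i=\bar d/d_i$. Polyhedral divisors. Let $\sigma\subseteq N_{\mathbb{Q}}$ be a polyhedral cone with dual cone $\sigma^\vee\subseteq M_{\mathbb{Q}}$ (for $\sigma=\mathbb{Q}_{\ge0}$, $\sigma^\vee=\mathbb{Q}_{\ge0}$). The recession cone of a polyhedron is the cone of directions of rays contained in it. On a normal variety $Y$, consider finite formal sums $\mathfrak{D}=\sum_i\Delta_i\cdot D_i$ with $D_i$ Weil divisors on $Y$ and $\Delta_i\subseteq N_{\mathbb{Q}}$ polyhedra with recession cone $\sigma$. For $u\in\sigma^\vee$ put $\mathfrak{D}(u)=\sum_i\min_{v\in\Delta_i}\langle u,v\rangle\cdot D_i$, a rational Weil divisor. For a rational Weil divisor $D$ let $\Gamma(Y,\mathcal{O}(D))=\{g\in\mathbb{K}(Y)^\times\mid (g)+D\ge 0\}\cup\{0\}$, and for $0\ne g\in\Gamma(Y,\mathcal{O}(D))$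 put $Y_g=Y\setminus\mathrm{Supp}(D+(g))$. $D$ is semiample if for some $m\in\mathbb{Z}_{>0}$ the sets $Y_g$, $0\neq g\in\Gamma(Y,\mathcal{O}(mD))$, cover $Y$; $D$ is big if for some $m\in\mathbb{Z}_{>0}$ there is $0\neq g\in\Gamma(Y,\mathcal{O}(mD))$ with $Y_g$ affine. $\mathfrak{D}$ is a proper $\sigma$-polyhedral divisor (pp-divisor) if $\mathfrak{D}(u)$ is $\mathbb{Q}$-Cartier and semiample for all $u\in\sigma^\vee$, and big for all $u$ in the relative interior of $\sigma^\vee$. The pp-divisor $\mathfrak{D}$ on a projective normal variety $Y$ corresponds to the $T$-action on the normal affine variety $X$ if there is an isomorphism of $M$-graded algebras $\mathbb{K}[X]\cong\bigoplus_{m\in\sigma^\vee\cap M}\Gamma(Y,\mathcal{O}(\mathfrak{D}(m)))$, where multiplication on the right is that of $\mathbb{K}(Y)$. *)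

theory Defs
  imports
    "HOL-Analysis.Abstract_Topology"
    "HOL-Computational_Algebra.Polynomial"
    "HOL-Algebra.Module"
    "HOL-Algebra.QuotRing"
    "HOL-Library.FuncSet"
begin

section \<open>Polynomial functions and the Zariski topology\<close>

text \<open>
  A point of \<open>K^n\<close> is a list of length \<open>n\<close>. All ground fields used below are infinite, so
  polynomials are identified with polynomial functions. Exponents are functions \<open>nat \<Rightarrow> nat\<close> of
  which only the values below \<open>n\<close> matter.
\<close>

definition monomial_fun :: "nat \<Rightarrow> (nat \<Rightarrow> nat) \<Rightarrow> 'k::field list \<Rightarrow> 'k" where
  "monomial_fun n m x = (\<Prod>i<n. x ! i ^ m i)"

definition poly_funs :: "nat \<Rightarrow> ('k::field list \<Rightarrow> 'k) set" where
  "poly_funs n = {\<lambda>x. \<Sum>m\<in>A. c m * monomial_fun n m x | A c. finite A}"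

definition weighted_degree :: "nat list \<Rightarrow> (nat \<Rightarrow> nat) \<Rightarrow> nat" where
  "weighted_degree ws m = (\<Sum>i<length ws. ws ! i * m i)"

definition homogeneous_funs :: "nat list \<Rightarrow> nat \<Rightarrow> ('k::field list \<Rightarrow> 'k) set" where
  "homogeneous_funs ws e =
    {\<lambda>x. \<Sum>m\<in>A. c m * monomial_fun (length ws) m x | A c.
       finite A \<and> (\<forall>m\<in>A. weighted_degree ws m = e)}"

definition zariski :: "nat \<Rightarrow> 'k::field list topology" where
  "zariski n = topology_generated_by {{x. length x = n \<and> p x \<noteq> 0} | p. p \<in> poly_funs n}"


section \<open>Varieties as spaces with functions\<close>

text \<open>
  \<open>reg Y U\<close> collects the functions that are regular on the open set \<open>U\<close>; their values outside
  \<open>U\<close> are irrelevant.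
\<close>

record ('p, 'k) fun_space =
  zar :: "'p topology"
  reg :: "'p set \<Rightarrow> ('p \<Rightarrow> 'k) set"

abbreviation points :: "('p, 'k) fun_space \<Rightarrow> 'p set" where
  "points Y \<equiv> topspace (zar Y)"

definition morphism ::
    "('p, 'k) fun_space \<Rightarrow> ('q, 'k) fun_space \<Rightarrow> ('p \<Rightarrow> 'q) \<Rightarrow> bool" where
  "morphism Y Z \<phi> \<longleftrightarrow> continuous_map (zar Y) (zar Z) \<phi> \<and>
     (\<forall>V f. openin (zar Z) V \<and> f \<in> reg Z V \<longrightarrow> f \<circ> \<phi> \<in> reg Y {x \<in> points Y. \<phi> x \<in> V})"

definition isomorphic :: "('p, 'k) fun_space \<Rightarrow> ('q, 'k) fun_space \<Rightarrow> bool" where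
  "isomorphic Y Z \<longleftrightarrow> (\<exists>\<phi> \<psi>. morphism Y Z \<phi> \<and> morphism Z Y \<psi> \<and>
     (\<forall>x\<in>points Y. \<psi> (\<phi> x) = x) \<and> (\<forall>z\<in>points Z. \<phi> (\<psi> z) = z))"

definition open_subspace :: "('p, 'k) fun_space \<Rightarrow> 'p set \<Rightarrow> ('p, 'k) fun_space" where
  "open_subspace Y U = \<lparr>zar = subtopology (zar Y) U, reg = reg Y\<rparr>"

definition affine_space_on :: "nat \<Rightarrow> 'k::field list set \<Rightarrow> ('k list, 'k) fun_space" where
  "affine_space_on n S =
    \<lparr>zar = subtopology (zariski n) S,
     reg = (\<lambda>U. {f. \<forall>x\<in>U. \<exists>W p q. openin (subtopology (zariski n) S) W \<and> x \<in> W \<and> W \<subseteq> U \<and>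
                  p \<in> poly_funs n \<and> q \<in> poly_funs n \<and>
                  (\<forall>y\<in>W. q y \<noteq> 0 \<and> f y = p y / q y)})\<rparr>"

definition affine_open :: "('p, 'k::field) fun_space \<Rightarrow> 'p set \<Rightarrow> bool" where
  "affine_open Y U \<longleftrightarrow> openin (zar Y) U \<and>
     (\<exists>n S. closedin (zariski n) S \<and> isomorphic (open_subspace Y U) (affine_space_on n S))"

definition irreducible_closed :: "('p, 'k) fun_space \<Rightarrow> 'p set \<Rightarrow> bool" where
  "irreducible_closed Y Z \<longleftrightarrow> closedin (zar Y) Z \<and> Z \<noteq> {} \<and>
     (\<forall>A B. closedin (zar Y) A \<and> closedin (zar Y) B \<and> Z = A \<union> B \<longrightarrow> A = Z \<or> B = Z)"

definition separated :: "('p, 'k::field) fun_space \<Rightarrow> bool" where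
  "separated Y \<longleftrightarrow> (\<forall>n S \<phi> \<psi>. closedin (zariski n) S \<and>
     morphism (affine_space_on n S) Y \<phi> \<and> morphism (affine_space_on n S) Y \<psi> \<longrightarrow>
     closedin (zariski n) {z \<in> S. \<phi> z = \<psi> z})"

definition variety :: "('p, 'k::field) fun_space \<Rightarrow> bool" where
  "variety Y \<longleftrightarrow> irreducible_closed Y (points Y) \<and> separated Y \<and>
     (\<exists>\<U>. finite \<U> \<and> (\<forall>U\<in>\<U>. affine_open Y U) \<and> \<Union>\<U> = points Y)"


subsection \<open>Weighted projective spaces\<close>

text \<open>A point of the weighted projective space is an orbit of the torus, i.e. a set of lists.\<close>

definition orbit :: "nat list \<Rightarrow> 'k::field list \<Rightarrow> 'k list set" where
  "orbit ws x = {map2 (\<lambda>w c. t ^ w * c) ws x | t. t \<noteq> 0}"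

definition punctured :: "nat list \<Rightarrow> 'k::field list set" where
  "punctured ws = {x. length x = length ws \<and> (\<exists>i<length ws. x ! i \<noteq> 0)}"

definition weighted_zariski :: "nat list \<Rightarrow> 'k::field list set topology" where
  "weighted_zariski ws = topology_generated_by
     {orbit ws ` {x \<in> punctured ws. q x \<noteq> 0} | q e. q \<in> homogeneous_funs ws e}"

definition wproj_space_on ::
    "nat list \<Rightarrow> 'k::field list set set \<Rightarrow> ('k list set, 'k) fun_space" where
  "wproj_space_on ws S =
    \<lparr>zar = subtopology (weighted_zariski ws) S,
     reg = (\<lambda>U. {f. \<forall>y\<in>U. \<exists>W e p q. openin (subtopology (weighted_zariski ws) S) W \<and>
                  y \<in> W \<and> W \<subseteq> U \<and> p \<in> homogeneous_funs ws e \<and> q \<in> homogeneous_funs ws e \<and>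
                  (\<forall>z\<in>W. \<forall>x\<in>z. q x \<noteq> 0 \<and> f z = p x / q x)})\<rparr>"

definition wproj_zero_set ::
    "nat list \<Rightarrow> ('k::field list \<Rightarrow> 'k) \<Rightarrow> 'k list set set" where
  "wproj_zero_set ws F = orbit ws ` {x \<in> punctured ws. F x = 0}"

text \<open>
  Weighted projective spaces are themselves projective, so admitting arbitrary positive weights
  here gives the usual class of projective varieties.
\<close>

definition projective_variety :: "('p, 'k::field) fun_space \<Rightarrow> bool" where
  "projective_variety Y \<longleftrightarrow> variety Y \<and>
     (\<exists>ws S. (\<forall>w\<in>set ws. 0 < w) \<and> closedin (weighted_zariski ws) S \<and>
        isomorphic Y (wproj_space_on ws S))"


section \<open>The function field, normality, and orders of vanishing\<close>

definition germ_pairs :: "('p, 'k) fun_space \<Rightarrow> ('p set \<times> ('p \<Rightarrow> 'k)) set" where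
  "germ_pairs Y = {(U, f). openin (zar Y) U \<and> U \<noteq> {} \<and> f \<in> reg Y U}"

definition germ_rel ::
    "('p, 'k) fun_space \<Rightarrow> (('p set \<times> ('p \<Rightarrow> 'k)) \<times> ('p set \<times> ('p \<Rightarrow> 'k))) set" where
  "germ_rel Y = {((U, f), (V, g)). (U, f) \<in> germ_pairs Y \<and> (V, g) \<in> germ_pairs Y \<and>
     (\<exists>W. openin (zar Y) W \<and> W \<noteq> {} \<and> W \<subseteq> U \<inter> V \<and> (\<forall>x\<in>W. f x = g x))}"

type_synonym ('p, 'k) ratfun = "('p set \<times> ('p \<Rightarrow> 'k)) set"

definition ratfun_of :: "('p, 'k) fun_space \<Rightarrow> 'p set \<Rightarrow> ('p \<Rightarrow> 'k) \<Rightarrow> ('p, 'k) ratfun" where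
  "ratfun_of Y U f = germ_rel Y `` {(U, f)}"

definition const_ratfun :: "('p, 'k) fun_space \<Rightarrow> 'k \<Rightarrow> ('p, 'k) ratfun" where
  "const_ratfun Y c = ratfun_of Y (points Y) (\<lambda>_. c)"

definition function_field :: "('p, 'k::field) fun_space \<Rightarrow> ('p, 'k) ratfun ring" where
  "function_field Y =
    \<lparr>carrier = germ_pairs Y // germ_rel Y,
     mult = (\<lambda>a b. \<Union>(U, f)\<in>a. \<Union>(V, g)\<in>b. ratfun_of Y (U \<inter> V) (\<lambda>x. f x * g x)),
     one = const_ratfun Y 1,
     zero = const_ratfun Y 0,
     add = (\<lambda>a b. \<Union>(U, f)\<in>a. \<Union>(V, g)\<in>b. ratfun_of Y (U \<inter> V) (\<lambda>x. f x + g x))\<rparr>"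

text \<open>The local ring along an irreducible closed set \<open>Z\<close>, and its maximal ideal.\<close>

definition local_ring :: "('p, 'k) fun_space \<Rightarrow> 'p set \<Rightarrow> ('p, 'k) ratfun set" where
  "local_ring Y Z = {ratfun_of Y U f | U f. (U, f) \<in> germ_pairs Y \<and> U \<inter> Z \<noteq> {}}"

definition local_max_ideal :: "('p, 'k::field) fun_space \<Rightarrow> 'p set \<Rightarrow> ('p, 'k) ratfun set" where
  "local_max_ideal Y Z = {ratfun_of Y U f | U f.
     (U, f) \<in> germ_pairs Y \<and> U \<inter> Z \<noteq> {} \<and> (\<forall>x\<in>U \<inter> Z. f x = 0)}"

definition integrally_closed_in :: "('a, 'm) ring_scheme \<Rightarrow> 'a set \<Rightarrow> bool" where
  "integrally_closed_in R A \<longleftrightarrow> (\<forall>g\<in>carrier R. \<forall>(n::nat) c. (\<forall>i<n. c i \<in> A) \<and>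
     g [^]\<^bsub>R\<^esub> n \<oplus>\<^bsub>R\<^esub> (\<Oplus>\<^bsub>R\<^esub>i\<in>{..<n}. c i \<otimes>\<^bsub>R\<^esub> g [^]\<^bsub>R\<^esub> i) = \<zero>\<^bsub>R\<^esub> \<longrightarrow> g \<in> A)"

definition normal_variety :: "('p, 'k::field) fun_space \<Rightarrow> bool" where
  "normal_variety Y \<longleftrightarrow> variety Y \<and>
     (\<forall>y\<in>points Y. integrally_closed_in (function_field Y) (local_ring Y {y}))"

text \<open>Irreducible closed subsets of codimension one.\<close>

definition prime_divisor :: "('p, 'k) fun_space \<Rightarrow> 'p set \<Rightarrow> bool" where
  "prime_divisor Y Z \<longleftrightarrow> irreducible_closed Y Z \<and> Z \<noteq> points Y \<and>
     \<not> (\<exists>Z'. irreducible_closed Y Z' \<and> Z \<subset> Z' \<and> Z' \<subset> points Y)"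

text \<open>
  On a normal variety the local ring along a prime divisor \<open>Z\<close> is a discrete valuation ring;
  the order of \<open>g \<noteq> 0\<close> is the \<open>k\<close> with \<open>g = u t^k\<close> for a uniformizer \<open>t\<close> and a unit \<open>u\<close>.
\<close>

definition uniformizer :: "('p, 'k::field) fun_space \<Rightarrow> 'p set \<Rightarrow> ('p, 'k) ratfun \<Rightarrow> bool" where
  "uniformizer Y Z t \<longleftrightarrow>
     local_max_ideal Y Z = (\<lambda>a. t \<otimes>\<^bsub>function_field Y\<^esub> a) ` local_ring Y Z"

definition ord_along :: "('p, 'k::field) fun_space \<Rightarrow> 'p set \<Rightarrow> ('p, 'k) ratfun \<Rightarrow> int" where
  "ord_along Y Z g = (THE k. \<exists>t u. t \<in> local_ring Y Z \<and> uniformizer Y Z t \<and>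
     u \<in> local_ring Y Z \<and> inv\<^bsub>function_field Y\<^esub> u \<in> local_ring Y Z \<and>
     u \<in> Units (function_field Y) \<and>
     g = u \<otimes>\<^bsub>function_field Y\<^esub> (t [^]\<^bsub>function_field Y\<^esub> k))"


section \<open>Weil divisors\<close>

text \<open>A divisor assigns coefficients to the prime divisors; a coefficient function vanishes
  off the prime divisors.\<close>

definition weil_divisor :: "('p, 'k) fun_space \<Rightarrow> ('p set \<Rightarrow> 'a::zero) \<Rightarrow> bool" where
  "weil_divisor Y D \<longleftrightarrow> finite {Z. D Z \<noteq> 0} \<and> (\<forall>Z. D Z \<noteq> 0 \<longrightarrow> prime_divisor Y Z)"

definition point_sum :: "'p set \<Rightarrow> 'p set \<Rightarrow> int" where
  "point_sum S Z = (if \<exists>p\<in>S. Z = {p} then 1 else 0)"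

definition nonzero_ratfuns :: "('p, 'k::field) fun_space \<Rightarrow> ('p, 'k) ratfun set" where
  "nonzero_ratfuns Y = carrier (function_field Y) - {\<zero>\<^bsub>function_field Y\<^esub>}"

definition sections ::
    "('p, 'k::field) fun_space \<Rightarrow> ('p set \<Rightarrow> rat) \<Rightarrow> ('p, 'k) ratfun set" where
  "sections Y D = {g \<in> nonzero_ratfuns Y.
       \<forall>Z. prime_divisor Y Z \<longrightarrow> 0 \<le> of_int (ord_along Y Z g) + D Z} \<union>
     {\<zero>\<^bsub>function_field Y\<^esub>}"

text \<open>The set \<open>Y_g\<close>; it depends on the divisor \<open>D\<close> of which \<open>g\<close> is a section.\<close>

definition nonvanishing_locus ::
    "('p, 'k::field) fun_space \<Rightarrow> ('p set \<Rightarrow> rat) \<Rightarrow> ('p, 'k) ratfun \<Rightarrow> 'p set" where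
  "nonvanishing_locus Y D g =
     points Y - \<Union>{Z. prime_divisor Y Z \<and> D Z + of_int (ord_along Y Z g) \<noteq> 0}"

definition nonzero_sections ::
    "('p, 'k::field) fun_space \<Rightarrow> ('p set \<Rightarrow> rat) \<Rightarrow> ('p, 'k) ratfun set" where
  "nonzero_sections Y D = sections Y D - {\<zero>\<^bsub>function_field Y\<^esub>}"

abbreviation div_mult :: "nat \<Rightarrow> ('p set \<Rightarrow> rat) \<Rightarrow> 'p set \<Rightarrow> rat" where
  "div_mult m D \<equiv> (\<lambda>Z. of_nat m * D Z)"

definition semiample :: "('p, 'k::field) fun_space \<Rightarrow> ('p set \<Rightarrow> rat) \<Rightarrow> bool" where
  "semiample Y D \<longleftrightarrow> (\<exists>m>0. points Y =
     (\<Union>g\<in>nonzero_sections Y (div_mult m D). nonvanishing_locus Y (div_mult m D) g))"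

definition big :: "('p, 'k::field) fun_space \<Rightarrow> ('p set \<Rightarrow> rat) \<Rightarrow> bool" where
  "big Y D \<longleftrightarrow> (\<exists>m>0. \<exists>g\<in>nonzero_sections Y (div_mult m D).
     affine_open Y (nonvanishing_locus Y (div_mult m D) g))"

text \<open>Cartier: locally the divisor of a rational function (in particular integral).\<close>

definition cartier :: "('p, 'k::field) fun_space \<Rightarrow> ('p set \<Rightarrow> rat) \<Rightarrow> bool" where
  "cartier Y D \<longleftrightarrow> (\<forall>y\<in>points Y. \<exists>U. openin (zar Y) U \<and> y \<in> U \<and>
     (\<exists>g\<in>nonzero_ratfuns Y. \<forall>Z. prime_divisor Y Z \<and> Z \<inter> U \<noteq> {} \<longrightarrow>
        D Z = of_int (ord_along Y Z g)))"

definition q_cartier :: "('p, 'k::field) fun_space \<Rightarrow> ('p set \<Rightarrow> rat) \<Rightarrow> bool" where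
  "q_cartier Y D \<longleftrightarrow> (\<exists>m>0. cartier Y (div_mult m D))"


section \<open>Polyhedral divisors over the lattice \<open>N = \<int>\<close>\<close>

definition polyhedron :: "rat set \<Rightarrow> bool" where
  "polyhedron P \<longleftrightarrow> (\<exists>A :: (rat \<times> rat) set. finite A \<and> P = {v. \<forall>(a, b)\<in>A. b \<le> a * v})"

definition polyhedral_cone :: "rat set \<Rightarrow> bool" where
  "polyhedral_cone C \<longleftrightarrow> (\<exists>A :: rat set. finite A \<and> C = {v. \<forall>a\<in>A. 0 \<le> a * v})"

definition recession_cone :: "rat set \<Rightarrow> rat set" where
  "recession_cone P = {v. \<exists>p. \<forall>t\<ge>0. p + t * v \<in> P}"

definition dual_cone :: "rat set \<Rightarrow> rat set" where
  "dual_cone C = {u. \<forall>v\<in>C. 0 \<le> u * v}"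

text \<open>The interior relative to the affine hull, which in dimension one is the union of the
  lines through two (possibly equal) points.\<close>

definition rat_rel_interior :: "rat set \<Rightarrow> rat set" where
  "rat_rel_interior C = {u \<in> C. \<exists>e>0. \<forall>a\<in>C. \<forall>b\<in>C. \<forall>t.
     \<bar>(1 - t) * a + t * b - u\<bar> < e \<longrightarrow> (1 - t) * a + t * b \<in> C}"

text \<open>A formal sum of polyhedra times Weil divisors.\<close>

type_synonym 'p polyhedral_sum = "(rat set \<times> ('p set \<Rightarrow> int)) list"

definition min_pairing :: "rat \<Rightarrow> rat set \<Rightarrow> rat" where
  "min_pairing u P = (LEAST q. q \<in> (\<lambda>v. u * v) ` P)"

definition eval_polyhedral :: "'p polyhedral_sum \<Rightarrow> rat \<Rightarrow> 'p set \<Rightarrow> rat" where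
  "eval_polyhedral \<DD> u Z = (\<Sum>(P, D)\<leftarrow>\<DD>. min_pairing u P * of_int (D Z))"

definition polyhedral_divisor ::
    "('p, 'k::field) fun_space \<Rightarrow> rat set \<Rightarrow> 'p polyhedral_sum \<Rightarrow> bool" where
  "polyhedral_divisor Y \<sigma> \<DD> \<longleftrightarrow> normal_variety Y \<and> polyhedral_cone \<sigma> \<and>
     (\<forall>(P, D)\<in>set \<DD>. polyhedron P \<and> recession_cone P = \<sigma> \<and> weil_divisor Y D)"

definition pp_divisor ::
    "('p, 'k::field) fun_space \<Rightarrow> rat set \<Rightarrow> 'p polyhedral_sum \<Rightarrow> bool" where
  "pp_divisor Y \<sigma> \<DD> \<longleftrightarrow> polyhedral_divisor Y \<sigma> \<DD> \<and>
     (\<forall>u\<in>dual_cone \<sigma>. q_cartier Y (eval_polyhedral \<DD> u) \<and> semiample Y (eval_polyhedral \<DD> u)) \<and>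
     (\<forall>u\<in>rat_rel_interior (dual_cone \<sigma>). big Y (eval_polyhedral \<DD> u))"


section \<open>Torus actions and graded algebras\<close>

definition coordinate_ring ::
    "nat \<Rightarrow> 'k::field list set \<Rightarrow> ('k, 'k list \<Rightarrow> 'k) module" where
  "coordinate_ring n X =
    \<lparr>carrier = (\<lambda>p. restrict p X) ` poly_funs n,
     mult = (\<lambda>f g. \<lambda>x\<in>X. f x * g x),
     one = (\<lambda>x\<in>X. 1),
     zero = (\<lambda>x\<in>X. 0),
     add = (\<lambda>f g. \<lambda>x\<in>X. f x + g x),
     smult = (\<lambda>c f. \<lambda>x\<in>X. c * f x)\<rparr>"

text \<open>An algebraic action of the one-dimensional torus; morphisms from \<open>T \<times> X\<close> to the affine line
  are Laurent polynomials in \<open>t\<close> over the coordinate ring.\<close>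

definition torus_action ::
    "nat \<Rightarrow> 'k::field list set \<Rightarrow> ('k \<Rightarrow> 'k list \<Rightarrow> 'k list) \<Rightarrow> bool" where
  "torus_action n X act \<longleftrightarrow>
     (\<forall>x\<in>X. act 1 x = x) \<and>
     (\<forall>t x. t \<noteq> 0 \<and> x \<in> X \<longrightarrow> act t x \<in> X) \<and>
     (\<forall>s t x. s \<noteq> 0 \<and> t \<noteq> 0 \<and> x \<in> X \<longrightarrow> act (s * t) x = act s (act t x)) \<and>
     (\<forall>i<n. \<exists>p\<in>poly_funs (Suc n). \<exists>k::nat. \<forall>t x. t \<noteq> 0 \<and> x \<in> X \<longrightarrow>
        act t x ! i = p (t # x) / t ^ k)"

text \<open>
  The grading of the coordinate ring by \<open>M = \<int>\<close>. For the action with weights \<open>ws\<close> it is the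
  grading with \<open>deg x_i = ws ! i\<close>, see \<open>weight_space_nonneg\<close> and \<open>weight_space_neg\<close>.
\<close>

definition weight_space ::
    "nat \<Rightarrow> 'k::field list set \<Rightarrow> ('k \<Rightarrow> 'k list \<Rightarrow> 'k list) \<Rightarrow> int \<Rightarrow> ('k list \<Rightarrow> 'k) set" where
  "weight_space n X act m = {f \<in> carrier (coordinate_ring n X).
     \<forall>t x. t \<noteq> 0 \<and> x \<in> X \<longrightarrow> f (act t x) = t powi m * f x}"

text \<open>
  The direct sum of the section spaces over \<open>dual_cone \<sigma> \<inter> M\<close>, as finitely supported families
  indexed by \<open>M = \<int>\<close>; the product is the convolution formed with the product of the function field.
\<close>

definition section_algebra ::
    "('p, 'k::field) fun_space \<Rightarrow> rat set \<Rightarrow> 'p polyhedral_sum \<Rightarrow>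
     ('k, int \<Rightarrow> ('p, 'k) ratfun) module" where
  "section_algebra Y \<sigma> \<DD> = (let K = function_field Y in
    \<lparr>carrier = {h. finite {m. h m \<noteq> \<zero>\<^bsub>K\<^esub>} \<and>
        (\<forall>m. if of_int m \<in> dual_cone \<sigma> then h m \<in> sections Y (eval_polyhedral \<DD> (of_int m))
             else h m = \<zero>\<^bsub>K\<^esub>)},
     mult = (\<lambda>h k m. \<Oplus>\<^bsub>K\<^esub>i\<in>{i. h i \<noteq> \<zero>\<^bsub>K\<^esub> \<and> k (m - i) \<noteq> \<zero>\<^bsub>K\<^esub>}. h i \<otimes>\<^bsub>K\<^esub> k (m - i)),
     one = (\<lambda>m. if m = 0 then \<one>\<^bsub>K\<^esub> else \<zero>\<^bsub>K\<^esub>),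
     zero = (\<lambda>m. \<zero>\<^bsub>K\<^esub>),
     add = (\<lambda>h k m. h m \<oplus>\<^bsub>K\<^esub> k m),
     smult = (\<lambda>c h m. const_ratfun Y c \<otimes>\<^bsub>K\<^esub> h m)\<rparr>)"

definition section_piece ::
    "('p, 'k::field) fun_space \<Rightarrow> rat set \<Rightarrow> 'p polyhedral_sum \<Rightarrow> int \<Rightarrow>
     (int \<Rightarrow> ('p, 'k) ratfun) set" where
  "section_piece Y \<sigma> \<DD> m = {h \<in> carrier (section_algebra Y \<sigma> \<DD>).
     \<forall>j. j \<noteq> m \<longrightarrow> h j = \<zero>\<^bsub>function_field Y\<^esub>}"

definition graded_algebra_iso ::
    "('k, 'a) module \<Rightarrow> (int \<Rightarrow> 'a set) \<Rightarrow> ('k, 'b) module \<Rightarrow> (int \<Rightarrow> 'b set) \<Rightarrow>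
     ('a \<Rightarrow> 'b) \<Rightarrow> bool" where
  "graded_algebra_iso A grA B grB \<phi> \<longleftrightarrow> \<phi> \<in> ring_iso A B \<and>
     (\<forall>c. \<forall>a\<in>carrier A. \<phi> (c \<odot>\<^bsub>A\<^esub> a) = c \<odot>\<^bsub>B\<^esub> \<phi> a) \<and>
     (\<forall>m. \<phi> ` grA m = grB m)"

definition corresponds_to_action ::
    "('p, 'k::field) fun_space \<Rightarrow> rat set \<Rightarrow> 'p polyhedral_sum \<Rightarrow>
     nat \<Rightarrow> 'k list set \<Rightarrow> ('k \<Rightarrow> 'k list \<Rightarrow> 'k list) \<Rightarrow> bool" where
  "corresponds_to_action Y \<sigma> \<DD> n X act \<longleftrightarrow>
     projective_variety Y \<and> normal_variety Y \<and>
     closedin (zariski n) X \<and> normal_variety (affine_space_on n X) \<and> torus_action n X act \<and>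
     (\<exists>\<phi>. graded_algebra_iso
        (coordinate_ring n X) (weight_space n X act)
        (section_algebra Y \<sigma> \<DD>) (section_piece Y \<sigma> \<DD>) \<phi>)"


subsection \<open>The grading for a linear action\<close>

lemma monomial_fun_scale:
  assumes "length x = length ws"
  shows "monomial_fun (length ws) m (map2 (\<lambda>w c. t ^ w * c) ws x) =
    t ^ weighted_degree ws m * monomial_fun (length ws) m x"
  using assms
  by (simp add: monomial_fun_def weighted_degree_def power_mult_distrib prod.distrib
      power_sum power_mult)

lemma sum_powers_eq_coeff:
  fixes a :: "'i \<Rightarrow> 'k::{field, semiring_char_0}"
  assumes "finite A" and eq: "\<And>t. t \<noteq> 0 \<Longrightarrow> (\<Sum>m\<in>A. a m * t ^ e m) = b * t ^ n"
  shows "(\<Sum>m\<in>{m\<in>A. e m = n}. a m) = b"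
proof -
  define q where "q = (\<Sum>m\<in>A. monom (a m) (e m)) - monom b n"
  have "poly q t = 0" if "t \<noteq> 0" for t
    using eq[OF that] by (simp add: q_def poly_sum poly_monom)
  then have sub: "UNIV - {0} \<subseteq> {t. poly q t = 0}"
    by auto
  have inf: "infinite (UNIV - {0::'k})"
    using infinite_UNIV_char_0[where 'a='k] by simp
  have "q = 0"
  proof (rule ccontr)
    assume "q \<noteq> 0"
    then have "finite {t. poly q t = 0}"
      by (rule poly_roots_finite)
    with sub inf show False
      using finite_subset by blast
  qed
  then have "coeff q n = 0"
    by simp
  then have "(\<Sum>m\<in>A. if e m = n then a m else 0) = b"
    by (simp add: q_def coeff_sum)
  with \<open>finite A\<close> show ?thesis
    by (simp add: sum.inter_filter)
qed

lemma weight_space_nonneg: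
  fixes X :: "'k::field_char_0 list set"
  assumes X: "\<And>x. x \<in> X \<Longrightarrow> length x = length ws"
    and act: "\<And>t x. t \<noteq> 0 \<Longrightarrow> x \<in> X \<Longrightarrow> act t x = map2 (\<lambda>w c. t ^ w * c) ws x"
    and stable: "\<And>t x. t \<noteq> 0 \<Longrightarrow> x \<in> X \<Longrightarrow> act t x \<in> X"
  shows "weight_space (length ws) X act (int e) = (\<lambda>p. restrict p X) ` homogeneous_funs ws e"
proof (intro equalityI subsetI)
  fix f assume f: "f \<in> weight_space (length ws) X act (int e)"
  then obtain A c where A: "finite A"
    and fx: "f = restrict (\<lambda>x. \<Sum>m\<in>A. c m * monomial_fun (length ws) m x) X"
    by (auto simp: weight_space_def coordinate_ring_def poly_funs_def)
  define B where "B = {m\<in>A. weighted_degree ws m = e}"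
  have "(\<Sum>m\<in>B. c m * monomial_fun (length ws) m x) = f x" if x: "x \<in> X" for x
    unfolding B_def
  proof (rule sum_powers_eq_coeff[OF A])
    fix t :: 'k assume t: "t \<noteq> 0"
    have "f (act t x) = (\<Sum>m\<in>A. c m * monomial_fun (length ws) m x * t ^ weighted_degree ws m)"
      unfolding fx using stable[OF t x] act[OF t x] monomial_fun_scale[OF X[OF x]]
      by (simp add: mult_ac)
    moreover have "f (act t x) = t powi int e * f x"
      using f t x unfolding weight_space_def by auto
    ultimately show "(\<Sum>m\<in>A. c m * monomial_fun (length ws) m x * t ^ weighted_degree ws m) =
        f x * t ^ e"
      by (simp add: mult.commute)
  qed
  then have "f = restrict (\<lambda>x. \<Sum>m\<in>B. c m * monomial_fun (length ws) m x) X"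
    unfolding fx by (auto simp: restrict_def fun_eq_iff)
  moreover have "(\<lambda>x. \<Sum>m\<in>B. c m * monomial_fun (length ws) m x) \<in> homogeneous_funs ws e"
    using A unfolding homogeneous_funs_def B_def
    by (intro CollectI exI[of _ "{m\<in>A. weighted_degree ws m = e}"] exI[of _ c]) auto
  ultimately show "f \<in> (\<lambda>p. restrict p X) ` homogeneous_funs ws e"
    by blast
next
  fix f assume "f \<in> (\<lambda>p. restrict p X) ` homogeneous_funs ws e"
  then obtain A c where A: "finite A" "\<And>m. m \<in> A \<Longrightarrow> weighted_degree ws m = e"
    and fx: "f = restrict (\<lambda>x. \<Sum>m\<in>A. c m * monomial_fun (length ws) m x) X"
    by (auto simp: homogeneous_funs_def)
  have "f (act t x) = t powi int e * f x" if "t \<noteq> 0" "x \<in> X" for t x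
    unfolding fx
    using that stable[OF that] act[OF that] monomial_fun_scale[OF X[OF that(2)]] A(2)
    by (simp add: sum_distrib_left mult_ac)
  moreover have "f \<in> carrier (coordinate_ring (length ws) X)"
    using A(1) fx by (auto simp: coordinate_ring_def poly_funs_def)
  ultimately show "f \<in> weight_space (length ws) X act (int e)"
    by (simp add: weight_space_def)
qed

lemma weight_space_neg:
  fixes X :: "'k::field_char_0 list set"
  assumes X: "\<And>x. x \<in> X \<Longrightarrow> length x = length ws"
    and act: "\<And>t x. t \<noteq> 0 \<Longrightarrow> x \<in> X \<Longrightarrow> act t x = map2 (\<lambda>w c. t ^ w * c) ws x"
    and stable: "\<And>t x. t \<noteq> 0 \<Longrightarrow> x \<in> X \<Longrightarrow> act t x \<in> X"
    and "m < 0"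
  shows "weight_space (length ws) X act m = {\<lambda>x\<in>X. 0}"
proof (intro equalityI subsetI)
  fix f assume f: "f \<in> weight_space (length ws) X act m"
  then obtain A c where A: "finite A"
    and fx: "f = restrict (\<lambda>x. \<Sum>m\<in>A. c m * monomial_fun (length ws) m x) X"
    by (auto simp: weight_space_def coordinate_ring_def poly_funs_def)
  define k where "k = nat (- m)"
  have k: "k > 0" "m = - int k"
    using \<open>m < 0\<close> by (auto simp: k_def)
  have "f x = 0" if x: "x \<in> X" for x
  proof -
    have "(\<Sum>m\<in>{m\<in>A. weighted_degree ws m + k = 0}. c m * monomial_fun (length ws) m x) = f x"
    proof (rule sum_powers_eq_coeff[OF A])
      fix t :: 'k assume t: "t \<noteq> 0"
      have e1: "f (act t x) = (\<Sum>m\<in>A. c m * monomial_fun (length ws) m x * t ^ weighted_degree ws m)"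
        unfolding fx using stable[OF t x] act[OF t x] monomial_fun_scale[OF X[OF x]]
        by (simp add: mult_ac)
      have e2: "f (act t x) = t powi m * f x"
        using f t x unfolding weight_space_def by auto
      have inv_t: "t powi m * t ^ k = 1"
        using t k by (simp add: power_int_minus)
      have
        "(\<Sum>m\<in>A. c m * monomial_fun (length ws) m x * t ^ weighted_degree ws m) * t ^ k =
         (t powi m * t ^ k) * f x"
        unfolding e1[symmetric] e2 by (simp only: mult_ac)
      also have "\<dots> = f x"
        using inv_t by simp
      finally have
        "(\<Sum>m\<in>A. c m * monomial_fun (length ws) m x * t ^ weighted_degree ws m) * t ^ k = f x" .
      then show "(\<Sum>m\<in>A. c m * monomial_fun (length ws) m x * t ^ (weighted_degree ws m + k)) =
          f x * t ^ 0"
        by (simp add: sum_distrib_right power_add mult.assoc)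
    qed
    then show ?thesis
      using k by simp
  qed
  then show "f \<in> {\<lambda>x\<in>X. 0}"
    unfolding fx by (auto simp: restrict_def fun_eq_iff)
next
  fix f :: "'k list \<Rightarrow> 'k" assume "f \<in> {\<lambda>x\<in>X. 0}"
  then have f: "f = restrict (\<lambda>x. \<Sum>m\<in>{}. 0 * monomial_fun (length ws) m x) X"
    by simp
  have "(\<lambda>x. \<Sum>m\<in>{}. 0 * monomial_fun (length ws) m x) \<in> poly_funs (length ws)"
    unfolding poly_funs_def by (intro CollectI exI[of _ "{}"] exI[of _ "\<lambda>_. 0"]) auto
  then have "f \<in> carrier (coordinate_ring (length ws) X)"
    unfolding f coordinate_ring_def by auto
  then show "f \<in> weight_space (length ws) X act m"
    using stable by (simp add: weight_space_def f)
qed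

end

theory Submission
  imports Defs "Berlekamp_Zassenhaus.Unique_Factorization_Poly"
begin

section \<open>Pham--Brieskorn surfaces and polyhedral divisors\<close>

text \<open>
  Let \<open>e_i\<close> be the quotient of \<open>d_i\<close> by the exponent of \<open>w_i\<close> in the equation of \<open>Y\<close>. The map
  \<open>x \<mapsto> (x_i^{e_i})\<close> makes \<open>Y\<close> the quotient of the punctured surface by the torus. The rational
  function \<open>\<chi> = x_0^{s_0} x_1^{s_1} x_2^{s_2}\<close> has weight one, so \<open>h \<mapsto> h / \<chi>^m\<close> turns functions of
  weight \<open>m\<close> into rational functions on \<open>Y\<close>. For the monomial \<open>x^b\<close> the result is a Laurent
  monomial in \<open>w\<close> of order \<open>(b_i - m s_i) / e_i\<close> along \<open>D_i\<close>, and hence a section of \<open>\<DD>(m)\<close>.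
  Conversely, \<open>g \<chi>^m\<close> is regular on the punctured surface for a section \<open>g\<close> of \<open>\<DD>(m)\<close>. It
  extends over the origin, since a fraction \<open>p / q\<close> that is locally regular outside of the origin
  can be averaged over the roots of unity acting on one coordinate, which reduces the claim
  to divisibility in the factorial ring of polynomials in the other two coordinates.

  The coefficients of \<open>\<DD>\<close> pair to a positive number with the weights of \<open>Y\<close>, because
  \<open>\<Sum> s_i \<cdot> lcm(d_0, d_1, d_2) / d_i = 1\<close>. Therefore multiples of \<open>\<DD>(u)\<close> have monomial sections
  whose nonvanishing loci are the charts \<open>w_i \<noteq> 0\<close> and the affine charts \<open>w_j w_k \<noteq> 0\<close>.
\<close>

section \<open>Polynomial functions\<close>

text \<open>\<open>X\<close> and the affine cone \<open>C\<close> over the curve are both zero sets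
  of three pure powers, with different exponents, so the locale \<open>pham\<close> is set up once
  and used for both: integrality of the cone makes the curve irreducible, while normality and
  extension over the origin are wanted for \<open>X\<close>. All of this rests on one fact: the sum
  \<open>h\<close> of two of the three terms is a squarefree plane polynomial, so the cone is the
  cyclic cover \<open>x_i^a = -h\<close> with reduced branch curve. The curve is never handled as an
  abstract quotient. Where two coordinates are nonzero, coprimality of their weights normalises the
  torus away and gives a closed model in affine 3-space with equation
  \<open>z^a = -t^b (t^n + 1)\<close>; local parameters, and with them normality and orders, are
  read off there. Weight-zero Laurent monomials on \<open>X\<close> are those of the curve:
  \<open>e_l\<close> divides the weight \<open>f_m\<close> of \<open>x_m\<close> for
  \<open>m \<noteq> l\<close>, and it is prime to \<open>f_l\<close> because \<open>s\<close> pairs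
  to 1 with \<open>f\<close>. This produces the fractions \<open>s_l / e_l\<close> in the divisor
  and lets any such \<open>s\<close> serve.\<close>

lemma monomial_fun_mult:
  "monomial_fun n (\<lambda>i. m i + m' i) x = monomial_fun n m x * monomial_fun n m' x"
  by (simp add: monomial_fun_def power_add prod.distrib)

lemma homogeneous_funsI:
  "finite A \<Longrightarrow> (\<And>m. m \<in> A \<Longrightarrow> weighted_degree ws m = e) \<Longrightarrow>
    (\<lambda>x. \<Sum>m\<in>A. c m * monomial_fun (length ws) m x) \<in> homogeneous_funs ws e"
  unfolding homogeneous_funs_def by blast

lemma homogeneous_funs_monomial:
  "weighted_degree ws m = e \<Longrightarrow> (\<lambda>x. c * monomial_fun (length ws) m x) \<in> homogeneous_funs ws e"
  using homogeneous_funsI[of "{m}" ws e "\<lambda>_. c"] by simp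

lemma homogeneous_funs_zero: "(\<lambda>x. 0) \<in> homogeneous_funs ws e"
  using homogeneous_funsI[of "{}" ws e] by simp

lemma homogeneous_funs_add:
  assumes "p \<in> homogeneous_funs ws e" "q \<in> homogeneous_funs ws e"
  shows "(\<lambda>x. p x + q x) \<in> homogeneous_funs ws e"
proof -
  obtain A c where A: "finite A" "\<forall>m\<in>A. weighted_degree ws m = e"
    "p = (\<lambda>x. \<Sum>m\<in>A. c m * monomial_fun (length ws) m x)"
    using assms(1) unfolding homogeneous_funs_def by blast
  obtain B d where B: "finite B" "\<forall>m\<in>B. weighted_degree ws m = e"
    "q = (\<lambda>x. \<Sum>m\<in>B. d m * monomial_fun (length ws) m x)"
    using assms(2) unfolding homogeneous_funs_def by blast
  have *: "(\<Sum>m\<in>A \<union> B. ((if m \<in> A then c m else 0) + (if m \<in> B then d m else 0)) *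
      monomial_fun (length ws) m x) = p x + q x" for x
  proof -
    have "(\<Sum>m\<in>A \<union> B. (if m \<in> A then c m else 0) * monomial_fun (length ws) m x) = p x"
      unfolding A(3) using A(1) B(1) by (intro sum.mono_neutral_cong_right) auto
    moreover have "(\<Sum>m\<in>A \<union> B. (if m \<in> B then d m else 0) * monomial_fun (length ws) m x) = q x"
      unfolding B(3) using A(1) B(1) by (intro sum.mono_neutral_cong_right) auto
    ultimately show ?thesis
      by (simp add: distrib_right sum.distrib)
  qed
  show ?thesis
    using homogeneous_funsI[of "A \<union> B" ws e
        "\<lambda>m. (if m \<in> A then c m else 0) + (if m \<in> B then d m else 0)"] A(1,2) B(1,2)
    unfolding * by blast
qed

lemma homogeneous_funs_sum:
  "(\<And>i. i \<in> I \<Longrightarrow> f i \<in> homogeneous_funs ws e) \<Longrightarrow> (\<lambda>x. \<Sum>i\<in>I. f i x) \<in> homogeneous_funs ws e"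
  by (induction I rule: infinite_finite_induct)
    (auto intro!: homogeneous_funs_zero homogeneous_funs_add)

lemma homogeneous_funs_mult:
  assumes "p \<in> homogeneous_funs ws e" "q \<in> homogeneous_funs ws e'"
  shows "(\<lambda>x. p x * q x) \<in> homogeneous_funs ws (e + e')"
proof -
  obtain A c where A: "finite A" "\<forall>m\<in>A. weighted_degree ws m = e"
    "p = (\<lambda>x. \<Sum>m\<in>A. c m * monomial_fun (length ws) m x)"
    using assms(1) unfolding homogeneous_funs_def by blast
  obtain B d where B: "finite B" "\<forall>m\<in>B. weighted_degree ws m = e'"
    "q = (\<lambda>x. \<Sum>m\<in>B. d m * monomial_fun (length ws) m x)"
    using assms(2) unfolding homogeneous_funs_def by blast
  have "(\<lambda>x. \<Sum>m\<in>A. \<Sum>n\<in>B. (c m * d n) * monomial_fun (length ws) (\<lambda>i. m i + n i) x)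
      \<in> homogeneous_funs ws (e + e')"
    using A(2) B(2)
    by (intro homogeneous_funs_sum homogeneous_funs_monomial)
      (simp add: weighted_degree_def distrib_left sum.distrib)
  then show ?thesis
    by (simp add: A(3) B(3) sum_product monomial_fun_mult mult_ac)
qed

lemma homogeneous_funs_const: "(\<lambda>x. c) \<in> homogeneous_funs ws 0"
  using homogeneous_funs_monomial[of ws "\<lambda>_. 0" 0 c]
  by (simp add: weighted_degree_def monomial_fun_def)

lemma homogeneous_funs_smult:
  "p \<in> homogeneous_funs ws e \<Longrightarrow> (\<lambda>x. c * p x) \<in> homogeneous_funs ws e"
  using homogeneous_funs_mult[OF homogeneous_funs_const, of p ws e c] by simp

lemma homogeneous_funs_diff:
  assumes "p \<in> homogeneous_funs ws e" "q \<in> homogeneous_funs ws e"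
  shows "(\<lambda>x. p x - q x) \<in> homogeneous_funs ws e"
  using homogeneous_funs_add[OF assms(1) homogeneous_funs_smult[OF assms(2), of "-1"]] by simp

lemma homogeneous_funs_coord:
  assumes "i < length ws" shows "(\<lambda>x. x ! i) \<in> homogeneous_funs ws (ws ! i)"
proof -
  have "weighted_degree ws (\<lambda>j. if j = i then 1 else 0) = ws ! i"
    using assms by (simp add: weighted_degree_def if_distrib cong: if_cong)
  moreover have "monomial_fun (length ws) (\<lambda>j. if j = i then 1 else 0) = (\<lambda>x :: 'a list. x ! i)"
    using assms by (auto simp: monomial_fun_def if_distrib[of "\<lambda>k. _ ^ k"] cong: if_cong)
  ultimately show ?thesis
    using homogeneous_funs_monomial[of ws "\<lambda>j. if j = i then 1 else 0" "ws ! i" "1 :: 'a"]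
    by auto
qed

lemma homogeneous_funs_power:
  assumes "p \<in> homogeneous_funs ws e" shows "(\<lambda>x. p x ^ k) \<in> homogeneous_funs ws (k * e)"
  by (induction k) (auto intro: homogeneous_funs_const[of 1, simplified] homogeneous_funs_mult[OF assms])

lemma homogeneous_funs_scale:
  assumes "p \<in> homogeneous_funs ws e" "length x = length ws"
  shows "p (map2 (\<lambda>w c. t ^ w * c) ws x) = t ^ e * p x"
proof -
  obtain A c where "finite A" "\<forall>m\<in>A. weighted_degree ws m = e"
    "p = (\<lambda>x. \<Sum>m\<in>A. c m * monomial_fun (length ws) m x)"
    using assms(1) unfolding homogeneous_funs_def by blast
  then show ?thesis
    by (simp add: monomial_fun_scale[OF assms(2)] sum_distrib_left mult.left_commute)
qed

text \<open>With all weights zero every polynomial is homogeneous of degree 0, so the closure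
  properties of \<open>poly_funs\<close> become instances of those of
  \<open>homogeneous_funs\<close>.\<close>

lemma poly_funs_homogeneous: "poly_funs n = homogeneous_funs (replicate n 0) 0"
  by (simp add: poly_funs_def homogeneous_funs_def weighted_degree_def)

lemma homogeneous_funs_subset: "homogeneous_funs ws e \<subseteq> poly_funs (length ws)"
  unfolding homogeneous_funs_def poly_funs_def by blast

lemma poly_funs_const: "(\<lambda>x. c) \<in> poly_funs n"
  and poly_funs_add: "p \<in> poly_funs n \<Longrightarrow> q \<in> poly_funs n \<Longrightarrow> (\<lambda>x. p x + q x) \<in> poly_funs n"
  and poly_funs_diff: "p \<in> poly_funs n \<Longrightarrow> q \<in> poly_funs n \<Longrightarrow> (\<lambda>x. p x - q x) \<in> poly_funs n"
  and poly_funs_mult: "p \<in> poly_funs n \<Longrightarrow> q \<in> poly_funs n \<Longrightarrow> (\<lambda>x. p x * q x) \<in> poly_funs n"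
  and poly_funs_smult: "p \<in> poly_funs n \<Longrightarrow> (\<lambda>x. c * p x) \<in> poly_funs n"
  and poly_funs_power: "p \<in> poly_funs n \<Longrightarrow> (\<lambda>x. p x ^ k) \<in> poly_funs n"
  unfolding poly_funs_homogeneous
  using homogeneous_funs_const homogeneous_funs_add homogeneous_funs_diff
    homogeneous_funs_mult[of _ _ 0 _ 0] homogeneous_funs_smult
    homogeneous_funs_power[of _ "replicate n 0" 0]
  by auto

lemma poly_funs_uminus: "p \<in> poly_funs n \<Longrightarrow> (\<lambda>x. - p x) \<in> poly_funs n"
  using poly_funs_smult[of p n "-1"] by simp

lemma poly_funs_coord: "i < n \<Longrightarrow> (\<lambda>x. x ! i) \<in> poly_funs n"
  using homogeneous_funs_coord[of i "replicate n 0"] unfolding poly_funs_homogeneous by simp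

lemma poly_funs_sum:
  "(\<And>i. i \<in> I \<Longrightarrow> f i \<in> poly_funs n) \<Longrightarrow> (\<lambda>x. \<Sum>i\<in>I. f i x) \<in> poly_funs n"
  by (induction I rule: infinite_finite_induct) (auto intro!: poly_funs_const poly_funs_add)

lemma poly_funs_prod:
  "(\<And>i. i \<in> I \<Longrightarrow> f i \<in> poly_funs n) \<Longrightarrow> (\<lambda>x. \<Prod>i\<in>I. f i x) \<in> poly_funs n"
  by (induction I rule: infinite_finite_induct) (auto intro!: poly_funs_const poly_funs_mult)

lemmas poly_funs_intros = poly_funs_const poly_funs_add poly_funs_diff poly_funs_mult
  poly_funs_power poly_funs_uminus poly_funs_coord poly_funs_sum poly_funs_prod

lemma poly_funs_induct [consumes 1, case_names const coord add mult]:
  assumes "p \<in> poly_funs n"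
    and const: "\<And>c. P (\<lambda>x. c)" and coord: "\<And>i. i < n \<Longrightarrow> P (\<lambda>x. x ! i)"
    and add: "\<And>p q. p \<in> poly_funs n \<Longrightarrow> q \<in> poly_funs n \<Longrightarrow> P p \<Longrightarrow> P q \<Longrightarrow> P (\<lambda>x. p x + q x)"
    and mult: "\<And>p q. p \<in> poly_funs n \<Longrightarrow> q \<in> poly_funs n \<Longrightarrow> P p \<Longrightarrow> P q \<Longrightarrow> P (\<lambda>x. p x * q x)"
  shows "P p"
proof -
  \<comment> \<open>Membership is carried along with \<open>P\<close> because the rules for sums and
    products ask for it.\<close>
  define Q where "Q f \<longleftrightarrow> f \<in> poly_funs n \<and> P f" for f
  have Q_pow: "Q (\<lambda>x. x ! i ^ k)" if "i < n" for i k
    by (induction k) (auto simp: Q_def that intro!: const coord mult poly_funs_intros)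
  have Q_mono: "Q (\<lambda>x. \<Prod>i<k. x ! i ^ m i)" if "k \<le> n" for k m
    using that
    by (induction k) (use Q_pow in \<open>auto simp: Q_def intro!: const mult poly_funs_mult poly_funs_const\<close>)
  have Q_sum: "Q (\<lambda>x. \<Sum>m\<in>A. c m * monomial_fun n m x)" if "finite A" for A c
    using that
  proof induction
    case (insert m A)
    have "Q (\<lambda>x. c m * monomial_fun n m x)"
      unfolding monomial_fun_def using Q_mono[of n m]
      by (auto simp: Q_def intro!: const mult poly_funs_mult poly_funs_const)
    then show ?case
      using insert by (auto simp: Q_def intro!: add poly_funs_add)
  qed (auto simp: Q_def intro!: const poly_funs_const)
  show ?thesis
    using assms(1) Q_sum by (auto simp: poly_funs_def Q_def)
qed

lemma poly_funs_compose:
  assumes "p \<in> poly_funs n" "\<And>i. i < n \<Longrightarrow> g i \<in> poly_funs m"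
  shows "(\<lambda>x. p (map (\<lambda>i. g i x) [0..<n])) \<in> poly_funs m"
  using assms(1) by (induction rule: poly_funs_induct) (auto intro!: poly_funs_intros assms(2))

section \<open>Plane polynomials as a factorial ring\<close>

text \<open>
  Coefficients are taken in the field of fractions of \<open>K\<close>, a copy of \<open>K\<close> for which the library
  provides the class \<open>field_gcd\<close>; this makes the polynomial rings below factorial.
\<close>

type_synonym 'k plane = "'k fract poly poly"

definition of_fract :: "'k::field fract \<Rightarrow> 'k" where
  "of_fract = the_inv to_fract"

text \<open>A formal fraction \<open>Fract a b\<close> over a field already equals the element
  \<open>a / b\<close> of that field.\<close>

lemma surj_to_fract: "surj (to_fract :: 'k::field \<Rightarrow> _)"
proof (rule surjI)
  fix x :: "'k fract"
  show "to_fract (case Rep_fract x of r \<Rightarrow> (SOME y. to_fract y = x)) = x"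
  proof -
    obtain a b where "x = Fract a b" "b \<noteq> 0" by (cases x)
    then have "to_fract (a / b) = x"
      by (simp add: to_fract_def eq_fract)
    then show ?thesis
      by (metis (mono_tags) someI_ex)
  qed
qed

lemma of_to_fract [simp]: "of_fract (to_fract x) = x"
  unfolding of_fract_def by (intro the_inv_f_f injI) simp

lemma to_of_fract [simp]: "to_fract (of_fract x) = x"
proof -
  obtain y where "x = to_fract y" using surj_to_fract by (rule surjE)
  then show ?thesis by simp
qed

lemma of_fract_hom [simp]:
  "of_fract 0 = 0" "of_fract 1 = 1" "of_fract (x + y) = of_fract x + of_fract y"
  "of_fract (x * y) = of_fract x * of_fract y" "of_fract (- x) = - of_fract x"
  "of_fract (x - y) = of_fract x - of_fract y"
  "of_fract x = 0 \<longleftrightarrow> x = 0"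
       apply (metis of_to_fract to_fract_0)
      apply (metis of_to_fract to_fract_1)
     apply (metis of_to_fract to_of_fract to_fract_add)
    apply (metis of_to_fract to_of_fract to_fract_mult)
   apply (metis of_to_fract to_of_fract to_fract_uminus)
  apply (metis of_to_fract to_of_fract to_fract_diff)
  by (metis to_of_fract to_fract_0 of_to_fract)

lemma of_fract_power [simp]: "of_fract (x ^ n) = of_fract x ^ n"
  by (induction n) auto

lemma of_nat_fract: "(of_nat n :: 'k::field fract) = to_fract (of_nat n)"
  by (induction n) (simp_all only: of_nat_0 of_nat_Suc to_fract_0 to_fract_1 to_fract_add)

lemma infinite_UNIV_fract: "infinite (UNIV :: 'k::field_char_0 fract set)"
proof
  assume "finite (UNIV :: 'k fract set)"
  then have "finite (of_fract ` (UNIV :: 'k fract set))" by (rule finite_imageI)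
  moreover have "of_fract ` (UNIV :: 'k fract set) = UNIV" by (metis of_to_fract surjI)
  ultimately show False using infinite_UNIV_char_0[where 'a='k] by simp
qed

text \<open>The outer variable of \<open>plane\<close> stands for \<open>v\<close> and the inner one
  for \<open>u\<close>, so \<open>v\<close> is substituted as a constant polynomial before
  \<open>u\<close>.\<close>

definition ev2 :: "'k::field plane \<Rightarrow> 'k \<Rightarrow> 'k \<Rightarrow> 'k" where
  "ev2 p u v = of_fract (poly (poly p [:to_fract v:]) (to_fract u))"

definition ev3 :: "'k::field plane poly \<Rightarrow> 'k \<Rightarrow> 'k \<Rightarrow> 'k \<Rightarrow> 'k" where
  "ev3 p x u v = ev2 (poly p [:[:to_fract x:]:]) u v"

lemma ev2_hom [simp]:
  "ev2 0 u v = 0" "ev2 1 u v = 1" "ev2 (p + q) u v = ev2 p u v + ev2 q u v"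
  "ev2 (p * q) u v = ev2 p u v * ev2 q u v" "ev2 (- p) u v = - ev2 p u v"
  "ev2 (p - q) u v = ev2 p u v - ev2 q u v" "ev2 (p ^ n) u v = ev2 p u v ^ n"
  "ev2 [:[:to_fract c:]:] u v = c" "ev2 [:[:0, 1:]:] u v = u" "ev2 [:0, 1:] u v = v"
  by (simp_all add: ev2_def)

lemma ev2_vars [simp]: "ev2 [:pCons 0 1:] u v = u" "ev2 (pCons 0 1) u v = v"
  by (simp_all add: ev2_def)

lemma ev2_sum [simp]: "ev2 (sum f A) u v = (\<Sum>i\<in>A. ev2 (f i) u v)"
  by (induction A rule: infinite_finite_induct) auto

lemma ev3_hom [simp]:
  "ev3 0 x u v = 0" "ev3 1 x u v = 1" "ev3 (p + q) x u v = ev3 p x u v + ev3 q x u v"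
  "ev3 (p * q) x u v = ev3 p x u v * ev3 q x u v" "ev3 [:r:] x u v = ev2 r u v"
  "ev3 [:0, 1:] x u v = x" "ev3 (p ^ n) x u v = ev3 p x u v ^ n"
  by (simp_all add: ev3_def)

lemma ev3_var [simp]: "ev3 (pCons 0 1) x u v = x"
  by (simp add: ev3_def)

lemma ev3_altdef: "ev3 p x u v = (\<Sum>r\<le>degree p. ev2 (coeff p r) u v * x ^ r)"
  by (simp add: ev3_def poly_altdef)

text \<open>A nonzero univariate polynomial over an infinite domain has finitely many roots. This is
  applied to the inner variable for each fixed \<open>v\<close>, and then to the outer one with the
  constants as roots.\<close>

lemma ev2_eq_0_imp:
  fixes p :: "'k::field_char_0 plane"
  assumes "\<And>u v. ev2 p u v = 0" shows "p = 0"
proof -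
  have 1: "q = 0" if "\<And>u. poly q (to_fract u) = 0" for q :: "'k fract poly"
  proof (rule ccontr)
    assume "q \<noteq> 0"
    then have "finite {x. poly q x = 0}" by (rule poly_roots_finite)
    moreover have "{x. poly q x = 0} = UNIV"
    proof -
      have "poly q x = 0" for x using that[of "of_fract x"] by simp
      then show ?thesis by blast
    qed
    ultimately show False using infinite_UNIV_fract[where 'k='k] by simp
  qed
  have 2: "poly p [:to_fract v:] = 0" for v
    by (rule 1) (use assms in \<open>simp add: ev2_def\<close>)
  show ?thesis
  proof (rule ccontr)
    assume "p \<noteq> 0"
    then have "finite {x. poly p x = 0}" by (rule poly_roots_finite)
    moreover have "range (\<lambda>v. [:to_fract v:]) \<subseteq> {x. poly p x = 0}" using 2 by auto
    moreover have "infinite (range (\<lambda>v::'k. [:to_fract v:]))"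
      using infinite_UNIV_char_0[where 'a='k] by (subst finite_image_iff) (auto intro!: injI)
    ultimately show False using finite_subset by blast
  qed
qed

lemma ev2_poly_funs:
  assumes "j < n" "k < n" shows "(\<lambda>x. ev2 p (x ! j) (x ! k)) \<in> poly_funs n"
proof -
  have 1: "(\<lambda>x. ev2 [:q:] (x ! j) (x ! k)) \<in> poly_funs n" for q :: "'a fract poly"
  proof (induction q)
    case (pCons a q)
    have "ev2 [:pCons a q:] u v = of_fract a + u * ev2 [:q:] u v" for u v :: 'a
      by (simp add: ev2_def)
    then show ?case using pCons assms by (auto intro!: poly_funs_intros)
  qed (auto intro!: poly_funs_intros)
  show ?thesis
  proof (induction p)
    case (pCons a p)
    have "ev2 (pCons a p) u v = ev2 [:a:] u v + v * ev2 p u v" for u v :: 'a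
      by (simp add: ev2_def)
    then show ?case using pCons assms by (auto intro!: poly_funs_intros 1)
  qed (auto intro!: poly_funs_intros)
qed

text \<open>The coordinates may be permuted freely, so that any of the three can serve as the
  distinguished outermost variable.\<close>

lemma poly_funs_ev3:
  assumes "p \<in> poly_funs 3" "{i, j, k} = {0, 1, 2 :: nat}"
  obtains T where "\<And>x. p x = ev3 T (x ! i) (x ! j) (x ! k)"
proof -
  have "\<exists>T. \<forall>x. p x = ev3 T (x ! i) (x ! j) (x ! k)" using assms(1)
  proof (induction rule: poly_funs_induct)
    case (const c)
    show ?case by (intro exI[of _ "[:[:[:to_fract c:]:]:]"]) simp
  next
    case (coord l)
    then have "l \<in> {i, j, k}" unfolding assms(2) by auto
    then consider "l = i" | "l = j" | "l = k" by auto
    then show ?case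
    proof cases
      case 1 then show ?thesis by (intro exI[of _ "[:0, 1:]"]) simp
    next
      case 2 then show ?thesis by (intro exI[of _ "[:[:[:0, 1:]:]:]"]) simp
    next
      case 3 then show ?thesis by (intro exI[of _ "[:[:0, 1:]:]"]) simp
    qed
  next
    case (add p q)
    then show ?case by (metis ev3_hom(3))
  next
    case (mult p q)
    then show ?case by (metis ev3_hom(4))
  qed
  then show ?thesis using that by blast
qed

subsection \<open>Divisibility\<close>

text \<open>Complete integral closedness of a factorial ring. With v the multiplicity of a prime,
  the hypothesis says \<open>m * v(q) \<le> v(c) + m * v(p)\<close> for all \<open>m\<close>; taking
  \<open>m = v(c) + 1\<close> excludes \<open>v(q) > v(p)\<close>.\<close>

lemma almost_integral_dvd:
  fixes p q c :: "'a::{factorial_ring_gcd, semiring_gcd_mult_normalize}"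
  assumes "c \<noteq> 0" "q \<noteq> 0" "\<And>m. q ^ m dvd c * p ^ m"
  shows "q dvd p"
proof (cases "p = 0")
  case False
  show ?thesis
  proof (rule multiplicity_le_imp_dvd[OF assms(2)])
    fix \<pi> :: 'a assume "prime \<pi>"
    then have \<pi>: "prime_elem \<pi>" "\<not> is_unit \<pi>" by (auto simp: prime_def)
    show "multiplicity \<pi> q \<le> multiplicity \<pi> p"
    proof (rule ccontr)
      assume "\<not> multiplicity \<pi> q \<le> multiplicity \<pi> p"
      then have lt: "multiplicity \<pi> p + 1 \<le> multiplicity \<pi> q" by simp
      define m where "m = multiplicity \<pi> c + 1"
      have "multiplicity \<pi> (q ^ m) \<le> multiplicity \<pi> (c * p ^ m)"
        using assms False by (intro dvd_imp_multiplicity_le) auto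
      then have "m * multiplicity \<pi> q \<le> multiplicity \<pi> c + m * multiplicity \<pi> p"
        using \<pi> assms False
        by (simp add: prime_elem_multiplicity_mult_distrib prime_elem_multiplicity_power_distrib)
      moreover have "m * (multiplicity \<pi> p + 1) \<le> m * multiplicity \<pi> q"
        using lt by (rule mult_left_mono) simp
      ultimately show False by (simp add: m_def)
    qed
  qed
qed auto

text \<open>Multiplicities at a prime satisfy \<open>n * v(q) \<le> n * v(p) + l\<close>, because a
  squarefree \<open>h\<close> contributes at most \<open>l\<close>; since \<open>l < n\<close>, this
  leaves no room for \<open>v(q) > v(p)\<close>.\<close>

lemma dvd_of_power_dvd_squarefree:
  fixes p q h :: "'a::{factorial_ring_gcd, semiring_gcd_mult_normalize}"
  assumes "q \<noteq> 0" "h \<noteq> 0" and sf: "\<And>\<pi>. prime \<pi> \<Longrightarrow> \<not> \<pi> ^ 2 dvd h"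
    and "l < n" "q ^ n dvd p ^ n * h ^ l"
  shows "q dvd p"
proof (cases "p = 0")
  case False
  show ?thesis
  proof (rule multiplicity_le_imp_dvd[OF assms(1)])
    fix \<pi> :: 'a assume pr: "prime \<pi>"
    then have \<pi>: "prime_elem \<pi>" "\<not> is_unit \<pi>" by (auto simp: prime_def)
    have "multiplicity \<pi> h \<le> 1"
      using sf[OF pr] power_dvd_iff_le_multiplicity[OF \<open>h \<noteq> 0\<close> \<pi>(2), of 2] by simp
    then have "l * multiplicity \<pi> h \<le> l" by simp
    moreover have "multiplicity \<pi> (q ^ n) \<le> multiplicity \<pi> (p ^ n * h ^ l)"
      using assms False by (intro dvd_imp_multiplicity_le) auto
    then have "n * multiplicity \<pi> q \<le> n * multiplicity \<pi> p + l * multiplicity \<pi> h"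
      using \<pi> assms False
      by (simp add: prime_elem_multiplicity_mult_distrib prime_elem_multiplicity_power_distrib)
    ultimately have "n * multiplicity \<pi> q < n * (multiplicity \<pi> p + 1)"
      using \<open>l < n\<close> by (simp only: distrib_left mult_1_right)
    then have "multiplicity \<pi> q < multiplicity \<pi> p + 1" by (metis mult_less_cancel1)
    then show "multiplicity \<pi> q \<le> multiplicity \<pi> p" by simp
  qed
qed auto

lemma plane_const_dvd_Y:
  fixes c :: "'k::field_char_0 fract poly"
  assumes "[:c:] dvd [:0, 1:]" shows "is_unit [:c:]"
proof -
  have "c dvd coeff [:0, 1:] 1" using assms const_poly_dvd_iff by blast
  then show ?thesis by (simp add: is_unit_const_poly_iff)
qed

definition fermat_poly :: "nat \<Rightarrow> nat \<Rightarrow> 'k::field plane" where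
  "fermat_poly m n = [:[:0, 1:]:] ^ m + [:0, 1:] ^ n"

lemma ev2_fermat [simp]: "ev2 (fermat_poly m n) u v = u ^ m + v ^ n"
  by (simp add: fermat_poly_def)

text \<open>The derivative in the outer variable \<open>v\<close> is \<open>n v^(n - 1)\<close>. A
  prime whose square divides the polynomial divides this derivative too, hence \<open>v\<close>,
  hence \<open>u^m\<close> and \<open>u\<close>; being of degree zero in \<open>v\<close> and
  dividing \<open>v\<close>, it would be a unit.\<close>

lemma fermat_poly_squarefree:
  fixes \<pi> :: "'k::field_char_0 plane"
  assumes "prime \<pi>" "m > 0" "n > 0"
  shows "\<not> \<pi> ^ 2 dvd fermat_poly m n"
proof
  assume "\<pi> ^ 2 dvd fermat_poly m n"
  then obtain r where r: "fermat_poly m n = \<pi> * (\<pi> * r)"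
    by (metis dvdE power2_eq_square mult.assoc)
  have pe: "prime_elem \<pi>" "\<not> is_unit \<pi>" using assms(1) by (auto simp: prime_def)
  have "pderiv (fermat_poly m n) = \<pi> * (pderiv (\<pi> * r) + r * pderiv \<pi>)"
    unfolding r by (simp add: pderiv_mult algebra_simps)
  moreover have "pderiv (fermat_poly m n :: 'k plane) = Polynomial.smult (of_nat n) ([:0, 1:] ^ (n - 1))"
  proof -
    have "pderiv ([:[:0, 1:]:] ^ m :: 'k plane) = 0"
      by (simp add: pderiv_power pderiv_pCons)
    moreover have "pderiv ([:0, 1:] ^ n :: 'k plane) = Polynomial.smult (of_nat n) ([:0, 1:] ^ (n - 1))"
      by (simp add: pderiv_power pderiv_pCons)
    ultimately show ?thesis by (simp add: fermat_poly_def pderiv_add)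
  qed
  ultimately have d: "\<pi> dvd Polynomial.smult (of_nat n) ([:0, 1:] ^ (n - 1))" by (metis dvd_triv_left)
  \<comment> \<open>Characteristic zero enters here: \<open>n\<close> is a unit and can be stripped
    from the derivative.\<close>
  have "(of_nat n :: 'k fract) \<noteq> 0" using assms(3) by (simp add: of_nat_fract)
  then have u: "is_unit (of_nat n :: 'k fract poly)"
    by (simp add: of_nat_poly is_unit_const_poly_iff)
  have "\<pi> dvd [:0, 1:] ^ (n - 1)"
  proof -
    obtain c where "(of_nat n :: 'k fract poly) * c = 1" using u by (metis dvdE)
    then have "Polynomial.smult c (Polynomial.smult (of_nat n) ([:0, 1:] ^ (n - 1) :: 'k plane)) = [:0, 1:] ^ (n - 1)"
      by (simp add: mult.commute)
    with d show ?thesis by (metis dvd_smult)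
  qed
  then have Y: "\<pi> dvd [:0, 1:]" using pe(1) by (meson prime_elem_dvd_power)
  have "\<pi> dvd [:[:0, 1:]:] ^ m + [:0, 1:] ^ n" using r unfolding fermat_poly_def by (metis dvd_triv_left)
  moreover have "\<pi> dvd [:0, 1:] ^ n" using Y assms(3) by (meson dvd_power dvd_trans)
  ultimately have "\<pi> dvd [:[:0, 1:]:] ^ m" by (metis dvd_add_left_iff)
  then have X: "\<pi> dvd [:[:0, 1:]:]" using pe(1) by (meson prime_elem_dvd_power)
  then have "degree \<pi> \<le> degree [:[:0, 1 :: 'k fract:]:]"
    by (intro dvd_imp_degree_le) auto
  then have "degree \<pi> = 0" by simp
  then obtain c where "\<pi> = [:c:]" by (metis degree_eq_zeroE)
  with Y plane_const_dvd_Y pe(2) show False by blast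
qed

lemma fermat_poly_nonzero:
  assumes "m > 0" shows "fermat_poly m n \<noteq> (0 :: 'k::field_char_0 plane)"
proof
  assume "fermat_poly m n = (0 :: 'k plane)"
  then have "u ^ m + v ^ n = 0" for u v :: 'k by (metis ev2_fermat ev2_hom(1))
  from this[of 1 1] this[of 0 1] assms show False by simp
qed

lemma fermat_poly_not_unit:
  assumes "m > 0" "n > 0"
  shows "\<not> is_unit (fermat_poly m n :: 'k::field_char_0 plane)"
proof
  assume "is_unit (fermat_poly m n :: 'k plane)"
  then obtain q :: "'k plane" where "1 = fermat_poly m n * q" by (auto elim: dvdE)
  then have "ev2 (1 :: 'k plane) 0 0 = ev2 (fermat_poly m n * q) 0 0" by simp
  then show False using assms by (simp add: power_0_left)
qed

lemma poly_has_root_fract: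
  fixes p :: "'k::alg_closed_field fract poly"
  assumes "degree p > 0" shows "\<exists>x. poly p (to_fract x) = 0"
proof -
  define q where "q = map_poly of_fract p"
  have dq: "degree q = degree p" unfolding q_def by (rule degree_map_poly) auto
  then obtain x where "poly q x = 0" using alg_closed_imp_poly_has_root[of q] assms by auto
  moreover have "poly q x = of_fract (poly p (to_fract x))"
    unfolding q_def by (induction p) (auto simp: map_poly_pCons)
  ultimately show ?thesis by auto
qed

text \<open>Substituting the inner variable first turns a fixed \<open>u\<close> into a univariate
  polynomial in \<open>v\<close>, to which the existence of roots applies.\<close>

lemma ev2_slice: "ev2 p u v = of_fract (poly (map_poly (\<lambda>c. poly c (to_fract u)) p) (to_fract v))"
  by (induction p) (auto simp: ev2_def map_poly_pCons)

lemma exists_good_value: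
  fixes p :: "'k::field_char_0 fract poly"
  assumes "p \<noteq> 0" shows "\<exists>v. v \<noteq> 0 \<and> poly p (to_fract v) \<noteq> 0"
proof (rule ccontr)
  assume "\<not> ?thesis"
  then have *: "v \<noteq> 0 \<Longrightarrow> poly p (to_fract v) = 0" for v by blast
  \<comment> \<open>The factor \<open>pCons 0\<close> adds the root 0, so that vanishing at all
    nonzero points becomes vanishing everywhere.\<close>
  have "poly (pCons 0 p) x = 0" for x using *[of "of_fract x"] by (cases "of_fract x = 0") auto
  then have "{x. poly (pCons 0 p) x = 0} = UNIV" by blast
  moreover have "finite {x. poly (pCons 0 p) x = 0}" using assms by (intro poly_roots_finite) auto
  ultimately show False using infinite_UNIV_fract[where 'k='k] by simp
qed

lemma fract_poly_clear_denominators: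
  fixes p :: "'a :: {factorial_semiring,semiring_Gcd,ring_gcd,idom_divide,
    semiring_gcd_mult_normalize} fract poly"
  obtains d q where "d \<noteq> 0" "Polynomial.smult (to_fract d) p = fract_poly q"
proof -
  obtain c q where p: "p = Polynomial.smult c (fract_poly q)" by (rule content_decompose_fract)
  obtain a b where c: "c = Fract a b" "b \<noteq> 0" by (cases c)
  have "Polynomial.smult (to_fract b) p = fract_poly (Polynomial.smult a q)"
    using c by (simp add: p Fract_conv_to_fract)
  with c that show ?thesis by blast
qed

text \<open>A Nullstellensatz for plane curves. If \<pi> involves only \<open>u\<close>, it is
  linear up to a unit and a generic \<open>v\<close> works. Otherwise Gauss's lemma keeps \<pi>
  prime over the field of fractions of the coefficients, so it is coprime to \<open>S\<close> there,
  and a Bezout identity cleared of denominators shows that common zeros lie over finitely many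
  \<open>u\<close>. The point has to avoid the origin because local fractions are given only on the
  punctured cone.\<close>

lemma prime_plane_zero:
  fixes \<pi> S :: "'k::{alg_closed_field, field_char_0} plane"
  assumes "prime_elem \<pi>" "\<not> \<pi> dvd S"
  obtains u v where "u \<noteq> 0 \<or> v \<noteq> 0" "ev2 \<pi> u v = 0" "ev2 S u v \<noteq> 0"
proof (cases "degree \<pi> = 0")
  case True
  then obtain c where c: "\<pi> = [:c:]" by (metis degree_eq_zeroE)
  have irr: "irreducible c"
    using prime_elem_imp_irreducible[OF assms(1)] unfolding c by (simp add: irreducible_const_poly_iff)
  then have "degree c > 0"
    by (metis degree_eq_zeroE is_unit_const_poly_iff dvd_field_iff bot_nat_0.not_eq_extremum
        irreducible_def pCons_eq_0_iff one_neq_zero zero_neq_one)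
  then obtain u where u: "poly c (to_fract u) = 0" using poly_has_root_fract by blast
  then have "[:- to_fract u, 1:] dvd c" by (simp add: poly_eq_0_iff_dvd)
  then have c_dvd: "c dvd [:- to_fract u, 1:]"
    using irr irreducibleD'[of c "[:- to_fract u, 1:]"] by (auto simp: is_unit_pCons_iff)
  obtain n where n: "\<not> c dvd coeff S n" using assms(2) unfolding c const_poly_dvd_iff by blast
  have "poly (coeff S n) (to_fract u) \<noteq> 0"
    using n c_dvd by (metis dvd_trans poly_eq_0_iff_dvd)
  then have "coeff (map_poly (\<lambda>c. poly c (to_fract u)) S) n \<noteq> 0" by (simp add: coeff_map_poly)
  then have "map_poly (\<lambda>c. poly c (to_fract u)) S \<noteq> 0" by (metis coeff_0)
  then obtain v where "v \<noteq> 0" "poly (map_poly (\<lambda>c. poly c (to_fract u)) S) (to_fract v) \<noteq> 0"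
    using exists_good_value by blast
  then have "ev2 S u v \<noteq> 0" "v \<noteq> 0" by (simp_all add: ev2_slice)
  moreover have "ev2 \<pi> u v = 0" using u by (simp add: c ev2_def)
  ultimately show ?thesis using that by blast
next
  case False
  have irr: "irreducible \<pi>" using assms(1) by (rule prime_elem_imp_irreducible)
  have ir: "irreducible (fract_poly \<pi>)" "content \<pi> = 1"
    using nonconst_poly_irreducible_iff[OF False] irr by auto
  have "\<not> fract_poly \<pi> dvd fract_poly S" using fract_poly_dvdD[OF _ ir(2)] assms(2) by blast
  moreover have "prime_elem (fract_poly \<pi>)" using ir(1) by (rule field_poly_irreducible_imp_prime)
  ultimately have cop: "algebraic_semidom_class.coprime (fract_poly \<pi>) (fract_poly S)" by (intro prime_elem_imp_coprime)
  obtain x y where "bezout_coefficients (fract_poly \<pi>) (fract_poly S) = (x, y)" by fastforce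
  then have one: "x * fract_poly \<pi> + y * fract_poly S = 1"
    using cop bezout_coefficients[of "fract_poly \<pi>" "fract_poly S" x y] by simp
  obtain d q where d: "d \<noteq> 0" "Polynomial.smult (to_fract d) x = fract_poly q"
    by (rule fract_poly_clear_denominators)
  obtain e r where e: "e \<noteq> 0" "Polynomial.smult (to_fract e) y = fract_poly r"
    by (rule fract_poly_clear_denominators)
  have "fract_poly (Polynomial.smult e (q * \<pi>) + Polynomial.smult d (r * S)) =
      Polynomial.smult (to_fract (d * e)) (x * fract_poly \<pi> + y * fract_poly S)"
    by (simp add: d(2)[symmetric] e(2)[symmetric] smult_add_right mult.commute)
  also have "\<dots> = fract_poly [:d * e:]"
    unfolding one by (intro poly_eqI) (simp add: coeff_map_poly coeff_pCons split: nat.split)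
  finally have bez: "Polynomial.smult e (q * \<pi>) + Polynomial.smult d (r * S) = [:d * e:]"
    by (simp only: fract_poly_eq_iff)
  \<comment> \<open>At such a \<open>u\<close> the identity survives, and the slice of \<pi> keeps
    its positive degree; it therefore has a root \<open>v\<close>, where \<open>S\<close> cannot
    vanish.\<close>
  obtain u where u: "u \<noteq> 0" "poly (d * e * lead_coeff \<pi>) (to_fract u) \<noteq> 0"
    using exists_good_value[of "d * e * lead_coeff \<pi>"] d(1) e(1) False by fastforce
  have "degree (map_poly (\<lambda>c. poly c (to_fract u)) \<pi>) = degree \<pi>"
    using u(2) by (intro Polynomial.map_poly_degree_eq) auto
  then obtain v where v: "poly (map_poly (\<lambda>c. poly c (to_fract u)) \<pi>) (to_fract v) = 0"
    using poly_has_root_fract[of "map_poly (\<lambda>c. poly c (to_fract u)) \<pi>"] False by auto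
  then have \<pi>0: "ev2 \<pi> u v = 0" by (simp add: ev2_slice)
  have "ev2 (Polynomial.smult e (q * \<pi>) + Polynomial.smult d (r * S)) u v =
      of_fract (poly (d * e) (to_fract u))"
    unfolding bez by (simp add: ev2_def)
  moreover have "ev2 (Polynomial.smult e (q * \<pi>) + Polynomial.smult d (r * S)) u v
      = of_fract (poly e (to_fract u)) * (ev2 q u v * ev2 \<pi> u v) +
        of_fract (poly d (to_fract u)) * (ev2 r u v * ev2 S u v)"
    by (simp add: ev2_def)
  ultimately have "ev2 S u v \<noteq> 0" using u(2) \<pi>0 by auto
  with \<pi>0 u(1) that show ?thesis by blast
qed

section \<open>Roots of unity\<close>

text \<open>A factor repeated in the linear factorisation would make \<open>p\<close> and its
  derivative vanish at the same point, so the multiset of roots is a set.\<close>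

lemma card_poly_roots_eq_degree:
  fixes p :: "'k::{alg_closed_field, field_char_0} poly"
  assumes "p \<noteq> 0" "\<And>x. poly p x = 0 \<Longrightarrow> poly (pderiv p) x \<noteq> 0"
  shows "card {x. poly p x = 0} = degree p"
proof -
  obtain A where A: "size A = degree p" "p = Polynomial.smult (lead_coeff p) (\<Prod>x\<in>#A. [:-x, 1:])"
    using alg_closed_imp_factorization[OF assms(1)] by blast
  have roots: "poly p x = 0 \<longleftrightarrow> x \<in># A" for x
  proof -
    have "poly (\<Prod>x\<in>#A. [:-x, 1:]) x = 0 \<longleftrightarrow> x \<in># A" for A :: "'k multiset"
      by (induction A) auto
    moreover have "poly p x = lead_coeff p * poly (\<Prod>x\<in>#A. [:-x, 1:]) x"
      by (subst A(2)) simp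
    ultimately show ?thesis using assms(1) by simp
  qed
  have "count A x \<le> 1" for x
  proof (rule ccontr)
    assume "\<not> count A x \<le> 1"
    then have "2 \<le> count A x" by simp
    then have "replicate_mset 2 x \<subseteq># A" by (simp add: count_le_replicate_mset_subset_eq)
    then obtain B where "A = replicate_mset 2 x + B" by (metis subset_mset.le_iff_add)
    then have "p = [:-x, 1:] * ([:-x, 1:] * Polynomial.smult (lead_coeff p) (\<Prod>x\<in>#B. [:-x, 1:]))"
      by (subst A(2)) (simp add: numeral_2_eq_2 mult.assoc)
    then obtain r where r: "p = [:-x, 1:] * ([:-x, 1:] * r)" by blast
    then have "poly p x = 0" by simp
    moreover have "poly (pderiv p) x = 0"
      unfolding r by (simp only: pderiv_mult poly_add poly_mult) simp
    ultimately show False using assms(2) by blast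
  qed
  then have "A = mset_set (set_mset A)"
    by (intro multiset_eqI) (metis count_eq_zero_iff count_mset_set(1,3) finite_set_mset le_antisym
        less_one linorder_not_le nat_less_le)
  then have "size A = card (set_mset A)" by (metis size_mset_set)
  moreover have "{x. poly p x = 0} = set_mset A" using roots by auto
  ultimately show ?thesis using A(1) by simp
qed

lemma card_roots_of_unity:
  assumes "n > 0" shows "card {z :: 'k::{alg_closed_field, field_char_0}. z ^ n = 1} = n"
proof -
  define p where "p = monom 1 n - (1 :: 'k poly)"
  have deg: "degree p = n" unfolding p_def
    using assms by (subst diff_conv_add_uminus, subst degree_add_eq_left) (auto simp: degree_monom_eq)
  have "card {x. poly p x = 0} = degree p"
  proof (rule card_poly_roots_eq_degree)
    show "p \<noteq> 0" using deg assms by auto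
    fix x assume "poly p x = 0"
    then have "x \<noteq> 0" using assms by (auto simp: p_def poly_monom power_0_left)
    then show "poly (pderiv p) x \<noteq> 0" using assms by (auto simp: p_def pderiv_diff pderiv_monom poly_monom)
  qed
  then show ?thesis using deg by (simp add: p_def poly_monom)
qed

lemma finite_roots_of_unity:
  assumes "n > 0" shows "finite {z :: 'k::{alg_closed_field, field_char_0}. z ^ n = 1}"
  using card_roots_of_unity[OF assms, where 'k='k] assms by (metis card.infinite less_numeral_extra(3))

text \<open>Character orthogonality: multiplication by a fixed root of unity \<open>w\<close>
  permutes the summands and scales the sum by \<open>w ^ s\<close>, where
  \<open>s = r mod n\<close>.\<close>

lemma sum_roots_of_unity:
  assumes "n > 0"
  shows "(\<Sum>z\<in>{z :: 'k::{alg_closed_field, field_char_0}. z ^ n = 1}. z ^ r) =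
    (if n dvd r then of_nat n else 0)"
proof (cases "n dvd r")
  case True
  then have "(\<Sum>z\<in>{z :: 'k. z ^ n = 1}. z ^ r) = (\<Sum>z\<in>{z :: 'k. z ^ n = 1}. 1)"
    by (intro sum.cong) (auto simp: power_mult elim!: dvdE)
  then show ?thesis using True card_roots_of_unity[OF assms, where 'k='k] by simp
next
  case False
  define s where "s = r mod n"
  have s: "0 < s" "s < n" using False assms by (auto simp: s_def mod_greater_zero_iff_not_dvd)
  have red: "z ^ r = z ^ s" if "z ^ n = 1" for z :: 'k
    using that unfolding s_def by (metis mult_div_mod_eq power_add power_mult power_one mult_1)
  \<comment> \<open>The equation \<open>z ^ s = 1\<close> has only \<open>s < n\<close> solutions,
    so some n-th root of unity fails it.\<close>
  have "\<exists>w :: 'k. w ^ n = 1 \<and> w ^ s \<noteq> 1"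
  proof (rule ccontr)
    assume "\<not> ?thesis"
    then have "{z :: 'k. z ^ n = 1} \<subseteq> {z. z ^ s = 1}" by auto
    from card_mono[OF finite_roots_of_unity[OF s(1)] this] show False
      using s assms by (simp add: card_roots_of_unity)
  qed
  then obtain w :: 'k where w: "w ^ n = 1" "w ^ s \<noteq> 1" by blast
  then have "w \<noteq> 0" using assms by (auto simp: power_0_left)
  have "(\<Sum>z\<in>{z :: 'k. z ^ n = 1}. z ^ s) = (\<Sum>z\<in>{z :: 'k. z ^ n = 1}. (w * z) ^ s)"
    by (rule sum.reindex_bij_witness[of _ "\<lambda>z. w * z" "\<lambda>z. z / w"])
      (use w \<open>w \<noteq> 0\<close> in \<open>auto simp: power_mult_distrib power_divide\<close>)
  also have "\<dots> = w ^ s * (\<Sum>z\<in>{z :: 'k. z ^ n = 1}. z ^ s)"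
    by (simp add: power_mult_distrib sum_distrib_left)
  finally have "(\<Sum>z\<in>{z :: 'k. z ^ n = 1}. z ^ s) = 0" using w(2) by (simp add: mult_cancel_right1)
  then show ?thesis using False red by simp
qed

section \<open>Pham--Brieskorn cones\<close>

locale pham =
  fixes a :: "nat \<Rightarrow> nat" and C :: "'k::{alg_closed_field, field_char_0} list set"
  assumes a_pos: "\<And>i. i < 3 \<Longrightarrow> a i > 0"
    and C_def: "C = {x. length x = 3 \<and> x ! 0 ^ a 0 + x ! 1 ^ a 1 + x ! 2 ^ a 2 = 0}"

text \<open>\<open>x_i\<close> is treated as an algebraic function of \<open>x_j\<close> and
  \<open>x_k\<close>. Arbitrary axes make every result available for all three projections.\<close>

locale pham_axes = pham a C
  for a :: "nat \<Rightarrow> nat" and C :: "'k::{alg_closed_field, field_char_0} list set" +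
  fixes i j k :: nat
  assumes axes: "{i, j, k} = {0, 1, 2}"
begin

lemma axes_less: "i < 3" "j < 3" "k < 3"
  and axes_neq: "i \<noteq> j" "i \<noteq> k" "j \<noteq> k" "j \<noteq> i" "k \<noteq> i" "k \<noteq> j"
proof -
  have "i \<in> {0, 1, 2}" "j \<in> {0, 1, 2}" "k \<in> {0, 1, 2}" unfolding axes[symmetric] by auto
  then show "i < 3" "j < 3" "k < 3" by auto
  have "card {i, j, k} = 3" unfolding axes by simp
  then show "i \<noteq> j" "i \<noteq> k" "j \<noteq> k" "j \<noteq> i" "k \<noteq> i" "k \<noteq> j"
    by (auto simp: card_insert_if split: if_splits)
qed

lemma axes_cases: "l < 3 \<Longrightarrow> l = i \<or> l = j \<or> l = k"
proof -
  assume "l < 3" then have "l \<in> {0, 1, 2}" by auto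
  then show ?thesis unfolding axes[symmetric] by auto
qed

lemma axes_pos: "a i > 0" "a j > 0" "a k > 0"
  using a_pos axes_less by auto

lemma sum_axes: "f (0::nat) + f 1 + f 2 = f i + f j + (f k :: 'b::comm_monoid_add)"
proof -
  have "sum f {0, 1, 2} = sum f {i, j, k}" by (simp only: axes)
  then show ?thesis using axes_neq by (simp add: add.assoc)
qed

lemma mem_C: "x \<in> C \<longleftrightarrow> length x = 3 \<and> x ! i ^ a i + x ! j ^ a j + x ! k ^ a k = 0"
  using sum_axes[of "\<lambda>l. x ! l ^ a l"] by (simp add: C_def)

definition h :: "'k plane" where "h = fermat_poly (a j) (a k)"

lemma ev2_h: "ev2 h u v = u ^ a j + v ^ a k"
  by (simp add: h_def)

lemma C_power: "x \<in> C \<Longrightarrow> x ! i ^ a i = - ev2 h (x ! j) (x ! k)"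
  unfolding ev2_h eq_neg_iff_add_eq_0 by (simp add: mem_C add.assoc)

definition pt :: "'k \<Rightarrow> 'k \<Rightarrow> 'k \<Rightarrow> 'k list" where
  "pt x u v = map (\<lambda>l. if l = i then x else if l = j then u else v) [0..<3]"

lemma pt_nth [simp]: "length (pt x u v) = 3" "pt x u v ! i = x" "pt x u v ! j = u" "pt x u v ! k = v"
  using axes_less axes_neq by (simp_all add: pt_def)

lemma pt_eqI: "length x = 3 \<Longrightarrow> x = pt (x ! i) (x ! j) (x ! k)"
  by (rule nth_equalityI) (auto dest!: axes_cases)

lemma pt_C: "pt x u v \<in> C \<longleftrightarrow> x ^ a i = - ev2 h u v"
  unfolding ev2_h eq_neg_iff_add_eq_0 by (simp add: mem_C add.assoc)

lemma exists_above: "\<exists>x. pt x u v \<in> C"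
  using nth_root_exists[OF axes_pos(1)] by (simp add: pt_C)

lemma above_nonzero: "pt x u v \<in> C \<Longrightarrow> ev2 h u v \<noteq> 0 \<Longrightarrow> x \<noteq> 0"
  using axes_pos by (auto simp: pt_C power_0_left)

text \<open>For \<open>z\<close> in \<open>\<mu>\<close> these are the deck transformations of the
  cyclic cover given by the projection to \<open>x_j\<close> and \<open>x_k\<close>.\<close>

definition rot :: "'k \<Rightarrow> 'k list \<Rightarrow> 'k list" where
  "rot z x = x[i := z * x ! i]"

lemma rot_nth: "length x = 3 \<Longrightarrow> rot z x ! i = z * x ! i" "rot z x ! j = x ! j" "rot z x ! k = x ! k"
  "length (rot z x) = length x"
  using axes_less axes_neq by (simp_all add: rot_def)

lemma C_length: "x \<in> C \<Longrightarrow> length x = 3"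
  by (simp add: mem_C)

abbreviation "\<mu> \<equiv> {z :: 'k. z ^ a i = 1}"

lemma rot_C: "x \<in> C \<Longrightarrow> z \<in> \<mu> \<Longrightarrow> rot z x \<in> C"
  by (auto simp: mem_C rot_nth power_mult_distrib)

lemma finite_mu: "finite \<mu>"
  by (rule finite_roots_of_unity[OF axes_pos(1)])

lemma rot_poly_funs:
  assumes "p \<in> poly_funs 3" shows "(\<lambda>x. p (map (\<lambda>l. if l = i then z * x ! l else x ! l) [0..<3])) \<in> poly_funs 3"
proof (rule poly_funs_compose[OF assms])
  fix l :: nat assume "l < 3"
  then show "(\<lambda>x. if l = i then z * x ! l else x ! l) \<in> poly_funs 3"
    by (cases "l = i") (auto intro!: poly_funs_intros)
qed

lemma rot_eq: "length x = 3 \<Longrightarrow> rot z x = map (\<lambda>l. if l = i then z * x ! l else x ! l) [0..<3]"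
  by (rule nth_equalityI) (auto simp: rot_def nth_list_update)

text \<open>\<open>xcoeff T s\<close> is the coefficient of \<open>x_i^s\<close>, \<open>s < a_i\<close>, in the reduction of \<open>T\<close> modulo
  \<open>x_i^{a_i} + h\<close>.\<close>

definition xcoeff :: "'k plane poly \<Rightarrow> nat \<Rightarrow> 'k plane" where
  "xcoeff T s = (\<Sum>r\<in>{r. r \<le> degree T \<and> r mod a i = s}. coeff T r * (- h) ^ (r div a i))"

lemma ev3_xcoeff:
  assumes "x \<in> C"
  shows "ev3 T (x ! i) (x ! j) (x ! k) = (\<Sum>s<a i. ev2 (xcoeff T s) (x ! j) (x ! k) * x ! i ^ s)"
proof -
  have red: "ev2 (coeff T r) (x ! j) (x ! k) * x ! i ^ r =
      ev2 (coeff T r * (- h) ^ (r div a i)) (x ! j) (x ! k) * x ! i ^ (r mod a i)" for r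
  proof -
    have "x ! i ^ r = (x ! i ^ a i) ^ (r div a i) * x ! i ^ (r mod a i)"
      by (metis mult_div_mod_eq power_add power_mult)
    then show ?thesis by (simp add: C_power[OF assms] mult.assoc)
  qed
  have "(\<Sum>s<a i. ev2 (xcoeff T s) (x ! j) (x ! k) * x ! i ^ s) =
    (\<Sum>s<a i. \<Sum>r\<in>{r\<in>{..degree T}. r mod a i = s}.
      ev2 (coeff T r * (- h) ^ (r div a i)) (x ! j) (x ! k) * x ! i ^ (r mod a i))"
    by (intro sum.cong refl) (simp add: xcoeff_def sum_distrib_right)
  also have "\<dots> = (\<Sum>r\<le>degree T.
      ev2 (coeff T r * (- h) ^ (r div a i)) (x ! j) (x ! k) * x ! i ^ (r mod a i))"
    using axes_pos by (intro sum.group) auto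
  finally show ?thesis by (simp only: ev3_altdef red)
qed

text \<open>The factor \<open>z ^ (a i - s)\<close> plays the part of \<open>z\<close> to the power
  \<open>- s\<close> without negative exponents; by orthogonality the average extracts the isotypic
  component of \<open>x_i^s\<close>.\<close>

lemma ev3_average:
  assumes "x \<in> C" "s < a i"
  shows "(\<Sum>z\<in>\<mu>. z ^ (a i - s) * ev3 T (rot z x ! i) (x ! j) (x ! k)) =
    of_nat (a i) * (ev2 (xcoeff T s) (x ! j) (x ! k) * x ! i ^ s)"
proof -
  have "(\<Sum>z\<in>\<mu>. z ^ (a i - s) * ev3 T (rot z x ! i) (x ! j) (x ! k)) =
    (\<Sum>z\<in>\<mu>. \<Sum>m<a i. z ^ (a i - s + m) * (ev2 (xcoeff T m) (x ! j) (x ! k) * x ! i ^ m))"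
  proof (rule sum.cong[OF refl])
    fix z assume "z \<in> \<mu>"
    from rot_C[OF assms(1) this] show "z ^ (a i - s) * ev3 T (rot z x ! i) (x ! j) (x ! k) =
      (\<Sum>m<a i. z ^ (a i - s + m) * (ev2 (xcoeff T m) (x ! j) (x ! k) * x ! i ^ m))"
      using ev3_xcoeff[of "rot z x" T] C_length[OF assms(1)]
      by (simp add: rot_nth sum_distrib_left power_mult_distrib power_add mult_ac)
  qed
  also have "\<dots> = (\<Sum>m<a i. (\<Sum>z\<in>\<mu>. z ^ (a i - s + m)) * (ev2 (xcoeff T m) (x ! j) (x ! k) * x ! i ^ m))"
    by (subst sum.swap) (simp add: sum_distrib_right)
  also have "\<dots> = (\<Sum>m<a i. if m = s then of_nat (a i) * (ev2 (xcoeff T s) (x ! j) (x ! k) * x ! i ^ s) else 0)"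
  proof (rule sum.cong[OF refl])
    fix m assume m: "m \<in> {..<a i}"
    \<comment> \<open>\<open>a i - s + m\<close> lies strictly between 0 and \<open>2 * a i\<close>,
      so \<open>a i\<close> itself is the only possible multiple.\<close>
    have "a i dvd a i - s + m \<longleftrightarrow> m = s"
    proof
      assume "a i dvd a i - s + m"
      then obtain q where q: "a i - s + m = a i * q" by (auto elim: dvdE)
      have "a i - s + m > 0" "a i - s + m < a i * 2" using m assms(2) by auto
      then have "q = 1" using q by (cases "q = 0") (auto simp: less_2_cases_iff)
      then show "m = s" using q assms(2) by simp
    qed (use assms(2) in simp)
    then show "(\<Sum>z\<in>\<mu>. z ^ (a i - s + m)) * (ev2 (xcoeff T m) (x ! j) (x ! k) * x ! i ^ m) =
      (if m = s then of_nat (a i) * (ev2 (xcoeff T s) (x ! j) (x ! k) * x ! i ^ s) else 0)"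
      using sum_roots_of_unity[OF axes_pos(1), of "a i - s + m"] by auto
  qed
  also have "\<dots> = of_nat (a i) * (ev2 (xcoeff T s) (x ! j) (x ! k) * x ! i ^ s)"
    using assms(2) by (simp add: sum.delta)
  finally show ?thesis .
qed

lemma of_nat_ai: "(of_nat (a i) :: 'k) \<noteq> 0"
  using axes_pos by simp

lemma h_nonzero: "h \<noteq> 0"
  unfolding h_def by (rule fermat_poly_nonzero[OF axes_pos(2)])

text \<open>Over every point of the plane with \<open>h\<close> nonzero lies a point with
  \<open>x_i \<noteq> 0\<close>, so \<open>P * h\<close> vanishes on the whole plane and
  \<open>h\<close> can be cancelled.\<close>

lemma plane_eq_0I:
  assumes "\<And>x. x \<in> C \<Longrightarrow> x ! i \<noteq> 0 \<Longrightarrow> ev2 P (x ! j) (x ! k) = 0"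
  shows "P = 0"
proof -
  have "P * h = 0"
  proof (rule ev2_eq_0_imp)
    fix u v
    obtain x where "pt x u v \<in> C" using exists_above by blast
    with assms[of "pt x u v"] above_nonzero show "ev2 (P * h) u v = 0" by auto
  qed
  then show ?thesis using h_nonzero by simp
qed

text \<open>Vanishing on the part \<open>x_i \<noteq> 0\<close> is stable under the rotations, so
  each average vanishes too. In effect the powers \<open>x_i^s\<close> with \<open>s < a i\<close>
  are independent over the plane polynomials.\<close>

lemma xcoeff_eq_0:
  assumes "\<And>x. x \<in> C \<Longrightarrow> x ! i \<noteq> 0 \<Longrightarrow> ev3 T (x ! i) (x ! j) (x ! k) = 0" "s < a i"
  shows "xcoeff T s = 0"
proof (rule plane_eq_0I)
  fix x assume x: "x \<in> C" "x ! i \<noteq> 0"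
  have "z ^ (a i - s) * ev3 T (rot z x ! i) (x ! j) (x ! k) = 0" if "z \<in> \<mu>" for z
  proof -
    have "z \<noteq> 0" using that axes_pos by (auto simp: power_0_left)
    then show ?thesis
      using assms(1)[OF rot_C[OF x(1) that]] x by (simp add: rot_nth C_length)
  qed
  then have "of_nat (a i) * (ev2 (xcoeff T s) (x ! j) (x ! k) * x ! i ^ s) = 0"
    unfolding ev3_average[OF x(1) assms(2), symmetric] by (intro sum.neutral) blast
  then show "ev2 (xcoeff T s) (x ! j) (x ! k) = 0" using x of_nat_ai by simp
qed

text \<open>An exponent \<open>r > 0\<close> divisible by \<open>a i\<close> brings in at least one
  factor \<open>h\<close>, so only the constant coefficient survives modulo
  \<open>h\<close>.\<close>

lemma xcoeff_0: "\<exists>r. xcoeff T 0 = coeff T 0 + h * r"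
proof -
  have "xcoeff T 0 = coeff T 0 * (- h) ^ (0 div a i) +
      (\<Sum>r\<in>{r. r \<le> degree T \<and> r mod a i = 0} - {0}. coeff T r * (- h) ^ (r div a i))"
    unfolding xcoeff_def by (rule sum.remove) auto
  also have "(\<Sum>r\<in>{r. r \<le> degree T \<and> r mod a i = 0} - {0}. coeff T r * (- h) ^ (r div a i)) =
      (\<Sum>r\<in>{r. r \<le> degree T \<and> r mod a i = 0} - {0}. h * (- coeff T r * (- h) ^ (r div a i - 1)))"
  proof (rule sum.cong[OF refl])
    fix r assume "r \<in> {r. r \<le> degree T \<and> r mod a i = 0} - {0}"
    then have "r div a i > 0" by (auto elim!: dvdE simp: mod_eq_0_iff_dvd)
    then have "(- h) ^ (r div a i) = - h * (- h) ^ (r div a i - 1)"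
      by (metis power_eq_if not_gr_zero)
    then show "coeff T r * (- h) ^ (r div a i) = h * (- coeff T r * (- h) ^ (r div a i - 1))"
      by simp
  qed
  finally show ?thesis unfolding sum_distrib_left[symmetric] by simp
qed

end

section \<open>Integrality of the cone\<close>

context pham_axes begin

lemma ev3_monom: "ev3 (monom c n) x u v = ev2 c u v * x ^ n"
  by (simp add: ev3_def poly_monom)

lemma ev3_sum: "ev3 (sum f A) x u v = (\<Sum>l\<in>A. ev3 (f l) x u v)"
  by (induction A rule: infinite_finite_induct) auto

lemma poly_funs_rot:
  assumes "p \<in> poly_funs 3"
  obtains q where "q \<in> poly_funs 3" "\<And>x. length x = 3 \<Longrightarrow> q x = p (rot z x)"
  using rot_poly_funs[OF assms, of z] by (rule that) (simp add: rot_eq)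

text \<open>If \<open>T\<close> vanished wherever \<open>x_i \<noteq> 0\<close>, its constant
  coefficient would be a multiple of \<open>h\<close>, hence of \<pi>.\<close>

lemma ev3_good_nonzero:
  assumes "\<pi> dvd h" "\<not> \<pi> dvd coeff T 0"
  obtains x where "x \<in> C" "x ! i \<noteq> 0" "ev3 T (x ! i) (x ! j) (x ! k) \<noteq> 0"
proof (rule ccontr)
  assume "\<not> thesis"
  then have "xcoeff T 0 = 0" using that axes_pos by (intro xcoeff_eq_0) auto
  moreover obtain r where "xcoeff T 0 = coeff T 0 + h * r" using xcoeff_0 by blast
  ultimately have "coeff T 0 = - (h * r)" by (simp add: eq_neg_iff_add_eq_0)
  with assms show False by simp
qed

text \<open>Since \<open>\<pi>\<close> divides \<open>h\<close> exactly once, the ideal \<open>(x_i, \<pi>)\<close> is principal at its generic point: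
  up to a factor prime to \<open>\<pi>\<close> every function is a power of \<open>x_i\<close> times a function outside of the
  ideal.\<close>

lemma pole_order_form:
  assumes pr: "prime \<pi>" and h': "h = \<pi> * h'" "\<not> \<pi> dvd h'"
    and x0: "x0 \<in> C" "ev3 T (x0 ! i) (x0 ! j) (x0 ! k) \<noteq> 0"
  obtains s e T' where "\<not> \<pi> dvd s" "\<not> \<pi> dvd coeff T' 0"
    "\<And>x. x \<in> C \<Longrightarrow> ev2 s (x ! j) (x ! k) * ev3 T (x ! i) (x ! j) (x ! k) =
      x ! i ^ e * ev3 T' (x ! i) (x ! j) (x ! k)"
proof -
  have pe: "prime_elem \<pi>" "\<not> is_unit \<pi>" using pr by (auto simp: prime_def)
  define L where "L = {l. l < a i \<and> xcoeff T l \<noteq> 0}"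
  have finL: "finite L" by (simp add: L_def)
  have "L \<noteq> {}"
  proof
    assume "L = {}"
    then have "\<forall>l<a i. xcoeff T l = 0" by (auto simp: L_def)
    then show False using x0(2) by (simp add: ev3_xcoeff[OF x0(1)])
  qed
  define m where "m l = multiplicity \<pi> (xcoeff T l)" for l
  have "\<exists>P. xcoeff T l = \<pi> ^ m l * P \<and> \<not> \<pi> dvd P" if "l \<in> L" for l
    using multiplicity_decompose'[of "xcoeff T l" \<pi>] that pe(2) unfolding m_def L_def by blast
  then obtain P where P: "xcoeff T l = \<pi> ^ m l * P l" "\<not> \<pi> dvd P l" if "l \<in> L" for l by metis
  \<comment> \<open>Multiplication by \<open>h' ^ M\<close> supplies a factor \<open>h'\<close> for
    every factor \<pi> of a coefficient; together they form \<open>h\<close>, which is a power of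
    \<open>x_i\<close> up to sign.\<close>
  define M where "M = sum m L"
  have mM: "m l \<le> M" if "l \<in> L" for l unfolding M_def using finL that by (simp add: member_le_sum)
  \<comment> \<open>This is the order of \<open>T\<close> for the valuation in which
    \<open>x_i\<close> has value 1 and \<pi> has value \<open>a i\<close>.\<close>
  define e where "e = Min ((\<lambda>l. a i * m l + l) ` L)"
  have e_le: "e \<le> a i * m l + l" if "l \<in> L" for l unfolding e_def using finL that by simp
  obtain l0 where l0: "l0 \<in> L" "e = a i * m l0 + l0"
  proof -
    have "e \<in> (\<lambda>l. a i * m l + l) ` L"
      unfolding e_def using finL \<open>L \<noteq> {}\<close> by (intro Min_in) auto
    then show ?thesis using that by blast
  qed
  define Q where "Q l = (- 1) ^ m l * h' ^ (M - m l) * P l" for l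
  define T' where "T' = (\<Sum>l\<in>L. monom (Q l) (a i * m l + l - e))"
  \<comment> \<open>Modulo \<open>a i\<close> the value determines \<open>l\<close>, so the minimum
    is attained once and nothing can cancel in the constant coefficient of
    \<open>T'\<close>.\<close>
  have inj: "l = l0" if "l \<in> L" "a i * m l + l = e" for l
  proof -
    have "(a i * m l + l) mod a i = (a i * m l0 + l0) mod a i" using that l0 by simp
    then show ?thesis using that(1) l0(1) by (simp add: L_def)
  qed
  have "coeff T' 0 = (\<Sum>l\<in>L. if l = l0 then Q l0 else 0)"
    unfolding T'_def coeff_sum coeff_monom
    using inj l0 e_le by (intro sum.cong) (auto simp: le_antisym)
  then have "coeff T' 0 = Q l0" using finL l0 by simp
  moreover have "\<not> \<pi> dvd Q l0"
    using h'(2) P(2)[OF l0(1)] pe prime_elem_dvd_power[of \<pi> h'] prime_elem_dvd_power[of \<pi> "-1"]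
    unfolding Q_def by (auto simp: prime_elem_dvd_mult_iff)
  ultimately have 1: "\<not> \<pi> dvd coeff T' 0" by simp
  have 2: "\<not> \<pi> dvd h' ^ M" using h'(2) prime_elem_dvd_power[OF pe(1)] by blast
  have 3: "ev2 (h' ^ M) (x ! j) (x ! k) * ev3 T (x ! i) (x ! j) (x ! k) =
      x ! i ^ e * ev3 T' (x ! i) (x ! j) (x ! k)" if x: "x \<in> C" for x
  proof -
    have "ev2 (h' ^ M) (x ! j) (x ! k) * (ev2 (xcoeff T l) (x ! j) (x ! k) * x ! i ^ l) =
      x ! i ^ e * (ev2 (Q l) (x ! j) (x ! k) * x ! i ^ (a i * m l + l - e))" if l: "l \<in> L" for l
    proof -
      have "h' ^ M * xcoeff T l = h ^ m l * (h' ^ (M - m l) * P l)"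
      proof -
        have "h' ^ M = h' ^ m l * h' ^ (M - m l)" using mM[OF l] by (simp add: power_add[symmetric])
        then show ?thesis unfolding h'(1) using P(1)[OF l] by (simp add: power_mult_distrib mult_ac)
      qed
      then have "ev2 (h' ^ M) (x ! j) (x ! k) * ev2 (xcoeff T l) (x ! j) (x ! k) =
          ev2 h (x ! j) (x ! k) ^ m l * ev2 (h' ^ (M - m l) * P l) (x ! j) (x ! k)"
        by (metis ev2_hom(4) ev2_hom(7))
      also have "ev2 h (x ! j) (x ! k) = - (x ! i ^ a i)" by (simp add: C_power[OF x])
      also have "(- (x ! i ^ a i)) ^ m l = (- 1) ^ m l * x ! i ^ (a i * m l)"
        by (metis power_minus power_mult)
      finally have "ev2 (h' ^ M) (x ! j) (x ! k) * ev2 (xcoeff T l) (x ! j) (x ! k) * x ! i ^ l =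
          ev2 (Q l) (x ! j) (x ! k) * (x ! i ^ (a i * m l + l))"
        by (simp add: Q_def power_add mult_ac)
      also have "x ! i ^ (a i * m l + l) = x ! i ^ e * x ! i ^ (a i * m l + l - e)"
        using e_le[OF l] by (metis le_add_diff_inverse power_add)
      finally show ?thesis by (simp add: mult_ac)
    qed
    moreover have "ev3 T (x ! i) (x ! j) (x ! k) = (\<Sum>l\<in>L. ev2 (xcoeff T l) (x ! j) (x ! k) * x ! i ^ l)"
      unfolding ev3_xcoeff[OF x] by (rule sum.mono_neutral_right) (auto simp: L_def)
    ultimately show ?thesis
      by (simp add: T'_def ev3_sum ev3_monom sum_distrib_left)
  qed
  show ?thesis using that[OF 2 1 3] .
qed

text \<open>Up to factors prime to \<pi>, both functions are powers of \<open>x_i\<close> times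
  functions outside of the ideal (\<open>x_i\<close>, \<pi>). Constant coefficients multiply and
  \<pi> is prime, so the product stays outside of the ideal and is nonzero at a point with
  \<open>x_i \<noteq> 0\<close>.\<close>

lemma domain_axes:
  assumes "p \<in> poly_funs 3" "q \<in> poly_funs 3" "x \<in> C" "p x \<noteq> 0" "y \<in> C" "q y \<noteq> 0"
  shows "\<exists>z\<in>C. p z * q z \<noteq> 0"
proof -
  obtain \<pi> where \<pi>: "prime \<pi>" "\<pi> dvd h"
    using prime_divisorE[OF h_nonzero] fermat_poly_not_unit[OF axes_pos(2,3)] unfolding h_def by blast
  obtain h' where h': "h = \<pi> * h'" using \<pi>(2) by (rule dvdE)
  have "\<not> \<pi> dvd h'"
    using fermat_poly_squarefree[OF \<pi>(1) axes_pos(2,3)] unfolding h_def[symmetric] h'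
    by (auto simp: power2_eq_square intro: mult_dvd_mono)
  note form = pole_order_form[OF \<pi>(1) h' this]
  obtain T where T: "\<And>x. p x = ev3 T (x ! i) (x ! j) (x ! k)" using poly_funs_ev3[OF assms(1) axes] by blast
  obtain U where U: "\<And>x. q x = ev3 U (x ! i) (x ! j) (x ! k)" using poly_funs_ev3[OF assms(2) axes] by blast
  obtain s e T' where T': "\<not> \<pi> dvd s" "\<not> \<pi> dvd coeff T' 0"
    "\<And>x. x \<in> C \<Longrightarrow> ev2 s (x ! j) (x ! k) * p x = x ! i ^ e * ev3 T' (x ! i) (x ! j) (x ! k)"
    using form[of x T] assms(3,4) T by metis
  obtain t f U' where U': "\<not> \<pi> dvd t" "\<not> \<pi> dvd coeff U' 0"
    "\<And>x. x \<in> C \<Longrightarrow> ev2 t (x ! j) (x ! k) * q x = x ! i ^ f * ev3 U' (x ! i) (x ! j) (x ! k)"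
    using form[of y U] assms(5,6) U by metis
  have "\<not> \<pi> dvd coeff (T' * U') 0"
    using T'(2) U'(2) \<pi>(1) by (simp add: coeff_mult_0 prime_dvd_mult_iff)
  then obtain z where z: "z \<in> C" "z ! i \<noteq> 0" "ev3 (T' * U') (z ! i) (z ! j) (z ! k) \<noteq> 0"
    using ev3_good_nonzero[OF \<pi>(2)] by blast
  then have "z ! i ^ e * ev3 T' (z ! i) (z ! j) (z ! k) * (z ! i ^ f * ev3 U' (z ! i) (z ! j) (z ! k)) \<noteq> 0"
    by simp
  then have "p z * q z \<noteq> 0" unfolding T'(3)[OF z(1), symmetric] U'(3)[OF z(1), symmetric] by auto
  with z(1) show ?thesis by blast
qed

end

lemma (in pham) axes_012: "pham_axes a C 0 1 2"
  by unfold_locales auto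

lemma (in pham) domain:
  assumes "p \<in> poly_funs 3" "q \<in> poly_funs 3" "\<exists>x\<in>C. p x \<noteq> 0" "\<exists>x\<in>C. q x \<noteq> 0"
  shows "\<exists>z\<in>C. p z * q z \<noteq> 0"
  using pham_axes.domain_axes[OF axes_012 assms(1,2)] assms(3,4) by blast

lemma (in pham) cancel:
  assumes "p \<in> poly_funs 3" "q \<in> poly_funs 3" "r \<in> poly_funs 3" "\<exists>x\<in>C. q x \<noteq> 0"
    "\<And>x. x \<in> C \<Longrightarrow> p x * q x = r x * q x" "x \<in> C"
  shows "p x = r x"
proof (rule ccontr)
  assume "p x \<noteq> r x"
  then have "\<exists>z\<in>C. (p z - r z) * q z \<noteq> 0"
    using assms by (intro domain poly_funs_diff) auto
  with assms(5) show False by (auto simp: left_diff_distrib)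
qed

lemma (in pham) domain_prod:
  assumes "finite I" "\<And>l. l \<in> I \<Longrightarrow> p l \<in> poly_funs 3" "\<And>l. l \<in> I \<Longrightarrow> \<exists>x\<in>C. p l x \<noteq> 0" "C \<noteq> {}"
  shows "\<exists>z\<in>C. (\<Prod>l\<in>I. p l z) \<noteq> 0"
  using assms(1,2,3)
proof (induction I)
  case empty
  then show ?case using \<open>C \<noteq> {}\<close> by auto
next
  case (insert l I)
  then show ?case
    using domain[of "p l" "\<lambda>z. \<Prod>l\<in>I. p l z"] by (auto intro!: poly_funs_prod)
qed

section \<open>Norms from the cone to the plane\<close>

context pham_axes begin

text \<open>The product of all rotated copies of \<open>p\<close> is invariant under rotation, hence
  a plane polynomial by averaging; its factors with \<open>z \<noteq> 1\<close> form the cofactor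
  \<open>q\<close>. Integrality keeps both nonzero.\<close>

lemma norm_multiple:
  assumes p: "p \<in> poly_funs 3" "\<exists>x\<in>C. p x \<noteq> 0"
  obtains q N where "q \<in> poly_funs 3" "N \<noteq> 0" "\<exists>x\<in>C. q x \<noteq> 0"
    "\<And>x. x \<in> C \<Longrightarrow> q x * p x = ev2 N (x ! j) (x ! k)"
    "\<And>x. x \<in> C \<Longrightarrow> ev2 N (x ! j) (x ! k) = (\<Prod>z\<in>\<mu>. p (rot z x))"
proof -
  have "\<exists>q. q \<in> poly_funs 3 \<and> (\<forall>x. length x = 3 \<longrightarrow> q x = p (rot z x))" for z
    using poly_funs_rot[OF p(1)] by metis
  then obtain P where P: "\<And>z. P z \<in> poly_funs 3" "\<And>z x. length x = 3 \<Longrightarrow> P z x = p (rot z x)"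
    by metis
  have nz: "\<exists>x\<in>C. P z x \<noteq> 0" if z: "z \<in> \<mu>" for z
  proof -
    obtain x where x: "x \<in> C" "p x \<noteq> 0" using p(2) by blast
    have "z \<noteq> 0" using z axes_pos by (auto simp: power_0_left)
    have "inverse z \<in> \<mu>" using z by (auto simp: power_inverse)
    moreover have "rot z (rot (inverse z) x) = x"
      using \<open>z \<noteq> 0\<close> C_length[OF x(1)] axes_less by (simp add: rot_def mult.assoc[symmetric])
    ultimately have "rot (inverse z) x \<in> C" "P z (rot (inverse z) x) \<noteq> 0"
      using rot_C[OF x(1)] x P(2) C_length[OF x(1)] by (auto simp: rot_nth)
    then show ?thesis by blast
  qed
  define q where "q x = (\<Prod>z\<in>\<mu> - {1}. P z x)" for x
  define g where "g x = (\<Prod>z\<in>\<mu>. P z x)" for x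
  have q: "q \<in> poly_funs 3" unfolding q_def using P by (intro poly_funs_prod) auto
  have g: "g \<in> poly_funs 3" unfolding g_def using P by (intro poly_funs_prod) auto
  have ne: "C \<noteq> {}" using p(2) by blast
  have g_eq: "g x = (\<Prod>z\<in>\<mu>. p (rot z x))" if "x \<in> C" for x
    using C_length[OF that] by (simp add: g_def P(2))
  obtain T where T: "\<And>x. g x = ev3 T (x ! i) (x ! j) (x ! k)" using poly_funs_ev3[OF g axes] by blast
  have inv: "g (rot w x) = g x" if "x \<in> C" "w \<in> \<mu>" for x w
  proof -
    have "w \<noteq> 0" using that axes_pos by (auto simp: power_0_left)
    have rr: "rot z (rot w x) = rot (z * w) x" for z
      using C_length[OF that(1)] axes_less by (simp add: rot_def mult.assoc)
    have "g (rot w x) = (\<Prod>z\<in>\<mu>. p (rot (z * w) x))"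
      using g_eq[OF rot_C[OF that]] by (simp add: rr)
    also have "\<dots> = (\<Prod>z\<in>\<mu>. p (rot z x))"
      by (rule prod.reindex_bij_witness[of _ "\<lambda>z. z / w" "\<lambda>z. z * w"])
        (use that(2) \<open>w \<noteq> 0\<close> in \<open>auto simp: power_mult_distrib power_divide\<close>)
    finally show ?thesis using g_eq[OF that(1)] by simp
  qed
  \<comment> \<open>Averaging with \<open>s = 0\<close> reproduces an invariant function, which
    identifies it with the plane polynomial \<open>xcoeff T 0\<close>.\<close>
  have N: "ev2 (xcoeff T 0) (x ! j) (x ! k) = g x" if x: "x \<in> C" for x
  proof -
    have "of_nat (a i) * ev2 (xcoeff T 0) (x ! j) (x ! k) = (\<Sum>z\<in>\<mu>. z ^ a i * g (rot z x))"
      using ev3_average[OF x axes_pos(1), of T] by (simp add: T rot_nth C_length[OF x])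
    also have "\<dots> = (\<Sum>z\<in>\<mu>. g x)" using inv[OF x] by (intro sum.cong) auto
    also have "\<dots> = of_nat (a i) * g x" using card_roots_of_unity[OF axes_pos(1), where 'k='k] by simp
    finally show ?thesis using of_nat_ai by simp
  qed
  have gq: "g x = q x * p x" if "x \<in> C" for x
  proof -
    have "g x = P 1 x * q x" unfolding g_def q_def by (rule prod.remove) (auto intro: finite_mu)
    moreover have "rot 1 x = x" using C_length[OF that] axes_less by (simp add: rot_def)
    ultimately show ?thesis using P(2)[OF C_length[OF that]] by simp
  qed
  show ?thesis
  proof (rule that[OF q, of "xcoeff T 0"])
    have "\<exists>z\<in>C. g z \<noteq> 0" unfolding g_def by (rule domain_prod[OF finite_mu P(1) nz ne])
    then obtain z where "z \<in> C" "g z \<noteq> 0" by blast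
    then show "xcoeff T 0 \<noteq> 0" using N[OF \<open>z \<in> C\<close>] by auto
    show "\<exists>x\<in>C. q x \<noteq> 0" unfolding q_def
      by (rule domain_prod) (use finite_mu P(1) nz ne in auto)
  qed (use N gq g_eq in simp_all)
qed

text \<open>Averaging the identity over the rotations replaces the cofactor \<open>r\<close> by its
  invariant part, a plane polynomial.\<close>

lemma dvd_descend:
  assumes "r \<in> poly_funs 3"
    "\<And>x. x \<in> C \<Longrightarrow> ev2 F (x ! j) (x ! k) = ev2 G (x ! j) (x ! k) * r x"
  shows "G dvd F"
proof -
  obtain T where T: "\<And>x. r x = ev3 T (x ! i) (x ! j) (x ! k)" using poly_funs_ev3[OF assms(1) axes] by blast
  have "F - G * xcoeff T 0 = 0"
  proof (rule plane_eq_0I)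
    fix x assume x: "x \<in> C"
    have "of_nat (a i) * ev2 (G * xcoeff T 0) (x ! j) (x ! k) =
        (\<Sum>z\<in>\<mu>. ev2 G (x ! j) (x ! k) * r (rot z x))"
      using ev3_average[OF x axes_pos(1), of T]
      by (simp add: T rot_nth C_length[OF x] sum_distrib_left[symmetric] mult.left_commute)
    also have "\<dots> = (\<Sum>z\<in>\<mu>. ev2 F (x ! j) (x ! k))"
      using assms(2)[OF rot_C[OF x]] by (intro sum.cong) (auto simp: rot_nth)
    also have "\<dots> = of_nat (a i) * ev2 F (x ! j) (x ! k)"
      using card_roots_of_unity[OF axes_pos(1), where 'k='k] by simp
    finally show "ev2 (F - G * xcoeff T 0) (x ! j) (x ! k) = 0" using of_nat_ai by simp
  qed
  then show ?thesis by simp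
qed

lemma h_squarefree: "prime \<pi> \<Longrightarrow> \<not> \<pi> ^ 2 dvd h"
  unfolding h_def by (rule fermat_poly_squarefree[OF _ axes_pos(2,3)])

end

section \<open>Normality and extension over the origin\<close>

context pham_axes begin

abbreviation evC :: "'k plane \<Rightarrow> 'k list \<Rightarrow> 'k" where
  "evC P x \<equiv> ev2 P (x ! j) (x ! k)"

lemma evC_poly_funs: "evC P \<in> poly_funs 3"
  using axes_less by (intro ev2_poly_funs)

lemma evC_nonzero: "P \<noteq> 0 \<Longrightarrow> \<exists>x\<in>C. evC P x \<noteq> 0"
  using plane_eq_0I by blast

text \<open>All powers of \<open>f / Q\<close> have the common denominator \<open>D\<close>. The
  condition is multiplied out because \<open>Q\<close> may have zeros on the cone.\<close>

definition almost_integral :: "'k plane \<Rightarrow> ('k list \<Rightarrow> 'k) \<Rightarrow> bool" where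
  "almost_integral Q f \<longleftrightarrow> (\<exists>D. D \<noteq> 0 \<and>
    (\<forall>n. \<exists>r\<in>poly_funs 3. \<forall>x\<in>C. evC D x * f x ^ n = evC Q x ^ n * r x))"

lemma almost_integral_const: "almost_integral Q (\<lambda>x. c * evC Q x)"
  unfolding almost_integral_def
  by (intro exI[of _ 1] conjI allI) (auto simp: power_mult_distrib intro!: bexI[of _ "\<lambda>x. c ^ _"] poly_funs_const)

lemma almost_integral_cong:
  "almost_integral Q f \<Longrightarrow> (\<And>x. x \<in> C \<Longrightarrow> f x = g x) \<Longrightarrow> almost_integral Q g"
  unfolding almost_integral_def by simp

lemma almost_integral_smult:
  assumes "almost_integral Q f" shows "almost_integral Q (\<lambda>x. c * f x)"
proof -
  obtain D where D: "D \<noteq> 0" "\<forall>n. \<exists>r\<in>poly_funs 3. \<forall>x\<in>C. evC D x * f x ^ n = evC Q x ^ n * r x"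
    using assms unfolding almost_integral_def by blast
  have "\<exists>r\<in>poly_funs 3. \<forall>x\<in>C. evC D x * (c * f x) ^ n = evC Q x ^ n * r x" for n
  proof -
    obtain r where r: "r \<in> poly_funs 3" "\<forall>x\<in>C. evC D x * f x ^ n = evC Q x ^ n * r x" using D(2) by blast
    have "\<forall>x\<in>C. evC D x * (c * f x) ^ n = evC Q x ^ n * (c ^ n * r x)"
      using r(2) by (simp add: power_mult_distrib mult.left_commute)
    then show ?thesis by (intro bexI[of _ "\<lambda>x. c ^ n * r x"] poly_funs_smult r(1))
  qed
  then show ?thesis unfolding almost_integral_def using D(1) by blast
qed

text \<open>In the binomial expansion of \<open>(f + g) ^ n\<close> every mixed term is cleared by
  the product of the two denominators.\<close>

lemma almost_integral_add:
  assumes "almost_integral Q f" "almost_integral Q g"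
  shows "almost_integral Q (\<lambda>x. f x + g x)"
proof -
  obtain D r where D: "D \<noteq> 0" "\<And>n. r n \<in> poly_funs 3"
    "\<And>n x. x \<in> C \<Longrightarrow> evC D x * f x ^ n = evC Q x ^ n * r n x"
    using assms(1) unfolding almost_integral_def by metis
  obtain E s where E: "E \<noteq> 0" "\<And>n. s n \<in> poly_funs 3"
    "\<And>n x. x \<in> C \<Longrightarrow> evC E x * g x ^ n = evC Q x ^ n * s n x"
    using assms(2) unfolding almost_integral_def by metis
  have "\<exists>t\<in>poly_funs 3. \<forall>x\<in>C. evC (D * E) x * (f x + g x) ^ n = evC Q x ^ n * t x" for n
  proof (intro bexI ballI)
    show "(\<lambda>x. \<Sum>m\<le>n. of_nat (n choose m) * (r m x * s (n - m) x)) \<in> poly_funs 3"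
      by (intro poly_funs_sum poly_funs_smult poly_funs_mult D E)
    fix x assume x: "x \<in> C"
    have "evC (D * E) x * (f x + g x) ^ n =
        (\<Sum>m\<le>n. of_nat (n choose m) * ((evC D x * f x ^ m) * (evC E x * g x ^ (n - m))))"
      by (simp add: binomial_ring sum_distrib_left mult_ac)
    also have "\<dots> = (\<Sum>m\<le>n. evC Q x ^ n * (of_nat (n choose m) * (r m x * s (n - m) x)))"
    proof (rule sum.cong[OF refl])
      fix m assume "m \<in> {..n}"
      then have "evC Q x ^ n = evC Q x ^ m * evC Q x ^ (n - m)" by (simp add: power_add[symmetric])
      then show "of_nat (n choose m) * ((evC D x * f x ^ m) * (evC E x * g x ^ (n - m))) =
        evC Q x ^ n * (of_nat (n choose m) * (r m x * s (n - m) x))"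
        unfolding D(3)[OF x] E(3)[OF x] by (simp add: mult_ac)
    qed
    finally show "evC (D * E) x * (f x + g x) ^ n =
        evC Q x ^ n * (\<Sum>m\<le>n. of_nat (n choose m) * (r m x * s (n - m) x))"
      by (simp add: sum_distrib_left)
  qed
  then show ?thesis unfolding almost_integral_def using D(1) E(1) by (intro exI[of _ "D * E"]) simp
qed

lemma almost_integral_sum:
  "finite I \<Longrightarrow> (\<And>l. l \<in> I \<Longrightarrow> almost_integral Q (f l)) \<Longrightarrow> almost_integral Q (\<lambda>x. \<Sum>l\<in>I. f l x)"
  by (induction I rule: finite_induct) (use almost_integral_const[of Q 0] in \<open>auto intro: almost_integral_add\<close>)

lemma almost_integral_rot:
  assumes "almost_integral Q f" "z \<in> \<mu>" shows "almost_integral Q (\<lambda>x. f (rot z x))"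
proof -
  obtain D where D: "D \<noteq> 0" "\<forall>n. \<exists>r\<in>poly_funs 3. \<forall>x\<in>C. evC D x * f x ^ n = evC Q x ^ n * r x"
    using assms unfolding almost_integral_def by blast
  have "\<exists>r\<in>poly_funs 3. \<forall>x\<in>C. evC D x * f (rot z x) ^ n = evC Q x ^ n * r x" for n
  proof -
    obtain r where r: "r \<in> poly_funs 3" "\<forall>x\<in>C. evC D x * f x ^ n = evC Q x ^ n * r x" using D(2) by blast
    obtain s where s: "s \<in> poly_funs 3" "\<And>x. length x = 3 \<Longrightarrow> s x = r (rot z x)"
      using poly_funs_rot[OF r(1)] by metis
    have "evC D x * f (rot z x) ^ n = evC Q x ^ n * s x" if x: "x \<in> C" for x
      using r(2) rot_C[OF x assms(2)] s(2)[OF C_length[OF x]] by (metis rot_nth(2,3))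
    with s(1) show ?thesis by blast
  qed
  then show ?thesis unfolding almost_integral_def using D(1) by blast
qed

text \<open>This is regularity of \<open>f / Q\<close> on the punctured cone. The cross-multiplied
  identity is asked for on all of \<open>C\<close>, so that no neighbourhoods have to be
  tracked.\<close>

definition locally_fraction :: "'k plane \<Rightarrow> ('k list \<Rightarrow> 'k) \<Rightarrow> bool" where
  "locally_fraction Q f \<longleftrightarrow> (\<forall>x\<in>C. (\<exists>l<3. x ! l \<noteq> 0) \<longrightarrow>
    (\<exists>p\<in>poly_funs 3. \<exists>q\<in>poly_funs 3. q x \<noteq> 0 \<and> (\<forall>y\<in>C. f y * q y = p y * evC Q y)))"

lemma locally_fraction_cong:
  "locally_fraction Q f \<Longrightarrow> (\<And>x. x \<in> C \<Longrightarrow> f x = g x) \<Longrightarrow> locally_fraction Q g"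
  unfolding locally_fraction_def by simp

lemma locally_fraction_smult:
  assumes "locally_fraction Q f" shows "locally_fraction Q (\<lambda>x. c * f x)"
  unfolding locally_fraction_def
proof (intro ballI impI)
  fix x assume "x \<in> C" "\<exists>l<3. x ! l \<noteq> 0"
  then obtain p q where "p \<in> poly_funs 3" "q \<in> poly_funs 3" "q x \<noteq> 0"
    "\<forall>y\<in>C. f y * q y = p y * evC Q y" using assms unfolding locally_fraction_def by blast
  then show "\<exists>p\<in>poly_funs 3. \<exists>q\<in>poly_funs 3. q x \<noteq> 0 \<and> (\<forall>y\<in>C. c * f y * q y = p y * evC Q y)"
    by (intro bexI[of _ "\<lambda>x. c * p x"] bexI[of _ q]) (auto intro: poly_funs_smult simp: mult.assoc)
qed

lemma locally_fraction_add:
  assumes "locally_fraction Q f" "locally_fraction Q g"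
  shows "locally_fraction Q (\<lambda>x. f x + g x)"
  unfolding locally_fraction_def
proof (intro ballI impI)
  fix x assume x: "x \<in> C" "\<exists>l<3. x ! l \<noteq> 0"
  obtain p q where 1: "p \<in> poly_funs 3" "q \<in> poly_funs 3" "q x \<noteq> 0"
    "\<forall>y\<in>C. f y * q y = p y * evC Q y" using x assms(1) unfolding locally_fraction_def by blast
  obtain p' q' where 2: "p' \<in> poly_funs 3" "q' \<in> poly_funs 3" "q' x \<noteq> 0"
    "\<forall>y\<in>C. g y * q' y = p' y * evC Q y" using x assms(2) unfolding locally_fraction_def by blast
  have "(f y + g y) * (q y * q' y) = (p y * q' y + p' y * q y) * evC Q y" if "y \<in> C" for y
  proof -
    have "(f y + g y) * (q y * q' y) = (f y * q y) * q' y + (g y * q' y) * q y"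
      by (simp add: algebra_simps)
    also have "\<dots> = (p y * q' y + p' y * q y) * evC Q y"
      using 1(4) 2(4) that by (simp add: algebra_simps)
    finally show ?thesis .
  qed
  then show "\<exists>p\<in>poly_funs 3. \<exists>q\<in>poly_funs 3. q x \<noteq> 0 \<and> (\<forall>y\<in>C. (f y + g y) * q y = p y * evC Q y)"
    using 1 2 by (intro bexI[of _ "\<lambda>y. p y * q' y + p' y * q y"] bexI[of _ "\<lambda>y. q y * q' y"])
      (auto intro!: poly_funs_add poly_funs_mult)
qed

lemma locally_fraction_0: "locally_fraction Q (\<lambda>x. 0)"
  unfolding locally_fraction_def
  by (intro ballI impI bexI[of _ "\<lambda>x. 0"] bexI[of _ "\<lambda>x. 1"] poly_funs_const) auto

lemma locally_fraction_sum:
  "finite I \<Longrightarrow> (\<And>l. l \<in> I \<Longrightarrow> locally_fraction Q (f l)) \<Longrightarrow> locally_fraction Q (\<lambda>x. \<Sum>l\<in>I. f l x)"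
  by (induction I rule: finite_induct) (auto intro: locally_fraction_add locally_fraction_0)

lemma locally_fraction_rot:
  assumes "locally_fraction Q f" "z \<in> \<mu>" shows "locally_fraction Q (\<lambda>x. f (rot z x))"
  unfolding locally_fraction_def
proof (intro ballI impI)
  fix x assume x: "x \<in> C" "\<exists>l<3. x ! l \<noteq> 0"
  have "z \<noteq> 0" using assms(2) axes_pos by (auto simp: power_0_left)
  then have "\<exists>l<3. rot z x ! l \<noteq> 0"
    using x C_length[OF x(1)] by (metis axes_cases mult_eq_0_iff rot_nth(1-3))
  then obtain p q where 1: "p \<in> poly_funs 3" "q \<in> poly_funs 3" "q (rot z x) \<noteq> 0"
    "\<forall>y\<in>C. f y * q y = p y * evC Q y"
    using rot_C[OF x(1) assms(2)] assms(1) unfolding locally_fraction_def by blast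
  obtain p' where p': "p' \<in> poly_funs 3" "\<And>x. length x = 3 \<Longrightarrow> p' x = p (rot z x)"
    using poly_funs_rot[OF 1(1)] by metis
  obtain q' where q': "q' \<in> poly_funs 3" "\<And>x. length x = 3 \<Longrightarrow> q' x = q (rot z x)"
    using poly_funs_rot[OF 1(2)] by metis
  have "f (rot z y) * q' y = p' y * evC Q y" if "y \<in> C" for y
    using 1(4) rot_C[OF that assms(2)] p'(2)[OF C_length[OF that]] q'(2)[OF C_length[OF that]]
    by (metis rot_nth(2,3))
  moreover have "q' x \<noteq> 0" using q'(2)[OF C_length[OF x(1)]] 1(3) by simp
  ultimately show "\<exists>p\<in>poly_funs 3. \<exists>q\<in>poly_funs 3. q x \<noteq> 0 \<and> (\<forall>y\<in>C. f (rot z y) * q y = p y * evC Q y)"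
    using p'(1) q'(1) by blast
qed

lemma locally_fraction_power:
  assumes "locally_fraction Q f" shows "locally_fraction (Q ^ n) (\<lambda>x. f x ^ n)"
  unfolding locally_fraction_def
proof (intro ballI impI)
  fix x assume "x \<in> C" "\<exists>l<3. x ! l \<noteq> 0"
  then obtain p q where "p \<in> poly_funs 3" "q \<in> poly_funs 3" "q x \<noteq> 0"
    "\<forall>y\<in>C. f y * q y = p y * evC Q y" using assms unfolding locally_fraction_def by blast
  then show "\<exists>p\<in>poly_funs 3. \<exists>q\<in>poly_funs 3. q x \<noteq> 0 \<and> (\<forall>y\<in>C. f y ^ n * q y = p y * evC (Q ^ n) y)"
    by (intro bexI[of _ "\<lambda>x. p x ^ n"] bexI[of _ "\<lambda>x. q x ^ n"])
      (auto intro!: poly_funs_power simp: power_mult_distrib[symmetric])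
qed

text \<open>The \<open>a i\<close>-th power removes \<open>x_i\<close>, whose own
  \<open>a i\<close>-th power is \<open>- h\<close>; this is how a single component is brought down
  to the plane.\<close>

lemma evC_power_term:
  assumes "x \<in> C"
  shows "(evC P x * x ! i ^ s) ^ a i = evC (P ^ a i * (- h) ^ s) x"
proof -
  have "(evC P x * x ! i ^ s) ^ a i = evC P x ^ a i * (x ! i ^ a i) ^ s"
    by (simp add: power_mult_distrib power_mult[symmetric] mult.commute)
  then show ?thesis by (simp add: C_power[OF assms])
qed

lemma dvd_of_power_dvd:
  assumes "Q \<noteq> 0" "s < a i" "Q ^ a i dvd P ^ a i * (- h) ^ s" shows "Q dvd P"
proof (rule dvd_of_power_dvd_squarefree[OF assms(1) h_nonzero h_squarefree assms(2)])
  have "(- h) ^ s = h ^ s \<or> (- h) ^ s = - (h ^ s)" by (cases "even s") auto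
  then show "Q ^ a i dvd P ^ a i * h ^ s" using assms(3) by auto
qed

text \<open>The \<open>a i\<close>-th power of the component is a plane polynomial whose quotient by
  \<open>Q ^ a i\<close> is still almost integral, so the factorial case applies; squarefreeness of
  \<open>h\<close> then undoes the power.\<close>

lemma almost_integral_imp_dvd:
  assumes "Q \<noteq> 0" "s < a i" "almost_integral Q (\<lambda>x. evC P x * x ! i ^ s)"
  shows "Q dvd P"
proof (rule dvd_of_power_dvd[OF assms(1,2)])
  obtain D where D: "D \<noteq> 0" "\<forall>n. \<exists>r\<in>poly_funs 3. \<forall>x\<in>C. evC D x * (evC P x * x ! i ^ s) ^ n = evC Q x ^ n * r x"
    using assms(3) unfolding almost_integral_def by blast
  show "Q ^ a i dvd P ^ a i * (- h) ^ s"
  proof (rule almost_integral_dvd[OF D(1)])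
    show "Q ^ a i \<noteq> 0" using assms(1) by simp
    fix m
    obtain r where r: "r \<in> poly_funs 3"
      "\<forall>x\<in>C. evC D x * (evC P x * x ! i ^ s) ^ (a i * m) = evC Q x ^ (a i * m) * r x" using D(2) by blast
    show "(Q ^ a i) ^ m dvd D * (P ^ a i * (- h) ^ s) ^ m"
    proof (rule dvd_descend[OF r(1)])
      fix x assume x: "x \<in> C"
      have "evC (D * (P ^ a i * (- h) ^ s) ^ m) x = evC D x * (evC P x * x ! i ^ s) ^ (a i * m)"
        unfolding power_mult evC_power_term[OF x] by simp
      also have "\<dots> = evC ((Q ^ a i) ^ m) x * r x" using r(2) x by (simp add: power_mult)
      finally show "evC (D * (P ^ a i * (- h) ^ s) ^ m) x = evC ((Q ^ a i) ^ m) x * r x" .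
    qed
  qed
qed

text \<open>Let S/B be the \<open>a i\<close>-th power of the fraction in lowest terms. A prime
  factor of \<open>B\<close> vanishes at a point other than the origin where \<open>S\<close> does
  not; at a point of the cone above it, the local identity \<open>S q = p B\<close> contradicts
  \<open>q \<noteq> 0\<close>.\<close>

lemma locally_fraction_imp_dvd:
  assumes "Q \<noteq> 0" "s < a i" "locally_fraction Q (\<lambda>x. evC P x * x ! i ^ s)"
  shows "Q dvd P"
proof (rule dvd_of_power_dvd[OF assms(1,2)])
  define F where "F = P ^ a i * (- h) ^ s"
  define G where "G = Q ^ a i"
  have G0: "G \<noteq> 0" using assms(1) by (simp add: G_def)
  have lf: "locally_fraction G (\<lambda>x. (evC P x * x ! i ^ s) ^ a i)"
    unfolding G_def by (rule locally_fraction_power[OF assms(3)])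
  define d where "d = gcd F G"
  obtain S where S: "F = d * S" unfolding d_def by (metis dvdE gcd_dvd1)
  obtain B where B: "G = d * B" unfolding d_def by (metis dvdE gcd_dvd2)
  have d0: "d \<noteq> 0" using G0 by (simp add: d_def)
  have cop: "gcd S B = 1"
  proof -
    have "S = F div gcd F G" "B = G div gcd F G"
      using d0 nonzero_mult_div_cancel_left[of d S] nonzero_mult_div_cancel_left[of d B]
      unfolding d_def[symmetric] S[symmetric] B[symmetric] by simp_all
    then show ?thesis using G0 div_gcd_coprime[of F G] by (metis coprime_imp_gcd_eq_1)
  qed
  have "is_unit B"
  proof (rule ccontr)
    assume "\<not> is_unit B"
    have "B \<noteq> 0" using G0 B by auto
    then obtain \<pi> where \<pi>: "prime \<pi>" "\<pi> dvd B" using \<open>\<not> is_unit B\<close> by (rule prime_divisorE)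
    have "\<not> \<pi> dvd S"
    proof
      assume "\<pi> dvd S"
      with \<pi>(2) have "\<pi> dvd gcd S B" by (rule gcd_greatest[rotated])
      with cop \<pi>(1) show False by (metis not_prime_unit)
    qed
    moreover have "prime_elem \<pi>" using \<pi>(1) unfolding prime_def by blast
    ultimately obtain u v where uv: "u \<noteq> 0 \<or> v \<noteq> 0" "ev2 \<pi> u v = 0" "ev2 S u v \<noteq> 0"
      using prime_plane_zero by blast
    obtain t where t: "pt t u v \<in> C" using exists_above by blast
    define x where "x = pt t u v"
    have x: "x \<in> C" "x ! j = u" "x ! k = v" using t by (simp_all add: x_def)
    have "\<exists>l<3. x ! l \<noteq> 0" using uv(1) x axes_less by metis
    then obtain p q where pq: "p \<in> poly_funs 3" "q \<in> poly_funs 3" "q x \<noteq> 0"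
      "\<And>y. y \<in> C \<Longrightarrow> (evC P y * y ! i ^ s) ^ a i * q y = p y * evC G y"
      using lf x(1) unfolding locally_fraction_def by blast
    \<comment> \<open>The common factor \<open>d\<close> may vanish at \<open>x\<close>, so it is
      cancelled as a function, by integrality of the cone, before evaluating.\<close>
    have Sq: "evC S y * q y = p y * evC B y" if "y \<in> C" for y
    proof (rule cancel[OF _ _ _ evC_nonzero[OF d0] _ that])
      show "(\<lambda>y. evC S y * q y) \<in> poly_funs 3" "(\<lambda>y. p y * evC B y) \<in> poly_funs 3" "evC d \<in> poly_funs 3"
        by (auto intro!: poly_funs_mult evC_poly_funs pq)
      fix y assume y: "y \<in> C"
      have "evC F y * q y = p y * evC G y"
        using pq(4)[OF y] unfolding evC_power_term[OF y] F_def .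
      then show "evC S y * q y * evC d y = p y * evC B y * evC d y" by (simp add: S B mult_ac)
    qed
    obtain B' where "B = \<pi> * B'" using \<pi>(2) by (rule dvdE)
    then have "evC B x = 0" using uv(2) by (simp add: x)
    then show False using Sq[OF x(1)] uv(3) pq(3) by (simp add: x)
  qed
  then have "G dvd F" unfolding S B by (rule mult_dvd_mono[OF dvd_refl unit_imp_dvd])
  then show "Q ^ a i dvd P ^ a i * (- h) ^ s" by (simp add: F_def G_def)
qed

text \<open>Averaging over the rotations isolates the coefficients of a function.\<close>

lemma dvd_by_averaging:
  assumes AI: "\<And>f z. z \<in> \<mu> \<Longrightarrow> \<Phi> f \<Longrightarrow> \<Phi> (\<lambda>x. f (rot z x))"
    "\<And>f c. \<Phi> f \<Longrightarrow> \<Phi> (\<lambda>x. c * f x)"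
    "\<And>I f. finite I \<Longrightarrow> (\<And>l. l \<in> I \<Longrightarrow> \<Phi> (f l)) \<Longrightarrow> \<Phi> (\<lambda>x. \<Sum>l\<in>(I :: 'k set). f l x)"
    and cong: "\<And>f g. \<Phi> f \<Longrightarrow> (\<And>x. x \<in> C \<Longrightarrow> f x = g x) \<Longrightarrow> \<Phi> g"
    and imp: "\<And>P s. s < a i \<Longrightarrow> \<Phi> (\<lambda>x. evC P x * x ! i ^ s) \<Longrightarrow> Q dvd P"
    and p: "p \<in> poly_funs 3" "\<Phi> p"
  shows "\<exists>r\<in>poly_funs 3. \<forall>x\<in>C. p x = evC Q x * r x"
proof -
  obtain T where T: "\<And>x. p x = ev3 T (x ! i) (x ! j) (x ! k)" using poly_funs_ev3[OF p(1) axes] by blast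
  have "\<exists>R. xcoeff T s = Q * R" if s: "s < a i" for s
  proof -
    have "\<Phi> (\<lambda>x. \<Sum>z\<in>\<mu>. z ^ (a i - s) * p (rot z x))"
      by (intro AI(3) finite_mu AI(2) AI(1) p(2))
    from AI(2)[OF this, of "inverse (of_nat (a i))"] have "\<Phi> (\<lambda>x. evC (xcoeff T s) x * x ! i ^ s)"
    proof (rule cong)
      fix x assume x: "x \<in> C"
      show "inverse (of_nat (a i)) * (\<Sum>z\<in>\<mu>. z ^ (a i - s) * p (rot z x)) = evC (xcoeff T s) x * x ! i ^ s"
        using ev3_average[OF x s, of T] of_nat_ai by (simp add: T rot_nth)
    qed
    from imp[OF s this] show ?thesis by (auto elim: dvdE)
  qed
  then obtain R where R: "\<And>s. s < a i \<Longrightarrow> xcoeff T s = Q * R s" by metis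
  show ?thesis
  proof (intro bexI ballI)
    show "(\<lambda>x. \<Sum>s<a i. evC (R s) x * x ! i ^ s) \<in> poly_funs 3"
      using axes_less by (intro poly_funs_sum poly_funs_mult evC_poly_funs poly_funs_power poly_funs_coord)
    fix x assume "x \<in> C"
    then show "p x = evC Q x * (\<Sum>s<a i. evC (R s) x * x ! i ^ s)"
      by (simp add: T ev3_xcoeff R sum_distrib_left mult.assoc)
  qed
qed

text \<open>The cofactor \<open>q'\<close> that turns \<open>q\<close> into its norm
  \<open>Q\<close> was multiplied into the numerator as well, and integrality allows cancelling
  it.\<close>

lemma reduce_denominator:
  assumes q: "q \<in> poly_funs 3" "q' \<in> poly_funs 3" "\<exists>x\<in>C. q' x \<noteq> 0"
    and p: "p \<in> poly_funs 3" and Q: "\<And>x. x \<in> C \<Longrightarrow> q' x * q x = evC Q x"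
    and r: "r \<in> poly_funs 3" "\<And>x. x \<in> C \<Longrightarrow> p x * q' x = evC Q x * r x" and x: "x \<in> C"
  shows "p x = q x * r x"
  by (rule cancel[OF p q(2) poly_funs_mult[OF q(1) r(1)] q(3) _ x])
    (simp add: r(2) Q[symmetric] mult_ac)

text \<open>Both denominators are replaced by their norms; then \<open>Q\<close> and
  \<open>D\<close> are plane polynomials and the components of the numerator can be treated one at a
  time.\<close>

lemma normal_axes:
  assumes p: "p \<in> poly_funs 3" and q: "q \<in> poly_funs 3" "\<exists>x\<in>C. q x \<noteq> 0"
    and c: "c \<in> poly_funs 3" "\<exists>x\<in>C. c x \<noteq> 0"
    and ai: "\<And>n. \<exists>r\<in>poly_funs 3. \<forall>x\<in>C. c x * p x ^ n = q x ^ n * r x"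
  shows "\<exists>r\<in>poly_funs 3. \<forall>x\<in>C. p x = q x * r x"
proof -
  obtain q' Q where q': "q' \<in> poly_funs 3" "Q \<noteq> 0" "\<exists>x\<in>C. q' x \<noteq> 0" "\<And>x. x \<in> C \<Longrightarrow> q' x * q x = evC Q x"
    using norm_multiple[OF q] by metis
  obtain c' D where c': "c' \<in> poly_funs 3" "D \<noteq> 0" "\<And>x. x \<in> C \<Longrightarrow> c' x * c x = evC D x"
    using norm_multiple[OF c] by metis
  define p' where "p' x = p x * q' x" for x
  have p': "p' \<in> poly_funs 3" unfolding p'_def by (intro poly_funs_mult p q')
  have "almost_integral Q p'"
    unfolding almost_integral_def
  proof (intro exI[of _ D] conjI allI)
    fix n
    obtain r where r: "r \<in> poly_funs 3" "\<forall>x\<in>C. c x * p x ^ n = q x ^ n * r x" using ai by blast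
    have "evC D x * p' x ^ n = evC Q x ^ n * (c' x * r x)" if x: "x \<in> C" for x
    proof -
      have "evC D x * p' x ^ n = c' x * (c x * p x ^ n) * q' x ^ n"
        using c'(3)[OF x] by (simp add: p'_def power_mult_distrib mult_ac flip: c'(3)[OF x])
      also have "\<dots> = (q' x * q x) ^ n * (c' x * r x)" using r(2) x by (simp add: power_mult_distrib mult_ac)
      finally show ?thesis using q'(4)[OF x] by simp
    qed
    then show "\<exists>r\<in>poly_funs 3. \<forall>x\<in>C. evC D x * p' x ^ n = evC Q x ^ n * r x"
      using c'(1) r(1) by (intro bexI[of _ "\<lambda>x. c' x * r x"]) (auto intro: poly_funs_mult)
  qed (fact c'(2))
  then have "\<exists>r\<in>poly_funs 3. \<forall>x\<in>C. p' x = evC Q x * r x"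
    by (intro dvd_by_averaging[where \<Phi> = "almost_integral Q"] p')
      (fact almost_integral_rot almost_integral_smult almost_integral_sum almost_integral_cong almost_integral_imp_dvd[OF q'(2)] | 
       blast intro: almost_integral_rot almost_integral_smult almost_integral_sum almost_integral_cong almost_integral_imp_dvd[OF q'(2)])+
  then obtain r where r: "r \<in> poly_funs 3" "\<And>x. x \<in> C \<Longrightarrow> p' x = evC Q x * r x"
    by blast
  show ?thesis
    using reduce_denominator[OF q(1) q'(1,3) p q'(4) r(1) r(2)[unfolded p'_def]] r(1) by blast
qed

text \<open>A local fraction for \<open>p / q\<close> is also one for \<open>p q'\<close> over the
  norm of \<open>q\<close>, and the components under the rotations inherit these fractions.\<close>

lemma hartogs_axes:
  assumes p: "p \<in> poly_funs 3" and q: "q \<in> poly_funs 3" "\<exists>x\<in>C. q x \<noteq> 0"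
    and loc: "\<And>x. x \<in> C \<Longrightarrow> \<exists>l<3. x ! l \<noteq> 0 \<Longrightarrow>
      \<exists>p'\<in>poly_funs 3. \<exists>q'\<in>poly_funs 3. q' x \<noteq> 0 \<and> (\<forall>y\<in>C. p y * q' y = p' y * q y)"
  shows "\<exists>r\<in>poly_funs 3. \<forall>x\<in>C. p x = q x * r x"
proof -
  obtain q' Q where q': "q' \<in> poly_funs 3" "Q \<noteq> 0" "\<exists>x\<in>C. q' x \<noteq> 0" "\<And>x. x \<in> C \<Longrightarrow> q' x * q x = evC Q x"
    using norm_multiple[OF q] by metis
  define p' where "p' x = p x * q' x" for x
  have p': "p' \<in> poly_funs 3" unfolding p'_def by (intro poly_funs_mult p q')
  have "locally_fraction Q p'"
    unfolding locally_fraction_def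
  proof (intro ballI impI)
    fix x assume "x \<in> C" "\<exists>l<3. x ! l \<noteq> 0"
    then obtain r s where rs: "r \<in> poly_funs 3" "s \<in> poly_funs 3" "s x \<noteq> 0" "\<forall>y\<in>C. p y * s y = r y * q y"
      using loc by blast
    have "p' y * s y = r y * evC Q y" if y: "y \<in> C" for y
    proof -
      have "p' y * s y = (p y * s y) * q' y" by (simp add: p'_def)
      also have "\<dots> = r y * (q' y * q y)" using rs(4) y by simp
      finally show ?thesis using q'(4)[OF y] by simp
    qed
    with rs show "\<exists>p\<in>poly_funs 3. \<exists>q\<in>poly_funs 3. q x \<noteq> 0 \<and> (\<forall>y\<in>C. p' y * q y = p y * evC Q y)" by blast
  qed
  then have "\<exists>r\<in>poly_funs 3. \<forall>x\<in>C. p' x = evC Q x * r x"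
    by (intro dvd_by_averaging[where \<Phi> = "locally_fraction Q"] p')
      (fact locally_fraction_rot locally_fraction_smult locally_fraction_sum locally_fraction_cong locally_fraction_imp_dvd[OF q'(2)] | 
       blast intro: locally_fraction_rot locally_fraction_smult locally_fraction_sum locally_fraction_cong locally_fraction_imp_dvd[OF q'(2)])+
  then obtain r where r: "r \<in> poly_funs 3" "\<And>x. x \<in> C \<Longrightarrow> p' x = evC Q x * r x"
    by blast
  show ?thesis
    using reduce_denominator[OF q(1) q'(1,3) p q'(4) r(1) r(2)[unfolded p'_def]] r(1) by blast
qed

end

lemmas (in pham) normal = pham_axes.normal_axes[OF axes_012]
  and hartogs = pham_axes.hartogs_axes[OF axes_012]

section \<open>Spaces whose functions are locally fractions\<close>

text \<open>\<open>Fr W f\<close> is meant as: a single fraction represents \<open>f\<close> on all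
  of \<open>W\<close>; regularity is the local version. Affine and weighted projective spaces differ
  only in the fractions allowed, so they share all consequences.\<close>

locale frac_space =
  fixes Y :: "('p, 'k::field) fun_space" and Fr :: "'p set \<Rightarrow> ('p \<Rightarrow> 'k) \<Rightarrow> bool"
  assumes reg_eq: "\<And>U. reg Y U = {f. \<forall>x\<in>U. \<exists>W. openin (zar Y) W \<and> x \<in> W \<and> W \<subseteq> U \<and> Fr W f}"
    and Fr_mono: "\<And>W W' f. Fr W f \<Longrightarrow> W' \<subseteq> W \<Longrightarrow> Fr W' f"
    and Fr_cong: "\<And>W f g. Fr W f \<Longrightarrow> (\<And>x. x \<in> W \<Longrightarrow> f x = g x) \<Longrightarrow> Fr W g"
    and Fr_const: "\<And>W c. Fr W (\<lambda>_. c)"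
    and Fr_add: "\<And>W f g. Fr W f \<Longrightarrow> Fr W g \<Longrightarrow> Fr W (\<lambda>x. f x + g x)"
    and Fr_mult: "\<And>W f g. Fr W f \<Longrightarrow> Fr W g \<Longrightarrow> Fr W (\<lambda>x. f x * g x)"
    and Fr_inverse: "\<And>W f. Fr W f \<Longrightarrow> (\<And>x. x \<in> W \<Longrightarrow> f x \<noteq> 0) \<Longrightarrow> Fr W (\<lambda>x. inverse (f x))"
    and Fr_open: "\<And>W f. Fr W f \<Longrightarrow> openin (zar Y) W \<Longrightarrow> openin (zar Y) {x \<in> W. f x \<noteq> 0}"
begin

lemma regI: "(\<And>x. x \<in> U \<Longrightarrow> \<exists>W. openin (zar Y) W \<and> x \<in> W \<and> W \<subseteq> U \<and> Fr W f) \<Longrightarrow> f \<in> reg Y U"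
  unfolding reg_eq by blast

lemma regE:
  assumes "f \<in> reg Y U" "x \<in> U"
  obtains W where "openin (zar Y) W" "x \<in> W" "W \<subseteq> U" "Fr W f"
  using assms unfolding reg_eq by blast

lemma reg_Fr: "openin (zar Y) U \<Longrightarrow> Fr U f \<Longrightarrow> f \<in> reg Y U"
  by (rule regI) blast

lemma reg_cong: "f \<in> reg Y U \<Longrightarrow> (\<And>x. x \<in> U \<Longrightarrow> f x = g x) \<Longrightarrow> g \<in> reg Y U"
  unfolding reg_eq using Fr_cong by (simp, meson subsetD)

lemma reg_mono:
  assumes "f \<in> reg Y U" "V \<subseteq> U" "openin (zar Y) V" shows "f \<in> reg Y V"
proof (rule regI)
  fix x assume "x \<in> V"
  then have "x \<in> U" using assms(2) by blast
  with assms(1) obtain W where "openin (zar Y) W" "x \<in> W" "W \<subseteq> U" "Fr W f" by (rule regE)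
  then show "\<exists>W. openin (zar Y) W \<and> x \<in> W \<and> W \<subseteq> V \<and> Fr W f"
    using assms(3) \<open>x \<in> V\<close> by (intro exI[of _ "W \<inter> V"]) (auto intro: Fr_mono)
qed

lemma reg_glue:
  assumes "\<And>x. x \<in> U \<Longrightarrow> \<exists>W. openin (zar Y) W \<and> x \<in> W \<and> W \<subseteq> U \<and> f \<in> reg Y W"
  shows "f \<in> reg Y U"
proof (rule regI)
  fix x assume "x \<in> U"
  then obtain W where W: "x \<in> W" "W \<subseteq> U" "f \<in> reg Y W" using assms by blast
  obtain V where "openin (zar Y) V" "x \<in> V" "V \<subseteq> W" "Fr V f" using W(3,1) by (rule regE)
  with W(2) show "\<exists>W. openin (zar Y) W \<and> x \<in> W \<and> W \<subseteq> U \<and> Fr W f"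
    by (intro exI[of _ V]) auto
qed

lemma reg_const: "openin (zar Y) U \<Longrightarrow> (\<lambda>x. c) \<in> reg Y U"
  by (rule reg_Fr[OF _ Fr_const])

lemma reg_binary:
  assumes "f \<in> reg Y U" "g \<in> reg Y U" "\<And>W. Fr W f \<Longrightarrow> Fr W g \<Longrightarrow> Fr W h"
  shows "h \<in> reg Y U"
proof (rule regI)
  fix x assume x: "x \<in> U"
  obtain W where "openin (zar Y) W" "x \<in> W" "W \<subseteq> U" "Fr W f" using assms(1) x by (rule regE)
  moreover obtain V where "openin (zar Y) V" "x \<in> V" "V \<subseteq> U" "Fr V g" using assms(2) x by (rule regE)
  ultimately show "\<exists>W. openin (zar Y) W \<and> x \<in> W \<and> W \<subseteq> U \<and> Fr W h"
    by (intro exI[of _ "W \<inter> V"]) (auto intro!: assms(3) intro: Fr_mono)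
qed

lemma reg_add: "f \<in> reg Y U \<Longrightarrow> g \<in> reg Y U \<Longrightarrow> (\<lambda>x. f x + g x) \<in> reg Y U"
  by (rule reg_binary[OF _ _ Fr_add])

lemma reg_mult: "f \<in> reg Y U \<Longrightarrow> g \<in> reg Y U \<Longrightarrow> (\<lambda>x. f x * g x) \<in> reg Y U"
  by (rule reg_binary[OF _ _ Fr_mult])

lemma reg_smult: "f \<in> reg Y U \<Longrightarrow> (\<lambda>x. c * f x) \<in> reg Y U"
  by (rule reg_binary[of f U f]) (auto intro: Fr_mult Fr_const)

lemma reg_uminus: "f \<in> reg Y U \<Longrightarrow> (\<lambda>x. - f x) \<in> reg Y U"
  using reg_smult[of f U "-1"] by simp

lemma reg_diff: "f \<in> reg Y U \<Longrightarrow> g \<in> reg Y U \<Longrightarrow> (\<lambda>x. f x - g x) \<in> reg Y U"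
  using reg_add[OF _ reg_uminus, of f U g] by simp

lemma reg_inverse: "f \<in> reg Y U \<Longrightarrow> (\<And>x. x \<in> U \<Longrightarrow> f x \<noteq> 0) \<Longrightarrow> (\<lambda>x. inverse (f x)) \<in> reg Y U"
  unfolding reg_eq using Fr_inverse by (simp, meson subsetD)

lemma reg_divide:
  "f \<in> reg Y U \<Longrightarrow> g \<in> reg Y U \<Longrightarrow> (\<And>x. x \<in> U \<Longrightarrow> g x \<noteq> 0) \<Longrightarrow> (\<lambda>x. f x / g x) \<in> reg Y U"
  unfolding divide_inverse by (intro reg_mult reg_inverse)

lemma reg_power: "openin (zar Y) U \<Longrightarrow> f \<in> reg Y U \<Longrightarrow> (\<lambda>x. f x ^ n) \<in> reg Y U"
  by (induction n) (auto intro: reg_const reg_mult)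

lemma reg_powi:
  "openin (zar Y) U \<Longrightarrow> f \<in> reg Y U \<Longrightarrow> (\<And>x. x \<in> U \<Longrightarrow> f x \<noteq> 0) \<Longrightarrow> (\<lambda>x. f x powi n) \<in> reg Y U"
  unfolding power_int_def by (cases "0 \<le> n") (auto intro: reg_power intro!: reg_power[OF _ reg_inverse])

lemma reg_sum:
  "openin (zar Y) U \<Longrightarrow> (\<And>i. i \<in> I \<Longrightarrow> f i \<in> reg Y U) \<Longrightarrow> (\<lambda>x. \<Sum>i\<in>I. f i x) \<in> reg Y U"
  by (induction I rule: infinite_finite_induct) (auto intro: reg_const reg_add)

lemma reg_open:
  assumes "f \<in> reg Y U" shows "openin (zar Y) {x \<in> U. f x \<noteq> 0}"
proof (subst openin_subopen, intro ballI)
  fix x assume "x \<in> {x \<in> U. f x \<noteq> 0}"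
  then obtain W where "openin (zar Y) W" "x \<in> W" "W \<subseteq> U" "Fr W f" "f x \<noteq> 0"
    using assms unfolding reg_eq by auto
  then show "\<exists>T. openin (zar Y) T \<and> x \<in> T \<and> T \<subseteq> {x \<in> U. f x \<noteq> 0}"
    by (intro exI[of _ "{x \<in> W. f x \<noteq> 0}"]) (auto intro: Fr_open)
qed

lemma reg_neq_open:
  "f \<in> reg Y U \<Longrightarrow> g \<in> reg Y U \<Longrightarrow> openin (zar Y) {x \<in> U. f x \<noteq> g x}"
  using reg_open[OF reg_diff, of f U g] by simp

lemma reg_poly_funs:
  assumes "p \<in> poly_funs n" "openin (zar Y) U" "\<And>i. i < n \<Longrightarrow> (\<lambda>x. \<phi> x ! i) \<in> reg Y U"
  shows "(\<lambda>x. p (\<phi> x)) \<in> reg Y U"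
  using assms(1) by (induction rule: poly_funs_induct) (auto intro: reg_const reg_add reg_mult assms)

end

section \<open>The function field of an irreducible space\<close>

locale irr_space = frac_space Y Fr for Y :: "('p, 'k::field) fun_space" and Fr +
  assumes points_ne: "points Y \<noteq> {}"
    and irr: "\<And>U V. openin (zar Y) U \<Longrightarrow> openin (zar Y) V \<Longrightarrow> U \<noteq> {} \<Longrightarrow> V \<noteq> {} \<Longrightarrow> U \<inter> V \<noteq> {}"
begin

abbreviation germ :: "'p set \<Rightarrow> ('p \<Rightarrow> 'k) \<Rightarrow> bool" where
  "germ U f \<equiv> openin (zar Y) U \<and> U \<noteq> {} \<and> f \<in> reg Y U"

abbreviation R :: "'p set \<Rightarrow> ('p \<Rightarrow> 'k) \<Rightarrow> ('p, 'k) ratfun" where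
  "R \<equiv> ratfun_of Y"

abbreviation KY :: "('p, 'k) ratfun ring" where "KY \<equiv> function_field Y"

lemma germ_const: "germ (points Y) (\<lambda>x. c)"
  using points_ne by (simp add: reg_const)

lemma germ_mono: "germ U f \<Longrightarrow> V \<subseteq> U \<Longrightarrow> openin (zar Y) V \<Longrightarrow> V \<noteq> {} \<Longrightarrow> germ V f"
  by (auto intro: reg_mono)

lemma germ_Int: "germ U f \<Longrightarrow> germ V g \<Longrightarrow> germ (U \<inter> V) f \<and> germ (U \<inter> V) g"
  using irr by (auto intro: reg_mono)

lemma germ_binary:
  assumes "germ U f" "germ V g"
  shows germ_add: "germ (U \<inter> V) (\<lambda>x. f x + g x)" and germ_mult: "germ (U \<inter> V) (\<lambda>x. f x * g x)"
  using germ_Int[OF assms] by (auto intro: reg_add reg_mult)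

text \<open>The locus where two regular functions differ is open; if it were nonempty, it would meet
  \<open>W\<close>.\<close>

lemma agree:
  assumes "germ U f" "germ V g" "openin (zar Y) W" "W \<noteq> {}"
    and "\<And>x. x \<in> W \<Longrightarrow> x \<in> U \<Longrightarrow> x \<in> V \<Longrightarrow> f x = g x" and x: "x \<in> U" "x \<in> V"
  shows "f x = g x"
proof (rule ccontr)
  assume "f x \<noteq> g x"
  moreover have "openin (zar Y) {x \<in> U \<inter> V. f x \<noteq> g x}"
    using germ_Int[OF assms(1,2)] by (intro reg_neq_open) auto
  ultimately have "{x \<in> U \<inter> V. f x \<noteq> g x} \<inter> W \<noteq> {}" using assms(3,4) x by (intro irr) auto
  with assms(5) show False by blast
qed

text \<open>Agreement on one nonempty open set spreads to the whole overlap by density. This makes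
  the relation transitive and reduces equality of rational functions to values.\<close>

lemma germ_rel_iff:
  "((U, f), (V, g)) \<in> germ_rel Y \<longleftrightarrow> germ U f \<and> germ V g \<and> (\<forall>x\<in>U \<inter> V. f x = g x)"
proof
  assume "((U, f), (V, g)) \<in> germ_rel Y"
  then obtain W where W: "germ U f" "germ V g" "openin (zar Y) W" "W \<noteq> {}" "\<forall>x\<in>W. f x = g x"
    unfolding germ_rel_def germ_pairs_def by blast
  then show "germ U f \<and> germ V g \<and> (\<forall>x\<in>U \<inter> V. f x = g x)"
    using agree[OF W(1-4)] by blast
next
  assume *: "germ U f \<and> germ V g \<and> (\<forall>x\<in>U \<inter> V. f x = g x)"
  then have "openin (zar Y) (U \<inter> V)" "U \<inter> V \<noteq> {}" using irr by auto
  with * show "((U, f), (V, g)) \<in> germ_rel Y"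
    unfolding germ_rel_def germ_pairs_def by blast
qed

lemma equiv_germ_rel: "equiv (germ_pairs Y) (germ_rel Y)"
proof (rule equivI)
  show "germ_rel Y \<subseteq> germ_pairs Y \<times> germ_pairs Y" unfolding germ_rel_def by blast
  show "refl_on (germ_pairs Y) (germ_rel Y)"
    by (rule refl_onI) (auto simp: germ_rel_iff germ_pairs_def)
  show "sym (germ_rel Y)" by (rule symI) (auto simp: germ_rel_iff)
  show "trans (germ_rel Y)"
  proof (rule transI)
    fix a b c assume ab: "(a, b) \<in> germ_rel Y" and bc: "(b, c) \<in> germ_rel Y"
    obtain U f V g W h where abc: "a = (U, f)" "b = (V, g)" "c = (W, h)" by (metis surj_pair)
    have 1: "germ U f" "germ V g" "\<forall>x\<in>U \<inter> V. f x = g x" "germ W h" "\<forall>x\<in>V \<inter> W. g x = h x"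
      using ab bc unfolding abc germ_rel_iff by auto
    have "f x = h x" if "x \<in> U" "x \<in> W" for x
      using agree[OF 1(1,4), of V] 1 that by (metis IntI)
    then show "(a, c) \<in> germ_rel Y" using 1 by (auto simp: abc germ_rel_iff)
  qed
qed

lemma R_eq_iff: "germ U f \<Longrightarrow> germ V g \<Longrightarrow> R U f = R V g \<longleftrightarrow> (\<forall>x\<in>U \<inter> V. f x = g x)"
  unfolding ratfun_of_def
  by (subst eq_equiv_class_iff[OF equiv_germ_rel]) (auto simp: germ_rel_iff germ_pairs_def)

lemma R_eqI:
  assumes "germ U f" "germ V g" "openin (zar Y) W" "W \<noteq> {}"
    "\<And>x. x \<in> W \<Longrightarrow> x \<in> U \<Longrightarrow> x \<in> V \<Longrightarrow> f x = g x"
  shows "R U f = R V g"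
  using agree[OF assms] by (subst R_eq_iff) (use assms in auto)

lemma R_mem_iff: "germ U f \<Longrightarrow> (V, g) \<in> R U f \<longleftrightarrow> germ V g \<and> (\<forall>x\<in>U \<inter> V. f x = g x)"
  unfolding ratfun_of_def by (auto simp: germ_rel_iff)

lemma carrier_KY: "carrier KY = {R U f | U f. germ U f}"
  unfolding function_field_def by (auto simp: quotient_def ratfun_of_def germ_pairs_def)

lemma R_carrier: "germ U f \<Longrightarrow> R U f \<in> carrier KY"
  unfolding carrier_KY by blast

text \<open>The operations of the function field are unions over all representatives; every pair of
  representatives yields the same class, so the union is that class.\<close>

lemma R_binary:
  assumes germs: "germ U f" "germ V g" and op: "\<And>U V f g. germ U f \<Longrightarrow> germ V g \<Longrightarrow> germ (U \<inter> V) (\<lambda>x. F (f x) (g x))"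
  shows "(\<Union>(U', f')\<in>R U f. \<Union>(V', g')\<in>R V g. R (U' \<inter> V') (\<lambda>x. F (f' x) (g' x))) =
    R (U \<inter> V) (\<lambda>x. F (f x) (g x))"
proof -
  have "R (U' \<inter> V') (\<lambda>x. F (f' x) (g' x)) = R (U \<inter> V) (\<lambda>x. F (f x) (g x))"
    if "(U', f') \<in> R U f" "(V', g') \<in> R V g" for U' f' V' g'
    using that germs by (subst R_eq_iff) (auto simp: R_mem_iff intro!: op)
  moreover have "(U, f) \<in> R U f" "(V, g) \<in> R V g" using germs by (auto simp: R_mem_iff)
  ultimately show ?thesis by blast
qed

lemma R_mult: "germ U f \<Longrightarrow> germ V g \<Longrightarrow> R U f \<otimes>\<^bsub>KY\<^esub> R V g = R (U \<inter> V) (\<lambda>x. f x * g x)"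
  by (subst R_binary[where F = "(*)", symmetric]) (assumption | rule germ_mult | simp add: function_field_def)+

lemma R_add: "germ U f \<Longrightarrow> germ V g \<Longrightarrow> R U f \<oplus>\<^bsub>KY\<^esub> R V g = R (U \<inter> V) (\<lambda>x. f x + g x)"
  by (subst R_binary[where F = "(+)", symmetric]) (assumption | rule germ_add | simp add: function_field_def)+

lemma one_KY: "\<one>\<^bsub>KY\<^esub> = R (points Y) (\<lambda>x. 1)" and zero_KY: "\<zero>\<^bsub>KY\<^esub> = R (points Y) (\<lambda>x. 0)"
  by (simp_all add: function_field_def const_ratfun_def)

lemma R_eq_zero_iff: "germ U f \<Longrightarrow> R U f = \<zero>\<^bsub>KY\<^esub> \<longleftrightarrow> (\<forall>x\<in>U. f x = 0)"
  unfolding zero_KY using openin_subset[of "zar Y" U]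
  by (subst R_eq_iff[OF _ germ_const]) auto

lemma R_eq_one_iff: "germ U f \<Longrightarrow> R U f = \<one>\<^bsub>KY\<^esub> \<longleftrightarrow> (\<forall>x\<in>U. f x = 1)"
  unfolding one_KY using openin_subset[of "zar Y" U]
  by (subst R_eq_iff[OF _ germ_const]) auto

lemma R_restrict: "germ U f \<Longrightarrow> V \<subseteq> U \<Longrightarrow> openin (zar Y) V \<Longrightarrow> V \<noteq> {} \<Longrightarrow> R V f = R U f"
  by (subst R_eq_iff) (auto intro: reg_mono)

lemma KY_cases:
  assumes "g \<in> carrier KY" obtains U f where "g = R U f" "germ U f"
  using assms unfolding carrier_KY by blast

lemma nonvanishing_germ:
  assumes "germ U f" "x \<in> U" "f x \<noteq> 0" shows "germ {x \<in> U. f x \<noteq> 0} f"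
  using assms reg_open[of f U] by (auto intro: reg_mono)

lemma germ_inverse: "germ U f \<Longrightarrow> (\<And>x. x \<in> U \<Longrightarrow> f x \<noteq> 0) \<Longrightarrow> germ U (\<lambda>x. inverse (f x))"
  by (auto intro: reg_inverse)

lemma R_mult_same: "germ U f \<Longrightarrow> germ U g \<Longrightarrow> R U f \<otimes>\<^bsub>KY\<^esub> R U g = R U (\<lambda>x. f x * g x)"
  and R_add_same: "germ U f \<Longrightarrow> germ U g \<Longrightarrow> R U f \<oplus>\<^bsub>KY\<^esub> R U g = R U (\<lambda>x. f x + g x)"
  by (simp_all add: R_mult R_add)

lemma const_same:
  assumes "openin (zar Y) U" "U \<noteq> {}" shows "\<zero>\<^bsub>KY\<^esub> = R U (\<lambda>x. 0)" "\<one>\<^bsub>KY\<^esub> = R U (\<lambda>x. 1)"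
  using assms R_eq_zero_iff[of U "\<lambda>x. 0"] R_eq_one_iff[of U "\<lambda>x. 1"] by (auto simp: reg_const)

text \<open>Over a common domain the ring axioms become identities between values in the ground
  field.\<close>

lemma KY_common:
  assumes "a \<in> carrier KY" "b \<in> carrier KY" "c \<in> carrier KY"
  obtains U f g h where "a = R U f" "b = R U g" "c = R U h" "germ U f" "germ U g" "germ U h"
proof -
  obtain U f where a: "a = R U f" "germ U f" using assms(1) by (rule KY_cases)
  obtain V g where b: "b = R V g" "germ V g" using assms(2) by (rule KY_cases)
  obtain W h where c: "c = R W h" "germ W h" using assms(3) by (rule KY_cases)
  define Z where "Z = U \<inter> V \<inter> W"
  have Z: "openin (zar Y) Z" "Z \<noteq> {}"
    unfolding Z_def using a(2) b(2) c(2) irr[of U V] irr[of "U \<inter> V" W] by auto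
  have "a = R Z f" "b = R Z g" "c = R Z h" "germ Z f" "germ Z g" "germ Z h"
    using Z a b c R_restrict[of U f Z] R_restrict[of V g Z] R_restrict[of W h Z]
      germ_mono[of U f Z] germ_mono[of V g Z] germ_mono[of W h Z] by (auto simp: Z_def)
  then show ?thesis by (rule that)
qed

lemma germ_same:
  "germ U f \<Longrightarrow> germ U g \<Longrightarrow> germ U (\<lambda>x. f x + g x)"
  "germ U f \<Longrightarrow> germ U g \<Longrightarrow> germ U (\<lambda>x. f x * g x)"
  "germ U f \<Longrightarrow> germ U (\<lambda>x. - f x)"
  by (auto intro: reg_add reg_mult reg_uminus)

lemma cring_KY: "cring KY"
proof (rule cringI)
  have closed: "a \<oplus>\<^bsub>KY\<^esub> b \<in> carrier KY" "a \<otimes>\<^bsub>KY\<^esub> b \<in> carrier KY"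
    and comm: "a \<oplus>\<^bsub>KY\<^esub> b = b \<oplus>\<^bsub>KY\<^esub> a" "a \<otimes>\<^bsub>KY\<^esub> b = b \<otimes>\<^bsub>KY\<^esub> a"
    and assoc: "a \<oplus>\<^bsub>KY\<^esub> b \<oplus>\<^bsub>KY\<^esub> c = a \<oplus>\<^bsub>KY\<^esub> (b \<oplus>\<^bsub>KY\<^esub> c)" "a \<otimes>\<^bsub>KY\<^esub> b \<otimes>\<^bsub>KY\<^esub> c = a \<otimes>\<^bsub>KY\<^esub> (b \<otimes>\<^bsub>KY\<^esub> c)"
    and distr: "(a \<oplus>\<^bsub>KY\<^esub> b) \<otimes>\<^bsub>KY\<^esub> c = a \<otimes>\<^bsub>KY\<^esub> c \<oplus>\<^bsub>KY\<^esub> b \<otimes>\<^bsub>KY\<^esub> c"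
    and unit: "\<zero>\<^bsub>KY\<^esub> \<oplus>\<^bsub>KY\<^esub> a = a" "\<one>\<^bsub>KY\<^esub> \<otimes>\<^bsub>KY\<^esub> a = a"
    and inv: "\<exists>b\<in>carrier KY. b \<oplus>\<^bsub>KY\<^esub> a = \<zero>\<^bsub>KY\<^esub>"
    if abc: "a \<in> carrier KY" "b \<in> carrier KY" "c \<in> carrier KY" for a b c
  proof -
    obtain U f g h where *: "a = R U f" "b = R U g" "c = R U h" and germs: "germ U f" "germ U g" "germ U h"
      using abc by (rule KY_common)
    show "a \<oplus>\<^bsub>KY\<^esub> b \<in> carrier KY" "a \<otimes>\<^bsub>KY\<^esub> b \<in> carrier KY"
      using germs germ_same R_carrier by (simp_all add: * R_add_same R_mult_same)
    show "a \<oplus>\<^bsub>KY\<^esub> b = b \<oplus>\<^bsub>KY\<^esub> a" "a \<otimes>\<^bsub>KY\<^esub> b = b \<otimes>\<^bsub>KY\<^esub> a"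
      using germs by (simp_all add: * R_add_same R_mult_same add.commute mult.commute)
    show "a \<oplus>\<^bsub>KY\<^esub> b \<oplus>\<^bsub>KY\<^esub> c = a \<oplus>\<^bsub>KY\<^esub> (b \<oplus>\<^bsub>KY\<^esub> c)" "a \<otimes>\<^bsub>KY\<^esub> b \<otimes>\<^bsub>KY\<^esub> c = a \<otimes>\<^bsub>KY\<^esub> (b \<otimes>\<^bsub>KY\<^esub> c)"
      using germs germ_same by (simp_all add: * R_add_same R_mult_same add.assoc mult.assoc)
    show "(a \<oplus>\<^bsub>KY\<^esub> b) \<otimes>\<^bsub>KY\<^esub> c = a \<otimes>\<^bsub>KY\<^esub> c \<oplus>\<^bsub>KY\<^esub> b \<otimes>\<^bsub>KY\<^esub> c"
      using germs germ_same by (simp add: * R_add_same R_mult_same distrib_right)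
    show "\<zero>\<^bsub>KY\<^esub> \<oplus>\<^bsub>KY\<^esub> a = a" "\<one>\<^bsub>KY\<^esub> \<otimes>\<^bsub>KY\<^esub> a = a"
      using germs by (simp_all add: * const_same[of U] R_add_same R_mult_same reg_const)
    have "R U (\<lambda>x. - f x) \<oplus>\<^bsub>KY\<^esub> a = \<zero>\<^bsub>KY\<^esub>"
      using germs germ_same by (simp add: * const_same[of U] R_add_same)
    then show "\<exists>b\<in>carrier KY. b \<oplus>\<^bsub>KY\<^esub> a = \<zero>\<^bsub>KY\<^esub>" using R_carrier germ_same(3)[OF germs(1)] by blast
  qed
  have zo: "\<zero>\<^bsub>KY\<^esub> \<in> carrier KY" "\<one>\<^bsub>KY\<^esub> \<in> carrier KY"
    unfolding zero_KY one_KY by (rule R_carrier[OF germ_const])+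
  show "abelian_group KY"
  proof (rule abelian_groupI)
    fix x y z assume xyz: "x \<in> carrier KY" "y \<in> carrier KY"
    show "x \<oplus>\<^bsub>KY\<^esub> y \<in> carrier KY" "x \<oplus>\<^bsub>KY\<^esub> y = y \<oplus>\<^bsub>KY\<^esub> x"
      using closed(1)[OF xyz xyz(1)] comm(1)[OF xyz xyz(1)] by auto
    show "x \<oplus>\<^bsub>KY\<^esub> y \<oplus>\<^bsub>KY\<^esub> z = x \<oplus>\<^bsub>KY\<^esub> (y \<oplus>\<^bsub>KY\<^esub> z)" if "z \<in> carrier KY"
      using assoc(1)[OF xyz that] .
  next
    fix x assume x: "x \<in> carrier KY"
    show "\<zero>\<^bsub>KY\<^esub> \<oplus>\<^bsub>KY\<^esub> x = x" "\<exists>y\<in>carrier KY. y \<oplus>\<^bsub>KY\<^esub> x = \<zero>\<^bsub>KY\<^esub>"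
      using unit(1)[OF x x x] inv[OF x x x] by auto
  qed (fact zo)
  show "comm_monoid KY"
  proof (rule comm_monoidI)
    fix x y z assume xyz: "x \<in> carrier KY" "y \<in> carrier KY"
    show "x \<otimes>\<^bsub>KY\<^esub> y \<in> carrier KY" "x \<otimes>\<^bsub>KY\<^esub> y = y \<otimes>\<^bsub>KY\<^esub> x"
      using closed(2)[OF xyz xyz(1)] comm(2)[OF xyz xyz(1)] by auto
    show "x \<otimes>\<^bsub>KY\<^esub> y \<otimes>\<^bsub>KY\<^esub> z = x \<otimes>\<^bsub>KY\<^esub> (y \<otimes>\<^bsub>KY\<^esub> z)" if "z \<in> carrier KY"
      using assoc(2)[OF xyz that] .
  next
    fix x assume x: "x \<in> carrier KY"
    show "\<one>\<^bsub>KY\<^esub> \<otimes>\<^bsub>KY\<^esub> x = x" using unit(2)[OF x x x] .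
  qed (fact zo)
  show "(a \<oplus>\<^bsub>KY\<^esub> b) \<otimes>\<^bsub>KY\<^esub> c = a \<otimes>\<^bsub>KY\<^esub> c \<oplus>\<^bsub>KY\<^esub> b \<otimes>\<^bsub>KY\<^esub> c"
    if "a \<in> carrier KY" "b \<in> carrier KY" "c \<in> carrier KY" for a b c
    using that by (rule distr)
qed

sublocale KY: cring KY
  by (rule cring_KY)

lemma inverse_KY:
  assumes "germ U f" "\<And>x. x \<in> U \<Longrightarrow> f x \<noteq> 0"
  shows "R U f \<in> Units KY" "inv\<^bsub>KY\<^esub> R U f = R U (\<lambda>x. inverse (f x))"
proof -
  have g: "germ U (\<lambda>x. inverse (f x))" using assms by (rule germ_inverse)
  have "R U f \<otimes>\<^bsub>KY\<^esub> R U (\<lambda>x. inverse (f x)) = \<one>\<^bsub>KY\<^esub>"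
    using assms(2) g germ_same(2)[OF assms(1) g] by (simp add: R_mult_same[OF assms(1) g] R_eq_one_iff)
  then show "inv\<^bsub>KY\<^esub> R U f = R U (\<lambda>x. inverse (f x))"
    by (intro KY.comm_inv_char R_carrier assms(1) g)
  have "R U (\<lambda>x. inverse (f x)) \<otimes>\<^bsub>KY\<^esub> R U f = \<one>\<^bsub>KY\<^esub>"
    using assms(2) g germ_same(2)[OF g assms(1)] by (simp add: R_mult_same[OF g assms(1)] R_eq_one_iff)
  with \<open>R U f \<otimes>\<^bsub>KY\<^esub> R U (\<lambda>x. inverse (f x)) = \<one>\<^bsub>KY\<^esub>\<close> show "R U f \<in> Units KY"
    unfolding Units_def using R_carrier[OF assms(1)] R_carrier[OF g] by blast
qed

lemma nonzero_nonvanishing: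
  assumes "g \<in> carrier KY" "g \<noteq> \<zero>\<^bsub>KY\<^esub>"
  obtains U f where "germ U f" "g = R U f" "\<And>x. x \<in> U \<Longrightarrow> f x \<noteq> 0"
proof -
  obtain U f where f: "g = R U f" "germ U f" using assms(1) by (rule KY_cases)
  then obtain x where x: "x \<in> U" "f x \<noteq> 0" using assms(2) R_eq_zero_iff by blast
  define V where "V = {x \<in> U. f x \<noteq> 0}"
  have V: "germ V f" unfolding V_def using f(2) x by (rule nonvanishing_germ)
  have "R V f = g" unfolding f(1) using V by (intro R_restrict[OF f(2)]) (auto simp: V_def)
  then show ?thesis by (intro that[OF V]) (simp_all add: V_def)
qed

lemma R_pow: "germ U f \<Longrightarrow> R U f [^]\<^bsub>KY\<^esub> (n::nat) = R U (\<lambda>x. f x ^ n)"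
proof (induction n)
  case (Suc n)
  then show ?case by (simp add: KY.nat_pow_Suc R_mult_same reg_power mult.commute)
qed (simp add: const_same)

lemma R_int_pow:
  assumes "germ U f" "\<And>x. x \<in> U \<Longrightarrow> f x \<noteq> 0"
  shows "R U f [^]\<^bsub>KY\<^esub> (k::int) = R U (\<lambda>x. f x powi k)"
proof (cases "k < 0")
  case True
  have "germ U (\<lambda>x. f x ^ nat (- k))" using assms by (auto intro: reg_power)
  have "R U f [^]\<^bsub>KY\<^esub> k = inv\<^bsub>KY\<^esub> (R U f [^]\<^bsub>KY\<^esub> nat (- k))"
    by (simp only: int_pow_def2 True if_True)
  also have "\<dots> = inv\<^bsub>KY\<^esub> (R U (\<lambda>x. f x ^ nat (- k)))"
    by (simp only: R_pow[OF assms(1)])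
  also have "\<dots> = R U (\<lambda>x. inverse (f x ^ nat (- k)))"
    using assms(2) by (intro inverse_KY(2)[OF \<open>germ U (\<lambda>x. f x ^ nat (- k))\<close>]) simp
  finally have "R U f [^]\<^bsub>KY\<^esub> k = R U (\<lambda>x. inverse (f x ^ nat (- k)))" .
  moreover have "(\<lambda>x. f x powi k) = (\<lambda>x. inverse (f x ^ nat (- k)))"
    using True by (auto simp: power_int_def power_inverse)
  ultimately show ?thesis by simp
next
  case False
  then have "R U f [^]\<^bsub>KY\<^esub> k = R U f [^]\<^bsub>KY\<^esub> nat k" by (simp only: int_pow_def2 if_False)
  also have "\<dots> = R U (\<lambda>x. f x ^ nat k)" by (rule R_pow[OF assms(1)])
  also have "(\<lambda>x. f x ^ nat k) = (\<lambda>x. f x powi k)" using False by (simp add: power_int_def)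
  finally show ?thesis .
qed

lemma R_finsum:
  assumes "finite I" "openin (zar Y) U" "U \<noteq> {}" "\<And>i. i \<in> I \<Longrightarrow> f i \<in> reg Y U"
  shows "(\<Oplus>\<^bsub>KY\<^esub>i\<in>I. R U (f i)) = R U (\<lambda>x. \<Sum>i\<in>I. f i x)"
  using assms(1,4)
proof (induction I)
  case empty
  then show ?case using assms by (simp add: const_same)
next
  case (insert i I)
  have "(\<lambda>i. R U (f i)) \<in> I \<rightarrow> carrier KY" "R U (f i) \<in> carrier KY"
    using insert assms by (auto intro!: R_carrier)
  moreover have "germ U (f i)" "germ U (\<lambda>x. \<Sum>i\<in>I. f i x)"
    using insert assms by (auto intro!: reg_sum)
  ultimately show ?case using insert by (simp add: KY.finsum_insert R_add_same)
qed

end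

section \<open>Local parameters\<close>

context irr_space begin

lemma local_ring_point: "local_ring Y {y} = {R U f | U f. germ U f \<and> y \<in> U}"
  unfolding local_ring_def germ_pairs_def by auto

lemma local_max_ideal_point: "local_max_ideal Y {y} = {R U f | U f. germ U f \<and> y \<in> U \<and> f y = 0}"
  unfolding local_max_ideal_def germ_pairs_def by auto

lemma local_ringI: "germ V f \<Longrightarrow> y \<in> V \<Longrightarrow> R V f \<in> local_ring Y {y}"
  unfolding local_ring_point by (intro CollectI exI[of _ V] exI[of _ f]) simp

lemma local_ringE:
  assumes "g \<in> local_ring Y {y}" obtains V f where "germ V f" "y \<in> V" "g = R V f"
  using assms unfolding local_ring_point by (elim CollectE exE conjE) (rule that; simp)

lemma max_idealI: "germ V f \<Longrightarrow> y \<in> V \<Longrightarrow> f y = 0 \<Longrightarrow> R V f \<in> local_max_ideal Y {y}"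
  unfolding local_max_ideal_point by (intro CollectI exI[of _ V] exI[of _ f]) simp

lemma max_idealE:
  assumes "g \<in> local_max_ideal Y {y}" obtains V f where "germ V f" "y \<in> V" "f y = 0" "g = R V f"
  using assms unfolding local_max_ideal_point by (elim CollectE exE conjE) (rule that; simp)

lemma zero_local: "y \<in> points Y \<Longrightarrow> \<zero>\<^bsub>KY\<^esub> \<in> local_ring Y {y}"
  and one_local: "y \<in> points Y \<Longrightarrow> \<one>\<^bsub>KY\<^esub> \<in> local_ring Y {y}"
  unfolding zero_KY one_KY by (rule local_ringI[OF germ_const], assumption)+

text \<open>The equation is only required where \<open>t\<close> does not vanish, so that negative orders make sense.\<close>

definition ord_is :: "'p \<Rightarrow> 'p set \<Rightarrow> ('p \<Rightarrow> 'k) \<Rightarrow> 'p set \<Rightarrow> ('p \<Rightarrow> 'k) \<Rightarrow> int \<Rightarrow> bool" where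
  "ord_is y U t V f k \<longleftrightarrow> (\<exists>W u. germ W u \<and> y \<in> W \<and> u y \<noteq> 0 \<and>
     (\<forall>x\<in>W \<inter> V \<inter> U. t x \<noteq> 0 \<longrightarrow> f x = u x * t x powi k))"

text \<open>The last clause is what turns the local ring at \<open>y\<close> into a discrete
  valuation ring with uniformizer \<open>t\<close>.\<close>

definition local_parameter :: "'p \<Rightarrow> 'p set \<Rightarrow> ('p \<Rightarrow> 'k) \<Rightarrow> bool" where
  "local_parameter y U t \<longleftrightarrow> germ U t \<and> y \<in> U \<and> t y = 0 \<and> (\<exists>x\<in>U. t x \<noteq> 0) \<and>
     (\<forall>V f. germ V f \<and> (\<exists>x\<in>V. f x \<noteq> 0) \<longrightarrow> (\<exists>k. ord_is y U t V f k))"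

lemma ord_is_unit: "germ V f \<Longrightarrow> y \<in> V \<Longrightarrow> f y \<noteq> 0 \<Longrightarrow> ord_is y U t V f 0"
  unfolding ord_is_def by (intro exI[of _ V] exI[of _ f]) auto

lemma ord_is_mult:
  assumes "ord_is y U t V f k" "ord_is y U t V' g l"
  shows "ord_is y U t (V \<inter> V') (\<lambda>x. f x * g x) (k + l)"
proof -
  obtain W u where 1: "germ W u" "y \<in> W" "u y \<noteq> 0"
    "\<And>x. x \<in> W \<Longrightarrow> x \<in> V \<Longrightarrow> x \<in> U \<Longrightarrow> t x \<noteq> 0 \<Longrightarrow> f x = u x * t x powi k"
    using assms(1) unfolding ord_is_def by blast
  obtain W' u' where 2: "germ W' u'" "y \<in> W'" "u' y \<noteq> 0"
    "\<And>x. x \<in> W' \<Longrightarrow> x \<in> V' \<Longrightarrow> x \<in> U \<Longrightarrow> t x \<noteq> 0 \<Longrightarrow> g x = u' x * t x powi l"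
    using assms(2) unfolding ord_is_def by blast
  show ?thesis unfolding ord_is_def
    using germ_mult[OF 1(1) 2(1)] 1(2-4) 2(2-4)
    by (intro exI[of _ "W \<inter> W'"] exI[of _ "\<lambda>x. u x * u' x"]) (auto simp: power_int_add)
qed

lemma ord_is_mono: "ord_is y U t V f k \<Longrightarrow> V' \<subseteq> V \<Longrightarrow> (\<And>x. x \<in> V' \<Longrightarrow> g x = f x) \<Longrightarrow> ord_is y U t V' g k"
  unfolding ord_is_def by (elim exE conjE, intro exI conjI) auto

lemma ord_is_power:
  assumes "ord_is y U t V f k" "\<And>x. x \<in> V \<Longrightarrow> f x \<noteq> 0"
  shows "ord_is y U t V (\<lambda>x. f x powi n) (k * n)"
proof -
  obtain W u where 1: "germ W u" "y \<in> W" "u y \<noteq> 0"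
    "\<And>x. x \<in> W \<Longrightarrow> x \<in> V \<Longrightarrow> x \<in> U \<Longrightarrow> t x \<noteq> 0 \<Longrightarrow> f x = u x * t x powi k"
    using assms(1) unfolding ord_is_def by blast
  have "germ {x \<in> W. u x \<noteq> 0} u" using 1 by (intro nonvanishing_germ) auto
  then have "germ {x \<in> W. u x \<noteq> 0} (\<lambda>x. u x powi n)" by (auto intro!: reg_powi)
  then show ?thesis unfolding ord_is_def using 1
    by (intro exI[of _ "{x \<in> W. u x \<noteq> 0}"] exI[of _ "\<lambda>x. u x powi n"])
      (auto simp: power_int_mult_distrib power_int_mult)
qed

text \<open>Sums and products of the function field are evaluated on the intersection of all
  domains, which contains the point \<open>x\<close> and is therefore nonempty.\<close>

lemma integral_equation:
  fixes n :: nat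
  assumes f: "germ V f" and A: "\<And>i. i < n \<Longrightarrow> germ (A i) (\<gamma> i)"
    and eq: "R V f [^]\<^bsub>KY\<^esub> n \<oplus>\<^bsub>KY\<^esub> (\<Oplus>\<^bsub>KY\<^esub>i\<in>{..<n}. c i \<otimes>\<^bsub>KY\<^esub> R V f [^]\<^bsub>KY\<^esub> i) = \<zero>\<^bsub>KY\<^esub>"
    and c: "\<And>i. i < n \<Longrightarrow> c i = R (A i) (\<gamma> i)"
    and x: "x \<in> V" "\<And>i. i < n \<Longrightarrow> x \<in> A i"
  shows "f x ^ n + (\<Sum>i<n. \<gamma> i x * f x ^ i) = 0"
proof -
  define Z where "Z = V \<inter> (\<Inter>i<n. A i)"
  have "openin (zar Y) (V \<inter> (\<Inter>i\<in>I. A i))" if "finite I" "I \<subseteq> {..<n}" for I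
    using that
  proof (induction I)
    case (insert i I)
    have "V \<inter> (\<Inter>i\<in>insert i I. A i) = A i \<inter> (V \<inter> (\<Inter>i\<in>I. A i))" by blast
    then show ?case using insert A(1)[of i] by (simp add: openin_Int)
  qed (use f in auto)
  from this[of "{..<n}"] x have Z: "openin (zar Y) Z" "Z \<noteq> {}" unfolding Z_def by auto
  have ZA: "Z \<subseteq> A i" if "i < n" for i using that unfolding Z_def by blast
  have ZV: "Z \<subseteq> V" by (simp add: Z_def)
  have gZ: "R V f = R Z f" by (rule R_restrict[OF f ZV Z, symmetric])
  have fZ: "f \<in> reg Y Z" using germ_mono[OF f ZV Z] by simp
  have cZ: "c i = R Z (\<gamma> i)" if "i < n" for i
    unfolding c[OF that] by (rule R_restrict[OF A[OF that] ZA[OF that] Z, symmetric])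
  have \<gamma>Z: "\<gamma> i \<in> reg Y Z" if "i < n" for i
    using germ_mono[OF A[OF that] ZA[OF that] Z] by simp
  have termZ: "(\<lambda>x. \<gamma> i x * f x ^ i) \<in> reg Y Z" if "i < n" for i
    by (intro reg_mult reg_power \<gamma>Z fZ that Z)
  have powZ: "R Z f [^]\<^bsub>KY\<^esub> i = R Z (\<lambda>x. f x ^ i)" for i :: nat
    using Z fZ by (intro R_pow) simp
  have cgZ: "c i \<otimes>\<^bsub>KY\<^esub> R V f [^]\<^bsub>KY\<^esub> i = R Z (\<lambda>x. \<gamma> i x * f x ^ i)" if "i < n" for i
    unfolding cZ[OF that] gZ powZ using Z \<gamma>Z[OF that] reg_power[OF Z(1) fZ, of i]
    by (intro R_mult_same) simp_all
  have "(\<Oplus>\<^bsub>KY\<^esub>i\<in>{..<n}. c i \<otimes>\<^bsub>KY\<^esub> R V f [^]\<^bsub>KY\<^esub> i) = (\<Oplus>\<^bsub>KY\<^esub>i\<in>{..<n}. R Z (\<lambda>x. \<gamma> i x * f x ^ i))"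
    using Z termZ by (intro KY.finsum_cong' refl) (auto simp: cgZ intro!: R_carrier)
  also have "\<dots> = R Z (\<lambda>x. \<Sum>i<n. \<gamma> i x * f x ^ i)"
    using Z termZ by (intro R_finsum) auto
  finally have fs: "(\<Oplus>\<^bsub>KY\<^esub>i\<in>{..<n}. c i \<otimes>\<^bsub>KY\<^esub> R V f [^]\<^bsub>KY\<^esub> i) = R Z (\<lambda>x. \<Sum>i<n. \<gamma> i x * f x ^ i)" .
  have sumZ: "(\<lambda>x. \<Sum>i<n. \<gamma> i x * f x ^ i) \<in> reg Y Z" using Z termZ by (intro reg_sum) auto
  have gp: "germ Z (\<lambda>x. f x ^ n)" "germ Z (\<lambda>x. \<Sum>i<n. \<gamma> i x * f x ^ i)"
    using Z sumZ reg_power[OF Z(1) fZ] by simp_all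
  have "R Z (\<lambda>x. f x ^ n + (\<Sum>i<n. \<gamma> i x * f x ^ i)) = \<zero>\<^bsub>KY\<^esub>"
    using eq unfolding fs unfolding gZ powZ R_add_same[OF gp] .
  moreover have "x \<in> Z" using x by (simp add: Z_def)
  ultimately show ?thesis using R_eq_zero_iff[OF germ_same(1)[OF gp]] by blast
qed

context
  fixes y U t assumes lp: "local_parameter y U t"
begin

lemma lp_germ: "germ U t" "y \<in> U" "t y = 0" "\<exists>x\<in>U. t x \<noteq> 0"
  using lp unfolding local_parameter_def by auto

lemma lp_exists: "germ V f \<Longrightarrow> x \<in> V \<Longrightarrow> f x \<noteq> 0 \<Longrightarrow> \<exists>k. ord_is y U t V f k"
  using lp unfolding local_parameter_def by blast

definition "Ut = {x \<in> U. t x \<noteq> 0}"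

lemma Ut: "germ Ut t" "Ut \<subseteq> U" "\<And>x. x \<in> Ut \<Longrightarrow> t x \<noteq> 0"
  using lp_germ nonvanishing_germ[OF lp_germ(1)] unfolding Ut_def by auto

lemma germ_t_power: "germ U (\<lambda>x. t x ^ n)"
  using lp_germ by (auto intro: reg_power)

text \<open>The identity \<open>u = g t^n\<close>, known only on a dense open set, extends to
  \<open>y\<close>, where \<open>t\<close> vanishes. Uniqueness of orders, their sign and integral
  closedness are all reduced to this.\<close>

lemma vanish_contra:
  assumes "germ W u" "y \<in> W" "germ V g" "y \<in> V" "n > 0" "germ Z z"
    and "\<And>x. x \<in> W \<Longrightarrow> x \<in> V \<Longrightarrow> x \<in> U \<Longrightarrow> t x \<noteq> 0 \<Longrightarrow> x \<in> Z \<Longrightarrow> u x = g x * t x ^ n"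
  shows "u y = 0"
proof -
  have g: "germ (V \<inter> U) (\<lambda>x. g x * t x ^ n)" by (rule germ_mult[OF assms(3) germ_t_power])
  have "openin (zar Y) (Z \<inter> Ut)" "Z \<inter> Ut \<noteq> {}" using irr assms(6) Ut(1) by auto
  then have "u y = g y * t y ^ n"
  proof (rule agree[OF assms(1) g])
    fix x assume "x \<in> Z \<inter> Ut" "x \<in> W" "x \<in> V \<inter> U"
    then show "u x = g x * t x ^ n" by (intro assms(7)) (auto simp: Ut_def)
  qed (use assms(2,4) lp_germ(2) in auto)
  then show ?thesis using lp_germ(3) assms(5) by simp
qed

lemma ord_is_unique:
  assumes "germ V f" "ord_is y U t V f k" "ord_is y U t V f l"
  shows "k = l"
proof -
  have "\<not> k < l" if *: "ord_is y U t V f k" "ord_is y U t V f l" for k l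
  proof
    assume "k < l"
    obtain W u where 1: "germ W u" "y \<in> W" "u y \<noteq> 0"
      "\<And>x. x \<in> W \<Longrightarrow> x \<in> V \<Longrightarrow> x \<in> U \<Longrightarrow> t x \<noteq> 0 \<Longrightarrow> f x = u x * t x powi k"
      using *(1) unfolding ord_is_def by blast
    obtain W' u' where 2: "germ W' u'" "y \<in> W'" "u' y \<noteq> 0"
      "\<And>x. x \<in> W' \<Longrightarrow> x \<in> V \<Longrightarrow> x \<in> U \<Longrightarrow> t x \<noteq> 0 \<Longrightarrow> f x = u' x * t x powi l"
      using *(2) unfolding ord_is_def by blast
    have "u y = 0"
    proof (rule vanish_contra[OF 1(1,2) 2(1,2) _ assms(1)])
      show "nat (l - k) > 0" using \<open>k < l\<close> by simp
      fix x assume x: "x \<in> W" "x \<in> W'" "x \<in> U" "t x \<noteq> 0" "x \<in> V"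
      have "u x * t x powi k = u' x * t x powi l" using 1(4) 2(4) x by metis
      also have "t x powi l = t x powi (l - k) * t x powi k" using x(4) by (simp add: power_int_add[symmetric])
      also have "t x powi (l - k) = t x ^ nat (l - k)" using \<open>k < l\<close> by (simp add: power_int_def)
      finally show "u x = u' x * t x ^ nat (l - k)" using x(4) by simp
    qed
    with 1(3) show False by contradiction
  qed
  from this[OF assms(2,3)] this[OF assms(3,2)] show ?thesis by simp
qed

lemma ord_is_nonneg_local:
  assumes "germ V f" "ord_is y U t V f k" "k \<ge> 0"
  obtains W u where "germ W u" "y \<in> W" "u y \<noteq> 0" "R V f = R (W \<inter> U) (\<lambda>x. u x * t x ^ nat k)"
proof -
  obtain W u where 1: "germ W u" "y \<in> W" "u y \<noteq> 0"
    "\<And>x. x \<in> W \<Longrightarrow> x \<in> V \<Longrightarrow> x \<in> U \<Longrightarrow> t x \<noteq> 0 \<Longrightarrow> f x = u x * t x powi k"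
    using assms(2) unfolding ord_is_def by blast
  have "R V f = R (W \<inter> U) (\<lambda>x. u x * t x ^ nat k)"
    using Ut by (intro R_eqI[OF assms(1) germ_mult[OF 1(1) germ_t_power], of Ut])
      (auto simp: 1(4) power_int_def assms(3))
  with 1 that show ?thesis by blast
qed

text \<open>A regular germ \<open>g\<close> of negative order would give \<open>u = g t^n\<close>
  with \<open>n > 0\<close>, which forces the unit \<open>u\<close> to vanish at
  \<open>y\<close>.\<close>

lemma ord_is_local_iff:
  assumes "germ V f" "ord_is y U t V f k"
  shows "R V f \<in> local_ring Y {y} \<longleftrightarrow> 0 \<le> k"
proof
  assume "0 \<le> k"
  obtain W u where W: "germ W u" "y \<in> W" "u y \<noteq> 0" "R V f = R (W \<inter> U) (\<lambda>x. u x * t x ^ nat k)"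
    by (rule ord_is_nonneg_local[OF assms \<open>0 \<le> k\<close>])
  show "R V f \<in> local_ring Y {y}"
    unfolding W(4) by (rule local_ringI[OF germ_mult[OF W(1) germ_t_power]]) (use W(2) lp_germ(2) in simp)
next
  assume "R V f \<in> local_ring Y {y}"
  then obtain V' g where g: "germ V' g" "y \<in> V'" "R V f = R V' g" by (rule local_ringE)
  obtain W u where 1: "germ W u" "y \<in> W" "u y \<noteq> 0"
    "\<And>x. x \<in> W \<Longrightarrow> x \<in> V \<Longrightarrow> x \<in> U \<Longrightarrow> t x \<noteq> 0 \<Longrightarrow> f x = u x * t x powi k"
    using assms(2) unfolding ord_is_def by blast
  show "0 \<le> k"
  proof (rule ccontr)
    assume k: "\<not> 0 \<le> k"
    have "u y = 0"
    proof (rule vanish_contra[OF 1(1,2) g(1,2) _ assms(1)])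
      show "nat (- k) > 0" using k by simp
      fix x assume x: "x \<in> W" "x \<in> V'" "x \<in> U" "t x \<noteq> 0" "x \<in> V"
      have "f x = g x" using R_eq_iff[OF assms(1) g(1)] g(3) x by blast
      then have "g x = u x * t x powi k" using 1(4)[OF x(1,5,3,4)] by simp
      moreover have "t x powi k * t x ^ nat (- k) = 1" using k x(4) by (simp add: power_int_def power_inverse)
      ultimately show "u x = g x * t x ^ nat (- k)" by (simp add: mult.assoc)
    qed
    with 1(3) show False by contradiction
  qed
qed

lemma ord_is_pos:
  assumes "germ V f" "ord_is y U t V f k" "y \<in> V" "f y = 0"
  shows "k > 0"
proof -
  have "0 \<le> k" using ord_is_local_iff[OF assms(1,2)] local_ringI[OF assms(1,3)] by simp
  moreover have "k \<noteq> 0"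
  proof
    assume "k = 0"
    obtain W u where 1: "germ W u" "y \<in> W" "u y \<noteq> 0" "R V f = R (W \<inter> U) (\<lambda>x. u x * t x ^ nat k)"
      by (rule ord_is_nonneg_local[OF assms(1,2) \<open>0 \<le> k\<close>])
    then have "f y = u y * t y ^ nat k"
      using R_eq_iff[OF assms(1) germ_mult[OF 1(1) germ_t_power[of "nat k"]]] assms(3) lp_germ(2) by auto
    with 1(3) \<open>k = 0\<close> assms(4) show False by simp
  qed
  ultimately show ?thesis by simp
qed

lemma uniformizer_lp: "uniformizer Y {y} (R U t)"
  unfolding uniformizer_def
proof
  show "local_max_ideal Y {y} \<subseteq> (\<lambda>a. R U t \<otimes>\<^bsub>KY\<^esub> a) ` local_ring Y {y}"
  proof
    fix g assume "g \<in> local_max_ideal Y {y}"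
    then obtain V f where f: "germ V f" "y \<in> V" "f y = 0" "g = R V f" by (rule max_idealE)
    note f = f(4) f(1-3)
    show "g \<in> (\<lambda>a. R U t \<otimes>\<^bsub>KY\<^esub> a) ` local_ring Y {y}"
    proof (cases "\<exists>x\<in>V. f x \<noteq> 0")
      case False
      then have "g = \<zero>\<^bsub>KY\<^esub>" using f by (simp add: R_eq_zero_iff)
      then have "g = R U t \<otimes>\<^bsub>KY\<^esub> \<zero>\<^bsub>KY\<^esub>" using R_carrier[OF lp_germ(1)] by simp
      moreover have "\<zero>\<^bsub>KY\<^esub> \<in> local_ring Y {y}"
        using zero_local f openin_subset[of "zar Y" V] by blast
      ultimately show ?thesis by blast
    next
      case True
      then obtain k where k: "ord_is y U t V f k" using lp_exists f(2) by blast
      then have "k > 0" using f ord_is_pos by blast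
      then have "0 \<le> k" by simp
      obtain W u where 1: "germ W u" "y \<in> W" "u y \<noteq> 0" "R V f = R (W \<inter> U) (\<lambda>x. u x * t x ^ nat k)"
        by (rule ord_is_nonneg_local[OF f(2) k \<open>0 \<le> k\<close>])
      have g': "germ (W \<inter> U) (\<lambda>x. u x * t x ^ (nat k - 1))" by (rule germ_mult[OF 1(1) germ_t_power])
      have "t x ^ nat k = t x * t x ^ (nat k - 1)" for x
        using \<open>k > 0\<close> power_minus_mult[of "nat k" "t x"] by (simp add: mult.commute)
      then have "g = R U t \<otimes>\<^bsub>KY\<^esub> R (W \<inter> U) (\<lambda>x. u x * t x ^ (nat k - 1))"
        unfolding f(1) 1(4) R_mult[OF lp_germ(1) g'] by (simp add: Int_absorb1 mult.left_commute Int_left_commute)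
      then show ?thesis using local_ringI[OF g'] 1(2) lp_germ(2) by simp
    qed
  qed
  show "(\<lambda>a. R U t \<otimes>\<^bsub>KY\<^esub> a) ` local_ring Y {y} \<subseteq> local_max_ideal Y {y}"
  proof
    fix g assume "g \<in> (\<lambda>a. R U t \<otimes>\<^bsub>KY\<^esub> a) ` local_ring Y {y}"
    then obtain a where a: "a \<in> local_ring Y {y}" "g = R U t \<otimes>\<^bsub>KY\<^esub> a" by blast
    obtain V f where V: "germ V f" "y \<in> V" "a = R V f" using a(1) by (rule local_ringE)
    show "g \<in> local_max_ideal Y {y}"
      unfolding a(2) V(3) R_mult[OF lp_germ(1) V(1)]
      using V(2) lp_germ(2,3) by (intro max_idealI germ_mult[OF lp_germ(1) V(1)]) auto
  qed
qed

text \<open>Writing \<open>t' = u t^k\<close> and \<open>t = t' a\<close> gives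
  \<open>1 = u a t^(k - 1)\<close>, which fails at \<open>y\<close> unless
  \<open>k = 1\<close>.\<close>

lemma uniformizer_ord:
  assumes t': "t' \<in> local_ring Y {y}" "uniformizer Y {y} t'"
  obtains V f where "germ V f" "y \<in> V" "t' = R V f" "ord_is y U t V f 1"
proof -
  obtain V f where f: "germ V f" "y \<in> V" "t' = R V f" using t'(1) by (rule local_ringE)
  have one: "\<one>\<^bsub>KY\<^esub> \<in> local_ring Y {y}"
    using one_local f openin_subset[of "zar Y" V] by blast
  have "t' \<otimes>\<^bsub>KY\<^esub> \<one>\<^bsub>KY\<^esub> \<in> local_max_ideal Y {y}" using t'(2) one unfolding uniformizer_def by blast
  then have "R V f \<in> local_max_ideal Y {y}" using R_carrier[OF f(1)] f(3) by simp
  then obtain V' f' where f': "germ V' f'" "y \<in> V'" "f' y = 0" "R V f = R V' f'"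
    by (rule max_idealE)
  then have fy: "f y = 0" using R_eq_iff[OF f(1) f'(1)] f(2) by auto
  have "R U t \<in> local_max_ideal Y {y}" by (rule max_idealI[OF lp_germ(1-3)])
  then obtain a where "a \<in> local_ring Y {y}" "R U t = t' \<otimes>\<^bsub>KY\<^esub> a" using t'(2) unfolding uniformizer_def by blast
  then obtain A \<alpha> where \<alpha>: "germ A \<alpha>" "y \<in> A" "R U t = R V f \<otimes>\<^bsub>KY\<^esub> R A \<alpha>"
    unfolding f(3) by (metis local_ringE)
  then have eq: "t x = f x * \<alpha> x" if "x \<in> U" "x \<in> V" "x \<in> A" for x
    using R_eq_iff[OF lp_germ(1) germ_mult[OF f(1) \<alpha>(1)]] that by (simp add: R_mult[OF f(1) \<alpha>(1)])
  have "Ut \<inter> (V \<inter> A) \<noteq> {}" using irr[of Ut "V \<inter> A"] irr[of V A] Ut(1) f(1) \<alpha>(1) by auto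
  then obtain x where "x \<in> V" "f x \<noteq> 0" using eq Ut by fastforce
  then obtain k where k: "ord_is y U t V f k" using lp_exists[OF f(1)] by blast
  then have "k > 0" using ord_is_pos[OF f(1) k f(2) fy] by blast
  obtain W u where 1: "germ W u" "y \<in> W" "u y \<noteq> 0"
    "\<And>x. x \<in> W \<Longrightarrow> x \<in> V \<Longrightarrow> x \<in> U \<Longrightarrow> t x \<noteq> 0 \<Longrightarrow> f x = u x * t x powi k"
    using k unfolding ord_is_def by blast
  have "k = 1"
  proof (rule ccontr)
    assume "k \<noteq> 1"
    then have k2: "nat k - 1 > 0" using \<open>k > 0\<close> by simp
    have yp: "y \<in> points Y" using f openin_subset by blast
    have "(1::'k) = 0"
    proof (rule vanish_contra[OF germ_const yp germ_mult[OF 1(1) \<alpha>(1)] _ k2 f(1)])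
      show "y \<in> W \<inter> A" using 1 \<alpha> by simp
      fix x assume x: "x \<in> points Y" "x \<in> W \<inter> A" "x \<in> U" "t x \<noteq> 0" "x \<in> V"
      have pw: "t x powi k = t x ^ (nat k - 1) * t x"
        using \<open>k > 0\<close> power_minus_mult[of "nat k" "t x"] by (simp add: power_int_def)
      have b: "f x = u x * (t x ^ (nat k - 1) * t x)"
        unfolding pw[symmetric] using x by (intro 1(4)) auto
      have "(u x * \<alpha> x * t x ^ (nat k - 1)) * t x = f x * \<alpha> x"
        unfolding b by (simp only: mult_ac)
      also have "\<dots> = t x" using x by (intro eq[symmetric]) auto
      finally show "1 = u x * \<alpha> x * t x ^ (nat k - 1)" using x(4) by (metis mult_cancel_right2)
    qed
    then show False by simp
  qed
  with k have "ord_is y U t V f 1" by simp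
  from that[OF f this] show ?thesis .
qed

text \<open>The definition admits every uniformizer, so uniqueness has to compare each of them with
  \<open>t\<close>; all have order one, hence a unit times \<open>t'^l\<close> has order
  \<open>l\<close> with respect to \<open>t\<close>.\<close>

lemma ord_along_lp:
  assumes f: "germ V f" "x0 \<in> V" "f x0 \<noteq> 0" and k: "ord_is y U t V f k"
  shows "ord_along Y {y} (R V f) = k"
  unfolding ord_along_def
proof (rule the_equality)
  obtain W u where 1: "germ W u" "y \<in> W" "u y \<noteq> 0"
    "\<And>x. x \<in> W \<Longrightarrow> x \<in> V \<Longrightarrow> x \<in> U \<Longrightarrow> t x \<noteq> 0 \<Longrightarrow> f x = u x * t x powi k"
    using k unfolding ord_is_def by blast
  define W' where "W' = {x \<in> W. u x \<noteq> 0}"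
  have W': "germ W' u" "y \<in> W'" "\<And>x. x \<in> W' \<Longrightarrow> u x \<noteq> 0"
    unfolding W'_def using 1 nonvanishing_germ by auto
  have "R Ut t = R U t" using Ut by (intro R_restrict[OF lp_germ(1)]) auto
  then have pow: "R U t [^]\<^bsub>KY\<^esub> k = R Ut (\<lambda>x. t x powi k)" using R_int_pow[OF Ut(1) Ut(3)] by metis
  have g: "germ Ut (\<lambda>x. t x powi k)" using Ut by (auto intro!: reg_powi)
  have "R V f = R W' u \<otimes>\<^bsub>KY\<^esub> (R U t [^]\<^bsub>KY\<^esub> k)"
    unfolding pow R_mult[OF W'(1) g] using Ut
    by (intro R_eqI[OF f(1) germ_mult[OF W'(1) g], of Ut]) (auto simp: W'_def 1(4))
  moreover have "R W' u \<in> local_ring Y {y}" by (rule local_ringI[OF W'(1,2)])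
  moreover have "inv\<^bsub>KY\<^esub> R W' u \<in> local_ring Y {y}"
    by (subst inverse_KY(2)[OF W'(1)], rule W'(3), assumption,
        rule local_ringI[OF germ_inverse[OF W'(1)] W'(2)], rule W'(3))
  moreover have "R W' u \<in> Units KY" by (rule inverse_KY(1)[OF W'(1,3)])
  moreover have "R U t \<in> local_ring Y {y}" by (rule local_ringI[OF lp_germ(1,2)])
  ultimately show "\<exists>t u. t \<in> local_ring Y {y} \<and> uniformizer Y {y} t \<and> u \<in> local_ring Y {y} \<and>
    inv\<^bsub>KY\<^esub> u \<in> local_ring Y {y} \<and> u \<in> Units KY \<and> R V f = u \<otimes>\<^bsub>KY\<^esub> (t [^]\<^bsub>KY\<^esub> k)"
    using uniformizer_lp by blast
next
  fix l :: int assume "\<exists>t u. t \<in> local_ring Y {y} \<and> uniformizer Y {y} t \<and> u \<in> local_ring Y {y} \<and>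
    inv\<^bsub>KY\<^esub> u \<in> local_ring Y {y} \<and> u \<in> Units KY \<and> R V f = u \<otimes>\<^bsub>KY\<^esub> (t [^]\<^bsub>KY\<^esub> l)"
  then obtain t' u' where t': "t' \<in> local_ring Y {y}" "uniformizer Y {y} t'" and u': "u' \<in> local_ring Y {y}"
    "inv\<^bsub>KY\<^esub> u' \<in> local_ring Y {y}" "u' \<in> Units KY" and eq: "R V f = u' \<otimes>\<^bsub>KY\<^esub> (t' [^]\<^bsub>KY\<^esub> l)" by blast
  obtain V' f' where f': "germ V' f'" "y \<in> V'" "t' = R V' f'" "ord_is y U t V' f' 1"
    using uniformizer_ord[OF t'] by blast
  obtain W u where W: "germ W u" "y \<in> W" "u' = R W u" using u'(1) by (rule local_ringE)
  obtain W' v where W': "germ W' v" "y \<in> W'" "inv\<^bsub>KY\<^esub> u' = R W' v" using u'(2) by (rule local_ringE)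
  have "u' \<otimes>\<^bsub>KY\<^esub> inv\<^bsub>KY\<^esub> u' = \<one>\<^bsub>KY\<^esub>" using u'(3) by simp
  then have "R (W \<inter> W') (\<lambda>x. u x * v x) = \<one>\<^bsub>KY\<^esub>" unfolding W(3) W'(3)[unfolded W(3)] R_mult[OF W(1) W'(1)] .
  then have "u y * v y = 1" using R_eq_one_iff[OF germ_mult[OF W(1) W'(1)]] W(2) W'(2) by blast
  then have uy: "u y \<noteq> 0" by auto
  \<comment> \<open>The exponent \<open>l\<close> may be negative, so \<open>f'\<close> must be
    known to be nonzero before its power is formed pointwise.\<close>
  have "\<exists>x\<in>V'. f' x \<noteq> 0"
  proof (rule ccontr)
    assume "\<not> ?thesis"
    then have f'0: "f' x = 0" if "x \<in> V'" for x using that by blast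
    obtain W2 u2 where 2: "germ W2 u2" "y \<in> W2" "u2 y \<noteq> 0"
      "\<And>x. x \<in> W2 \<Longrightarrow> x \<in> V' \<Longrightarrow> x \<in> U \<Longrightarrow> t x \<noteq> 0 \<Longrightarrow> f' x = u2 x * t x powi 1"
      using f'(4) unfolding ord_is_def by blast
    have "u2 y = 0"
    proof (rule vanish_contra[of W2 u2 "points Y" "\<lambda>x. 0" 1 V' f'])
      show "y \<in> points Y" using f'(1,2) openin_subset by blast
      fix x assume "x \<in> W2" "x \<in> U" "t x \<noteq> 0" "x \<in> V'"
      then show "u2 x = 0 * t x ^ 1" using 2(4)[of x] f'0 by simp
    qed (use 2(1,2) germ_const f'(1) in simp_all)
    with 2(3) show False by contradiction
  qed
  then obtain x1 where x1: "x1 \<in> V'" "f' x1 \<noteq> 0" by blast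
  define V2 where "V2 = {x \<in> V'. f' x \<noteq> 0}"
  have V2: "germ V2 f'" "\<And>x. x \<in> V2 \<Longrightarrow> f' x \<noteq> 0" "V2 \<subseteq> V'"
    unfolding V2_def using nonvanishing_germ[OF f'(1) x1] by auto
  have "R V2 f' = t'" unfolding f'(3) using V2 by (intro R_restrict[OF f'(1)]) auto
  then have pow: "t' [^]\<^bsub>KY\<^esub> l = R V2 (\<lambda>x. f' x powi l)" using R_int_pow[OF V2(1) V2(2)] by metis
  have g: "germ V2 (\<lambda>x. f' x powi l)" using V2 by (auto intro!: reg_powi)
  have "ord_is y U t V2 f' 1" using f'(4) V2(3) by (rule ord_is_mono) simp
  from ord_is_power[OF this V2(2), of l] have "ord_is y U t V2 (\<lambda>x. f' x powi l) l" by simp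
  from ord_is_mult[OF ord_is_unit[OF W(1,2) uy] this]
  have o: "ord_is y U t (W \<inter> V2) (\<lambda>x. u x * f' x powi l) l" by simp
  have gg: "germ (W \<inter> V2) (\<lambda>x. u x * f' x powi l)" by (rule germ_mult[OF W(1) g])
  have eqR: "R V f = R (W \<inter> V2) (\<lambda>x. u x * f' x powi l)"
    unfolding eq pow W(3) by (rule R_mult[OF W(1) g])
  have "V \<inter> (W \<inter> V2) \<noteq> {}" "openin (zar Y) (V \<inter> (W \<inter> V2))" using irr[of V "W \<inter> V2"] f(1) gg by auto
  then have "germ (V \<inter> (W \<inter> V2)) f" using f(1) by (auto intro: reg_mono)
  moreover have "ord_is y U t (V \<inter> (W \<inter> V2)) f k" using k by (rule ord_is_mono) auto
  moreover have "ord_is y U t (V \<inter> (W \<inter> V2)) f l"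
    using o by (rule ord_is_mono) (use R_eq_iff[OF f(1) gg] eqR in auto)
  ultimately show "l = k" by (metis ord_is_unique)
qed

text \<open>If the order were \<open>- m < 0\<close>, write the function as \<open>u / t^m\<close>
  and multiply the equation of degree \<open>n\<close> by \<open>t^(m n)\<close>: every term except
  \<open>u^n\<close> keeps a factor \<open>t\<close>, so the unit \<open>u\<close> would vanish at
  \<open>y\<close>.\<close>

lemma integrally_closed_lp: "integrally_closed_in KY (local_ring Y {y})"
  unfolding integrally_closed_in_def
proof (intro ballI allI impI, elim conjE)
  fix g and n :: nat and c
  assume g: "g \<in> carrier KY" and c: "\<forall>i<n. c i \<in> local_ring Y {y}"
    and eq: "g [^]\<^bsub>KY\<^esub> n \<oplus>\<^bsub>KY\<^esub> (\<Oplus>\<^bsub>KY\<^esub>i\<in>{..<n}. c i \<otimes>\<^bsub>KY\<^esub> g [^]\<^bsub>KY\<^esub> i) = \<zero>\<^bsub>KY\<^esub>"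
  have yp: "y \<in> points Y" using lp_germ(1,2) openin_subset by blast
  obtain V f where f: "g = R V f" "germ V f" using g by (rule KY_cases)
  show "g \<in> local_ring Y {y}"
  proof (cases "\<exists>x\<in>V. f x \<noteq> 0")
    case False
    then have "g = R (points Y) (\<lambda>x. 0)" using f by (simp add: R_eq_zero_iff zero_KY[symmetric])
    then show ?thesis using local_ringI[OF germ_const[of 0] yp] by simp
  next
    case True
    then obtain k where k: "ord_is y U t V f k" using lp_exists f(2) by blast
    show ?thesis
    proof (rule ccontr)
      assume "g \<notin> local_ring Y {y}"
      then have "k < 0" using ord_is_local_iff[OF f(2) k] f(1) by simp
      define m where "m = nat (- k)"
      have m: "m > 0" "k = - int m" using \<open>k < 0\<close> by (auto simp: m_def)
      obtain W u where 1: "germ W u" "y \<in> W" "u y \<noteq> 0"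
        "\<And>x. x \<in> W \<Longrightarrow> x \<in> V \<Longrightarrow> x \<in> U \<Longrightarrow> t x \<noteq> 0 \<Longrightarrow> f x = u x * t x powi k"
        using k unfolding ord_is_def by blast
      have "\<forall>i. \<exists>A \<gamma>. i < n \<longrightarrow> germ A \<gamma> \<and> y \<in> A \<and> c i = R A \<gamma>"
        using c by (meson local_ringE)
      then obtain A \<gamma> where A: "\<And>i. i < n \<Longrightarrow> germ (A i) (\<gamma> i)" "\<And>i. i < n \<Longrightarrow> y \<in> A i"
        "\<And>i. i < n \<Longrightarrow> c i = R (A i) (\<gamma> i)" by metis
      define B where "B = W \<inter> U \<inter> (\<Inter>i<n. A i)"
      have openB: "openin (zar Y) B" "y \<in> B"
      proof -
        have "openin (zar Y) (W \<inter> U \<inter> (\<Inter>i\<in>I. A i)) \<and> y \<in> W \<inter> U \<inter> (\<Inter>i\<in>I. A i)"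
          if "finite I" "I \<subseteq> {..<n}" for I
          using that
        proof (induction I)
          case (insert i I)
          have "W \<inter> U \<inter> (\<Inter>i\<in>insert i I. A i) = A i \<inter> (W \<inter> U \<inter> (\<Inter>i\<in>I. A i))" by blast
          then show ?case using insert A(1,2)[of i] by (simp add: openin_Int)
        qed (use 1 lp_germ in auto)
        from this[of "{..<n}"] show "openin (zar Y) B" "y \<in> B" unfolding B_def by auto
      qed
      define Z where "Z = V \<inter> (\<Inter>i<n. A i)"
      have eqZ: "f x ^ n + (\<Sum>i<n. \<gamma> i x * f x ^ i) = 0" if "x \<in> Z" for x
        using integral_equation[OF f(2) A(1) eq[unfolded f(1)] A(3)] that unfolding Z_def by blast
      have gn: "germ W (\<lambda>x. u x ^ n)" using 1(1) by (auto intro: reg_power)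
      \<comment> \<open>The exponent is one less than \<open>m * (n - i)\<close>, because one factor
        \<open>t\<close> is split off for \<open>vanish_contra\<close>; \<open>i < n\<close> and
        \<open>m > 0\<close> make this possible.\<close>
      have gs: "germ B (\<lambda>x. - (\<Sum>i<n. \<gamma> i x * u x ^ i * t x ^ (m * (n - i) - 1)))"
      proof -
        have "u \<in> reg Y B" "t \<in> reg Y B" "\<And>i. i < n \<Longrightarrow> \<gamma> i \<in> reg Y B"
          using reg_mono[of u W B] reg_mono[of t U B] reg_mono[of "\<gamma> _" "A _" B] openB 1(1) lp_germ(1) A(1)
          by (auto simp: B_def)
        then show ?thesis
          using openB by (intro conjI reg_uminus reg_sum reg_mult reg_power) auto
      qed
      have "u y ^ n = 0"
      proof (rule vanish_contra[where n = 1, OF gn 1(2) gs openB(2) _ f(2)])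
        fix x assume x: "x \<in> W" "x \<in> B" "x \<in> U" "t x \<noteq> 0" "x \<in> V"
        then have "x \<in> Z" by (simp add: Z_def B_def)
        have ft: "f x * t x ^ m = u x" using 1(4)[of x] x by (simp add: m(2) power_int_minus)
        have "u x ^ n = f x ^ n * t x ^ (m * n)" by (simp add: ft[symmetric] power_mult_distrib power_mult)
        also have "\<dots> = - (\<Sum>i<n. \<gamma> i x * f x ^ i) * t x ^ (m * n)"
          using eqZ[OF \<open>x \<in> Z\<close>] by (simp add: eq_neg_iff_add_eq_0[symmetric])
        also have "\<dots> = - (\<Sum>i<n. \<gamma> i x * u x ^ i * t x ^ (m * (n - i) - 1) * t x)"
        proof -
          have "f x ^ i * t x ^ (m * n) = u x ^ i * t x ^ (m * (n - i) - 1) * t x" if "i < n" for i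
          proof -
            have "m * n = m * i + (Suc (m * (n - i) - 1))"
              using that m(1) by (simp add: distrib_left[symmetric])
            then have "t x ^ (m * n) = t x ^ (m * i) * t x ^ Suc (m * (n - i) - 1)" by (metis power_add)
            then show ?thesis by (simp add: ft[symmetric] power_mult_distrib power_mult[symmetric] mult_ac)
          qed
          then show ?thesis by (simp add: sum_distrib_right mult.assoc)
        qed
        finally show "u x ^ n = - (\<Sum>i<n. \<gamma> i x * u x ^ i * t x ^ (m * (n - i) - 1)) * t x ^ 1"
          by (simp add: sum_distrib_right)
      qed simp
      with 1(3) show False by simp
    qed
  qed
qed

end

end

section \<open>The Zariski topologies\<close>

lemma topspace_zariski [simp]: "topspace (zariski n :: 'k::field list topology) = {x. length x = n}"
proof -
  have "{x :: 'k list. length x = n} \<in> {{x. length x = n \<and> p x \<noteq> 0} |p. p \<in> poly_funs n}"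
    using poly_funs_const[of 1 n] by (intro CollectI exI[of _ "\<lambda>x. 1"]) auto
  from Union_upper[OF this] show ?thesis
    unfolding zariski_def topology_generated_by_topspace by (intro equalityI) auto
qed

lemma openin_zariski_basic: "p \<in> poly_funs n \<Longrightarrow> openin (zariski n) {x. length x = n \<and> p x \<noteq> 0}"
  unfolding zariski_def by (rule topology_generated_by_Basis) blast

text \<open>Products of polynomials show that the generating open sets are stable under
  intersection.\<close>

lemma zariski_basis:
  assumes "openin (zariski n) U" "x \<in> U"
  shows "\<exists>p\<in>poly_funs n. p x \<noteq> 0 \<and> {y. length y = n \<and> p y \<noteq> 0} \<subseteq> U"
proof -
  have "generate_topology_on {{x. length x = n \<and> p x \<noteq> 0} | p. p \<in> poly_funs n} U"
    using assms(1) unfolding zariski_def openin_topology_generated_by_iff .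
  then show ?thesis using assms(2)
  proof (induction arbitrary: x)
    case (Int A B)
    from Int.prems Int.IH(1)[of x] obtain p where
      p: "p \<in> poly_funs n" "p x \<noteq> 0" "{y. length y = n \<and> p y \<noteq> 0} \<subseteq> A" by auto
    from Int.prems Int.IH(2)[of x] obtain q where
      q: "q \<in> poly_funs n" "q x \<noteq> 0" "{y. length y = n \<and> q y \<noteq> 0} \<subseteq> B" by auto
    show ?case using p q by (intro bexI[of _ "\<lambda>x. p x * q x"] poly_funs_mult) auto
  next
    case (UN K)
    then obtain k where "k \<in> K" "x \<in> k" by blast
    with UN.IH[of k x] show ?case by blast
  next
    case (Basis s)
    then obtain p where "p \<in> poly_funs n" "s = {x. length x = n \<and> p x \<noteq> 0}" by blast
    with Basis.prems show ?case by (intro bexI[of _ p]) auto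
  qed simp
qed

lemma orbit_self: "length x = length ws \<Longrightarrow> x \<in> orbit ws x"
  unfolding orbit_def by (intro CollectI exI[of _ 1]) (auto intro!: nth_equalityI)

lemma homogeneous_orbit:
  assumes "q \<in> homogeneous_funs ws e" "x' \<in> orbit ws x" "length x = length ws"
  obtains t where "t \<noteq> 0" "q x' = t ^ e * q x"
proof -
  obtain t where "t \<noteq> 0" "x' = map2 (\<lambda>w c. t ^ w * c) ws x" using assms(2) by (auto simp: orbit_def)
  then show ?thesis using that homogeneous_funs_scale[OF assms(1,3), of t] by simp
qed

lemma homogeneous_orbit_nz:
  assumes "q \<in> homogeneous_funs ws e" "x' \<in> orbit ws x" "length x = length ws"
  shows "q x' = 0 \<longleftrightarrow> q x = 0"
  using homogeneous_orbit[OF assms] by (metis mult_eq_0_iff power_not_zero)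

lemma punctured_length: "x \<in> punctured ws \<Longrightarrow> length x = length ws"
  by (simp add: punctured_def)

lemma topspace_weighted_zariski [simp]:
  "topspace (weighted_zariski ws :: 'k::field list set topology) = orbit ws ` punctured ws"
proof -
  have "orbit ws ` (punctured ws :: 'k list set)
      \<in> {orbit ws ` {x \<in> punctured ws. q x \<noteq> 0} |q e. q \<in> homogeneous_funs ws e}"
    using homogeneous_funs_const[of 1 ws] by (intro CollectI exI[of _ "\<lambda>x. 1"] exI[of _ 0]) auto
  from Union_upper[OF this] show ?thesis
    unfolding weighted_zariski_def topology_generated_by_topspace by (intro equalityI) auto
qed

lemma openin_weighted_basic:
  "q \<in> homogeneous_funs ws e \<Longrightarrow> openin (weighted_zariski ws) (orbit ws ` {x \<in> punctured ws. q x \<noteq> 0})"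
  unfolding weighted_zariski_def by (rule topology_generated_by_Basis) blast

lemma weighted_basic_iff:
  assumes "q \<in> homogeneous_funs ws e" "x \<in> punctured ws"
  shows "orbit ws x \<in> orbit ws ` {x \<in> punctured ws. q x \<noteq> 0} \<longleftrightarrow> q x \<noteq> 0"
proof
  assume "orbit ws x \<in> orbit ws ` {x \<in> punctured ws. q x \<noteq> 0}"
  then obtain x' where x': "x' \<in> punctured ws" "q x' \<noteq> 0" "orbit ws x = orbit ws x'" by blast
  then have "x \<in> orbit ws x'" using orbit_self[of x ws] punctured_length[OF assms(2)] by simp
  then show "q x \<noteq> 0" using homogeneous_orbit_nz[OF assms(1)] x' punctured_length by blast
qed (use assms in blast)

lemma weighted_basis:
  assumes "openin (weighted_zariski ws) U" "x \<in> punctured ws" "orbit ws x \<in> U"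
  shows "\<exists>q e. q \<in> homogeneous_funs ws e \<and> q x \<noteq> 0 \<and> orbit ws ` {x \<in> punctured ws. q x \<noteq> 0} \<subseteq> U"
proof -
  have "generate_topology_on {orbit ws ` {x \<in> punctured ws. q x \<noteq> 0} | q e. q \<in> homogeneous_funs ws e} U"
    using assms(1) unfolding weighted_zariski_def openin_topology_generated_by_iff .
  then show ?thesis using assms(3)
  proof induction
    case (Int A B)
    from Int.prems have "orbit ws x \<in> A" "orbit ws x \<in> B" by simp_all
    from Int.IH(1)[OF this(1)] Int.IH(2)[OF this(2)] obtain p e q e'
      where *: "p \<in> homogeneous_funs ws e" "p x \<noteq> 0" "orbit ws ` {x \<in> punctured ws. p x \<noteq> 0} \<subseteq> A"
      "q \<in> homogeneous_funs ws e'" "q x \<noteq> 0" "orbit ws ` {x \<in> punctured ws. q x \<noteq> 0} \<subseteq> B"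
      by (elim exE conjE) (rule that)
    have "(\<lambda>x. p x * q x) \<in> homogeneous_funs ws (e + e')" by (rule homogeneous_funs_mult[OF *(1,4)])
    moreover have "orbit ws ` {x \<in> punctured ws. p x * q x \<noteq> 0} \<subseteq> A \<inter> B" using *(3,6) by auto
    ultimately show ?case using *(2,5)
      by (intro exI[of _ "\<lambda>x. p x * q x"] exI[of _ "e + e'"]) auto
  next
    case (UN K)
    then obtain k where k: "k \<in> K" "orbit ws x \<in> k" by blast
    from UN.IH[OF k] obtain q e where "q \<in> homogeneous_funs ws e" "q x \<noteq> 0"
      "orbit ws ` {x \<in> punctured ws. q x \<noteq> 0} \<subseteq> k" by (elim exE conjE) (rule that)
    with k(1) show ?case by (intro exI[of _ q] exI[of _ e]) auto
  next
    case (Basis s)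
    then obtain q e where q: "q \<in> homogeneous_funs ws e" "s = orbit ws ` {x \<in> punctured ws. q x \<noteq> 0}" by blast
    have "q x \<noteq> 0" using Basis.prems unfolding q(2) weighted_basic_iff[OF q(1) assms(2)] .
    then show ?case using q by (intro exI[of _ q] exI[of _ e]) simp
  qed simp
qed

section \<open>Affine and projective spaces as spaces of local fractions\<close>

definition affine_Fr :: "nat \<Rightarrow> 'k::field list set \<Rightarrow> ('k list \<Rightarrow> 'k) \<Rightarrow> bool" where
  "affine_Fr n W f \<longleftrightarrow> (\<exists>p q. p \<in> poly_funs n \<and> q \<in> poly_funs n \<and> (\<forall>y\<in>W. q y \<noteq> 0 \<and> f y = p y / q y))"

lemma affine_FrI:
  "p \<in> poly_funs n \<Longrightarrow> q \<in> poly_funs n \<Longrightarrow> (\<And>y. y \<in> W \<Longrightarrow> q y \<noteq> 0 \<and> f y = p y / q y) \<Longrightarrow> affine_Fr n W f"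
  unfolding affine_Fr_def by blast

lemma frac_space_affine: "frac_space (affine_space_on n S) (affine_Fr n)"
proof
  show "reg (affine_space_on n S) U =
      {f. \<forall>x\<in>U. \<exists>W. openin (zar (affine_space_on n S)) W \<and> x \<in> W \<and> W \<subseteq> U \<and> affine_Fr n W f}" for U
    unfolding affine_space_on_def affine_Fr_def by simp
  show "affine_Fr n W' f" if "affine_Fr n W f" "W' \<subseteq> W" for W W' and f :: "'a list \<Rightarrow> 'a"
    using that unfolding affine_Fr_def by blast
  show "affine_Fr n W g" if "affine_Fr n W f" "\<And>x. x \<in> W \<Longrightarrow> f x = g x" for W and f g :: "'a list \<Rightarrow> 'a"
    using that unfolding affine_Fr_def by metis
  show "affine_Fr n W (\<lambda>_. c)" for W and c :: 'a
    by (rule affine_FrI[OF poly_funs_const[of c] poly_funs_const[of 1]]) simp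
  fix W and f g :: "'a list \<Rightarrow> 'a"
  assume f: "affine_Fr n W f"
  then obtain p q where p: "p \<in> poly_funs n" "q \<in> poly_funs n" "\<And>y. y \<in> W \<Longrightarrow> q y \<noteq> 0 \<and> f y = p y / q y"
    unfolding affine_Fr_def by blast
  { assume "affine_Fr n W g"
    then obtain p' q' where p': "p' \<in> poly_funs n" "q' \<in> poly_funs n" "\<And>y. y \<in> W \<Longrightarrow> q' y \<noteq> 0 \<and> g y = p' y / q' y"
      unfolding affine_Fr_def by blast
    show "affine_Fr n W (\<lambda>x. f x + g x)"
      by (rule affine_FrI[of "\<lambda>x. p x * q' x + p' x * q x" _ "\<lambda>x. q x * q' x"])
        (use p p' in \<open>auto intro!: poly_funs_intros simp: field_simps\<close>)
    show "affine_Fr n W (\<lambda>x. f x * g x)"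
      by (rule affine_FrI[of "\<lambda>x. p x * p' x" _ "\<lambda>x. q x * q' x"])
        (use p p' in \<open>auto intro!: poly_funs_intros\<close>) }
  show "affine_Fr n W (\<lambda>x. inverse (f x))" if "\<And>x. x \<in> W \<Longrightarrow> f x \<noteq> 0"
    by (rule affine_FrI[OF p(2,1)]) (use p(3) that in auto)
  assume "openin (zar (affine_space_on n S)) W"
  then have W: "openin (subtopology (zariski n) S) W" by (simp add: affine_space_on_def)
  then have WS: "W \<subseteq> S" "W \<subseteq> {x. length x = n}" using openin_subset[OF W] by auto
  have "{x \<in> W. f x \<noteq> 0} = W \<inter> (S \<inter> {x. length x = n \<and> p x \<noteq> 0})" using WS p(3) by auto
  moreover have "openin (subtopology (zariski n) S) (S \<inter> {x. length x = n \<and> p x \<noteq> 0})"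
    by (rule openin_subtopology_Int2[OF openin_zariski_basic[OF p(1)]])
  ultimately show "openin (zar (affine_space_on n S)) {x \<in> W. f x \<noteq> 0}"
    using W by (simp add: affine_space_on_def openin_Int)
qed

definition weighted_Fr :: "nat list \<Rightarrow> 'k::field list set set \<Rightarrow> ('k list set \<Rightarrow> 'k) \<Rightarrow> bool" where
  "weighted_Fr ws W f \<longleftrightarrow> (\<exists>e p q. p \<in> homogeneous_funs ws e \<and> q \<in> homogeneous_funs ws e \<and>
     (\<forall>z\<in>W. \<forall>x\<in>z. q x \<noteq> 0 \<and> f z = p x / q x))"

lemma weighted_FrI:
  "p \<in> homogeneous_funs ws e \<Longrightarrow> q \<in> homogeneous_funs ws e \<Longrightarrow>
    (\<And>z x. z \<in> W \<Longrightarrow> x \<in> z \<Longrightarrow> q x \<noteq> 0 \<and> f z = p x / q x) \<Longrightarrow> weighted_Fr ws W f"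
  unfolding weighted_Fr_def by blast

lemma frac_space_wproj: "frac_space (wproj_space_on ws S) (weighted_Fr ws)"
proof
  show "reg (wproj_space_on ws S) U =
      {f. \<forall>x\<in>U. \<exists>W. openin (zar (wproj_space_on ws S)) W \<and> x \<in> W \<and> W \<subseteq> U \<and> weighted_Fr ws W f}" for U
    unfolding wproj_space_on_def weighted_Fr_def by simp
  show "weighted_Fr ws W' f" if "weighted_Fr ws W f" "W' \<subseteq> W" for W W' and f :: "'a list set \<Rightarrow> 'a"
    using that unfolding weighted_Fr_def by blast
  show "weighted_Fr ws W g" if "weighted_Fr ws W f" "\<And>x. x \<in> W \<Longrightarrow> f x = g x" for W and f g :: "'a list set \<Rightarrow> 'a"
    using that unfolding weighted_Fr_def by metis
  show "weighted_Fr ws W (\<lambda>_. c)" for W and c :: 'a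
    by (rule weighted_FrI[OF homogeneous_funs_const[of c] homogeneous_funs_const[of 1]]) simp
  fix W and f g :: "'a list set \<Rightarrow> 'a"
  assume f: "weighted_Fr ws W f"
  then obtain e p q where p: "p \<in> homogeneous_funs ws e" "q \<in> homogeneous_funs ws e"
    "\<And>z x. z \<in> W \<Longrightarrow> x \<in> z \<Longrightarrow> q x \<noteq> 0 \<and> f z = p x / q x"
    unfolding weighted_Fr_def by blast
  { assume "weighted_Fr ws W g"
    then obtain e' p' q' where p': "p' \<in> homogeneous_funs ws e'" "q' \<in> homogeneous_funs ws e'"
      "\<And>z x. z \<in> W \<Longrightarrow> x \<in> z \<Longrightarrow> q' x \<noteq> 0 \<and> g z = p' x / q' x"
      unfolding weighted_Fr_def by blast
    note hom = homogeneous_funs_add[OF homogeneous_funs_mult[OF p(1) p'(2)]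
        homogeneous_funs_mult[OF p(2) p'(1)]] homogeneous_funs_mult[OF p(1) p'(1)] homogeneous_funs_mult[OF p(2) p'(2)]
    show "weighted_Fr ws W (\<lambda>x. f x + g x)"
    proof (rule weighted_FrI[OF hom(1,3)])
      fix z x assume "z \<in> W" "x \<in> z"
      from p(3)[OF this] p'(3)[OF this] show "q x * q' x \<noteq> 0 \<and> f z + g z = (p x * q' x + q x * p' x) / (q x * q' x)"
        by (simp add: field_simps)
    qed
    show "weighted_Fr ws W (\<lambda>x. f x * g x)"
    proof (rule weighted_FrI[OF hom(2,3)])
      fix z x assume "z \<in> W" "x \<in> z"
      from p(3)[OF this] p'(3)[OF this] show "q x * q' x \<noteq> 0 \<and> f z * g z = (p x * p' x) / (q x * q' x)"
        by simp
    qed }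
  show "weighted_Fr ws W (\<lambda>x. inverse (f x))" if nz: "\<And>x. x \<in> W \<Longrightarrow> f x \<noteq> 0"
  proof (rule weighted_FrI[OF p(2,1)])
    fix z x assume "z \<in> W" "x \<in> z"
    from p(3)[OF this] nz[OF \<open>z \<in> W\<close>] show "p x \<noteq> 0 \<and> inverse (f z) = q x / p x" by auto
  qed
  assume "openin (zar (wproj_space_on ws S)) W"
  then have W: "openin (subtopology (weighted_zariski ws) S) W" by (simp add: wproj_space_on_def)
  define B where "B = orbit ws ` {x \<in> punctured ws. p x \<noteq> 0}"
  have "z \<in> {x \<in> W. f x \<noteq> 0} \<longleftrightarrow> z \<in> W \<inter> (S \<inter> B)" for z
  proof (cases "z \<in> W")
    case True
    then have zS: "z \<in> S" "z \<in> orbit ws ` punctured ws" using openin_subset[OF W] by auto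
    then obtain x where x: "x \<in> punctured ws" "z = orbit ws x" by blast
    have "f z \<noteq> 0 \<longleftrightarrow> p x \<noteq> 0" using p(3)[OF True, of x] x orbit_self punctured_length by fastforce
    also have "\<dots> \<longleftrightarrow> z \<in> B" unfolding B_def x(2) by (rule weighted_basic_iff[OF p(1) x(1), symmetric])
    finally show ?thesis using True zS by simp
  qed simp
  then have "{x \<in> W. f x \<noteq> 0} = W \<inter> (S \<inter> B)" by blast
  moreover have "openin (subtopology (weighted_zariski ws) S) (S \<inter> B)"
    unfolding B_def by (rule openin_subtopology_Int2[OF openin_weighted_basic[OF p(1)]])
  ultimately show "openin (zar (wproj_space_on ws S)) {x \<in> W. f x \<noteq> 0}"
    using W by (simp add: wproj_space_on_def openin_Int)
qed

section \<open>Morphisms\<close>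

lemma points_affine [simp]: "points (affine_space_on n S) = S \<inter> {x. length x = n}"
  by (auto simp: affine_space_on_def)

lemma affine_basic_open:
  "p \<in> poly_funs n \<Longrightarrow> openin (zar (affine_space_on n S)) (S \<inter> {x. length x = n \<and> p x \<noteq> 0})"
  unfolding affine_space_on_def by (simp add: openin_subtopology_Int2[OF openin_zariski_basic])

lemma affine_basis:
  assumes "openin (zar (affine_space_on n S)) U" "x \<in> U"
  obtains p where "p \<in> poly_funs n" "p x \<noteq> 0" "S \<inter> {y. length y = n \<and> p y \<noteq> 0} \<subseteq> U"
proof -
  obtain T where T: "openin (zariski n) T" "U = T \<inter> S"
    using assms(1) unfolding affine_space_on_def by (auto simp: openin_subtopology)
  then obtain p where "p \<in> poly_funs n" "p x \<noteq> 0" "{y. length y = n \<and> p y \<noteq> 0} \<subseteq> T"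
    using zariski_basis[OF T(1)] assms(2) by blast
  with T that show ?thesis by blast
qed

lemma affine_poly_reg:
  assumes "p \<in> poly_funs n" "openin (zar (affine_space_on n S)) U"
  shows "p \<in> reg (affine_space_on n S) U"
  by (rule frac_space.reg_Fr[OF frac_space_affine assms(2)])
    (rule affine_FrI[OF assms(1) poly_funs_const[of 1]], simp)

text \<open>Polynomials in regular coordinates are regular, and a basic open set pulls back to the
  nonvanishing locus of such a function; continuity and regularity of composites both
  follow.\<close>

lemma (in frac_space) morphism_into_affine:
  assumes U0: "openin (zar Y) U0" and \<phi>S: "\<And>x. x \<in> U0 \<Longrightarrow> \<phi> x \<in> S \<and> length (\<phi> x) = n"
    and coord: "\<And>i. i < n \<Longrightarrow> (\<lambda>x. \<phi> x ! i) \<in> reg Y U0"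
  shows "morphism (open_subspace Y U0) (affine_space_on n S) \<phi>"
proof -
  have poly: "(\<lambda>x. p (\<phi> x)) \<in> reg Y U0" if "p \<in> poly_funs n" for p
    by (rule reg_poly_funs[OF that U0 coord])
  have pts: "points (open_subspace Y U0) = U0"
    using openin_subset[OF U0] by (auto simp: open_subspace_def)
  have op: "openin (zar (open_subspace Y U0)) W \<longleftrightarrow> openin (zar Y) W \<and> W \<subseteq> U0" for W
    by (simp add: open_subspace_def openin_open_subtopology[OF U0])
  have cont: "continuous_map (zar (open_subspace Y U0)) (zar (affine_space_on n S)) \<phi>"
    unfolding continuous_map_def pts
  proof (intro conjI allI impI)
    show "\<phi> \<in> U0 \<rightarrow> points (affine_space_on n S)" using \<phi>S by auto
    fix U assume U: "openin (zar (affine_space_on n S)) U"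
    have "openin (zar Y) {x \<in> U0. \<phi> x \<in> U}"
    proof (subst openin_subopen, intro ballI)
      fix x assume x: "x \<in> {x \<in> U0. \<phi> x \<in> U}"
      then obtain p where p: "p \<in> poly_funs n" "p (\<phi> x) \<noteq> 0" "S \<inter> {y. length y = n \<and> p y \<noteq> 0} \<subseteq> U"
        using affine_basis[OF U] by blast
      show "\<exists>T. openin (zar Y) T \<and> x \<in> T \<and> T \<subseteq> {x \<in> U0. \<phi> x \<in> U}"
        using p x \<phi>S reg_open[OF poly[OF p(1)]]
        by (intro exI[of _ "{x \<in> U0. p (\<phi> x) \<noteq> 0}"]) auto
    qed
    then show "openin (zar (open_subspace Y U0)) {x \<in> U0. \<phi> x \<in> U}" unfolding op by auto
  qed
  show ?thesis unfolding morphism_def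
  proof (intro conjI cont allI impI, elim conjE)
    fix V f assume V: "openin (zar (affine_space_on n S)) V" and f: "f \<in> reg (affine_space_on n S) V"
    interpret A: frac_space "affine_space_on n S" "affine_Fr n" by (rule frac_space_affine)
    have "f \<circ> \<phi> \<in> reg Y {x \<in> U0. \<phi> x \<in> V}"
    proof (rule reg_glue)
      fix x assume x: "x \<in> {x \<in> U0. \<phi> x \<in> V}"
      then obtain W where W: "openin (zar (affine_space_on n S)) W" "\<phi> x \<in> W" "W \<subseteq> V" "affine_Fr n W f"
        using A.regE[OF f] by blast
      obtain p q where pq: "p \<in> poly_funs n" "q \<in> poly_funs n" "\<And>y. y \<in> W \<Longrightarrow> q y \<noteq> 0 \<and> f y = p y / q y"
        using W(4) unfolding affine_Fr_def by blast
      define T where "T = {x \<in> U0. \<phi> x \<in> W}"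
      have T: "openin (zar Y) T"
        using openin_continuous_map_preimage[OF cont W(1)] unfolding pts op T_def by blast
      have "(\<lambda>x. p (\<phi> x) / q (\<phi> x)) \<in> reg Y T"
        using pq T by (intro reg_divide reg_mono[OF poly]) (auto simp: T_def)
      then have "f \<circ> \<phi> \<in> reg Y T" by (rule reg_cong) (use pq in \<open>auto simp: T_def\<close>)
      then show "\<exists>W. openin (zar Y) W \<and> x \<in> W \<and> W \<subseteq> {x \<in> U0. \<phi> x \<in> V} \<and> f \<circ> \<phi> \<in> reg Y W"
        using T x W by (intro exI[of _ T]) (auto simp: T_def)
    qed
    then show "f \<circ> \<phi> \<in> reg (open_subspace Y U0) {x \<in> points (open_subspace Y U0). \<phi> x \<in> V}"
      unfolding pts by (simp add: open_subspace_def)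
  qed
qed

text \<open>Both points must lie in one open set that carries the distinguishing function. This
  gives closed equalisers of morphisms directly, without a product space and its diagonal.\<close>

definition (in frac_space) separating :: bool where
  "separating \<longleftrightarrow> (\<forall>y\<in>points Y. \<forall>y'\<in>points Y. y \<noteq> y' \<longrightarrow>
     (\<exists>V f. openin (zar Y) V \<and> y \<in> V \<and> y' \<in> V \<and> f \<in> reg Y V \<and> f y \<noteq> f y'))"

lemma (in frac_space) separatingE:
  assumes "separating" "y \<in> points Y" "y' \<in> points Y" "y \<noteq> y'"
  obtains V f where "openin (zar Y) V" "y \<in> V" "y' \<in> V" "f \<in> reg Y V" "f y \<noteq> f y'"
proof -
  have "\<exists>V f. openin (zar Y) V \<and> y \<in> V \<and> y' \<in> V \<and> f \<in> reg Y V \<and> f y \<noteq> f y'"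
    using assms(1)[unfolded separating_def, rule_format, OF assms(2-4)] .
  then show ?thesis by (elim exE conjE) (rule that)
qed

lemma (in frac_space) closed_point:
  assumes "separating" "y \<in> points Y" shows "closedin (zar Y) {y}"
proof -
  have "openin (zar Y) (points Y - {y})"
  proof (subst openin_subopen, intro ballI)
    fix y' assume y': "y' \<in> points Y - {y}"
    then have "y' \<in> points Y" "y \<noteq> y'" by auto
    then obtain V f where V: "openin (zar Y) V" "y \<in> V" "y' \<in> V" "f \<in> reg Y V" "f y \<noteq> f y'"
      by (rule separatingE[OF assms])
    have "openin (zar Y) {v \<in> V. f v \<noteq> f y}" by (rule reg_neq_open[OF V(4) reg_const[OF V(1)]])
    then show "\<exists>T. openin (zar Y) T \<and> y' \<in> T \<and> T \<subseteq> points Y - {y}"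
      using V openin_subset[OF V(1)] by (intro exI[of _ "{v \<in> V. f v \<noteq> f y}"]) auto
  qed
  then show ?thesis using assms(2) by (simp add: closedin_def)
qed

text \<open>Where \<phi> and \<psi> differ, some \<open>f\<close> has different values at the two
  images, and the inequality persists nearby because both composites are regular.\<close>

lemma (in frac_space) separatedI:
  assumes "separating" shows "separated Y"
  unfolding separated_def
proof (intro allI impI, elim conjE)
  fix n :: nat and S and \<phi> \<psi> :: "'k list \<Rightarrow> 'p"
  assume S: "closedin (zariski n) S" and \<phi>: "morphism (affine_space_on n S) Y \<phi>"
    and \<psi>: "morphism (affine_space_on n S) Y \<psi>"
  interpret A: frac_space "affine_space_on n S" "affine_Fr n" by (rule frac_space_affine)
  have c\<phi>: "continuous_map (zar (affine_space_on n S)) (zar Y) \<phi>" using \<phi> by (simp add: morphism_def)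
  have c\<psi>: "continuous_map (zar (affine_space_on n S)) (zar Y) \<psi>" using \<psi> by (simp add: morphism_def)
  have pts: "points (affine_space_on n S) = S" using closedin_subset[OF S] by auto
  have "openin (zar (affine_space_on n S)) (S - {z \<in> S. \<phi> z = \<psi> z})"
  proof (subst openin_subopen, intro ballI)
    fix z assume z: "z \<in> S - {z \<in> S. \<phi> z = \<psi> z}"
    have zp: "\<phi> z \<in> points Y" "\<psi> z \<in> points Y"
      using z pts continuous_map_image_subset_topspace[OF c\<phi>] continuous_map_image_subset_topspace[OF c\<psi>] by auto
    have "\<phi> z \<noteq> \<psi> z" using z by blast
    then obtain V f where V: "openin (zar Y) V" "\<phi> z \<in> V" "\<psi> z \<in> V" "f \<in> reg Y V" "f (\<phi> z) \<noteq> f (\<psi> z)"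
      by (rule separatingE[OF assms zp])
    define P where "P = {x \<in> points (affine_space_on n S). \<phi> x \<in> V}"
    define Q where "Q = {x \<in> points (affine_space_on n S). \<psi> x \<in> V}"
    have P: "openin (zar (affine_space_on n S)) P" "f \<circ> \<phi> \<in> reg (affine_space_on n S) P"
      unfolding P_def using openin_continuous_map_preimage[OF c\<phi> V(1)] \<phi> V(1,4) unfolding morphism_def by blast+
    have Q: "openin (zar (affine_space_on n S)) Q" "f \<circ> \<psi> \<in> reg (affine_space_on n S) Q"
      unfolding Q_def using openin_continuous_map_preimage[OF c\<psi> V(1)] \<psi> V(1,4) unfolding morphism_def by blast+
    have PQ: "openin (zar (affine_space_on n S)) (P \<inter> Q)" using P Q by blast
    have "openin (zar (affine_space_on n S)) {x \<in> P \<inter> Q. (f \<circ> \<phi>) x \<noteq> (f \<circ> \<psi>) x}"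
      by (rule A.reg_neq_open[OF A.reg_mono[OF P(2) _ PQ] A.reg_mono[OF Q(2) _ PQ]]) auto
    then show "\<exists>T. openin (zar (affine_space_on n S)) T \<and> z \<in> T \<and> T \<subseteq> S - {z \<in> S. \<phi> z = \<psi> z}"
    proof (intro exI conjI)
      have "z \<in> P" "z \<in> Q" using z V(2,3) unfolding P_def Q_def pts by auto
      then show "z \<in> {x \<in> P \<inter> Q. (f \<circ> \<phi>) x \<noteq> (f \<circ> \<psi>) x}" using V(5) by simp
      have "P \<subseteq> S" unfolding P_def pts by blast
      then show "{x \<in> P \<inter> Q. (f \<circ> \<phi>) x \<noteq> (f \<circ> \<psi>) x} \<subseteq> S - {z \<in> S. \<phi> z = \<psi> z}" by auto
    qed
  qed
  then have "closedin (zar (affine_space_on n S)) {z \<in> S. \<phi> z = \<psi> z}"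
    unfolding closedin_def pts by auto
  then have "closedin (subtopology (zariski n) S) {z \<in> S. \<phi> z = \<psi> z}" by (simp add: affine_space_on_def)
  then show "closedin (zariski n) {z \<in> S. \<phi> z = \<psi> z}" using closedin_trans_full[OF _ S] by blast
qed

lemma (in irr_space) irreducible_points: "irreducible_closed Y (points Y)"
  unfolding irreducible_closed_def
proof (intro conjI allI impI points_ne closedin_topspace)
  fix A B assume *: "closedin (zar Y) A \<and> closedin (zar Y) B \<and> points Y = A \<union> B"
  then have "openin (zar Y) (points Y - A)" "openin (zar Y) (points Y - B)"
    unfolding closedin_def by blast+
  moreover have "(points Y - A) \<inter> (points Y - B) = {}" using * by blast
  ultimately have "points Y - A = {} \<or> points Y - B = {}" using irr by blast
  then show "A = points Y \<or> B = points Y" using * closedin_subset by blast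
qed

section \<open>Normality of Pham--Brieskorn surfaces\<close>

lemma openin_Int_INT:
  fixes n :: nat
  assumes "openin T V" "\<And>i. i < n \<Longrightarrow> openin T (A i)" shows "openin T (V \<inter> (\<Inter>i<n. A i))"
  using assms(2)
proof (induction n)
  case (Suc n)
  have "V \<inter> (\<Inter>i<Suc n. A i) = (V \<inter> (\<Inter>i<n. A i)) \<inter> A n" by (auto simp: less_Suc_eq)
  then show ?case using Suc by (simp add: openin_Int)
qed (use assms in simp)

context pham begin

abbreviation XC :: "('k list, 'k) fun_space" where "XC \<equiv> affine_space_on 3 C"

lemma C_len: "x \<in> C \<Longrightarrow> length x = 3"
  by (simp add: C_def)

lemma points_XC: "points XC = C"
  using C_len by auto

lemma zero_in_C: "[0, 0, 0] \<in> C"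
  using a_pos[of 0] a_pos[of 1] a_pos[of 2] by (simp add: C_def power_0_left)

lemma equation_poly: "(\<lambda>x. x ! 0 ^ a 0 + x ! 1 ^ a 1 + x ! 2 ^ a 2) \<in> poly_funs 3"
  by (intro poly_funs_intros) auto

lemma closedin_C: "closedin (zariski 3) C"
proof -
  have "{x. length x = 3} - C = {x. length x = 3 \<and> x ! 0 ^ a 0 + x ! 1 ^ a 1 + x ! 2 ^ a 2 \<noteq> 0}"
    by (auto simp: C_def)
  then show ?thesis
    using openin_zariski_basic[OF equation_poly] C_len by (auto simp: closedin_def)
qed

lemma irr_space_XC: "irr_space XC (affine_Fr 3)"
proof (intro irr_space.intro frac_space_affine irr_space_axioms.intro)
  show "points XC \<noteq> {}" unfolding points_XC using zero_in_C by blast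
  fix U V assume U: "openin (zar XC) U" "U \<noteq> {}" and V: "openin (zar XC) V" "V \<noteq> {}"
  obtain x y where x: "x \<in> U" and y: "y \<in> V" using U V by blast
  then have xy: "x \<in> C" "y \<in> C" using openin_subset[OF U(1)] openin_subset[OF V(1)] points_XC by auto
  obtain p where p: "p \<in> poly_funs 3" "p x \<noteq> 0" "C \<inter> {y. length y = 3 \<and> p y \<noteq> 0} \<subseteq> U"
    by (rule affine_basis[OF U(1) x])
  obtain q where q: "q \<in> poly_funs 3" "q y \<noteq> 0" "C \<inter> {y. length y = 3 \<and> q y \<noteq> 0} \<subseteq> V"
    by (rule affine_basis[OF V(1) y])
  obtain z where "z \<in> C" "p z * q z \<noteq> 0" using domain[OF p(1) q(1)] p(2) q(2) xy by blast
  then have "z \<in> U \<inter> V" using p(3) q(3) C_len by auto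
  then show "U \<inter> V \<noteq> {}" by blast
qed

sublocale XC: irr_space XC "affine_Fr 3"
  by (rule irr_space_XC)

lemma separating_XC: "XC.separating"
  unfolding XC.separating_def points_XC
proof (intro ballI impI)
  fix y y' assume *: "y \<in> C" "y' \<in> C" "y \<noteq> y'"
  then obtain i where i: "i < 3" "y ! i \<noteq> y' ! i" using C_len nth_equalityI[of y y'] by auto
  have o: "openin (zar XC) C" using openin_topspace[of "zar XC"] unfolding points_XC .
  have "(\<lambda>x. x ! i) \<in> reg XC C" by (rule affine_poly_reg[OF poly_funs_coord[OF i(1)] o])
  with o * i show "\<exists>V f. openin (zar XC) V \<and> y \<in> V \<and> y' \<in> V \<and> f \<in> reg XC V \<and> f y \<noteq> f y'"
    by (intro exI[of _ C] exI[of _ "\<lambda>x. x ! i"]) simp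
qed

lemma variety_XC: "variety XC"
  unfolding variety_def
proof (intro conjI XC.irreducible_points XC.separatedI separating_XC)
  have "open_subspace XC C = XC"
    by (simp add: open_subspace_def affine_space_on_def subtopology_subtopology)
  moreover have "morphism XC XC id"
    unfolding morphism_def by (auto simp: openin_subset Collect_conj_eq Int_absorb1 dest!: openin_subset)
  ultimately have "isomorphic (open_subspace XC C) XC"
    unfolding isomorphic_def by (intro exI[of _ id]) auto
  then have "affine_open XC C"
    unfolding affine_open_def using closedin_C openin_topspace[of "zar XC"] unfolding points_XC by blast
  then show "\<exists>\<U>. finite \<U> \<and> (\<forall>U\<in>\<U>. affine_open XC U) \<and> \<Union>\<U> = points XC"
    unfolding points_XC by (intro exI[of _ "{C}"]) simp
qed

text \<open>The monic equation expresses \<open>P ^ N\<close> with \<open>N \<ge> n\<close> through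
  lower powers, so by induction \<open>Q ^ n\<close> is a common denominator of all powers of
  \<open>P / Q\<close>.\<close>

lemma monic_equation_imp_fraction:
  fixes n :: nat
  assumes P: "P \<in> poly_funs 3" and Q: "Q \<in> poly_funs 3" "\<exists>x\<in>C. Q x \<noteq> 0"
    and b: "\<And>i. i < n \<Longrightarrow> b i \<in> poly_funs 3"
    and eq: "\<And>x. x \<in> C \<Longrightarrow> P x ^ n + (\<Sum>i<n. b i x * Q x ^ (n - i) * P x ^ i) = 0"
  shows "\<exists>r\<in>poly_funs 3. \<forall>x\<in>C. P x = Q x * r x"
proof (rule normal[OF P Q])
  show "(\<lambda>x. Q x ^ n) \<in> poly_funs 3" by (rule poly_funs_power[OF Q(1)])
  show "\<exists>x\<in>C. Q x ^ n \<noteq> 0" using Q(2) by auto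
  fix N show "\<exists>r\<in>poly_funs 3. \<forall>x\<in>C. Q x ^ n * P x ^ N = Q x ^ N * r x"
  proof (induction N rule: less_induct)
    case (less N)
    show ?case
    proof (cases "N < n")
      case True
      have "Q x ^ n * P x ^ N = Q x ^ N * (Q x ^ (n - N) * P x ^ N)" for x
        using True by (simp add: mult.assoc[symmetric] power_add[symmetric])
      then show ?thesis using P Q(1)
        by (intro bexI[of _ "\<lambda>x. Q x ^ (n - N) * P x ^ N"]) (auto intro!: poly_funs_intros)
    next
      case False
      have "\<exists>r. r \<in> poly_funs 3 \<and> (\<forall>x\<in>C. Q x ^ n * P x ^ (N - n + i) = Q x ^ (N - n + i) * r x)" if "i < n" for i
      proof -
        have "N - n + i < N" using that False by linarith
        from less.IH[OF this] show ?thesis by blast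
      qed
      then obtain r where r: "\<And>i. i < n \<Longrightarrow> r i \<in> poly_funs 3"
        "\<And>i x. i < n \<Longrightarrow> x \<in> C \<Longrightarrow> Q x ^ n * P x ^ (N - n + i) = Q x ^ (N - n + i) * r i x" by metis
      have "Q x ^ n * P x ^ N = Q x ^ N * (- (\<Sum>i<n. b i x * r i x))" if x: "x \<in> C" for x
      proof -
        have "P x ^ N = P x ^ (N - n) * P x ^ n" using False by (simp add: power_add[symmetric])
        also have "P x ^ n = - (\<Sum>i<n. b i x * Q x ^ (n - i) * P x ^ i)"
          using eq[OF x] by (simp only: eq_neg_iff_add_eq_0)
        finally have "Q x ^ n * P x ^ N =
            - (\<Sum>i<n. b i x * Q x ^ (n - i) * (Q x ^ n * P x ^ (N - n + i)))"
          by (simp add: sum_distrib_left power_add mult_ac)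
        also have "\<dots> = - (\<Sum>i<n. Q x ^ N * (b i x * r i x))"
        proof -
          have "b i x * Q x ^ (n - i) * (Q x ^ n * P x ^ (N - n + i)) = Q x ^ N * (b i x * r i x)"
            if "i \<in> {..<n}" for i
          proof -
            have "i < n" using that by simp
            then have "Q x ^ N = Q x ^ (n - i) * Q x ^ (N - n + i)"
              using False by (simp add: power_add[symmetric])
            then show ?thesis unfolding r(2)[OF \<open>i < n\<close> x] by (simp add: mult_ac)
          qed
          from sum.cong[OF refl this] show ?thesis by (rule arg_cong)
        qed
        finally show ?thesis by (simp add: sum_distrib_left)
      qed
      then show ?thesis using b r(1)
        by (intro bexI[of _ "\<lambda>x. - (\<Sum>i<n. b i x * r i x)"]) (auto intro!: poly_funs_intros)
    qed
  qed
qed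

lemma XC_agree:
  assumes "p \<in> poly_funs 3" "q \<in> poly_funs 3" "openin (zar XC) U" "U \<noteq> {}" "\<And>x. x \<in> U \<Longrightarrow> p x = q x" "x \<in> C"
  shows "p x = q x"
proof (rule XC.agree[of C p C q U x])
  have "openin (zar XC) C" "C \<noteq> {}" using openin_topspace[of "zar XC"] zero_in_C unfolding points_XC by auto
  then show "XC.germ C p" "XC.germ C q" using affine_poly_reg assms(1,2) by auto
qed (use assms in auto)

text \<open>Near \<open>y\<close> the coefficients are fractions with a common denominator
  \<open>q0\<close> that does not vanish at \<open>y\<close>. The element \<open>q0 g\<close> is
  integral over the coordinate ring, hence a polynomial \<open>r\<close>, and \<open>r / q0\<close>
  is regular at \<open>y\<close>.\<close>

lemma normal_variety_XC: "normal_variety XC"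
  unfolding normal_variety_def
proof (intro conjI variety_XC ballI)
  fix y assume "y \<in> points XC"
  then have y: "y \<in> C" unfolding points_XC .
  show "integrally_closed_in (function_field XC) (local_ring XC {y})"
    unfolding integrally_closed_in_def
  proof (intro ballI allI impI, elim conjE)
    fix g and n :: nat and c
    assume g: "g \<in> carrier XC.KY" and c: "\<forall>i<n. c i \<in> local_ring XC {y}"
      and eq: "g [^]\<^bsub>XC.KY\<^esub> n \<oplus>\<^bsub>XC.KY\<^esub> (\<Oplus>\<^bsub>XC.KY\<^esub>i\<in>{..<n}. c i \<otimes>\<^bsub>XC.KY\<^esub> g [^]\<^bsub>XC.KY\<^esub> i) = \<zero>\<^bsub>XC.KY\<^esub>"
    obtain V f where f: "g = XC.R V f" "XC.germ V f" using g by (rule XC.KY_cases)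
    then obtain x0 where "x0 \<in> V" by blast
    have freg: "f \<in> reg XC V" using f(2) by simp
    obtain W where W: "openin (zar XC) W" "x0 \<in> W" "W \<subseteq> V" "affine_Fr 3 W f"
      by (rule XC.regE[OF freg \<open>x0 \<in> V\<close>])
    have Wn: "W \<noteq> {}" using W(2) by blast
    have gW: "g = XC.R W f" unfolding f(1) by (rule XC.R_restrict[OF f(2) W(3,1) Wn, symmetric])
    have germW: "XC.germ W f" by (rule XC.germ_mono[OF f(2) W(3,1) Wn])
    have WC: "W \<subseteq> C" using openin_subset[OF W(1)] points_XC by auto
    obtain P Q where PQ: "P \<in> poly_funs 3" "Q \<in> poly_funs 3" "\<And>x. x \<in> W \<Longrightarrow> Q x \<noteq> 0 \<and> f x = P x / Q x"
      using W(4) unfolding affine_Fr_def by blast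
    define \<Phi> where "\<Phi> i B \<gamma> p q \<longleftrightarrow> XC.germ B \<gamma> \<and> y \<in> B \<and> c i = XC.R B \<gamma> \<and> p \<in> poly_funs 3 \<and>
      q \<in> poly_funs 3 \<and> (\<forall>x\<in>B. q x \<noteq> 0 \<and> \<gamma> x = p x / q x)" for i B \<gamma> p q
    have "\<exists>B \<gamma> p q. \<Phi> i B \<gamma> p q" if "i < n" for i
    proof -
      have "c i \<in> local_ring XC {y}" using c that by blast
      then obtain A \<gamma> where A: "XC.germ A \<gamma>" "y \<in> A" "c i = XC.R A \<gamma>" by (rule XC.local_ringE)
      have \<gamma>reg: "\<gamma> \<in> reg XC A" using A(1) by simp
      obtain B where B: "openin (zar XC) B" "y \<in> B" "B \<subseteq> A" "affine_Fr 3 B \<gamma>"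
        by (rule XC.regE[OF \<gamma>reg A(2)])
      have Bn: "B \<noteq> {}" using B(2) by blast
      have "c i = XC.R B \<gamma>" unfolding A(3) by (rule XC.R_restrict[OF A(1) B(3,1) Bn, symmetric])
      moreover have "XC.germ B \<gamma>" by (rule XC.germ_mono[OF A(1) B(3,1) Bn])
      moreover obtain p q where "p \<in> poly_funs 3" "q \<in> poly_funs 3" "\<forall>x\<in>B. q x \<noteq> 0 \<and> \<gamma> x = p x / q x"
        using B(4) unfolding affine_Fr_def by (elim exE conjE) (rule that)
      ultimately show ?thesis unfolding \<Phi>_def using B(2) by (intro exI[of _ B] exI[of _ \<gamma>] exI[of _ p] exI[of _ q]) simp
    qed
    then have "\<forall>i. \<exists>B \<gamma> p q. i < n \<longrightarrow> \<Phi> i B \<gamma> p q" by blast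
    then obtain B \<gamma> p q where \<Phi>: "\<And>i. i < n \<Longrightarrow> \<Phi> i (B i) (\<gamma> i) (p i) (q i)" by metis
    have B: "\<And>i. i < n \<Longrightarrow> XC.germ (B i) (\<gamma> i)" "\<And>i. i < n \<Longrightarrow> y \<in> B i"
      "\<And>i. i < n \<Longrightarrow> c i = XC.R (B i) (\<gamma> i)" "\<And>i. i < n \<Longrightarrow> p i \<in> poly_funs 3" "\<And>i. i < n \<Longrightarrow> q i \<in> poly_funs 3"
      "\<And>i x. i < n \<Longrightarrow> x \<in> B i \<Longrightarrow> q i x \<noteq> 0 \<and> \<gamma> i x = p i x / q i x"
      using \<Phi> unfolding \<Phi>_def by simp_all
    have eqf: "f x ^ n + (\<Sum>i<n. \<gamma> i x * f x ^ i) = 0" if "x \<in> W" "\<And>i. i < n \<Longrightarrow> x \<in> B i" for x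
      by (rule XC.integral_equation[where A = B and c = c, OF germW B(1) eq[unfolded gW] B(3) that])
    define q0 where "q0 x = (\<Prod>l<n. q l x)" for x
    \<comment> \<open>The i-th coefficient in the equation of \<open>q0 g\<close> is
      \<open>\<gamma> i\<close> times \<open>q0 ^ (n - i)\<close>; one of these factors
      \<open>q0\<close> cancels the denominator \<open>q i\<close>, which leaves a
      polynomial.\<close>
    define b where "b i x = p i x * (\<Prod>l\<in>{..<n} - {i}. q l x) * q0 x ^ (n - i - 1)" for i x
    have q0: "q0 \<in> poly_funs 3" unfolding q0_def using B(5) by (intro poly_funs_prod) auto
    have b: "b i \<in> poly_funs 3" if "i < n" for i
      unfolding b_def using B(4)[OF that] B(5) q0 by (intro poly_funs_mult poly_funs_prod poly_funs_power) auto
    have q0y: "q0 y \<noteq> 0" unfolding q0_def using B(2,6) by auto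
    define Z where "Z = W \<inter> (C \<inter> (\<Inter>i<n. B i))"
    have "openin (zar XC) C" using openin_topspace[of "zar XC"] unfolding points_XC .
    then have "openin (zar XC) (C \<inter> (\<Inter>i<n. B i))" using B(1) by (intro openin_Int_INT) auto
    moreover have "C \<inter> (\<Inter>i<n. B i) \<noteq> {}" using y B(2) by blast
    ultimately have Z: "openin (zar XC) Z" "Z \<noteq> {}"
      unfolding Z_def using XC.irr[OF W(1) _ Wn] W(1) by auto
    have ZC: "Z \<subseteq> C" using WC by (auto simp: Z_def)
    have eqC: "(q0 x * P x) ^ n + (\<Sum>i<n. b i x * Q x ^ (n - i) * (q0 x * P x) ^ i) = 0" if "x \<in> C" for x
    proof (rule XC_agree[OF _ _ Z _ that])
      show "(\<lambda>x. (q0 x * P x) ^ n + (\<Sum>i<n. b i x * Q x ^ (n - i) * (q0 x * P x) ^ i)) \<in> poly_funs 3"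
        using b q0 PQ(1,2) by (intro poly_funs_intros) auto
      show "(\<lambda>x. 0) \<in> poly_funs 3" by (rule poly_funs_const)
      fix x assume "x \<in> Z"
      then have x: "x \<in> W" "\<And>i. i < n \<Longrightarrow> x \<in> B i" by (auto simp: Z_def)
      have Qf: "Q x * f x = P x" "Q x \<noteq> 0" using PQ(3)[OF x(1)] by auto
      have trm: "b i x * Q x ^ (n - i) * (q0 x * P x) ^ i = (q0 x * Q x) ^ n * (\<gamma> i x * f x ^ i)" if i: "i < n" for i
      proof -
        define w where "w = (\<Prod>l\<in>{..<n} - {i}. q l x)"
        have q0w: "q0 x = q i x * w"
          unfolding q0_def w_def using i by (intro prod.remove) auto
        have pg: "p i x = q i x * \<gamma> i x" using B(6)[OF i x(2)[OF i]] by simp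
        have "b i x = \<gamma> i x * (q i x * w) * q0 x ^ (n - i - 1)"
          unfolding b_def w_def[symmetric] pg by (simp only: mult_ac)
        also have "\<dots> = \<gamma> i x * (q0 x * q0 x ^ (n - i - 1))"
          unfolding q0w[symmetric] by (simp only: mult.assoc)
        also have "q0 x * q0 x ^ (n - i - 1) = q0 x ^ (n - i)"
          using power_minus_mult[of "n - i" "q0 x"] i by (simp add: mult.commute)
        finally have "b i x * Q x ^ (n - i) * (q0 x * P x) ^ i =
            \<gamma> i x * ((q0 x * Q x) ^ (n - i) * (q0 x * Q x) ^ i) * f x ^ i"
          unfolding Qf(1)[symmetric] by (simp add: power_mult_distrib mult_ac)
        also have "(q0 x * Q x) ^ (n - i) * (q0 x * Q x) ^ i = (q0 x * Q x) ^ n"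
          using i by (simp add: power_add[symmetric])
        finally show ?thesis by (simp add: mult_ac)
      qed
      have "(q0 x * P x) ^ n = (q0 x * Q x) ^ n * f x ^ n"
        unfolding Qf(1)[symmetric] by (simp add: power_mult_distrib mult_ac)
      then have "(q0 x * P x) ^ n + (\<Sum>i<n. b i x * Q x ^ (n - i) * (q0 x * P x) ^ i) =
          (q0 x * Q x) ^ n * (f x ^ n + (\<Sum>i<n. \<gamma> i x * f x ^ i))"
        by (simp add: trm distrib_left sum_distrib_left)
      then show "(q0 x * P x) ^ n + (\<Sum>i<n. b i x * Q x ^ (n - i) * (q0 x * P x) ^ i) = 0"
        using eqf[OF x] by simp
    qed
    have "\<exists>x\<in>C. Q x \<noteq> 0" using PQ(3) W(2) WC by blast
    from monic_equation_imp_fraction[OF poly_funs_mult[OF q0 PQ(1)] PQ(2) this b eqC]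
    obtain r where r: "r \<in> poly_funs 3" "\<forall>x\<in>C. q0 x * P x = Q x * r x" by blast
    define U where "U = C \<inter> {x. length x = 3 \<and> q0 x \<noteq> 0}"
    have U: "openin (zar XC) U" "y \<in> U"
      unfolding U_def using affine_basic_open[OF q0] y q0y C_len by auto
    have gU: "XC.germ U (\<lambda>x. r x / q0 x)"
    proof -
      have "(\<lambda>x. r x / q0 x) \<in> reg XC U"
        by (rule XC.reg_divide[OF affine_poly_reg[OF r(1) U(1)] affine_poly_reg[OF q0 U(1)]]) (simp add: U_def)
      then show ?thesis using U by blast
    qed
    have "g = XC.R U (\<lambda>x. r x / q0 x)" unfolding gW
    proof (rule XC.R_eqI[OF germW gU W(1) Wn])
      fix x assume "x \<in> W" "x \<in> U"
      then show "f x = r x / q0 x" using PQ(3)[of x] r(2) by (auto simp: U_def field_simps)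
    qed
    then show "g \<in> local_ring XC {y}" using XC.local_ringI[OF gU U(2)] by simp
  qed
qed

end

section \<open>The quotient curve\<close>

text \<open>In the application \<open>D\<close> is the gcd of the three exponents of the surface and
  \<open>v\<close> lists the weights of the ambient weighted projective space.\<close>

locale pham_curve = pham a C
  for a :: "nat \<Rightarrow> nat" and C :: "'k::{alg_closed_field, field_char_0} list set" +
  fixes v :: "nat list" and D :: nat
  assumes v_len: "length v = 3" and v_pos: "\<And>l. l < 3 \<Longrightarrow> v ! l > 0"
    and v_coprime: "\<And>l m. l < 3 \<Longrightarrow> m < 3 \<Longrightarrow> l \<noteq> m \<Longrightarrow> gcd (v ! l) (v ! m) = 1"
    and D_pos: "D > 0" and av: "\<And>l. l < 3 \<Longrightarrow> a l * v ! l = D * v ! 0 * v ! 1 * v ! 2"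
begin

definition Feq :: "'k list \<Rightarrow> 'k" where
  "Feq = (\<lambda>w. w ! 0 ^ a 0 + w ! 1 ^ a 1 + w ! 2 ^ a 2)"

definition YY :: "('k list set, 'k) fun_space" where
  "YY = wproj_space_on v (wproj_zero_set v Feq)"

definition Cp :: "'k list set" where
  "Cp = {x \<in> C. \<exists>l<3. x ! l \<noteq> 0}"

definition sc :: "'k \<Rightarrow> 'k list \<Rightarrow> 'k list" where
  "sc t x = map2 (\<lambda>w c. t ^ w * c) v x"

lemma Feq_hom: "Feq \<in> homogeneous_funs v (D * v ! 0 * v ! 1 * v ! 2)"
proof -
  have "(\<lambda>x. x ! l ^ a l) \<in> homogeneous_funs v (D * v ! 0 * v ! 1 * v ! 2)" if "l < 3" for l
  proof -
    have "(\<lambda>x. x ! l ^ a l) \<in> homogeneous_funs v (a l * v ! l)"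
      by (rule homogeneous_funs_power[OF homogeneous_funs_coord]) (simp add: v_len that)
    then show ?thesis unfolding av[OF that] .
  qed
  from this[of 0] this[of 1] this[of 2] show ?thesis
    unfolding Feq_def by (intro homogeneous_funs_add) simp_all
qed

lemma Cp_eq: "{x \<in> punctured v. Feq x = 0} = Cp"
  unfolding Cp_def unfolding punctured_def v_len C_def Feq_def by auto

lemma Cp_sub: "Cp \<subseteq> C" and Cp_len: "x \<in> Cp \<Longrightarrow> length x = 3"
  and Cp_punctured: "x \<in> Cp \<Longrightarrow> x \<in> punctured v"
  unfolding Cp_eq[symmetric] unfolding C_def Feq_def punctured_def v_len by auto

lemma sc_nth: "length x = 3 \<Longrightarrow> l < 3 \<Longrightarrow> sc t x ! l = t ^ (v ! l) * x ! l"
  and sc_len [simp]: "length x = 3 \<Longrightarrow> length (sc t x) = 3"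
  by (simp_all add: sc_def v_len)

lemma orbit_iff: "x' \<in> orbit v x \<longleftrightarrow> (\<exists>t. t \<noteq> 0 \<and> x' = sc t x)"
  by (auto simp: orbit_def sc_def)

lemma hom_sc: "p \<in> homogeneous_funs v e \<Longrightarrow> length x = 3 \<Longrightarrow> p (sc t x) = t ^ e * p x"
  unfolding sc_def by (rule homogeneous_funs_scale) (simp_all add: v_len)

lemma sc_C: "x \<in> C \<Longrightarrow> sc t x \<in> C"
  using hom_sc[OF Feq_hom, of x t] C_len[of x] sc_len[of x t] unfolding Feq_def by (simp add: C_def)

lemma sc_Cp: "x \<in> Cp \<Longrightarrow> t \<noteq> 0 \<Longrightarrow> sc t x \<in> Cp"
  using sc_C[of x t] sc_nth[OF Cp_len] by (fastforce simp: Cp_def)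

lemma orbit_eq: "x \<in> Cp \<Longrightarrow> t \<noteq> 0 \<Longrightarrow> orbit v (sc t x) = orbit v x"
proof -
  assume x: "x \<in> Cp" "t \<noteq> 0"
  have *: "sc s (sc t x) = sc (s * t) x" for s t
    using Cp_len[OF x(1)] by (intro nth_equalityI) (auto simp: sc_nth power_mult_distrib)
  show ?thesis
  proof (intro equalityI subsetI)
    fix y assume "y \<in> orbit v (sc t x)"
    then obtain s where "s \<noteq> 0" "y = sc s (sc t x)" unfolding orbit_iff by blast
    then show "y \<in> orbit v x" unfolding orbit_iff * using x(2) by (intro exI[of _ "s * t"]) simp
  next
    fix y assume "y \<in> orbit v x"
    then obtain s where "s \<noteq> 0" "y = sc s x" unfolding orbit_iff by blast
    then show "y \<in> orbit v (sc t x)" unfolding orbit_iff * using x(2) by (intro exI[of _ "s / t"]) simp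
  qed
qed

lemma orbit_self': "x \<in> Cp \<Longrightarrow> x \<in> orbit v x"
  by (rule orbit_self) (simp add: v_len Cp_len)

lemma orbit_Cp: "x \<in> Cp \<Longrightarrow> x' \<in> orbit v x \<Longrightarrow> x' \<in> Cp"
  using sc_Cp by (auto simp: orbit_iff)

lemma orbit_eqD: "x \<in> Cp \<Longrightarrow> x' \<in> Cp \<Longrightarrow> orbit v x = orbit v x' \<Longrightarrow> \<exists>t. t \<noteq> 0 \<and> x = sc t x'"
  using orbit_self' orbit_iff by blast

lemma zero_set_eq: "wproj_zero_set v Feq = orbit v ` Cp"
  unfolding wproj_zero_set_def Cp_eq ..

lemma points_YY: "points YY = orbit v ` Cp"
  unfolding YY_def wproj_space_on_def zero_set_eq using Cp_punctured by auto

lemma YY_cases: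
  assumes "z \<in> points YY" obtains x where "x \<in> Cp" "z = orbit v x"
  using assms unfolding points_YY by blast

definition YD :: "('k list \<Rightarrow> 'k) \<Rightarrow> 'k list set set" where
  "YD q = orbit v ` {x \<in> Cp. q x \<noteq> 0}"

lemma YD_iff:
  assumes "q \<in> homogeneous_funs v e" "x \<in> Cp" shows "orbit v x \<in> YD q \<longleftrightarrow> q x \<noteq> 0"
proof
  assume "orbit v x \<in> YD q"
  then obtain x' where x': "x' \<in> Cp" "q x' \<noteq> 0" "orbit v x = orbit v x'" unfolding YD_def by blast
  obtain t where "t \<noteq> 0" "x = sc t x'" using orbit_eqD[OF assms(2) x'(1,3)] by blast
  then show "q x \<noteq> 0" using hom_sc[OF assms(1) Cp_len[OF x'(1)]] x'(2) by simp
qed (use assms in \<open>auto simp: YD_def\<close>)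

lemma YD_eq: "q \<in> homogeneous_funs v e \<Longrightarrow>
    YD q = wproj_zero_set v Feq \<inter> orbit v ` {x \<in> punctured v. q x \<noteq> 0}"
proof (intro equalityI subsetI)
  fix z assume q: "q \<in> homogeneous_funs v e"
    and "z \<in> wproj_zero_set v Feq \<inter> orbit v ` {x \<in> punctured v. q x \<noteq> 0}"
  then obtain x where x: "x \<in> Cp" "z = orbit v x" "z \<in> orbit v ` {x \<in> punctured v. q x \<noteq> 0}"
    unfolding zero_set_eq by blast
  then have "q x \<noteq> 0" using weighted_basic_iff[OF q Cp_punctured[OF x(1)]] by simp
  then show "z \<in> YD q" using x by (auto simp: YD_def)
next
  fix z assume "z \<in> YD q"
  then show "z \<in> wproj_zero_set v Feq \<inter> orbit v ` {x \<in> punctured v. q x \<noteq> 0}"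
    unfolding zero_set_eq YD_def using Cp_punctured by auto
qed

lemma YD_open: "q \<in> homogeneous_funs v e \<Longrightarrow> openin (zar YY) (YD q)"
  unfolding YD_eq YY_def wproj_space_on_def
  by (simp add: openin_subtopology_Int2[OF openin_weighted_basic])

lemma YY_basis:
  assumes "openin (zar YY) U" "x \<in> Cp" "orbit v x \<in> U"
  obtains q e where "q \<in> homogeneous_funs v e" "q x \<noteq> 0" "YD q \<subseteq> U"
proof -
  obtain T where T: "openin (weighted_zariski v) T" "U = T \<inter> wproj_zero_set v Feq"
    using assms(1) unfolding YY_def wproj_space_on_def by (auto simp: openin_subtopology)
  obtain q e where q: "q \<in> homogeneous_funs v e" "q x \<noteq> 0"
    "orbit v ` {x \<in> punctured v. q x \<noteq> 0} \<subseteq> T"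
    using weighted_basis[OF T(1) Cp_punctured[OF assms(2)]] assms(3) T(2) by blast
  then show ?thesis using T(2) YD_eq[OF q(1)] by (intro that[OF q(1,2)]) auto
qed

lemma hom_poly: "p \<in> homogeneous_funs v e \<Longrightarrow> p \<in> poly_funs 3"
  using homogeneous_funs_subset[of v e] v_len by auto

lemma coord_not_zero: "l < 3 \<Longrightarrow> \<exists>x\<in>C. x ! l \<noteq> 0"
proof -
  assume "l < 3"
  then consider "l = 0" | "l = 1" | "l = 2" by linarith
  then have "\<exists>j k. {j, l, k} = {0, 1, 2}"
  proof cases
    case 1 then show ?thesis by (intro exI[of _ 1] exI[of _ 2]) auto
  next
    case 2 then show ?thesis by (intro exI[of _ 0] exI[of _ 2]) auto
  next
    case 3 then show ?thesis by (intro exI[of _ 0] exI[of _ 1]) auto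
  qed
  then obtain j k where "{j, l, k} = {0, 1, 2}" by blast
  then interpret A: pham_axes a C j l k by unfold_locales
  obtain x where "A.pt x 1 1 \<in> C" using A.exists_above by blast
  then show ?thesis by (intro bexI[of _ "A.pt x 1 1"]) simp_all
qed

text \<open>A further factor \<open>x_0\<close> in the product keeps the common nonzero point away
  from the origin.\<close>

lemma domain_Cp:
  assumes "p \<in> poly_funs 3" "q \<in> poly_funs 3" "\<exists>x\<in>C. p x \<noteq> 0" "\<exists>x\<in>C. q x \<noteq> 0"
  shows "\<exists>x\<in>Cp. p x \<noteq> 0 \<and> q x \<noteq> 0"
proof -
  obtain z where "z \<in> C" "p z * (q z * z ! 0) \<noteq> 0"
    using domain[OF assms(1) poly_funs_mult[OF assms(2) poly_funs_coord[of 0]] assms(3)]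
      domain[OF assms(2) poly_funs_coord[of 0] assms(4) coord_not_zero[of 0]] by auto
  then show ?thesis by (intro bexI[of _ z]) (auto simp: Cp_def intro!: exI[of _ "0 :: nat"])
qed

lemma irr_space_YY: "irr_space YY (weighted_Fr v)"
proof (intro irr_space.intro irr_space_axioms.intro)
  show "frac_space YY (weighted_Fr v)" unfolding YY_def by (rule frac_space_wproj)
  obtain x where "x \<in> C" "x ! 0 \<noteq> 0" using coord_not_zero[of 0] by auto
  then show "points YY \<noteq> {}" unfolding points_YY by (auto simp: Cp_def intro!: exI[of _ "0 :: nat"])
  fix U V assume U: "openin (zar YY) U" "U \<noteq> {}" and V: "openin (zar YY) V" "V \<noteq> {}"
  obtain z where z: "z \<in> U" using U by blast
  then have "z \<in> points YY" using openin_subset[OF U(1)] by blast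
  then obtain x where x: "x \<in> Cp" "z = orbit v x" by (rule YY_cases)
  obtain p e where p: "p \<in> homogeneous_funs v e" "p x \<noteq> 0" "YD p \<subseteq> U"
    using YY_basis[OF U(1) x(1)] z x(2) by blast
  obtain z' where z': "z' \<in> V" using V by blast
  then have "z' \<in> points YY" using openin_subset[OF V(1)] by blast
  then obtain x' where x': "x' \<in> Cp" "z' = orbit v x'" by (rule YY_cases)
  obtain q e' where q: "q \<in> homogeneous_funs v e'" "q x' \<noteq> 0" "YD q \<subseteq> V"
    using YY_basis[OF V(1) x'(1)] z' x'(2) by blast
  obtain y where "y \<in> Cp" "p y \<noteq> 0" "q y \<noteq> 0"
    using domain_Cp[OF hom_poly[OF p(1)] hom_poly[OF q(1)]] x(1) x'(1) p(2) q(2) Cp_sub by blast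
  then have "orbit v y \<in> U \<inter> V" using p(3) q(3) by (auto simp: YD_def)
  then show "U \<inter> V \<noteq> {}" by blast
qed

sublocale YY: irr_space YY "weighted_Fr v"
  by (rule irr_space_YY)

lemma closedin_zero_set: "closedin (weighted_zariski v) (wproj_zero_set v Feq)"
proof -
  have "orbit v ` punctured v - wproj_zero_set v Feq = orbit v ` {x \<in> punctured v. Feq x \<noteq> 0}"
  proof (intro equalityI subsetI)
    fix z assume "z \<in> orbit v ` {x \<in> punctured v. Feq x \<noteq> 0}"
    then obtain x where x: "x \<in> punctured v" "Feq x \<noteq> 0" "z = orbit v x" by blast
    have "z \<notin> orbit v ` Cp"
    proof
      assume "z \<in> orbit v ` Cp"
      then obtain y where y: "y \<in> Cp" "z = orbit v y" by blast
      then have "x \<in> orbit v y" using x orbit_self[of x v] punctured_length by auto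
      then have "x \<in> Cp" using orbit_Cp[OF y(1)] by blast
      then show False using x(2) Cp_eq by blast
    qed
    then show "z \<in> orbit v ` punctured v - wproj_zero_set v Feq" using x unfolding zero_set_eq by blast
  qed (use Cp_eq zero_set_eq in blast)
  moreover have "wproj_zero_set v Feq \<subseteq> orbit v ` punctured v" unfolding zero_set_eq using Cp_punctured by blast
  ultimately show ?thesis
    using openin_weighted_basic[OF Feq_hom] by (simp add: closedin_def)
qed

definition rep :: "'k list set \<Rightarrow> 'k list" where "rep z = (SOME x. x \<in> z)"

lemma rep_orbit: "x \<in> Cp \<Longrightarrow> rep (orbit v x) \<in> orbit v x"
  using someI[of "\<lambda>y. y \<in> orbit v x" x] orbit_self'[of x] unfolding rep_def by blast

lemma rep_sc: "x \<in> Cp \<Longrightarrow> \<exists>t. t \<noteq> 0 \<and> rep (orbit v x) = sc t x"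
  using rep_orbit orbit_iff by blast

definition lmono :: "(nat \<Rightarrow> int) \<Rightarrow> 'k list \<Rightarrow> 'k" where
  "lmono c x = (\<Prod>l<3. x ! l powi c l)"

abbreviation weight0 :: "(nat \<Rightarrow> int) \<Rightarrow> bool" where
  "weight0 c \<equiv> (\<Sum>l<3. c l * int (v ! l)) = 0"

text \<open>Meaningful when \<open>weight0 c\<close> holds: then the Laurent monomial is constant on
  orbits and the choice made by \<open>rep\<close> does not matter.\<close>

definition wm :: "(nat \<Rightarrow> int) \<Rightarrow> 'k list set \<Rightarrow> 'k" where
  "wm c z = lmono c (rep z)"

lemma lmono_sc: "length x = 3 \<Longrightarrow> t \<noteq> 0 \<Longrightarrow> lmono c (sc t x) = t powi (\<Sum>l<3. c l * int (v ! l)) * lmono c x"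
  unfolding lmono_def
  by (simp add: sc_nth power_int_mult_distrib prod.distrib lessThan_nat_numeral lessThan_Suc
      power_int_add power_int_power mult.commute)

lemma wm_orbit: "x \<in> Cp \<Longrightarrow> weight0 c \<Longrightarrow> wm c (orbit v x) = lmono c x"
  using rep_sc[of x] lmono_sc[OF Cp_len] unfolding wm_def by fastforce

lemma lmono_mult: "(\<And>l. l < 3 \<Longrightarrow> x ! l \<noteq> 0 \<or> (c l \<ge> 0 \<and> c' l \<ge> 0)) \<Longrightarrow>
    lmono (\<lambda>l. c l + c' l) x = lmono c x * lmono c' x"
  unfolding lmono_def prod.distrib[symmetric]
proof (intro prod.cong refl)
  fix l assume "l \<in> {..<3 :: nat}" and *: "\<And>l. l < 3 \<Longrightarrow> x ! l \<noteq> 0 \<or> (c l \<ge> 0 \<and> c' l \<ge> 0)"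
  show "x ! l powi (c l + c' l) = x ! l powi c l * x ! l powi c' l"
  proof (cases "x ! l = 0")
    case True
    then have "c l \<ge> 0" "c' l \<ge> 0" using *[of l] \<open>l \<in> {..<3}\<close> by auto
    then show ?thesis by (simp add: power_int_def nat_add_distrib power_add)
  qed (simp add: power_int_add)
qed

lemma lmono_nonzero: "(\<And>l. l < 3 \<Longrightarrow> x ! l \<noteq> 0 \<or> c l = 0) \<Longrightarrow> lmono c x \<noteq> 0"
  unfolding lmono_def by (subst prod_zero_iff) auto

text \<open>Positive exponents form the numerator and negative ones the denominator; weight zero
  gives both monomials the same degree.\<close>

lemma wm_reg:
  assumes "weight0 c" "openin (zar YY) U"
    and nz: "\<And>x l. x \<in> Cp \<Longrightarrow> orbit v x \<in> U \<Longrightarrow> l < 3 \<Longrightarrow> c l < 0 \<Longrightarrow> x ! l \<noteq> 0"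
  shows "wm c \<in> reg YY U"
proof (rule YY.reg_Fr[OF assms(2)])
  define p where "p = (\<lambda>x :: 'k list. monomial_fun 3 (\<lambda>l. nat (c l)) x)"
  define q where "q = (\<lambda>x :: 'k list. monomial_fun 3 (\<lambda>l. nat (- c l)) x)"
  have deg: "weighted_degree v (\<lambda>l. nat (c l)) = weighted_degree v (\<lambda>l. nat (- c l))"
  proof -
    have "int (weighted_degree v (\<lambda>l. nat (c l))) - int (weighted_degree v (\<lambda>l. nat (- c l))) =
      (\<Sum>l<3. int (v ! l) * int (nat (c l)) - int (v ! l) * int (nat (- c l)))"
      by (simp add: weighted_degree_def v_len sum_subtractf)
    also have "\<dots> = (\<Sum>l<3. c l * int (v ! l))"
      by (intro sum.cong refl) (auto simp: mult.commute)
    finally show ?thesis using assms(1) by simp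
  qed
  show "weighted_Fr v U (wm c)"
  proof (rule weighted_FrI)
    show "p \<in> homogeneous_funs v (weighted_degree v (\<lambda>l. nat (c l)))"
      "q \<in> homogeneous_funs v (weighted_degree v (\<lambda>l. nat (c l)))"
      using homogeneous_funs_monomial[of v "\<lambda>l. nat (c l)" _ "1 :: 'k"]
        homogeneous_funs_monomial[of v "\<lambda>l. nat (- c l)" _ "1 :: 'k"]
      by (simp_all add: p_def q_def v_len deg)
    fix z x assume z: "z \<in> U" and "x \<in> z"
    then have "z \<in> points YY" using openin_subset[OF assms(2)] by blast
    then obtain y where y: "y \<in> Cp" "z = orbit v y" by (rule YY_cases)
    then have x: "x \<in> Cp" "z = orbit v x"
      using orbit_Cp[OF y(1)] \<open>x \<in> z\<close> orbit_eq[OF y(1)] by (auto simp: orbit_iff)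
    have "q x \<noteq> 0"
      unfolding q_def monomial_fun_def using nz[OF x(1)] z x(2) by (subst prod_zero_iff) auto
    moreover have "lmono c x = p x / q x"
      unfolding lmono_def p_def q_def monomial_fun_def prod_dividef[symmetric]
      by (intro prod.cong refl) (auto simp: power_int_def field_simps)
    ultimately show "q x \<noteq> 0 \<and> wm c z = p x / q x" using wm_orbit[OF x(1) assms(1)] x(2) by simp
  qed
qed

end

subsection \<open>Charts\<close>

text \<open>Where \<open>x_j\<close> and \<open>x_k\<close> are nonzero, the Bezout coefficients of
  their coprime weights yield a monomial \<open>x_j^al x_k^be\<close> of weight one, which
  normalises the torus away.\<close>

locale pham_chart = pham_curve a C v D + pham_axes a C i j k
  for a :: "nat \<Rightarrow> nat" and C :: "'k::{alg_closed_field, field_char_0} list set"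
    and v :: "nat list" and D i j k :: nat +
  fixes al be :: int
  assumes bez: "al * int (v ! j) + be * int (v ! k) = 1"
begin

lemma lessThan_3: "{..<3 :: nat} = {i, j, k}"
  unfolding axes by auto

lemma sum3: "(\<Sum>l<3. f l) = f i + (f j + f k :: 'b::comm_monoid_add)"
  and prod3: "(\<Prod>l<3. g l) = g i * (g j * g k :: 'c::comm_monoid_mult)"
  unfolding lessThan_3 using axes_neq by simp_all

text \<open>Exponents of \<open>z\<close>, the weight-zero function obtained by dividing
  \<open>x_i\<close> by the \<open>v_i\<close>-th power of the monomial of weight one.\<close>

definition cz :: "nat \<Rightarrow> int" where
  "cz l = (if l = i then 1 else if l = j then - al * int (v ! i) else - be * int (v ! i))"

text \<open>Exponents of \<open>t = x_j^(v_k) / x_k^(v_j)\<close>, a generator of the weight-zero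
  Laurent monomials in \<open>x_j\<close> and \<open>x_k\<close>.\<close>

definition ct :: "nat \<Rightarrow> int" where
  "ct l = (if l = i then 0 else if l = j then int (v ! k) else - int (v ! j))"

lemma cz_ct [simp]: "cz i = 1" "cz j = - al * int (v ! i)" "cz k = - be * int (v ! i)"
  "ct i = 0" "ct j = int (v ! k)" "ct k = - int (v ! j)"
  using axes_neq by (simp_all add: cz_def ct_def)

lemma weight0_cz: "weight0 cz"
proof -
  have "(\<Sum>l<3. cz l * int (v ! l)) = int (v ! i) * (1 - (al * int (v ! j) + be * int (v ! k)))"
    by (simp add: sum3 algebra_simps)
  then show ?thesis by (simp add: bez)
qed

lemma weight0_ct: "weight0 ct"
  by (simp add: sum3)

definition U :: "'k list set set" where "U = YD (\<lambda>x. x ! j * x ! k)"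

lemma U_hom: "(\<lambda>x. x ! j * x ! k) \<in> homogeneous_funs v (v ! j + v ! k)"
  using axes_less by (intro homogeneous_funs_mult homogeneous_funs_coord) (simp_all add: v_len)

lemma U_iff: "x \<in> Cp \<Longrightarrow> orbit v x \<in> U \<longleftrightarrow> x ! j \<noteq> 0 \<and> x ! k \<noteq> 0"
  unfolding U_def by (simp add: YD_iff[OF U_hom])

lemma U_open: "openin (zar YY) U"
  unfolding U_def by (rule YD_open[OF U_hom])

lemma U_cases:
  assumes "y \<in> U" obtains x where "x \<in> Cp" "y = orbit v x" "x ! j \<noteq> 0" "x ! k \<noteq> 0"
  using assms unfolding U_def YD_def by auto

text \<open>The third entry turns the condition \<open>t \<noteq> 0\<close> into the equation
  \<open>s ! 1 * s ! 2 = 1\<close>, so that the image is closed.\<close>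

definition kap :: "'k list set \<Rightarrow> 'k list" where
  "kap y = [wm cz y, wm ct y, inverse (wm ct y)]"

text \<open>The representative of an orbit on which the monomial \<open>x_j^al x_k^be\<close> equals
  1, written through the chart coordinates \<open>z\<close> and \<open>t\<close>.\<close>

definition om :: "'k \<Rightarrow> 'k \<Rightarrow> 'k list" where
  "om z t = pt z (t powi be) (t powi (- al))"

text \<open>Integral powers of \<open>s ! 1\<close> written as polynomials, \<open>s ! 2\<close>
  being its inverse on \<open>S\<close>.\<close>

definition pw :: "int \<Rightarrow> 'k list \<Rightarrow> 'k" where
  "pw e s = (if e \<ge> 0 then s ! 1 ^ nat e else s ! 2 ^ nat (- e))"

definition omS :: "'k list \<Rightarrow> 'k list" where
  "omS s = pt (s ! 0) (pw be s) (pw (- al) s)"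

definition S :: "'k list set" where
  "S = {s. length s = 3 \<and> s ! 1 * s ! 2 = 1 \<and> omS s \<in> C}"

lemma lmono_cz: "lmono cz x = x ! i * (x ! j powi (- al * int (v ! i)) * x ! k powi (- be * int (v ! i)))"
  and lmono_ct: "lmono ct x = x ! j powi int (v ! k) * x ! k powi (- int (v ! j))"
  by (simp_all add: lmono_def prod3)

lemma powi_power: "(x powi n :: 'k) ^ m = x powi (n * int m)"
  by (metis power_int_mult power_int_of_nat)

lemma pt_length3: "length x = 3 \<Longrightarrow> x ! i = z \<Longrightarrow> x ! j = u \<Longrightarrow> x ! k = w \<Longrightarrow> x = pt z u w"
  using pt_eqI by blast

text \<open>Scaling by the inverse of the weight-one monomial makes that monomial 1; the exponents
  match by \<open>1 - al v_j = be v_k\<close> and \<open>1 - be v_k = al v_j\<close>.\<close>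

lemma normalise:
  assumes x: "length x = 3" "x ! j \<noteq> 0" "x ! k \<noteq> 0"
  shows "sc (x ! j powi (- al) * x ! k powi (- be)) x = om (lmono cz x) (lmono ct x)"
proof -
  define m where "m = x ! j powi (- al) * x ! k powi (- be)"
  have m: "m ^ n = x ! j powi (- al * int n) * x ! k powi (- be * int n)" for n
    by (simp add: m_def power_mult_distrib powi_power)
  have ct: "lmono ct x powi e = x ! j powi (int (v ! k) * e) * x ! k powi (- int (v ! j) * e)" for e
    unfolding lmono_ct by (simp only: power_int_mult_distrib power_int_mult)
  have add: "b powi p * b = b powi (p + 1)" if "b \<noteq> 0" for b :: 'k and p
    using that by (simp add: power_int_add)
  have ej: "- al * int (v ! j) + 1 = int (v ! k) * be" and ek: "- be * int (v ! k) + 1 = - int (v ! j) * - al"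
    using bez by (simp_all add: algebra_simps)
  have "sc m x ! i = lmono cz x"
    using x axes_less by (simp add: sc_nth m lmono_cz)
  moreover have "sc m x ! j = lmono ct x powi be"
  proof -
    have "sc m x ! j = (x ! j powi (- al * int (v ! j)) * x ! j) * x ! k powi (- be * int (v ! j))"
      using x axes_less by (simp add: sc_nth m)
    also have "\<dots> = lmono ct x powi be"
      unfolding add[OF x(2)] ej ct by (simp add: mult.commute)
    finally show ?thesis .
  qed
  moreover have "sc m x ! k = lmono ct x powi (- al)"
  proof -
    have "sc m x ! k = x ! j powi (- al * int (v ! k)) * (x ! k powi (- be * int (v ! k)) * x ! k)"
      using x axes_less by (simp add: sc_nth m)
    also have "\<dots> = lmono ct x powi (- al)"
      unfolding add[OF x(3)] ek ct by (simp add: mult.commute)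
    finally show ?thesis .
  qed
  ultimately show ?thesis unfolding m_def[symmetric] om_def using x(1) by (intro pt_length3) auto
qed

lemma pw_eq: "s ! 1 * s ! 2 = 1 \<Longrightarrow> pw e s = s ! 1 powi e"
proof -
  assume "s ! 1 * s ! 2 = 1"
  then have "s ! 2 = inverse (s ! 1)" by (metis inverse_unique)
  then show ?thesis by (simp add: pw_def power_int_def)
qed

lemma omS_om: "s ! 1 * s ! 2 = 1 \<Longrightarrow> omS s = om (s ! 0) (s ! 1)"
  by (simp add: omS_def om_def pw_eq)

lemma om_coords: "om z t ! i = z" "om z t ! j = t powi be" "om z t ! k = t powi (- al)" "length (om z t) = 3"
  by (simp_all add: om_def)

lemma lmono_om:
  assumes "t \<noteq> 0" shows "lmono cz (om z t) = z" "lmono ct (om z t) = t"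
proof -
  have "lmono cz (om z t) = z * (t powi (be * (- al * int (v ! i))) * t powi (- al * (- be * int (v ! i))))"
    unfolding lmono_cz om_coords by (simp only: power_int_mult)
  also have "t powi (be * (- al * int (v ! i))) * t powi (- al * (- be * int (v ! i))) = t powi 0"
    using assms by (simp add: power_int_add[symmetric])
  finally show "lmono cz (om z t) = z" by simp
  have "lmono ct (om z t) = t powi (be * int (v ! k)) * t powi (- al * - int (v ! j))"
    unfolding lmono_ct om_coords by (simp only: power_int_mult)
  also have "\<dots> = t powi (be * int (v ! k) + - al * - int (v ! j))"
    using assms by (intro power_int_add[symmetric]) simp
  also have "be * int (v ! k) + - al * - int (v ! j) = 1" using bez by simp
  finally show "lmono ct (om z t) = t" by simp
qed

lemma kap_orbit: "x \<in> Cp \<Longrightarrow> kap (orbit v x) = [lmono cz x, lmono ct x, inverse (lmono ct x)]"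
  by (simp add: kap_def wm_orbit weight0_cz weight0_ct)

lemma lmono_ct_nz: "x ! j \<noteq> 0 \<Longrightarrow> x ! k \<noteq> 0 \<Longrightarrow> lmono ct x \<noteq> 0"
  by (simp add: lmono_ct)

lemma omS_kap:
  assumes "x \<in> Cp" "x ! j \<noteq> 0" "x ! k \<noteq> 0"
  obtains m where "m \<noteq> 0" "omS (kap (orbit v x)) = sc m x"
proof (rule that)
  show "x ! j powi (- al) * x ! k powi (- be) \<noteq> 0" using assms by simp
  show "omS (kap (orbit v x)) = sc (x ! j powi (- al) * x ! k powi (- be)) x"
    unfolding normalise[OF Cp_len[OF assms(1)] assms(2,3)] kap_orbit[OF assms(1)]
    using lmono_ct_nz[OF assms(2,3)] by (subst omS_om) simp_all
qed

lemma kap_S: "y \<in> U \<Longrightarrow> kap y \<in> S"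
proof -
  assume "y \<in> U"
  then obtain x where x: "x \<in> Cp" "y = orbit v x" "x ! j \<noteq> 0" "x ! k \<noteq> 0" by (rule U_cases)
  obtain m where m: "m \<noteq> 0" "omS (kap (orbit v x)) = sc m x" by (rule omS_kap[OF x(1,3,4)])
  have "sc m x \<in> C" using sc_Cp[OF x(1) m(1)] Cp_sub by blast
  then show ?thesis unfolding S_def x(2) using m(2) lmono_ct_nz[OF x(3,4)]
    by (simp add: kap_orbit[OF x(1)])
qed

lemma orbit_omS_kap: "y \<in> U \<Longrightarrow> orbit v (omS (kap y)) = y"
proof -
  assume "y \<in> U"
  then obtain x where x: "x \<in> Cp" "y = orbit v x" "x ! j \<noteq> 0" "x ! k \<noteq> 0" by (rule U_cases)
  obtain m where m: "m \<noteq> 0" "omS (kap (orbit v x)) = sc m x" by (rule omS_kap[OF x(1,3,4)])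
  show ?thesis unfolding x(2) m(2) by (rule orbit_eq[OF x(1) m(1)])
qed

lemma S_props:
  assumes "s \<in> S"
  shows "omS s \<in> Cp" "omS s ! j \<noteq> 0" "omS s ! k \<noteq> 0" "orbit v (omS s) \<in> U" "kap (orbit v (omS s)) = s"
    "s ! 1 \<noteq> 0" "length s = 3" "omS s = om (s ! 0) (s ! 1)"
proof -
  have s: "length s = 3" "s ! 1 * s ! 2 = 1" "omS s \<in> C" using assms by (auto simp: S_def)
  have nz: "s ! 1 \<noteq> 0" using s(2) by auto
  have e: "omS s = om (s ! 0) (s ! 1)" by (rule omS_om[OF s(2)])
  have jk: "omS s ! j \<noteq> 0" "omS s ! k \<noteq> 0" unfolding e om_coords using nz by simp_all
  have cp: "omS s \<in> Cp" unfolding Cp_def using s(3) jk axes_less by blast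
  have "s ! 2 = inverse (s ! 1)" using s(2) by (metis inverse_unique)
  then have "s = [s ! 0, s ! 1, inverse (s ! 1)]"
    using s(1) by (intro nth_equalityI) (auto simp: less_Suc_eq numeral_3_eq_3 numeral_2_eq_2)
  then have "kap (orbit v (omS s)) = s"
    unfolding kap_orbit[OF cp] unfolding e lmono_om[OF nz] by simp
  then show "omS s \<in> Cp" "omS s ! j \<noteq> 0" "omS s ! k \<noteq> 0" "orbit v (omS s) \<in> U" "kap (orbit v (omS s)) = s"
    "s ! 1 \<noteq> 0" "length s = 3" "omS s = om (s ! 0) (s ! 1)"
    using cp jk U_iff[OF cp] s nz e by auto
qed

lemma pw_poly: "pw e \<in> poly_funs 3"
  unfolding pw_def by (cases "e \<ge> 0") (auto intro!: poly_funs_intros)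

lemma pt_poly_compose:
  assumes "p \<in> poly_funs 3" "f \<in> poly_funs n" "g \<in> poly_funs n" "h' \<in> poly_funs n"
  shows "(\<lambda>s. p (pt (f s) (g s) (h' s))) \<in> poly_funs n"
proof -
  have "(\<lambda>s. p (map (\<lambda>l. (if l = i then f s else if l = j then g s else h' s)) [0..<3])) \<in> poly_funs n"
  proof (rule poly_funs_compose[OF assms(1)])
    fix l :: nat
    show "(\<lambda>s. if l = i then f s else if l = j then g s else h' s) \<in> poly_funs n"
      using assms(2-4) by (cases "l = i"; cases "l = j") simp_all
  qed
  then show ?thesis by (simp add: pt_def)
qed

lemma omS_poly: "p \<in> poly_funs 3 \<Longrightarrow> (\<lambda>s. p (omS s)) \<in> poly_funs 3"
  unfolding omS_def by (rule pt_poly_compose) (auto intro!: pw_poly poly_funs_intros)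

lemma closedin_S: "closedin (zariski 3) S"
proof -
  have Fp: "Feq \<in> poly_funs 3" using hom_poly[OF Feq_hom] .
  have 1: "(\<lambda>s :: 'k list. s ! 1 * s ! 2 - 1) \<in> poly_funs 3" by (intro poly_funs_intros) auto
  have "{x. length x = 3} - S = {x. length x = 3 \<and> x ! 1 * x ! 2 - 1 \<noteq> 0} \<union> {x. length x = 3 \<and> Feq (omS x) \<noteq> 0}"
  proof -
    have "y \<in> C \<longleftrightarrow> Feq y = 0" if "length y = 3" for y using that unfolding C_def Feq_def by simp
    then have "omS s \<in> C \<longleftrightarrow> Feq (omS s) = 0" for s by (simp add: omS_def)
    then show ?thesis by (auto simp: S_def)
  qed
  then have "openin (zariski 3) ({x. length x = 3} - S)"
    using openin_zariski_basic[OF 1] openin_zariski_basic[OF omS_poly[OF Fp]] by (simp add: openin_Un)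
  then show ?thesis by (auto simp: closedin_def S_def)
qed

lemma kap_reg: "l < 3 \<Longrightarrow> (\<lambda>y. kap y ! l) \<in> reg YY U"
proof -
  assume l: "l < 3"
  have z: "wm cz \<in> reg YY U"
  proof (rule wm_reg[OF weight0_cz U_open])
    fix x l assume "x \<in> Cp" "orbit v x \<in> U" "l < 3" "cz l < 0"
    then show "x ! l \<noteq> 0" using U_iff[of x] axes_cases[of l] by auto
  qed
  have t: "wm ct \<in> reg YY U"
  proof (rule wm_reg[OF weight0_ct U_open])
    fix x l assume "x \<in> Cp" "orbit v x \<in> U" "l < 3" "ct l < 0"
    then show "x ! l \<noteq> 0" using U_iff[of x] axes_cases[of l] by auto
  qed
  have "wm ct y \<noteq> 0" if "y \<in> U" for y
  proof -
    obtain x where x: "x \<in> Cp" "y = orbit v x" "x ! j \<noteq> 0" "x ! k \<noteq> 0" using \<open>y \<in> U\<close> by (rule U_cases)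
    show ?thesis unfolding x(2) wm_orbit[OF x(1) weight0_ct] by (rule lmono_ct_nz[OF x(3,4)])
  qed
  then have "(\<lambda>y. inverse (wm ct y)) \<in> reg YY U" by (rule YY.reg_inverse[OF t])
  moreover have "l = 0 \<or> l = 1 \<or> l = 2" using l by linarith
  ultimately show ?thesis using z t by (auto simp: kap_def)
qed

lemma kap_poly_reg: "p \<in> poly_funs 3 \<Longrightarrow> (\<lambda>y. p (kap y)) \<in> reg YY U"
  by (rule YY.reg_poly_funs[OF _ U_open kap_reg])

lemma morphism_kap: "morphism (open_subspace YY U) (affine_space_on 3 S) kap"
  using kap_S S_props(7) by (intro YY.morphism_into_affine[OF U_open] kap_reg) auto

lemma points_U: "points (open_subspace YY U) = U"
  using openin_subset[OF U_open] by (auto simp: open_subspace_def)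

lemma S_points: "points (affine_space_on 3 S) = S"
  using S_props(7) by auto

lemma morphism_omS: "morphism (affine_space_on 3 S) (open_subspace YY U) (\<lambda>s. orbit v (omS s))"
proof -
  interpret A: frac_space "affine_space_on 3 S" "affine_Fr 3" by (rule frac_space_affine)
  have openU: "openin (zar (open_subspace YY U)) W \<longleftrightarrow> openin (zar YY) W \<and> W \<subseteq> U" for W
    by (simp add: open_subspace_def openin_open_subtopology[OF U_open])
  have pre: "openin (zar (affine_space_on 3 S)) {s \<in> S. orbit v (omS s) \<in> W}" if W: "openin (zar YY) W" for W
  proof (subst openin_subopen, intro ballI)
    fix s assume "s \<in> {s \<in> S. orbit v (omS s) \<in> W}"
    then have s: "s \<in> S" "orbit v (omS s) \<in> W" by auto
    obtain q e where q: "q \<in> homogeneous_funs v e" "q (omS s) \<noteq> 0" "YD q \<subseteq> W"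
      by (rule YY_basis[OF W S_props(1)[OF s(1)] s(2)])
    have "openin (zar (affine_space_on 3 S)) (S \<inter> {x. length x = 3 \<and> q (omS x) \<noteq> 0})"
      by (rule affine_basic_open[OF omS_poly[OF hom_poly[OF q(1)]]])
    moreover have "s \<in> S \<inter> {x. length x = 3 \<and> q (omS x) \<noteq> 0}" using s S_props(7) q(2) by auto
    moreover have "S \<inter> {x. length x = 3 \<and> q (omS x) \<noteq> 0} \<subseteq> {s \<in> S. orbit v (omS s) \<in> W}"
      using q(3) S_props(1) by (auto simp: YD_def)
    ultimately show "\<exists>T. openin (zar (affine_space_on 3 S)) T \<and> s \<in> T \<and> T \<subseteq> {s \<in> S. orbit v (omS s) \<in> W}"
      by blast
  qed
  show ?thesis unfolding morphism_def continuous_map_def S_points points_U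
  proof (intro conjI allI impI, goal_cases)
    case 1 show ?case using S_props(4) by auto
  next
    case (2 W) then show ?case using pre unfolding openU by blast
  next
    case (3 V f)
    then have V: "openin (zar YY) V" "V \<subseteq> U" and f: "f \<in> reg YY V"
      unfolding openU by (auto simp: open_subspace_def)
    show ?case
    proof (rule A.reg_glue)
      fix s assume s: "s \<in> {s \<in> S. orbit v (omS s) \<in> V}"
      then have sV: "orbit v (omS s) \<in> V" by simp
      obtain W where W: "openin (zar YY) W" "orbit v (omS s) \<in> W" "W \<subseteq> V" "weighted_Fr v W f"
        by (rule YY.regE[OF f sV])
      obtain e p q where pq: "p \<in> homogeneous_funs v e" "q \<in> homogeneous_funs v e"
        "\<And>z x. z \<in> W \<Longrightarrow> x \<in> z \<Longrightarrow> q x \<noteq> 0 \<and> f z = p x / q x"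
        using W(4) unfolding weighted_Fr_def by blast
      define T where "T = {s \<in> S. orbit v (omS s) \<in> W}"
      have T: "openin (zar (affine_space_on 3 S)) T" unfolding T_def by (rule pre[OF W(1)])
      have val: "q (omS t) \<noteq> 0 \<and> f (orbit v (omS t)) = p (omS t) / q (omS t)" if "t \<in> T" for t
        using that pq(3) orbit_self'[OF S_props(1)] unfolding T_def by blast
      have "(\<lambda>t. p (omS t) / q (omS t)) \<in> reg (affine_space_on 3 S) T"
        by (rule A.reg_divide[OF affine_poly_reg[OF omS_poly[OF hom_poly[OF pq(1)]] T]
            affine_poly_reg[OF omS_poly[OF hom_poly[OF pq(2)]] T]]) (use val in blast)
      then have "f \<circ> (\<lambda>s. orbit v (omS s)) \<in> reg (affine_space_on 3 S) T"
        by (rule A.reg_cong) (use val in simp)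
      then show "\<exists>W. openin (zar (affine_space_on 3 S)) W \<and> s \<in> W \<and> W \<subseteq> {s \<in> S. orbit v (omS s) \<in> V} \<and>
          f \<circ> (\<lambda>s. orbit v (omS s)) \<in> reg (affine_space_on 3 S) W"
        using T s W by (intro exI[of _ T]) (auto simp: T_def)
    qed
  qed
qed

lemma affine_open_U: "affine_open YY U"
  unfolding affine_open_def
proof (intro conjI U_open exI[of _ 3] exI[of _ S] closedin_S)
  show "isomorphic (open_subspace YY U) (affine_space_on 3 S)"
    unfolding isomorphic_def points_U S_points
    using morphism_kap morphism_omS orbit_omS_kap S_props(5)
    by (intro exI[of _ kap] exI[of _ "\<lambda>s. orbit v (omS s)"]) simp
qed

end

text \<open>Both sides are regular where \<open>t\<close> is nonzero, so equality on the nonempty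
  open set \<open>Z\<close> extends to the whole domain.\<close>

lemma (in irr_space) ord_isI_dense:
  assumes f: "germ V f" and u: "germ W u" "y \<in> W" "u y \<noteq> 0" and t: "germ U t" "x0 \<in> U" "t x0 \<noteq> 0"
    and Z: "openin (zar Y) Z" "Z \<noteq> {}"
    and eq: "\<And>x. x \<in> Z \<Longrightarrow> x \<in> W \<Longrightarrow> x \<in> V \<Longrightarrow> x \<in> U \<Longrightarrow> t x \<noteq> 0 \<Longrightarrow> f x = u x * t x powi k"
  shows "ord_is y U t V f k"
proof -
  define Ut where "Ut = {x \<in> U. t x \<noteq> 0}"
  have Ut: "germ Ut t" unfolding Ut_def by (rule nonvanishing_germ[OF t])
  have "(\<lambda>x. t x powi k) \<in> reg Y Ut" using Ut by (intro reg_powi) (auto simp: Ut_def)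
  then have tk: "germ Ut (\<lambda>x. t x powi k)" using Ut by blast
  have "f x = u x * t x powi k" if "x \<in> W \<inter> V \<inter> U" "t x \<noteq> 0" for x
  proof (rule agree[OF f germ_mult[OF u(1) tk] Z])
    fix x assume "x \<in> Z" "x \<in> V" "x \<in> W \<inter> Ut"
    then show "f x = u x * t x powi k" by (intro eq) (auto simp: Ut_def)
  qed (use that in \<open>auto simp: Ut_def\<close>)
  then show ?thesis unfolding ord_is_def using u by blast
qed

lemma finite_power_roots:
  assumes "n > 0" shows "finite {z :: 'k::field. z ^ n = c}"
proof -
  have "coeff (monom 1 n - [:c:]) n = 1" using assms by (simp add: coeff_pCons split: nat.split)
  then have "monom 1 n - [:c:] \<noteq> 0" by (metis coeff_0 zero_neq_one)
  then have "finite {z. poly (monom 1 n - [:c:]) z = 0}" by (rule poly_roots_finite)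
  then show ?thesis by (simp add: poly_monom)
qed

text \<open>Intended for functions of \<open>t\<close> alone, hence the entry 0 in place of
  \<open>z\<close>; a power of \<open>t\<close> clears the negative exponents.\<close>

lemma laurent_clear:
  assumes "p \<in> poly_funs 3"
  shows "\<exists>M e. \<forall>t :: 'k::field. t \<noteq> 0 \<longrightarrow> p [0, t, inverse t] * t ^ e = poly M t"
  using assms
proof (induction rule: poly_funs_induct)
  case (const c)
  show ?case by (intro exI[of _ "[:c:]"] exI[of _ 0]) simp
next
  case (coord l)
  then consider "l = 0" | "l = 1" | "l = 2" by linarith
  then show ?case
  proof cases
    case 1 then show ?thesis by (intro exI[of _ 0]) simp
  next
    case 2 then show ?thesis by (intro exI[of _ "[:0, 1:]"] exI[of _ 0]) simp
  next
    case 3 then show ?thesis by (intro exI[of _ 1] exI[of _ 1]) simp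
  qed
next
  case (add p q)
  then obtain M e N f where *: "\<And>t. t \<noteq> 0 \<Longrightarrow> p [0, t, inverse t] * t ^ e = poly M t"
    "\<And>t. t \<noteq> 0 \<Longrightarrow> q [0, t, inverse t] * t ^ f = poly N t" by blast
  have "(p [0, t, inverse t] + q [0, t, inverse t]) * t ^ (e + f) = poly (M * monom 1 f + N * monom 1 e) t"
    if "t \<noteq> 0" for t
  proof -
    have "(p [0, t, inverse t] + q [0, t, inverse t]) * t ^ (e + f) =
        (p [0, t, inverse t] * t ^ e) * t ^ f + (q [0, t, inverse t] * t ^ f) * t ^ e"
      by (simp add: power_add algebra_simps)
    then show ?thesis unfolding *(1)[OF that] *(2)[OF that] by (simp add: poly_monom)
  qed
  then show ?case by blast
next
  case (mult p q)
  then obtain M e N f where *: "\<And>t. t \<noteq> 0 \<Longrightarrow> p [0, t, inverse t] * t ^ e = poly M t"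
    "\<And>t. t \<noteq> 0 \<Longrightarrow> q [0, t, inverse t] * t ^ f = poly N t" by blast
  have "(p [0, t, inverse t] * q [0, t, inverse t]) * t ^ (e + f) = poly (M * N) t" if "t \<noteq> 0" for t
  proof -
    have "(p [0, t, inverse t] * q [0, t, inverse t]) * t ^ (e + f) =
        (p [0, t, inverse t] * t ^ e) * (q [0, t, inverse t] * t ^ f)"
      by (simp add: power_add algebra_simps)
    then show ?thesis unfolding *(1)[OF that] *(2)[OF that] by simp
  qed
  then show ?case by blast
qed

section \<open>Equation and local parameters of a chart\<close>

context pham_chart begin

text \<open>With this number \<open>a j = nn * v ! k\<close> and \<open>a k = nn * v ! j\<close>, so
  \<open>x_j^(a j) / x_k^(a k)\<close> is \<open>t^nn\<close>, and the points with
  \<open>z = 0\<close> lie over the roots of \<open>t^nn = -1\<close>.\<close>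

definition nn :: nat where "nn = D * v ! i"

lemma nn_pos: "nn > 0"
  using D_pos v_pos[OF axes_less(1)] by (simp add: nn_def)

lemma a_jk: "a j = nn * v ! k" "a k = nn * v ! j"
proof -
  have "{..<3 :: nat} = {0, 1, 2}" by auto
  then have "(\<Prod>l<3. v ! l) = v ! 0 * v ! 1 * v ! 2" by (simp add: mult.assoc)
  then have pr: "D * v ! 0 * v ! 1 * v ! 2 = D * (v ! i * (v ! j * v ! k))"
    by (simp add: prod3 mult.assoc)
  have "a j * v ! j = (nn * v ! k) * v ! j" "a k * v ! k = (nn * v ! j) * v ! k"
    using av[OF axes_less(2)] av[OF axes_less(3)] unfolding pr nn_def by (simp_all add: mult_ac)
  then show "a j = nn * v ! k" "a k = nn * v ! j"
    using v_pos[OF axes_less(2)] v_pos[OF axes_less(3)] by auto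
qed

text \<open>The right-hand side of the chart equation \<open>z^(a i) = E\<close>, as a
  polynomial.\<close>

definition E where "E s = - pw (- al * int (a k)) s * (s ! 1 ^ nn + 1)"

lemma om_C: "t \<noteq> 0 \<Longrightarrow> om z t \<in> C \<longleftrightarrow> z ^ a i = - (t powi (- al * int (a k)) * (t ^ nn + 1))"
proof -
  assume t: "t \<noteq> 0"
  have e: "be * int (a j) = int nn + - al * int (a k)"
  proof -
    have "be * int (a j) + al * int (a k) = int nn * (al * int (v ! j) + be * int (v ! k))"
      by (simp add: a_jk algebra_simps)
    then show ?thesis by (simp add: bez)
  qed
  have "(t powi be) ^ a j = t ^ nn * t powi (- al * int (a k))"
    unfolding powi_power e using t by (subst power_int_add) simp_all
  moreover have "(t powi (- al)) ^ a k = t powi (- al * int (a k))" by (rule powi_power)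
  ultimately have "om z t \<in> C \<longleftrightarrow> z ^ a i + t powi (- al * int (a k)) * (t ^ nn + 1) = 0"
    unfolding mem_C om_coords by (simp add: algebra_simps)
  then show ?thesis by (simp add: eq_neg_iff_add_eq_0)
qed

lemma S_eq: "s \<in> S \<Longrightarrow> s ! 0 ^ a i = E s"
proof -
  assume s: "s \<in> S"
  have "s ! 1 * s ! 2 = 1" "omS s \<in> C" using s by (auto simp: S_def)
  then show ?thesis
    using om_C[OF S_props(6)[OF s]] unfolding S_props(8)[OF s] E_def by (simp add: pw_eq)
qed

lemma S_point: "t \<noteq> 0 \<Longrightarrow> \<exists>z. [z, t, inverse t] \<in> S \<and> (t ^ nn \<noteq> -1 \<longrightarrow> z \<noteq> 0)"
proof -
  assume t: "t \<noteq> 0"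
  obtain z where z: "z ^ a i = - (t powi (- al * int (a k)) * (t ^ nn + 1))"
    using nth_root_exists[OF axes_pos(1)] by blast
  have o: "omS [z, t, inverse t] = om z t" using t by (subst omS_om) simp_all
  have "[z, t, inverse t] \<in> S" unfolding S_def using t om_C[OF t, of z] z o by simp
  moreover have "z \<noteq> 0" if "t ^ nn \<noteq> - 1"
  proof
    assume "z = 0"
    then have "t powi (- al * int (a k)) * (t ^ nn + 1) = 0" using z axes_pos by (simp add: power_0_left)
    then have "t ^ nn + 1 = 0" using t by simp
    with that show False by (simp add: eq_neg_iff_add_eq_0)
  qed
  ultimately show ?thesis by blast
qed

lemma S_generic: "finite B \<Longrightarrow> \<exists>s\<in>S. s ! 0 \<noteq> 0 \<and> s ! 1 \<notin> B"
proof -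
  assume "finite B"
  then have "finite (insert 0 (B \<union> {t. t ^ nn = -1}))" using finite_power_roots[OF nn_pos] by simp
  then obtain t where "t \<notin> insert 0 (B \<union> {t. t ^ nn = -1})"
    using ex_new_if_finite[OF infinite_UNIV_char_0] by blast
  with S_point[of t] show ?thesis by fastforce
qed

lemma rot_sc: "length x = 3 \<Longrightarrow> rot z (sc m x) = sc m (rot z x)"
proof (rule nth_equalityI)
  fix l assume x: "length x = 3" and "l < length (rot z (sc m x))"
  then have "l < 3" by (simp add: rot_nth)
  then show "rot z (sc m x) ! l = sc m (rot z x) ! l"
    using x axes_cases[of l] by (auto simp: rot_nth sc_nth)
qed (simp add: rot_nth)

text \<open>On the chart the norm of \<open>p\<close> to the plane depends on \<open>t\<close>
  alone, because \<open>x_j\<close> and \<open>x_k\<close> do. It does not vanish identically: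
  homogeneity carries a nonzero value at an arbitrary point to its normalised
  representative.\<close>

lemma norm_chart:
  assumes p: "p \<in> homogeneous_funs v e" "\<exists>x\<in>C. p x \<noteq> 0"
  obtains q M e' where "q \<in> poly_funs 3" "M \<noteq> 0"
    "\<And>s. s \<in> S \<Longrightarrow> q s * p (omS s) * s ! 1 ^ e' = poly M (s ! 1)"
proof -
  obtain q N where N: "q \<in> poly_funs 3" "N \<noteq> 0" "\<exists>x\<in>C. q x \<noteq> 0"
    "\<And>x. x \<in> C \<Longrightarrow> q x * p x = ev2 N (x ! j) (x ! k)"
    "\<And>x. x \<in> C \<Longrightarrow> ev2 N (x ! j) (x ! k) = (\<Prod>z\<in>\<mu>. p (rot z x))"
    by (rule norm_multiple[OF hom_poly[OF p(1)] p(2)]) blast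
  have "(\<lambda>s. ev2 N (omS s ! j) (omS s ! k)) \<in> poly_funs 3" by (rule omS_poly[OF evC_poly_funs])
  from laurent_clear[OF this] obtain M e' where
    M: "\<And>t. t \<noteq> 0 \<Longrightarrow> ev2 N (omS [0, t, inverse t] ! j) (omS [0, t, inverse t] ! k) * t ^ e' = poly M t" by blast
  have om0: "omS [z, t, inverse t] ! j = t powi be" "omS [z, t, inverse t] ! k = t powi (- al)" if "t \<noteq> 0" for z t
    using that by (simp_all add: omS_om om_coords)
  have M': "ev2 N (t powi be) (t powi (- al)) * t ^ e' = poly M t" if "t \<noteq> 0" for t
    using M[OF that] by (simp add: om0[OF that])
  show ?thesis
  proof (rule that[OF omS_poly[OF N(1)], of M e'])
    show "q (omS s) * p (omS s) * s ! 1 ^ e' = poly M (s ! 1)" if s: "s \<in> S" for s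
    proof -
      have "omS s \<in> C" using S_props(1)[OF s] Cp_sub by blast
      from N(4)[OF this] show ?thesis
        using M'[OF S_props(6)[OF s]] by (simp add: S_props(8)[OF s] om_coords)
    qed
    \<comment> \<open>The extra factor forces both plane coordinates of the chosen point to be
      nonzero, so that it lies over the chart.\<close>
    have "N * ([:[:0, 1:]:] * [:0, 1:]) \<noteq> 0" using N(2) by simp
    then obtain u w where uw: "ev2 (N * ([:[:0, 1:]:] * [:0, 1:])) u w \<noteq> 0" using ev2_eq_0_imp by blast
    then have "ev2 N u w * (u * w) \<noteq> 0" unfolding ev2_hom .
    then have uw': "u \<noteq> 0" "w \<noteq> 0" "ev2 N u w \<noteq> 0" by auto
    obtain z where z: "pt z u w \<in> C" using exists_above by blast
    define x where "x = pt z u w"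
    have x: "x \<in> C" "length x = 3" "x ! j = u" "x ! k = w" using z by (simp_all add: x_def)
    define m where "m = x ! j powi (- al) * x ! k powi (- be)"
    have m0: "m \<noteq> 0" using x uw' by (simp add: m_def)
    define t where "t = lmono ct x"
    have t0: "t \<noteq> 0" unfolding t_def using x uw' by (intro lmono_ct_nz) auto
    have nrm: "sc m x = om (lmono cz x) t" unfolding m_def t_def using x uw' by (intro normalise) auto
    have scC: "sc m x \<in> C" by (rule sc_C[OF x(1)])
    have "(\<Prod>z\<in>\<mu>. p (rot z x)) \<noteq> 0" using N(5)[OF x(1)] x uw'(3) by simp
    then have nz: "p (rot z x) \<noteq> 0" if "z \<in> \<mu>" for z using that finite_mu by (metis prod_zero_iff)
    \<comment> \<open>Rotation commutes with scaling, so each factor of the norm is merely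
      multiplied by \<open>m ^ e\<close>.\<close>
    have "ev2 N (sc m x ! j) (sc m x ! k) = (\<Prod>z\<in>\<mu>. m ^ e * p (rot z x))"
      unfolding N(5)[OF scC] using x(2) by (intro prod.cong refl) (simp add: rot_sc hom_sc[OF p(1)] rot_nth)
    also have "\<dots> \<noteq> 0" using nz m0 finite_mu by (subst prod_zero_iff) auto
    finally have "ev2 N (t powi be) (t powi (- al)) \<noteq> 0" unfolding nrm om_coords .
    then have "poly M t \<noteq> 0" using M'[OF t0] t0 by (metis mult_eq_0_iff power_not_zero)
    then show "M \<noteq> 0" by auto
  qed
qed

text \<open>Zeros of \<open>p\<close> lie over the roots of its norm \<open>M\<close>, and the chart
  equation allows only finitely many \<open>z\<close> for each \<open>t\<close>.\<close>

lemma finite_zeros_U: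
  assumes p: "p \<in> homogeneous_funs v e" "\<exists>x\<in>C. p x \<noteq> 0"
  shows "finite {y \<in> U. y \<notin> YD p}"
proof -
  obtain q M e' where M: "q \<in> poly_funs 3" "M \<noteq> 0"
    "\<And>s. s \<in> S \<Longrightarrow> q s * p (omS s) * s ! 1 ^ e' = poly M (s ! 1)" by (rule norm_chart[OF p]) blast
  define B where "B = (\<Union>t\<in>{t. poly M t = 0}. (\<lambda>z. [z, t, inverse t]) ` {z. z ^ a i = - (t powi (- al * int (a k)) * (t ^ nn + 1))})"
  have "finite B" unfolding B_def
    by (intro finite_UN_I poly_roots_finite[OF M(2)] finite_imageI finite_power_roots axes_pos)
  moreover have "{y \<in> U. y \<notin> YD p} \<subseteq> (\<lambda>s. orbit v (omS s)) ` B"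
  proof
    fix y assume "y \<in> {y \<in> U. y \<notin> YD p}"
    then have y: "y \<in> U" "y \<notin> YD p" by auto
    define s where "s = kap y"
    have s: "s \<in> S" "orbit v (omS s) = y" unfolding s_def using y kap_S orbit_omS_kap by auto
    have "p (omS s) = 0" using y(2) YD_iff[OF p(1) S_props(1)[OF s(1)]] s(2) by simp
    then have "poly M (s ! 1) = 0" using M(3)[OF s(1)] by simp
    moreover have "s ! 0 ^ a i = - (s ! 1 powi (- al * int (a k)) * (s ! 1 ^ nn + 1))"
    proof -
      have "om (s ! 0) (s ! 1) \<in> C" using S_props(1,8)[OF s(1)] Cp_sub by auto
      then show ?thesis using om_C[OF S_props(6)[OF s(1)]] by simp
    qed
    moreover have "s = [s ! 0, s ! 1, inverse (s ! 1)]"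
    proof -
      have "s ! 2 = inverse (s ! 1)" using s(1) unfolding S_def by (metis (mono_tags, lifting) inverse_unique mem_Collect_eq)
      then show ?thesis using S_props(7)[OF s(1)]
        by (intro nth_equalityI) (auto simp: less_Suc_eq numeral_3_eq_3 numeral_2_eq_2)
    qed
    ultimately have "s \<in> B" unfolding B_def by blast
    then show "y \<in> (\<lambda>s. orbit v (omS s)) ` B" using s(2) by blast
  qed
  ultimately show ?thesis by (meson finite_imageI finite_subset)
qed

text \<open>Functions that are divisible by \<open>T\<close> near the point \<open>s0\<close> of the chart.\<close>

definition ldvd :: "('k list \<Rightarrow> 'k) \<Rightarrow> 'k list \<Rightarrow> ('k list \<Rightarrow> 'k) \<Rightarrow> bool" where
  "ldvd T s0 f \<longleftrightarrow> (\<exists>P W. P \<in> poly_funs 3 \<and> W \<in> poly_funs 3 \<and> W s0 \<noteq> 0 \<and> (\<forall>s\<in>S. W s * f s = T s * P s))"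

lemma ldvdI: "P \<in> poly_funs 3 \<Longrightarrow> W \<in> poly_funs 3 \<Longrightarrow> W s0 \<noteq> 0 \<Longrightarrow>
    (\<And>s. s \<in> S \<Longrightarrow> W s * f s = T s * P s) \<Longrightarrow> ldvd T s0 f"
  unfolding ldvd_def by blast

lemma ldvd_add:
  assumes "ldvd T s0 f" "ldvd T s0 g" shows "ldvd T s0 (\<lambda>s. f s + g s)"
proof -
  obtain P W where 1: "P \<in> poly_funs 3" "W \<in> poly_funs 3" "W s0 \<noteq> 0" "\<And>s. s \<in> S \<Longrightarrow> W s * f s = T s * P s"
    using assms(1) unfolding ldvd_def by blast
  obtain Q V where 2: "Q \<in> poly_funs 3" "V \<in> poly_funs 3" "V s0 \<noteq> 0" "\<And>s. s \<in> S \<Longrightarrow> V s * g s = T s * Q s"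
    using assms(2) unfolding ldvd_def by blast
  show ?thesis
  proof (rule ldvdI)
    show "(\<lambda>s. V s * P s + W s * Q s) \<in> poly_funs 3" "(\<lambda>s. W s * V s) \<in> poly_funs 3"
      using 1 2 by (intro poly_funs_intros; simp)+
    show "W s0 * V s0 \<noteq> 0" using 1 2 by simp
    fix s assume s: "s \<in> S"
    have "W s * V s * (f s + g s) = V s * (W s * f s) + W s * (V s * g s)" by (simp add: algebra_simps)
    then show "W s * V s * (f s + g s) = T s * (V s * P s + W s * Q s)"
      by (simp add: 1(4)[OF s] 2(4)[OF s] algebra_simps)
  qed
qed

lemma ldvd_mult:
  assumes "ldvd T s0 f" "g \<in> poly_funs 3" shows "ldvd T s0 (\<lambda>s. g s * f s)"
proof -
  obtain P W where 1: "P \<in> poly_funs 3" "W \<in> poly_funs 3" "W s0 \<noteq> 0" "\<And>s. s \<in> S \<Longrightarrow> W s * f s = T s * P s"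
    using assms(1) unfolding ldvd_def by blast
  show ?thesis
    by (rule ldvdI[of "\<lambda>s. g s * P s" W]) (use 1 assms(2) in \<open>auto intro: poly_funs_mult simp: mult.left_commute\<close>)
qed

lemma ldvd_cong: "ldvd T s0 f \<Longrightarrow> (\<And>s. s \<in> S \<Longrightarrow> f s = g s) \<Longrightarrow> ldvd T s0 g"
  unfolding ldvd_def by simp

lemma ldvd_product:
  assumes "ldvd T s0 (\<lambda>s. p s - p s0)" "ldvd T s0 (\<lambda>s. q s - q s0)" "p \<in> poly_funs 3"
  shows "ldvd T s0 (\<lambda>s. p s * q s - p s0 * q s0)"
proof -
  have "ldvd T s0 (\<lambda>s. p s * (q s - q s0) + q s0 * (p s - p s0))"
    by (intro ldvd_add ldvd_mult assms poly_funs_const)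
  then show ?thesis by (rule ldvd_cong) (simp add: algebra_simps)
qed

lemma ldvd_zero: "ldvd T s0 (\<lambda>s. 0)"
  by (rule ldvdI[of "\<lambda>s. 0" "\<lambda>s. 1"]) (auto intro: poly_funs_const)

lemma ldvd_power:
  assumes "ldvd T s0 (\<lambda>s. p s - p s0)" "p \<in> poly_funs 3" shows "ldvd T s0 (\<lambda>s. p s ^ n - p s0 ^ n)"
proof (induction n)
  case (Suc n)
  from ldvd_product[OF assms(1) Suc assms(2)] show ?case by simp
qed (simp add: ldvd_zero)

lemma ldvd_poly:
  assumes "\<And>l. l < 3 \<Longrightarrow> ldvd T s0 (\<lambda>s. s ! l - s0 ! l)" "p \<in> poly_funs 3"
  shows "ldvd T s0 (\<lambda>s. p s - p s0)"
  using assms(2)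
proof (induction rule: poly_funs_induct)
  case (add p q)
  from ldvd_add[OF add.IH] show ?case by (rule ldvd_cong) simp
next
  case (mult p q)
  then show ?case by (intro ldvd_product)
qed (use assms(1) ldvd_zero in simp_all)

text \<open>On the chart \<open>1/t - 1/t0\<close> equals
  \<open>- (t - t0) / (t t0)\<close>.\<close>

lemma ldvd_coord2:
  assumes s0: "s0 \<in> S" and "ldvd T s0 (\<lambda>s. s ! 1 - s0 ! 1)" shows "ldvd T s0 (\<lambda>s. s ! 2 - s0 ! 2)"
proof -
  have "(\<lambda>s. - (s ! 2 * s0 ! 2)) \<in> poly_funs 3" by (intro poly_funs_intros) auto
  from ldvd_mult[OF assms(2) this] show ?thesis
  proof (rule ldvd_cong)
    fix s assume "s \<in> S"
    then have "s ! 1 * s ! 2 = 1" "s0 ! 1 * s0 ! 2 = 1" using s0 by (auto simp: S_def)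
    then have "- (s ! 2 * s0 ! 2) * (s ! 1 - s0 ! 1) = s ! 2 * (s0 ! 1 * s0 ! 2) - s0 ! 2 * (s ! 1 * s ! 2)"
      by (simp add: algebra_simps)
    then show "- (s ! 2 * s0 ! 2) * (s ! 1 - s0 ! 1) = s ! 2 - s0 ! 2"
      using \<open>s ! 1 * s ! 2 = 1\<close> \<open>s0 ! 1 * s0 ! 2 = 1\<close> by simp
  qed
qed

text \<open>The last clause makes \<open>t - t(s0)\<close> a unit times \<open>T^c\<close>. It
  bounds how often \<open>T\<close> can divide a function, because norms are polynomials in
  \<open>t\<close>.\<close>

definition chart_param :: "('k list \<Rightarrow> 'k) \<Rightarrow> 'k list \<Rightarrow> bool" where
  "chart_param T s0 \<longleftrightarrow> T \<in> poly_funs 3 \<and> T s0 = 0 \<and> (\<exists>s\<in>S. T s \<noteq> 0) \<and>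
    (\<forall>p\<in>poly_funs 3. p s0 = 0 \<longrightarrow> ldvd T s0 p) \<and>
    (\<exists>c U1 U2. U1 \<in> poly_funs 3 \<and> U2 \<in> poly_funs 3 \<and> U1 s0 \<noteq> 0 \<and> U2 s0 \<noteq> 0 \<and>
       (\<forall>s\<in>S. U1 s * (s ! 1 - s0 ! 1) = U2 s * T s ^ c))"

text \<open>The cofactor of \<open>x - y\<close> in \<open>x^n - y^n\<close>, evaluated on the
  diagonal. For \<open>n > 0\<close> and \<open>x \<noteq> 0\<close> it is nonzero in characteristic
  zero, so the roots in question are simple.\<close>

lemma sum_powers_at: "(\<Sum>l<n. (x::'k) ^ (n - Suc l) * x ^ l) = of_nat n * x ^ (n - 1)"
proof -
  have "(\<Sum>l<n. x ^ (n - Suc l) * x ^ l) = (\<Sum>l<n. x ^ (n - 1))"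
    by (intro sum.cong refl) (simp add: power_add[symmetric])
  then show ?thesis by simp
qed

text \<open>At a point with \<open>z = 0\<close> the value \<open>t0\<close> is a simple root of
  \<open>t^nn + 1\<close>, so this polynomial is a unit times \<open>t - t0\<close>, and the chart
  equation makes \<open>t - t0\<close> a unit times \<open>z^(a i)\<close>.\<close>

lemma chart_param_z:
  assumes s0: "s0 \<in> S" "s0 ! 0 = 0" shows "chart_param (\<lambda>s. s ! 0) s0"
proof -
  define t0 where "t0 = s0 ! 1"
  have t0: "t0 \<noteq> 0" using S_props(6)[OF s0(1)] by (simp add: t0_def)
  have s12: "s0 ! 1 * s0 ! 2 = 1" using s0(1) by (simp add: S_def)
  have "pw (- al * int (a k)) s0 * (t0 ^ nn + 1) = 0"
    using S_eq[OF s0(1)] s0(2) axes_pos by (simp add: E_def t0_def power_0_left)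
  moreover have "pw (- al * int (a k)) s0 \<noteq> 0" using t0 by (simp add: pw_eq[OF s12] t0_def)
  ultimately have t0n: "t0 ^ nn = - 1" by (simp add: eq_neg_iff_add_eq_0)
  \<comment> \<open>Up to sign this is the cofactor of \<open>t - t0\<close> in
    \<open>t^nn - t0^nn\<close>, which does not vanish at \<open>s0\<close>.\<close>
  define G where "G s = - (\<Sum>l<nn. t0 ^ (nn - Suc l) * s ! 1 ^ l)" for s
  have G: "G \<in> poly_funs 3" unfolding G_def by (intro poly_funs_intros) auto
  have G0: "G s0 \<noteq> 0"
    unfolding G_def t0_def[symmetric] using nn_pos t0 by (simp add: sum_powers_at)
  have key: "G s * (s ! 1 - s0 ! 1) = pw (al * int (a k)) s * s ! 0 ^ a i" if s: "s \<in> S" for s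
  proof -
    have s12: "s ! 1 * s ! 2 = 1" using s by (simp add: S_def)
    have "G s * (s ! 1 - t0) = - (s ! 1 ^ nn - t0 ^ nn)"
      unfolding G_def by (subst power_diff_sumr2) (simp add: mult.commute)
    also have "\<dots> = - (s ! 1 ^ nn + 1)" by (simp add: t0n)
    also have "\<dots> = pw (al * int (a k)) s * E s"
    proof -
      have "pw (al * int (a k)) s * pw (- al * int (a k)) s = s ! 1 powi (al * int (a k) + - al * int (a k))"
        unfolding pw_eq[OF s12] using S_props(6)[OF s] by (intro power_int_add[symmetric]) simp
      then have one: "pw (al * int (a k)) s * pw (- al * int (a k)) s = 1" by simp
      have "pw (al * int (a k)) s * E s = - ((pw (al * int (a k)) s * pw (- al * int (a k)) s) * (s ! 1 ^ nn + 1))"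
        unfolding E_def by (simp only: mult_minus_left mult_minus_right mult.assoc)
      then show ?thesis unfolding one by simp
    qed
    finally show ?thesis by (simp add: S_eq[OF s] t0_def)
  qed
  have d1: "ldvd (\<lambda>s. s ! 0) s0 (\<lambda>s. s ! 1 - s0 ! 1)"
  proof (rule ldvdI[OF _ G G0])
    show "(\<lambda>s. pw (al * int (a k)) s * s ! 0 ^ (a i - 1)) \<in> poly_funs 3"
      by (intro poly_funs_intros pw_poly) auto
    fix s assume "s \<in> S"
    then show "G s * (s ! 1 - s0 ! 1) = s ! 0 * (pw (al * int (a k)) s * s ! 0 ^ (a i - 1))"
      using key power_minus_mult[OF axes_pos(1), of "s ! 0"] by (simp add: mult.commute mult.left_commute)
  qed
  have d0: "ldvd (\<lambda>s. s ! 0) s0 (\<lambda>s. s ! 0 - s0 ! 0)"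
    using s0(2) by (intro ldvdI[of "\<lambda>s. 1" "\<lambda>s. 1"]) (auto intro: poly_funs_const)
  have coord: "ldvd (\<lambda>s. s ! 0) s0 (\<lambda>s. s ! l - s0 ! l)" if "l < 3" for l
  proof -
    have "l = 0 \<or> l = 1 \<or> l = 2" using that by linarith
    then show ?thesis using d0 d1 ldvd_coord2[OF s0(1) d1] by auto
  qed
  show ?thesis unfolding chart_param_def
  proof (intro conjI ballI impI)
    show "\<exists>s\<in>S. s ! 0 \<noteq> 0" using S_generic[of "{}"] by auto
    show "ldvd (\<lambda>s. s ! 0) s0 p" if "p \<in> poly_funs 3" "p s0 = 0" for p
      using ldvd_poly[OF coord that(1)] that(2) by simp
    show "\<exists>c U1 U2. U1 \<in> poly_funs 3 \<and> U2 \<in> poly_funs 3 \<and> U1 s0 \<noteq> 0 \<and> U2 s0 \<noteq> 0 \<and>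
       (\<forall>s\<in>S. U1 s * (s ! 1 - s0 ! 1) = U2 s * s ! 0 ^ c)"
      using G G0 pw_poly key t0
      by (intro exI[of _ "a i"] exI[of _ G] exI[of _ "pw (al * int (a k))"]) (simp add: pw_eq[OF s12] t0_def)
  qed (auto intro: poly_funs_coord s0(2))
qed

text \<open>For \<open>z0 \<noteq> 0\<close> the difference \<open>z^(a i) - z0^(a i)\<close> is
  \<open>z - z0\<close> times a cofactor that is nonzero at \<open>s0\<close>; rewritten through
  \<open>E\<close>, it is divisible by \<open>t - t0\<close>.\<close>

lemma chart_param_t:
  assumes s0: "s0 \<in> S" "s0 ! 0 \<noteq> 0" shows "chart_param (\<lambda>s. s ! 1 - s0 ! 1) s0"
proof -
  let ?T = "\<lambda>s :: 'k list. s ! 1 - s0 ! 1"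
  have T: "?T \<in> poly_funs 3" by (intro poly_funs_intros) auto
  have d1: "ldvd ?T s0 ?T"
    by (rule ldvdI[of "\<lambda>s. 1" "\<lambda>s. 1"]) (auto intro: poly_funs_const)
  have d2: "ldvd ?T s0 (\<lambda>s. s ! 2 - s0 ! 2)" by (rule ldvd_coord2[OF s0(1) d1])
  have dp: "ldvd ?T s0 (\<lambda>s. pw e s - pw e s0)" for e
  proof -
    have c: "(\<lambda>s :: 'k list. s ! 1) \<in> poly_funs 3" "(\<lambda>s :: 'k list. s ! 2) \<in> poly_funs 3"
      by (intro poly_funs_coord; simp)+
    show ?thesis unfolding pw_def using ldvd_power[OF d1 c(1)] ldvd_power[OF d2 c(2)] by simp
  qed
  have "ldvd ?T s0 (\<lambda>s. s ! 1 ^ nn - s0 ! 1 ^ nn)" by (rule ldvd_power[OF d1]) (rule poly_funs_coord, simp)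
  from ldvd_mult[OF this poly_funs_const[of "-1"]]
  have dn: "ldvd ?T s0 (\<lambda>s. - (s ! 1 ^ nn + 1) - - (s0 ! 1 ^ nn + 1))"
    by (rule ldvd_cong) simp
  have dE: "ldvd ?T s0 (\<lambda>s. E s - E s0)"
    by (rule ldvd_cong[OF ldvd_product[OF dp[of "- al * int (a k)"] dn pw_poly]])
      (simp only: E_def mult_minus_left mult_minus_right)
  define H where "H s = (\<Sum>l<a i. s0 ! 0 ^ (a i - Suc l) * s ! 0 ^ l)" for s :: "'k list"
  have H: "H \<in> poly_funs 3" unfolding H_def by (intro poly_funs_intros) auto
  have H0: "H s0 \<noteq> 0" unfolding H_def using s0(2) axes_pos by (simp add: sum_powers_at)
  have d0: "ldvd ?T s0 (\<lambda>s. s ! 0 - s0 ! 0)"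
  proof -
    obtain P W where 1: "P \<in> poly_funs 3" "W \<in> poly_funs 3" "W s0 \<noteq> 0"
      "\<And>s. s \<in> S \<Longrightarrow> W s * (E s - E s0) = ?T s * P s"
      using dE unfolding ldvd_def by blast
    show ?thesis
    proof (rule ldvdI[OF 1(1) poly_funs_mult[OF 1(2) H]])
      show "W s0 * H s0 \<noteq> 0" using 1(3) H0 by simp
      fix s assume s: "s \<in> S"
      have "E s - E s0 = (s ! 0 - s0 ! 0) * H s"
        unfolding S_eq[OF s, symmetric] S_eq[OF s0(1), symmetric] H_def by (rule power_diff_sumr2)
      then show "W s * H s * (s ! 0 - s0 ! 0) = ?T s * P s" using 1(4)[OF s] by (simp add: mult_ac)
    qed
  qed
  have coord: "ldvd ?T s0 (\<lambda>s. s ! l - s0 ! l)" if "l < 3" for l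
  proof -
    have "l = 0 \<or> l = 1 \<or> l = 2" using that by linarith
    then show ?thesis using d0 d1 d2 by auto
  qed
  show ?thesis unfolding chart_param_def
  proof (intro conjI ballI impI)
    show "\<exists>s\<in>S. s ! 1 - s0 ! 1 \<noteq> 0" using S_generic[of "{s0 ! 1}"] by auto
    show "ldvd ?T s0 p" if "p \<in> poly_funs 3" "p s0 = 0" for p
      using ldvd_poly[OF coord that(1)] that(2) by simp
    show "\<exists>c U1 U2. U1 \<in> poly_funs 3 \<and> U2 \<in> poly_funs 3 \<and> U1 s0 \<noteq> 0 \<and> U2 s0 \<noteq> 0 \<and>
       (\<forall>s\<in>S. U1 s * (s ! 1 - s0 ! 1) = U2 s * (s ! 1 - s0 ! 1) ^ c)"
      by (intro exI[of _ 1] exI[of _ "\<lambda>s. 1"]) (simp add: poly_funs_const)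
  qed (use T in auto)
qed

end

section \<open>Orders of functions along the charts\<close>

context pham_chart begin

text \<open>A factor \<open>T\<close> is split off as long as the cofactor vanishes at
  \<open>s0\<close>. The norm \<open>M\<close> of \<open>p\<close> has a zero of finite order
  \<open>m\<close> at \<open>t(s0)\<close>, and \<open>t - t(s0)\<close> is a unit times
  \<open>T^c\<close>, so at most \<open>c * m\<close> divisions are possible.\<close>

lemma order_form:
  assumes T: "chart_param T s0" "s0 \<in> S" and p: "p \<in> homogeneous_funs v e" "\<exists>x\<in>C. p x \<noteq> 0"
  obtains n P W where "P \<in> poly_funs 3" "W \<in> poly_funs 3" "P s0 \<noteq> 0" "W s0 \<noteq> 0"
    "\<And>s. s \<in> S \<Longrightarrow> W s * p (omS s) = T s ^ n * P s"
proof -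
  have T': "T \<in> poly_funs 3" "T s0 = 0" "\<exists>s\<in>S. T s \<noteq> 0" "\<And>p. p \<in> poly_funs 3 \<Longrightarrow> p s0 = 0 \<Longrightarrow> ldvd T s0 p"
    using T unfolding chart_param_def by blast+
  obtain c U1 U2 where c: "U1 \<in> poly_funs 3" "U2 \<in> poly_funs 3" "U1 s0 \<noteq> 0" "U2 s0 \<noteq> 0"
    "\<And>s. s \<in> S \<Longrightarrow> U1 s * (s ! 1 - s0 ! 1) = U2 s * T s ^ c"
    using T unfolding chart_param_def by blast
  obtain q M e' where M: "q \<in> poly_funs 3" "M \<noteq> 0"
    "\<And>s. s \<in> S \<Longrightarrow> q s * p (omS s) * s ! 1 ^ e' = poly M (s ! 1)" by (rule norm_chart[OF p]) blast
  define m where "m = Polynomial.order (s0 ! 1) M"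
  obtain M' where M': "M = [:- s0 ! 1, 1:] ^ m * M'" "\<not> [:- s0 ! 1, 1:] dvd M'"
    using order_decomp[OF M(2), of "s0 ! 1"] unfolding m_def by blast
  have M'0: "poly M' (s0 ! 1) \<noteq> 0" using M'(2) by (simp add: poly_eq_0_iff_dvd)
  have Mp: "(\<lambda>s :: 'k list. poly N (s ! 1)) \<in> poly_funs 3" for N
    by (induction N) (auto intro!: poly_funs_intros)
  have "\<exists>n P W. P \<in> poly_funs 3 \<and> W \<in> poly_funs 3 \<and> P s0 \<noteq> 0 \<and> W s0 \<noteq> 0 \<and>
      (\<forall>s\<in>S. W s * p (omS s) = T s ^ n * P s)"
  proof (rule ccontr)
    assume no: "\<not> ?thesis"
    have ex: "\<exists>P W. P \<in> poly_funs 3 \<and> W \<in> poly_funs 3 \<and> W s0 \<noteq> 0 \<and> (\<forall>s\<in>S. W s * p (omS s) = T s ^ n * P s)" for n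
    proof (induction n)
      case 0
      show ?case
        by (intro exI[of _ "\<lambda>s. p (omS s)"] exI[of _ "\<lambda>s. 1"]) (auto intro: poly_funs_const omS_poly[OF hom_poly[OF p(1)]])
    next
      case (Suc n)
      then obtain P W where 1: "P \<in> poly_funs 3" "W \<in> poly_funs 3" "W s0 \<noteq> 0"
        "\<And>s. s \<in> S \<Longrightarrow> W s * p (omS s) = T s ^ n * P s" by blast
      have "P s0 = 0" using no 1 by blast
      from T'(4)[OF 1(1) this] obtain P' W' where 2: "P' \<in> poly_funs 3" "W' \<in> poly_funs 3" "W' s0 \<noteq> 0"
        "\<And>s. s \<in> S \<Longrightarrow> W' s * P s = T s * P' s" unfolding ldvd_def by blast
      have "(W' s * W s) * p (omS s) = T s ^ Suc n * P' s" if s: "s \<in> S" for s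
      proof -
        have "(W' s * W s) * p (omS s) = T s ^ n * (W' s * P s)" using 1(4)[OF s] by (simp add: mult_ac)
        then show ?thesis unfolding 2(4)[OF s] by (simp add: mult_ac)
      qed
      then show ?case using 1 2
        by (intro exI[of _ P'] exI[of _ "\<lambda>s. W' s * W s"]) (auto intro: poly_funs_mult)
    qed
    \<comment> \<open>One division more than the norm permits.\<close>
    from ex[of "Suc (c * m)"] obtain P W where 1: "P \<in> poly_funs 3" "W \<in> poly_funs 3" "W s0 \<noteq> 0"
      "\<And>s. s \<in> S \<Longrightarrow> W s * p (omS s) = T s ^ Suc (c * m) * P s" by blast
    define L where "L s = W s * poly M' (s ! 1) * U2 s ^ m" for s
    define RR where "RR s = T s * (U1 s ^ m * P s * q s * s ! 1 ^ e')" for s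
    have polys: "L \<in> poly_funs 3" "RR \<in> poly_funs 3"
      unfolding L_def RR_def by (intro poly_funs_mult poly_funs_power 1 c Mp M T' poly_funs_coord; simp)+
    \<comment> \<open>The power of \<open>T\<close> can be cancelled only off the zeros of
      \<open>T\<close>; density then carries the identity to \<open>s0\<close>, where
      \<open>RR\<close> vanishes and \<open>L\<close> does not.\<close>
    have eq: "L s = RR s" if s: "s \<in> S" "T s \<noteq> 0" for s
    proof -
      have "T s ^ (c * m) * L s = W s * poly M' (s ! 1) * (U2 s * T s ^ c) ^ m"
        by (simp add: L_def power_mult_distrib power_mult mult_ac)
      also have "\<dots> = W s * U1 s ^ m * poly M (s ! 1)"
        unfolding c(5)[OF s(1), symmetric] by (subst M'(1)) (simp add: power_mult_distrib mult_ac)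
      also have "\<dots> = U1 s ^ m * q s * s ! 1 ^ e' * (W s * p (omS s))"
        unfolding M(3)[OF s(1), symmetric] by (simp add: mult_ac)
      also have "\<dots> = T s ^ (c * m) * RR s" unfolding 1(4)[OF s(1)] RR_def by (simp add: mult_ac)
      finally show ?thesis using s(2) by simp
    qed
    define y where "y = orbit v (omS s0)"
    have y: "y \<in> U" "kap y = s0" using S_props[OF T(2)] by (auto simp: y_def)
    obtain s1 where s1: "s1 \<in> S" "T s1 \<noteq> 0" using T'(3) by blast
    define Z where "Z = {y \<in> U. T (kap y) \<noteq> 0}"
    have Z: "openin (zar YY) Z" unfolding Z_def by (rule YY.reg_open[OF kap_poly_reg[OF T'(1)]])
    have "orbit v (omS s1) \<in> Z" unfolding Z_def using S_props[OF s1(1)] s1(2) by simp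
    then have "Z \<noteq> {}" by blast
    have gL: "YY.germ U (\<lambda>y. L (kap y))" and gR: "YY.germ U (\<lambda>y. RR (kap y))"
      using U_open y(1) kap_poly_reg polys by auto
    have "L (kap y) = RR (kap y)"
      by (rule YY.agree[OF gL gR Z \<open>Z \<noteq> {}\<close>]) (use eq kap_S y in \<open>auto simp: Z_def\<close>)
    then have "L s0 = 0" unfolding y(2) RR_def T'(2) by simp
    then show False unfolding L_def using 1(3) M'0 c(4) by simp
  qed
  then show ?thesis using that by blast
qed

text \<open>A germ is locally a quotient of homogeneous functions of equal degree, and its order is
  the difference of the orders of numerator and denominator.\<close>

lemma local_parameter_chart:
  assumes T: "chart_param T s0" "s0 \<in> S"
  shows "YY.local_parameter (orbit v (omS s0)) U (\<lambda>y. T (kap y))"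
proof -
  define y0 where "y0 = orbit v (omS s0)"
  have y0: "y0 \<in> U" "kap y0 = s0" using S_props[OF T(2)] by (auto simp: y0_def)
  have T': "T \<in> poly_funs 3" "T s0 = 0" "\<exists>s\<in>S. T s \<noteq> 0" using T unfolding chart_param_def by blast+
  have gT: "YY.germ U (\<lambda>y. T (kap y))" using U_open y0(1) kap_poly_reg[OF T'(1)] by auto
  obtain s1 where s1: "s1 \<in> S" "T s1 \<noteq> 0" using T'(3) by blast
  define x1 where "x1 = orbit v (omS s1)"
  have x1: "x1 \<in> U" "T (kap x1) \<noteq> 0" unfolding x1_def using S_props[OF s1(1)] s1(2) by simp_all
  have "\<exists>k. YY.ord_is y0 U (\<lambda>y. T (kap y)) V f k" if f: "YY.germ V f" and z1: "z1 \<in> V" "f z1 \<noteq> 0" for V f z1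
  proof -
    have "f \<in> reg YY V" using f by simp
    then obtain W0 where W0: "openin (zar YY) W0" "z1 \<in> W0" "W0 \<subseteq> V" "weighted_Fr v W0 f"
      using z1(1) by (rule YY.regE)
    obtain e p q where pq: "p \<in> homogeneous_funs v e" "q \<in> homogeneous_funs v e"
      "\<And>z x. z \<in> W0 \<Longrightarrow> x \<in> z \<Longrightarrow> q x \<noteq> 0 \<and> f z = p x / q x"
      using W0(4) unfolding weighted_Fr_def by blast
    have "z1 \<in> points YY" using openin_subset[OF W0(1)] W0(2) by blast
    then obtain x where x: "x \<in> Cp" "z1 = orbit v x" by (rule YY_cases)
    have "q x \<noteq> 0" "p x \<noteq> 0" using pq(3)[OF W0(2), of x] x orbit_self' z1(2) by auto
    then have ne: "\<exists>x\<in>C. p x \<noteq> 0" "\<exists>x\<in>C. q x \<noteq> 0" using x(1) Cp_sub by blast+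
    obtain n P W where P: "P \<in> poly_funs 3" "W \<in> poly_funs 3" "P s0 \<noteq> 0" "W s0 \<noteq> 0"
      "\<And>s. s \<in> S \<Longrightarrow> W s * p (omS s) = T s ^ n * P s" by (rule order_form[OF T pq(1) ne(1)]) blast
    obtain n' P' W' where P': "P' \<in> poly_funs 3" "W' \<in> poly_funs 3" "P' s0 \<noteq> 0" "W' s0 \<noteq> 0"
      "\<And>s. s \<in> S \<Longrightarrow> W' s * q (omS s) = T s ^ n' * P' s" by (rule order_form[OF T pq(2) ne(2)]) blast
    define num where "num s = P s * W' s" for s
    define den where "den s = W s * P' s" for s
    have nd: "num \<in> poly_funs 3" "den \<in> poly_funs 3" unfolding num_def den_def using P P' by (auto intro: poly_funs_mult)
    define A where "A = {y \<in> U. den (kap y) \<noteq> 0}"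
    have A: "openin (zar YY) A" unfolding A_def by (rule YY.reg_open[OF kap_poly_reg[OF nd(2)]])
    have yA: "y0 \<in> A" unfolding A_def den_def using y0 P P' by simp
    have "(\<lambda>y. num (kap y) / den (kap y)) \<in> reg YY A"
      by (rule YY.reg_divide[OF YY.reg_mono[OF kap_poly_reg[OF nd(1)] _ A] YY.reg_mono[OF kap_poly_reg[OF nd(2)] _ A]])
        (auto simp: A_def)
    then have gA: "YY.germ A (\<lambda>y. num (kap y) / den (kap y))" using A yA by blast
    have "YY.ord_is y0 U (\<lambda>y. T (kap y)) V f (int n - int n')"
    proof (rule YY.ord_isI_dense[OF f gA yA _ gT x1 W0(1)])
      show "num (kap y0) / den (kap y0) \<noteq> 0" unfolding y0(2) num_def den_def using P P' by simp
      show "W0 \<noteq> {}" using W0(2) by blast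
      fix y assume y: "y \<in> W0" "y \<in> A" "y \<in> V" "y \<in> U" "T (kap y) \<noteq> 0"
      define s where "s = kap y"
      have s: "s \<in> S" "orbit v (omS s) = y" "T s \<noteq> 0" unfolding s_def using y kap_S orbit_omS_kap by auto
      have "omS s \<in> y" using orbit_self'[OF S_props(1)[OF s(1)]] s(2) by simp
      then have fy: "q (omS s) \<noteq> 0" "f y = p (omS s) / q (omS s)" using pq(3)[OF y(1)] by auto
      have d: "W s \<noteq> 0" "P' s \<noteq> 0" using y(2) unfolding A_def den_def s_def by auto
      then have "T s ^ n' * P' s \<noteq> 0" using s(3) by simp
      then have "W' s \<noteq> 0" using P'(5)[OF s(1)] by auto
      have "p (omS s) = T s ^ n * P s / W s" using P(5)[OF s(1)] d by (simp add: field_simps)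
      moreover have "q (omS s) = T s ^ n' * P' s / W' s" using P'(5)[OF s(1)] \<open>W' s \<noteq> 0\<close> by (simp add: field_simps)
      ultimately have "f y = num s / den s * (T s ^ n / T s ^ n')"
        unfolding fy(2) num_def den_def by (simp add: mult_ac)
      also have "T s ^ n / T s ^ n' = T s powi (int n - int n')" using s(3) by (simp add: power_int_diff)
      finally show "f y = num (kap y) / den (kap y) * T (kap y) powi (int n - int n')" by (simp add: s_def)
    qed
    then show ?thesis by blast
  qed
  moreover have "T (kap y0) = 0" unfolding y0(2) by (rule T'(2))
  ultimately show ?thesis unfolding YY.local_parameter_def y0_def[symmetric] using gT y0(1) x1 by blast
qed

definition param :: "'k list set \<Rightarrow> 'k list \<Rightarrow> 'k" where
  "param y = (if kap y ! 0 = 0 then (\<lambda>s. s ! 0) else (\<lambda>s. s ! 1 - kap y ! 1))"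

lemma local_parameter_param:
  assumes "y \<in> U" shows "YY.local_parameter y U (\<lambda>z. param y (kap z))"
proof -
  have "chart_param (param y) (kap y)"
    unfolding param_def using chart_param_z[OF kap_S[OF assms]] chart_param_t[OF kap_S[OF assms]] by simp
  from local_parameter_chart[OF this kap_S[OF assms]] show ?thesis
    unfolding orbit_omS_kap[OF assms] .
qed

text \<open>Dividing by \<open>z^(c i)\<close> leaves a Laurent monomial without \<open>x_i\<close>,
  which is a unit at a point where \<open>x_j\<close> and \<open>x_k\<close> are nonzero.\<close>

lemma ord_wm_zero:
  assumes x: "x \<in> Cp" "x ! i = 0" "x ! j \<noteq> 0" "x ! k \<noteq> 0" and c: "weight0 c"
    and V: "YY.germ V (wm c)"
  shows "YY.ord_is (orbit v x) U (\<lambda>z. param (orbit v x) (kap z)) V (wm c) (c i)"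
proof -
  have "kap (orbit v x) ! 0 = 0" using x by (simp add: kap_orbit lmono_cz)
  then have par: "param (orbit v x) (kap z) = wm cz z" for z by (simp add: param_def kap_def)
  define c' where "c' l = c l + - c i * cz l" for l
  have "(\<Sum>l<3. c' l * int (v ! l)) = (\<Sum>l<3. c l * int (v ! l)) - c i * (\<Sum>l<3. cz l * int (v ! l))"
    by (simp add: c'_def sum_distrib_left left_diff_distrib sum_subtractf mult.assoc)
  then have w: "weight0 c'" using c weight0_cz by simp
  have c'i: "c' i = 0" by (simp add: c'_def)
  have xU: "orbit v x \<in> U" using U_iff[OF x(1)] x by simp
  have "wm c' \<in> reg YY U"
  proof (rule wm_reg[OF w U_open])
    fix x l assume "x \<in> Cp" "orbit v x \<in> U" "l < 3" "c' l < 0"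
    then show "x ! l \<noteq> 0" using U_iff[of x] axes_cases[of l] c'i by auto
  qed
  then have g: "YY.germ U (wm c')" using U_open xU by blast
  have "wm c' (orbit v x) \<noteq> 0" unfolding wm_orbit[OF x(1) w]
    by (rule lmono_nonzero) (use x c'i axes_cases in auto)
  moreover have "wm c y = wm c' y * wm cz y powi c i" if y: "y \<in> U" "wm cz y \<noteq> 0" for y
  proof -
    obtain x where x: "x \<in> Cp" "y = orbit v x" "x ! j \<noteq> 0" "x ! k \<noteq> 0" using y(1) by (rule U_cases)
    have "x ! i \<noteq> 0" using y(2) unfolding x(2) wm_orbit[OF x(1) weight0_cz] lmono_cz by auto
    then have nz: "x ! l \<noteq> 0" if "l < 3" for l using x axes_cases[OF that] by auto
    have "lmono c' x * lmono cz x powi c i = (\<Prod>l<3. x ! l powi c' l * x ! l powi (c i * cz l))"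
      unfolding lmono_def prod.distrib by (simp add: prod3 power_int_mult_distrib flip: power_int_mult) (simp add: mult.commute)
    also have "\<dots> = lmono c x" unfolding lmono_def
      by (intro prod.cong refl) (use nz in \<open>simp add: power_int_add[symmetric] c'_def\<close>)
    finally show ?thesis unfolding x(2) wm_orbit[OF x(1) w] wm_orbit[OF x(1) c] wm_orbit[OF x(1) weight0_cz] by simp
  qed
  ultimately show ?thesis unfolding YY.ord_is_def par using g xU
    by (intro exI[of _ U] exI[of _ "wm c'"]) auto
qed

end

subsection \<open>Global structure of the curve\<close>

lemma (in frac_space) closedin_finite:
  assumes "separating" "finite Z" "Z \<subseteq> points Y" shows "closedin (zar Y) Z"
  using assms(2,3)
proof (induction Z)
  case (insert y Z)
  then show ?case using closed_point[OF assms(1), of y] closedin_Un[of "zar Y" "{y}" Z] by simp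
qed simp

lemma morphism_id: "morphism Y Y id"
proof -
  have "{x \<in> points Y. id x \<in> V} = V" if "openin (zar Y) V" for V
    using openin_subset[OF that] by auto
  then show ?thesis unfolding morphism_def by simp
qed

context pham_curve begin

lemma chart_exists:
  assumes "{i, j, k} = {0, 1, 2 :: nat}" obtains al be where "pham_chart a C v D i j k al be"
proof -
  interpret A: pham_axes a C i j k by unfold_locales (rule assms)
  have "gcd (v ! j) (v ! k) = 1" using v_coprime A.axes_less A.axes_neq by blast
  then have "gcd (int (v ! j)) (int (v ! k)) = 1" by (simp only: gcd_int_int_eq of_nat_1)
  then obtain al be where "al * int (v ! j) + be * int (v ! k) = 1" using bezout_int by metis
  then have "pham_chart a C v D i j k al be" by unfold_locales
  then show ?thesis by (rule that)
qed

text \<open>Were a second coordinate zero, the equation would kill the third, and the point would be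
  the origin.\<close>

lemma coords_nonzero:
  assumes "{i, j, k} = {0, 1, 2 :: nat}" "x \<in> Cp" "x ! i = 0" shows "x ! j \<noteq> 0" "x ! k \<noteq> 0"
proof -
  interpret A: pham_axes a C i j k by unfold_locales (rule assms(1))
  have eq: "x ! j ^ a j + x ! k ^ a k = 0"
    using assms A.mem_C A.axes_pos unfolding Cp_def by (auto simp: power_0_left)
  obtain l where "l < 3" "x ! l \<noteq> 0" using assms(2) unfolding Cp_def by blast
  then have "x ! j \<noteq> 0 \<or> x ! k \<noteq> 0" using A.axes_cases assms(3) by blast
  then show "x ! j \<noteq> 0" "x ! k \<noteq> 0" using eq A.axes_pos by (auto simp: power_0_left)
qed

text \<open>The axes are chosen such that a vanishing coordinate, of which there is at most one,
  becomes \<open>x_i\<close>.\<close>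

lemma good_axes:
  assumes "x \<in> Cp"
  obtains i j k where "{i, j, k} = {0, 1, 2 :: nat}" "x ! j \<noteq> 0" "x ! k \<noteq> 0" "(\<forall>l<3. x ! l \<noteq> 0) \<or> x ! i = 0"
proof (cases "\<forall>l<3. x ! l \<noteq> 0")
  case True
  then show ?thesis by (intro that[of 0 1 2]) auto
next
  case False
  then obtain l where l: "l < 3" "x ! l = 0" by blast
  then have "l = 0 \<or> l = 1 \<or> l = 2" by linarith
  then have "\<exists>j k. {l, j, k} = {0, 1, 2}" by (elim disjE) (rule exI[of _ 1], rule exI[of _ 2], simp,
      rule exI[of _ 0], rule exI[of _ 2], auto)
  then obtain j k where p: "{l, j, k} = {0, 1, 2}" by blast
  show ?thesis by (rule that[OF p]) (use coords_nonzero[OF p assms l(2)] l in auto)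
qed

lemma separating_YY: "YY.separating"
  unfolding YY.separating_def
proof (intro ballI impI)
  fix y y' assume "y \<in> points YY" "y' \<in> points YY" and ne: "y \<noteq> y'"
  then obtain x x' where x: "x \<in> Cp" "y = orbit v x" and x': "x' \<in> Cp" "y' = orbit v x'"
    using YY_cases by metis
  let ?G = "\<exists>V f. openin (zar YY) V \<and> y \<in> V \<and> y' \<in> V \<and> f \<in> reg YY V \<and> f y \<noteq> f y'"
  have common: ?G if p: "{i, j, k} = {0, 1, 2}" and nz: "x ! j \<noteq> 0" "x ! k \<noteq> 0" "x' ! j \<noteq> 0" "x' ! k \<noteq> 0" for i j k
  proof -
    obtain al be where "pham_chart a C v D i j k al be" by (rule chart_exists[OF p])
    then interpret A: pham_chart a C v D i j k al be .
    have U: "y \<in> A.U" "y' \<in> A.U" using A.U_iff x x' nz by auto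
    have "A.kap y \<noteq> A.kap y'" using A.orbit_omS_kap[OF U(1)] A.orbit_omS_kap[OF U(2)] ne by metis
    then obtain l where l: "l < 3" "A.kap y ! l \<noteq> A.kap y' ! l"
      using A.S_props(7)[OF A.kap_S[OF U(1)]] A.S_props(7)[OF A.kap_S[OF U(2)]] nth_equalityI[of "A.kap y" "A.kap y'"]
      by auto
    show ?thesis using U l A.U_open A.kap_reg[OF l(1)] by (intro exI[of _ A.U] exI[of _ "\<lambda>y. A.kap y ! l"]) simp
  qed
  \<comment> \<open>Two points need not lie in a common chart. If \<open>x_i\<close> vanishes at
    exactly one of them and \<open>x_k\<close> at neither, \<open>x_i^(v_k) / x_k^(v_i)\<close>
    separates them on \<open>x_k \<noteq> 0\<close>.\<close>
  have different: ?G if p: "{i, j, k} = {0, 1, 2}" and nz: "x ! i = 0" "x' ! i \<noteq> 0" "x ! k \<noteq> 0" "x' ! k \<noteq> 0" for i j k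
  proof -
    obtain al be where "pham_chart a C v D i j k al be" by (rule chart_exists[OF p])
    then interpret A: pham_chart a C v D i j k al be .
    define c where "c l = (if l = i then int (v ! k) else if l = k then - int (v ! i) else 0)" for l
    have c: "c i = int (v ! k)" "c j = 0" "c k = - int (v ! i)" using A.axes_neq by (simp_all add: c_def)
    have w: "weight0 c" by (simp add: A.sum3 c)
    have kh: "(\<lambda>x. x ! k) \<in> homogeneous_funs v (v ! k)"
      using homogeneous_funs_coord[of k v] A.axes_less by (simp add: v_len)
    have V: "openin (zar YY) (YD (\<lambda>x. x ! k))" by (rule YD_open[OF kh])
    have "wm c \<in> reg YY (YD (\<lambda>x. x ! k))"
    proof (rule wm_reg[OF w V])
      fix z l assume "z \<in> Cp" "orbit v z \<in> YD (\<lambda>x. x ! k)" "l < 3" "c l < 0"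
      then show "z ! l \<noteq> 0" using YD_iff[OF kh, of z] by (auto simp: c_def split: if_splits)
    qed
    moreover have "wm c y = 0" using v_pos[OF A.axes_less(3)] nz(1)
      unfolding x(2) wm_orbit[OF x(1) w] by (simp add: lmono_def A.prod3 c power_0_left)
    moreover have "wm c y' \<noteq> 0" using nz
      unfolding x'(2) wm_orbit[OF x'(1) w] by (simp add: lmono_def A.prod3 c)
    moreover have "y \<in> YD (\<lambda>x. x ! k)" "y' \<in> YD (\<lambda>x. x ! k)"
      using YD_iff[OF kh] x x' nz by auto
    ultimately show ?thesis using V by (intro exI[of _ "YD (\<lambda>x. x ! k)"] exI[of _ "wm c"]) auto
  qed
  obtain i j k where p: "{i, j, k} = {0, 1, 2 :: nat}" and nz: "x ! j \<noteq> 0" "x ! k \<noteq> 0"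
    by (rule good_axes[OF x(1)])
  have p': "{j, i, k} = {0, 1, 2}" "{k, i, j} = {0, 1, 2}" "{i, k, j} = {0, 1, 2}"
    unfolding p[symmetric] by (simp_all only: insert_commute)
  consider "x' ! j \<noteq> 0" "x' ! k \<noteq> 0" | "x' ! j = 0" | "x' ! k = 0" by blast
  then show ?G
  proof cases
    case 1 then show ?thesis by (rule common[OF p nz])
  next
    case 2
    then have nz': "x' ! i \<noteq> 0" "x' ! k \<noteq> 0" using coords_nonzero[OF p'(1) x'(1)] by auto
    show ?thesis
    proof (cases "x ! i = 0")
      case True then show ?thesis by (rule different[OF p _ nz'(1) nz(2) nz'(2)])
    next
      case False then show ?thesis by (rule common[OF p'(1) _ nz(2) nz'])
    qed
  next
    case 3
    then have nz': "x' ! i \<noteq> 0" "x' ! j \<noteq> 0" using coords_nonzero[OF p'(2) x'(1)] by auto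
    show ?thesis
    proof (cases "x ! i = 0")
      case True then show ?thesis by (rule different[OF p'(3) _ nz'(1) nz(1) nz'(2)])
    next
      case False then show ?thesis by (rule common[OF p'(2) _ nz(1) nz'])
    qed
  qed
qed

lemma axes_list: "{0, 1, 2} = {0, 1, 2 :: nat}" "{1, 0, 2} = {0, 1, 2 :: nat}" "{2, 0, 1} = {0, 1, 2 :: nat}"
  by auto

lemma cover:
  assumes "y \<in> points YY"
  shows "y \<in> YD (\<lambda>x. x ! 1 * x ! 2) \<or> y \<in> YD (\<lambda>x. x ! 0 * x ! 2) \<or> y \<in> YD (\<lambda>x. x ! 0 * x ! 1)"
proof -
  obtain x where x: "x \<in> Cp" "y = orbit v x" using assms by (rule YY_cases)
  have "(x ! 1 \<noteq> 0 \<and> x ! 2 \<noteq> 0) \<or> (x ! 0 \<noteq> 0 \<and> x ! 2 \<noteq> 0) \<or> (x ! 0 \<noteq> 0 \<and> x ! 1 \<noteq> 0)"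
    using coords_nonzero[OF axes_list(1) x(1)] coords_nonzero[OF axes_list(2) x(1)] by blast
  then show ?thesis unfolding x(2) YD_def using x(1) by auto
qed

lemma affine_open_YD:
  assumes "{i, j, k} = {0, 1, 2 :: nat}" shows "affine_open YY (YD (\<lambda>x. x ! j * x ! k))"
proof -
  obtain al be where "pham_chart a C v D i j k al be" by (rule chart_exists[OF assms])
  then interpret A: pham_chart a C v D i j k al be .
  show ?thesis using A.affine_open_U unfolding A.U_def .
qed

lemma variety_YY: "variety YY"
  unfolding variety_def
proof (intro conjI YY.irreducible_points YY.separatedI separating_YY)
  let ?\<U> = "{YD (\<lambda>x. x ! 1 * x ! 2), YD (\<lambda>x. x ! 0 * x ! 2), YD (\<lambda>x. x ! 0 * x ! 1)}"
  have "affine_open YY V" if "V \<in> ?\<U>" for V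
    using that affine_open_YD[OF axes_list(1)] affine_open_YD[OF axes_list(2)] affine_open_YD[OF axes_list(3)] by auto
  moreover have "\<Union>?\<U> = points YY"
    using cover by (auto simp: YD_def points_YY)
  ultimately show "\<exists>\<U>. finite \<U> \<and> (\<forall>U\<in>\<U>. affine_open YY U) \<and> \<Union>\<U> = points YY"
    by (intro exI[of _ ?\<U>]) auto
qed

lemma projective_variety_YY: "projective_variety YY"
  unfolding projective_variety_def
proof (intro conjI variety_YY exI[of _ v] exI[of _ "wproj_zero_set v Feq"] closedin_zero_set)
  show "\<forall>w\<in>set v. 0 < w" using v_pos v_len by (auto simp: in_set_conv_nth)
  show "isomorphic YY (wproj_space_on v (wproj_zero_set v Feq))"
    unfolding isomorphic_def YY_def[symmetric] using morphism_id[of YY] by (intro exI[of _ id]) simp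
qed

text \<open>The complement of \<open>Z\<close> contains the nonvanishing locus of some nonzero
  homogeneous \<open>p\<close>, and \<open>p\<close> has finitely many zeros on each of the three
  charts.\<close>

lemma finite_closed:
  assumes "closedin (zar YY) Z" "Z \<noteq> points YY" shows "finite Z"
proof -
  have "openin (zar YY) (points YY - Z)" using assms(1) by (simp add: closedin_def)
  moreover obtain y where y: "y \<in> points YY" "y \<notin> Z" using assms closedin_subset by blast
  moreover obtain x where x: "x \<in> Cp" "y = orbit v x" using y(1) by (rule YY_cases)
  ultimately obtain p e where p: "p \<in> homogeneous_funs v e" "p x \<noteq> 0" "YD p \<subseteq> points YY - Z"
    using YY_basis[of "points YY - Z" x] by blast
  have ne: "\<exists>x\<in>C. p x \<noteq> 0" using p(2) x(1) Cp_sub by blast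
  have fin: "finite {y \<in> YD (\<lambda>x. x ! j * x ! k). y \<notin> YD p}" if p': "{i, j, k} = {0, 1, 2 :: nat}" for i j k
  proof -
    obtain al be where "pham_chart a C v D i j k al be" by (rule chart_exists[OF p'])
    then interpret A: pham_chart a C v D i j k al be .
    show ?thesis using A.finite_zeros_U[OF p(1) ne] unfolding A.U_def .
  qed
  have "Z \<subseteq> {y \<in> YD (\<lambda>x. x ! 1 * x ! 2). y \<notin> YD p} \<union> {y \<in> YD (\<lambda>x. x ! 0 * x ! 2). y \<notin> YD p} \<union>
      {y \<in> YD (\<lambda>x. x ! 0 * x ! 1). y \<notin> YD p}"
    using cover p(3) closedin_subset[OF assms(1)] by blast
  then show ?thesis
    using fin[OF axes_list(1)] fin[OF axes_list(2)] fin[OF axes_list(3)] by (meson finite_UnI finite_subset)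
qed

lemma infinite_points: "infinite (points YY)"
proof
  assume fin: "finite (points YY)"
  obtain al be where "pham_chart a C v D 0 1 2 al be" by (rule chart_exists[OF axes_list(1)])
  then interpret A: pham_chart a C v D 0 1 2 al be .
  obtain s where s: "s \<in> A.S" "s ! 1 \<notin> (\<lambda>y. A.kap y ! 1) ` points YY"
    using A.S_generic[of "(\<lambda>y. A.kap y ! 1) ` points YY"] fin by blast
  have "orbit v (A.omS s) \<in> points YY" using A.S_props(1)[OF s(1)] unfolding points_YY by blast
  then have "A.kap (orbit v (A.omS s)) ! 1 \<in> (\<lambda>y. A.kap y ! 1) ` points YY" by blast
  then show False using s(2) A.S_props(5)[OF s(1)] by simp
qed

lemma irreducible_proper:
  assumes "irreducible_closed YY Z" "Z \<noteq> points YY" obtains y where "y \<in> points YY" "Z = {y}"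
proof -
  have Z: "closedin (zar YY) Z" "Z \<noteq> {}" using assms(1) unfolding irreducible_closed_def by auto
  have fin: "finite Z" by (rule finite_closed[OF Z(1) assms(2)])
  obtain y where y: "y \<in> Z" using Z(2) by blast
  have sub: "Z \<subseteq> points YY" by (rule closedin_subset[OF Z(1)])
  have "closedin (zar YY) {y}" "closedin (zar YY) (Z - {y})"
    using YY.closedin_finite[OF separating_YY] fin y sub by (auto intro!: YY.closedin_finite[OF separating_YY])
  moreover have "Z = {y} \<union> (Z - {y})" using y by blast
  ultimately have "{y} = Z \<or> Z - {y} = Z" using assms(1) unfolding irreducible_closed_def by blast
  then have "Z = {y}" using y by blast
  then show ?thesis using that[of y] y sub by blast
qed

text \<open>Proper closed sets are finite, so an irreducible one is a point; and a point is not the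
  whole curve, which is infinite.\<close>

lemma prime_divisor_YY: "prime_divisor YY Z \<longleftrightarrow> (\<exists>y\<in>points YY. Z = {y})"
proof
  assume "prime_divisor YY Z"
  then show "\<exists>y\<in>points YY. Z = {y}" unfolding prime_divisor_def using irreducible_proper by metis
next
  assume "\<exists>y\<in>points YY. Z = {y}"
  then obtain y where y: "y \<in> points YY" "Z = {y}" by blast
  have "irreducible_closed YY {y}"
    unfolding irreducible_closed_def using YY.closed_point[OF separating_YY y(1)] by blast
  moreover have "{y} \<noteq> points YY" using infinite_points by (metis finite.emptyI finite_insert)
  moreover have False if "irreducible_closed YY Z'" "{y} \<subset> Z'" "Z' \<subset> points YY" for Z'
    using irreducible_proper[OF that(1)] that(2,3) by blast
  ultimately show "prime_divisor YY Z" unfolding prime_divisor_def y(2) by blast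
qed

text \<open>On the punctured cone at most one coordinate vanishes, so the sum has at most one
  nonzero term: the order of the monomial at the point.\<close>

definition zsum :: "'k list \<Rightarrow> (nat \<Rightarrow> int) \<Rightarrow> int" where
  "zsum x c = (\<Sum>l<3. if x ! l = 0 then c l else 0)"

lemma U012_hom: "(\<lambda>x. x ! 0 * x ! 1 * x ! 2) \<in> homogeneous_funs v (v ! 0 + v ! 1 + v ! 2)"
  by (intro homogeneous_funs_mult homogeneous_funs_coord) (simp_all add: v_len)

definition U012 :: "'k list set set" where "U012 = YD (\<lambda>x. x ! 0 * x ! 1 * x ! 2)"

lemma less3: "(\<forall>l<3. P l) \<longleftrightarrow> P 0 \<and> P 1 \<and> P (2 :: nat)"
  by (auto simp: numeral_3_eq_3 numeral_2_eq_2 less_Suc_eq)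

lemma U012_iff: "x \<in> Cp \<Longrightarrow> orbit v x \<in> U012 \<longleftrightarrow> (\<forall>l<3. x ! l \<noteq> 0)"
  unfolding U012_def less3 by (subst YD_iff[OF U012_hom]) auto

lemma U012_open: "openin (zar YY) U012"
  unfolding U012_def by (rule YD_open[OF U012_hom])

lemma U012_nonempty: "U012 \<noteq> {}"
proof -
  have "\<exists>x\<in>Cp. x ! 0 * x ! 1 \<noteq> 0 \<and> x ! 2 \<noteq> 0"
  proof (rule domain_Cp)
    show "(\<lambda>x :: 'k list. x ! 0 * x ! 1) \<in> poly_funs 3" "(\<lambda>x :: 'k list. x ! 2) \<in> poly_funs 3"
      by (auto intro!: poly_funs_intros)
    show "\<exists>x\<in>C. x ! 2 \<noteq> 0" by (rule coord_not_zero) simp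
    show "\<exists>x\<in>C. x ! 0 * x ! 1 \<noteq> 0"
      by (rule domain) (auto intro!: poly_funs_intros coord_not_zero)
  qed
  then show ?thesis unfolding U012_def YD_def by auto
qed

lemma U012_cases:
  assumes "y \<in> U012" obtains x where "x \<in> Cp" "y = orbit v x" "\<And>l. l < 3 \<Longrightarrow> x ! l \<noteq> 0"
proof -
  have "y \<in> points YY" using assms openin_subset[OF U012_open] by blast
  then obtain x where "x \<in> Cp" "y = orbit v x" by (rule YY_cases)
  then show ?thesis using U012_iff assms that by blast
qed

lemma wm_germ: "weight0 c \<Longrightarrow> YY.germ U012 (wm c)"
  using wm_reg[OF _ U012_open, of c] U012_iff U012_open U012_nonempty by blast

text \<open>One parameter serves all monomials at once, so that orders of products with monomials
  can be added.\<close>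

lemma param_exists:
  assumes x: "x \<in> Cp"
  obtains U t where "YY.local_parameter (orbit v x) U t"
    "\<And>c V. weight0 c \<Longrightarrow> YY.germ V (wm c) \<Longrightarrow> YY.ord_is (orbit v x) U t V (wm c) (zsum x c)"
proof -
  obtain i j k where p: "{i, j, k} = {0, 1, 2 :: nat}" and nz: "x ! j \<noteq> 0" "x ! k \<noteq> 0"
    and i: "(\<forall>l<3. x ! l \<noteq> 0) \<or> x ! i = 0" by (rule good_axes[OF x])
  obtain al be where "pham_chart a C v D i j k al be" by (rule chart_exists[OF p])
  then interpret A: pham_chart a C v D i j k al be .
  have xU: "orbit v x \<in> A.U" using A.U_iff[OF x] nz by blast
  show ?thesis
  proof (rule that[OF A.local_parameter_param[OF xU]])
    fix c V assume c: "weight0 c" and V: "YY.germ V (wm c)"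
    show "YY.ord_is (orbit v x) A.U (\<lambda>z. A.param (orbit v x) (A.kap z)) V (wm c) (zsum x c)"
    proof (cases "x ! i = 0")
      case True
      then have "zsum x c = c i" unfolding zsum_def by (simp add: A.sum3 nz)
      then show ?thesis using A.ord_wm_zero[OF x True nz c V] by simp
    next
      case False
      \<comment> \<open>With all coordinates nonzero every monomial is a unit at the point.\<close>
      then have all: "\<forall>l<3. x ! l \<noteq> 0" using i by blast
      then have z: "zsum x c = 0" unfolding zsum_def by simp
      have "wm c (orbit v x) \<noteq> 0" unfolding wm_orbit[OF x c] by (rule lmono_nonzero) (use all in blast)
      then show ?thesis unfolding YY.ord_is_def z using wm_germ[OF c] U012_iff[OF x] all
        by (intro exI[of _ U012] exI[of _ "wm c"]) simp
    qed
  qed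
qed

lemma normal_variety_YY: "normal_variety YY"
  unfolding normal_variety_def
proof (intro conjI variety_YY ballI)
  fix y assume "y \<in> points YY"
  then obtain x where x: "x \<in> Cp" "y = orbit v x" by (rule YY_cases)
  obtain U t where "YY.local_parameter (orbit v x) U t" by (rule param_exists[OF x(1)])
  then show "integrally_closed_in (function_field YY) (local_ring YY {y})"
    unfolding x(2) by (rule YY.integrally_closed_lp)
qed

end

subsection \<open>Divisors on the curve\<close>

context pham_curve begin

lemma orbit_coord: "x \<in> Cp \<Longrightarrow> x' \<in> Cp \<Longrightarrow> orbit v x = orbit v x' \<Longrightarrow> l < 3 \<Longrightarrow> x ! l = 0 \<longleftrightarrow> x' ! l = 0"
  using orbit_eqD[of x x'] sc_nth[OF Cp_len, of x' l] by force

definition coord_points :: "nat \<Rightarrow> 'k list set set" where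
  "coord_points l = orbit v ` {x \<in> Cp. x ! l = 0}"

lemma coord_points_iff: "x \<in> Cp \<Longrightarrow> l < 3 \<Longrightarrow> orbit v x \<in> coord_points l \<longleftrightarrow> x ! l = 0"
  unfolding coord_points_def using orbit_coord by blast

lemma finite_coord_points:
  assumes "l < 3" shows "finite (coord_points l)"
proof -
  have h: "(\<lambda>x. x ! l) \<in> homogeneous_funs v (v ! l)" using homogeneous_funs_coord[of l v] assms by (simp add: v_len)
  have eq: "coord_points l = points YY - YD (\<lambda>x. x ! l)"
    unfolding points_YY using YD_iff[OF h] unfolding coord_points_def by fastforce
  have "openin (zar YY) (YD (\<lambda>x. x ! l))" by (rule YD_open[OF h])
  then have "closedin (zar YY) (coord_points l)" unfolding eq by (simp add: closedin_diff)
  moreover have "coord_points l \<noteq> points YY"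
  proof -
    obtain x where "x \<in> C" "x ! l \<noteq> 0" using coord_not_zero[OF assms] by blast
    then have "x \<in> Cp" "x ! l \<noteq> 0" using assms unfolding Cp_def by auto
    then show ?thesis using coord_points_iff[of x l] assms unfolding points_YY by blast
  qed
  ultimately show ?thesis by (rule finite_closed)
qed

lemma weil_divisor_coord:
  assumes "l < 3" shows "weil_divisor YY (point_sum (coord_points l))"
proof -
  have "{Z. point_sum (coord_points l) Z \<noteq> 0} \<subseteq> (\<lambda>y. {y}) ` coord_points l"
    by (auto simp: point_sum_def split: if_splits)
  moreover have "prime_divisor YY {y}" if "y \<in> coord_points l" for y
    using that unfolding prime_divisor_YY points_YY coord_points_def by blast
  ultimately show ?thesis unfolding weil_divisor_def using finite_coord_points[OF assms]
    by (auto intro: finite_subset)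
qed

definition qdiv :: "(nat \<Rightarrow> rat) \<Rightarrow> 'k list set set \<Rightarrow> rat" where
  "qdiv r Z = (\<Sum>l<3. r l * of_int (point_sum (coord_points l) Z))"

lemma qdiv_orbit: "x \<in> Cp \<Longrightarrow> qdiv r {orbit v x} = (\<Sum>l<3. if x ! l = 0 then r l else 0)"
  unfolding qdiv_def by (rule sum.cong) (auto simp: point_sum_def coord_points_iff)

lemma prime_divisor_cases:
  assumes "prime_divisor YY Z" obtains x where "x \<in> Cp" "Z = {orbit v x}"
  using assms unfolding prime_divisor_YY points_YY by blast

lemma sections_iff:
  assumes "g \<in> nonzero_ratfuns YY"
  shows "g \<in> sections YY B \<longleftrightarrow> (\<forall>x\<in>Cp. 0 \<le> of_int (ord_along YY {orbit v x} g) + B {orbit v x})"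
proof -
  have "(\<forall>Z. prime_divisor YY Z \<longrightarrow> 0 \<le> of_int (ord_along YY Z g) + B Z) \<longleftrightarrow>
      (\<forall>x\<in>Cp. 0 \<le> of_int (ord_along YY {orbit v x} g) + B {orbit v x})"
    unfolding prime_divisor_YY points_YY by auto
  then show ?thesis using assms unfolding sections_def nonzero_ratfuns_def by blast
qed

lemma wm_nonzero: "weight0 c \<Longrightarrow> y \<in> U012 \<Longrightarrow> wm c y \<noteq> 0"
  by (erule U012_cases) (simp add: wm_orbit lmono_nonzero)

lemma wm_add:
  assumes "weight0 c" "weight0 c'" "y \<in> U012"
  shows "weight0 (\<lambda>l. c l + c' l)" "wm (\<lambda>l. c l + c' l) y = wm c y * wm c' y"
proof -
  show w: "weight0 (\<lambda>l. c l + c' l)" using assms(1,2) by (simp add: distrib_right sum.distrib)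
  obtain x where x: "x \<in> Cp" "y = orbit v x" "\<And>l. l < 3 \<Longrightarrow> x ! l \<noteq> 0" using assms(3) by (rule U012_cases) blast
  show "wm (\<lambda>l. c l + c' l) y = wm c y * wm c' y"
    unfolding x(2) wm_orbit[OF x(1) assms(1)] wm_orbit[OF x(1) assms(2)] wm_orbit[OF x(1) w]
    by (rule lmono_mult) (use x(3) in blast)
qed

lemma weight0_0: "weight0 (\<lambda>l. 0)" by simp

lemma wm_0: "wm (\<lambda>l. 0) y = 1" by (simp add: wm_def lmono_def)

lemma weight0_uminus: "weight0 c \<Longrightarrow> weight0 (\<lambda>l. - c l)"
  by (simp add: sum_negf)

lemma wm_uminus:
  assumes "weight0 c" "y \<in> U012" shows "wm (\<lambda>l. - c l) y * wm c y = 1"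
  using wm_add(2)[OF weight0_uminus[OF assms(1)] assms] by (simp add: wm_0)

lemma wm_ratfun: "weight0 c \<Longrightarrow> YY.R U012 (wm c) \<in> nonzero_ratfuns YY"
proof -
  assume c: "weight0 c"
  have g: "YY.germ U012 (wm c)" by (rule wm_germ[OF c])
  obtain y where "y \<in> U012" using U012_nonempty by blast
  then have "YY.R U012 (wm c) \<noteq> \<zero>\<^bsub>YY.KY\<^esub>" using YY.R_eq_zero_iff[OF g] wm_nonzero[OF c] by blast
  then show ?thesis unfolding nonzero_ratfuns_def using YY.R_carrier[OF g] by blast
qed

lemma ord_wm:
  assumes "x \<in> Cp" "weight0 c" shows "ord_along YY {orbit v x} (YY.R U012 (wm c)) = zsum x c"
proof -
  obtain U t where lp: "YY.local_parameter (orbit v x) U t"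
    and o: "\<And>c V. weight0 c \<Longrightarrow> YY.germ V (wm c) \<Longrightarrow> YY.ord_is (orbit v x) U t V (wm c) (zsum x c)"
    by (rule param_exists[OF assms(1)]) blast
  obtain y where y: "y \<in> U012" using U012_nonempty by blast
  have g: "YY.germ U012 (wm c)" by (rule wm_germ[OF assms(2)])
  show ?thesis by (rule YY.ord_along_lp[OF lp g y wm_nonzero[OF assms(2) y] o[OF assms(2) g]])
qed

lemma weight0_with_coord:
  assumes "{i, j, k} = {0, 1, 2 :: nat}" obtains c where "weight0 c" "c i = (n :: int)"
proof -
  obtain al be where "pham_chart a C v D i j k al be" by (rule chart_exists[OF assms])
  then interpret A: pham_chart a C v D i j k al be .
  have "(\<Sum>l<3. (n * A.cz l) * int (v ! l)) = n * (\<Sum>l<3. A.cz l * int (v ! l))"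
    by (simp add: sum_distrib_left mult.assoc)
  then have "weight0 (\<lambda>l. n * A.cz l)" using A.weight0_cz by simp
  then show ?thesis using that[of "\<lambda>l. n * A.cz l"] by simp
qed

lemma zsum_axes: "{i, j, k} = {0, 1, 2 :: nat} \<Longrightarrow> x ! j \<noteq> 0 \<Longrightarrow> x ! k \<noteq> 0 \<Longrightarrow>
    (\<Sum>l<3. if x ! l = 0 then c l else 0) = (if x ! i = 0 then c i else (0 :: 'b::comm_monoid_add))"
proof -
  assume p: "{i, j, k} = {0, 1, 2 :: nat}" and nz: "x ! j \<noteq> 0" "x ! k \<noteq> 0"
  obtain al be where "pham_chart a C v D i j k al be" by (rule chart_exists[OF p])
  then interpret A: pham_chart a C v D i j k al be .
  show ?thesis by (simp add: A.sum3 nz)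
qed

text \<open>A monomial whose exponent equals the order of \<open>g\<close> absorbs the zero or pole
  along the vanishing coordinate. At a point without vanishing coordinate no monomial can change the
  order; the trivial one is used, and then \<open>g\<close> itself must be regular.\<close>

lemma section_local:
  assumes g: "g \<in> nonzero_ratfuns YY" and x: "x \<in> Cp"
    and k: "(\<exists>l<3. x ! l = 0) \<or> ord_along YY {orbit v x} g \<ge> 0"
  obtains c V u where "weight0 c" "YY.germ V u" "orbit v x \<in> V"
    "g = YY.R (V \<inter> U012) (\<lambda>y. u y * wm c y)"
    "\<And>l. l < 3 \<Longrightarrow> x ! l = 0 \<Longrightarrow> c l = ord_along YY {orbit v x} g"
proof -
  define k where "k = ord_along YY {orbit v x} g"
  obtain V0 f where f: "YY.germ V0 f" "g = YY.R V0 f" "\<And>x. x \<in> V0 \<Longrightarrow> f x \<noteq> 0"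
    using g YY.nonzero_nonvanishing unfolding nonzero_ratfuns_def by (metis DiffD1 DiffD2 singletonI)
  obtain y0 where y0: "y0 \<in> V0" using f(1) by blast
  obtain U t where lp: "YY.local_parameter (orbit v x) U t"
    and o: "\<And>c V. weight0 c \<Longrightarrow> YY.germ V (wm c) \<Longrightarrow> YY.ord_is (orbit v x) U t V (wm c) (zsum x c)"
    by (rule param_exists[OF x]) blast
  obtain k' where k': "YY.ord_is (orbit v x) U t V0 f k'"
    using YY.lp_exists[OF lp f(1) y0 f(3)[OF y0]] by blast
  then have "k' = k" using YY.ord_along_lp[OF lp f(1) y0 f(3)[OF y0]] f(2) k_def by simp
  with k' have ok: "YY.ord_is (orbit v x) U t V0 f k" by simp
  obtain c where c: "weight0 c" "zsum x c = k \<or> (\<forall>l. c l = 0) \<and> k \<ge> 0" "\<And>l. l < 3 \<Longrightarrow> x ! l = 0 \<Longrightarrow> c l = k"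
  proof (cases "\<forall>l<3. x ! l \<noteq> 0")
    case True
    then show ?thesis using that[OF weight0_0] assms(3) unfolding k_def by auto
  next
    case False
    obtain i j l where p: "{i, j, l} = {0, 1, 2 :: nat}" and nz: "x ! j \<noteq> 0" "x ! l \<noteq> 0" and i: "x ! i = 0"
      using good_axes[OF x] False by metis
    obtain c where c: "weight0 c" "c i = k" by (rule weight0_with_coord[OF p])
    show ?thesis
    proof (rule that[OF c(1)])
      show "zsum x c = k \<or> (\<forall>l. c l = 0) \<and> k \<ge> 0"
        unfolding zsum_def zsum_axes[OF p nz] using i c(2) by simp
      fix l' assume "l' < 3" "x ! l' = 0"
      moreover have "l' \<in> {i, j, l}" unfolding p using \<open>l' < 3\<close> by auto
      ultimately show "c l' = k" using nz c(2) by blast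
    qed
  qed
  have c': "weight0 (\<lambda>l. - c l)" by (rule weight0_uminus[OF c(1)])
  have z: "zsum x (\<lambda>l. - c l) = - zsum x c" unfolding zsum_def sum_negf[symmetric] by (rule sum.cong) auto
  have zc: "zsum x c = 0" if "\<forall>l. c l = 0" unfolding zsum_def by (rule sum.neutral) (use that in simp)
  have G: "YY.germ (V0 \<inter> U012) (\<lambda>y. f y * wm (\<lambda>l. - c l) y)"
    by (rule YY.germ_mult[OF f(1) wm_germ[OF c']])
  have oG: "YY.ord_is (orbit v x) U t (V0 \<inter> U012) (\<lambda>y. f y * wm (\<lambda>l. - c l) y) (k + zsum x (\<lambda>l. - c l))"
    by (rule YY.ord_is_mult[OF ok o[OF c' wm_germ[OF c']]])
  have "0 \<le> k + zsum x (\<lambda>l. - c l)" using c(2) z zc by auto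
  then have "YY.R (V0 \<inter> U012) (\<lambda>y. f y * wm (\<lambda>l. - c l) y) \<in> local_ring YY {orbit v x}"
    using YY.ord_is_local_iff[OF lp G oG] by blast
  then obtain V u where u: "YY.germ V u" "orbit v x \<in> V"
      "YY.R (V0 \<inter> U012) (\<lambda>y. f y * wm (\<lambda>l. - c l) y) = YY.R V u"
    by (rule YY.local_ringE)
  have eq: "\<forall>y\<in>V0 \<inter> U012 \<inter> V. f y * wm (\<lambda>l. - c l) y = u y" using u(3) YY.R_eq_iff[OF G u(1)] by blast
  have gu: "YY.germ (V \<inter> U012) (\<lambda>y. u y * wm c y)" by (rule YY.germ_mult[OF u(1) wm_germ[OF c(1)]])
  have "g = YY.R (V \<inter> U012) (\<lambda>y. u y * wm c y)" unfolding f(2)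
  proof (rule YY.R_eqI[OF f(1) gu, of U012])
    fix y assume y: "y \<in> U012" "y \<in> V0" "y \<in> V \<inter> U012"
    then have "f y * wm (\<lambda>l. - c l) y = u y" using eq by blast
    then have "u y * wm c y = f y * (wm (\<lambda>l. - c l) y * wm c y)" by (simp add: mult.assoc)
    then show "f y = u y * wm c y" using wm_uminus[OF c(1) y(1)] by simp
  qed (rule U012_open U012_nonempty)+
  then show ?thesis by (rule that[OF c(1) u(1,2) _ c(3)[unfolded k_def]])
qed

lemma ord_ge:
  assumes c: "weight0 c" and u: "YY.germ V u" "orbit v x \<in> V" and x: "x \<in> Cp"
    and g: "g = YY.R (V \<inter> U012) (\<lambda>y. u y * wm c y)" "g \<in> nonzero_ratfuns YY"
  shows "ord_along YY {orbit v x} g \<ge> zsum x c"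
proof -
  obtain U t where lp: "YY.local_parameter (orbit v x) U t"
    and o: "\<And>c V. weight0 c \<Longrightarrow> YY.germ V (wm c) \<Longrightarrow> YY.ord_is (orbit v x) U t V (wm c) (zsum x c)"
    by (rule param_exists[OF x]) blast
  have gu: "YY.germ (V \<inter> U012) (\<lambda>y. u y * wm c y)" by (rule YY.germ_mult[OF u(1) wm_germ[OF c]])
  have "g \<noteq> \<zero>\<^bsub>YY.KY\<^esub>" using g(2) unfolding nonzero_ratfuns_def by blast
  then obtain y where y: "y \<in> V \<inter> U012" "u y * wm c y \<noteq> 0" using YY.R_eq_zero_iff[OF gu] g(1) by blast
  then have "y \<in> V" "u y \<noteq> 0" by auto
  then obtain n where n: "YY.ord_is (orbit v x) U t V u n" using YY.lp_exists[OF lp u(1)] by blast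
  have "n \<ge> 0" using YY.ord_is_local_iff[OF lp u(1) n] YY.local_ringI[OF u] by blast
  moreover have "ord_along YY {orbit v x} g = n + zsum x c"
    unfolding g(1) by (rule YY.ord_along_lp[OF lp gu y YY.ord_is_mult[OF n o[OF c wm_germ[OF c]]]])
  ultimately show ?thesis by simp
qed

subsection \<open>Positivity\<close>

lemma common_denominator:
  obtains m :: nat and k :: "nat \<Rightarrow> int" where "m > 0" "\<And>l. l < 3 \<Longrightarrow> of_nat m * r l = (of_int (k l) :: rat)"
proof -
  have "\<exists>m k. m > 0 \<and> of_nat m * q = (of_int k :: rat)" for q
  proof (cases q)
    case (Fract x y)
    then show ?thesis by (intro exI[of _ "nat y"] exI[of _ x]) (simp add: Fract_of_int_quotient)
  qed
  then have "\<forall>l. \<exists>mk. fst mk > 0 \<and> of_nat (fst mk) * r l = of_int (snd mk)" by simp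
  then obtain mk :: "nat \<Rightarrow> nat \<times> int" where "\<forall>l. fst (mk l) > 0 \<and> of_nat (fst (mk l)) * r l = of_int (snd (mk l))"
    by (rule choice[THEN exE])
  then obtain m :: "nat \<Rightarrow> nat" and k :: "nat \<Rightarrow> int"
    where mk: "\<And>l. m l > 0" "\<And>l. of_nat (m l) * r l = of_int (k l)"
    using that[of "\<lambda>l. fst (mk l)" "\<lambda>l. snd (mk l)"] by blast
  have eq: "of_nat (m 0 * m 1 * m 2) * r l =
      of_int ((if l = 0 then int (m 1 * m 2) else if l = 1 then int (m 0 * m 2) else int (m 0 * m 1)) * k l)"
    if "l < 3" for l
  proof -
    have "l = 0 \<or> l = 1 \<or> l = 2" using that by linarith
    then show ?thesis using mk(2)[of l, symmetric] by (auto simp: mult_ac)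
  qed
  show ?thesis by (rule that[OF _ eq]) (simp_all add: mk(1))
qed

text \<open>A chart meets the coordinate points of its axis \<open>i\<close> only, so one monomial
  with exponent \<open>k i\<close> is a local equation of the multiple there.\<close>

lemma q_cartier_qdiv: "q_cartier YY (qdiv r)"
proof -
  obtain m :: nat and k where m: "m > 0" "\<And>l. l < 3 \<Longrightarrow> of_nat m * r l = of_int (k l)"
    by (rule common_denominator[of r]) blast
  have "cartier YY (div_mult m (qdiv r))"
    unfolding cartier_def
  proof
    fix y assume "y \<in> points YY"
    then obtain x where x: "x \<in> Cp" "y = orbit v x" by (rule YY_cases)
    obtain i j l where p: "{i, j, l} = {0, 1, 2 :: nat}" and nz: "x ! j \<noteq> 0" "x ! l \<noteq> 0"
      by (rule good_axes[OF x(1)])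
    obtain c where c: "weight0 c" "c i = k i" by (rule weight0_with_coord[OF p])
    obtain al be where "pham_chart a C v D i j l al be" by (rule chart_exists[OF p])
    then interpret A: pham_chart a C v D i j l al be .
    have "of_nat m * qdiv r Z = of_int (ord_along YY Z (YY.R U012 (wm c)))"
      if Z: "prime_divisor YY Z" "Z \<inter> A.U \<noteq> {}" for Z
    proof -
      obtain x' where x': "x' \<in> Cp" "Z = {orbit v x'}" by (rule prime_divisor_cases[OF Z(1)])
      have nz': "x' ! j \<noteq> 0" "x' ! l \<noteq> 0" using Z(2) x' A.U_iff by auto
      show ?thesis unfolding x'(2) ord_wm[OF x'(1) c(1)] qdiv_orbit[OF x'(1)] zsum_def zsum_axes[OF p nz']
        using m(2)[OF A.axes_less(1)] c(2) by simp
    qed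
    moreover have "y \<in> A.U" using A.U_iff[OF x(1)] nz x(2) by simp
    ultimately show "\<exists>U. openin (zar YY) U \<and> y \<in> U \<and> (\<exists>g\<in>nonzero_ratfuns YY.
        \<forall>Z. prime_divisor YY Z \<and> Z \<inter> U \<noteq> {} \<longrightarrow> of_nat m * qdiv r Z = of_int (ord_along YY Z g))"
      using A.U_open wm_ratfun[OF c(1)] by (intro exI[of _ A.U] conjI bexI[of _ "YY.R U012 (wm c)"]) auto
  qed
  then show ?thesis unfolding q_cartier_def using m(1) by blast
qed

text \<open>The divisor of the monomial with exponents \<open>b - k\<close>, added to the multiple
  of \<open>qdiv r\<close>, has coefficient \<open>b l\<close> along the l-th coordinate points;
  effectivity and the nonvanishing locus are read off from \<open>b\<close>.\<close>

lemma monomial_section: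
  fixes b k :: "nat \<Rightarrow> int"
  assumes m: "\<And>l. l < 3 \<Longrightarrow> of_nat m * r l = (of_int (k l) :: rat)" and b: "\<And>l. l < 3 \<Longrightarrow> b l \<ge> 0"
    and bk: "(\<Sum>l<3. b l * int (v ! l)) = (\<Sum>l<3. k l * int (v ! l))"
  shows "YY.R U012 (wm (\<lambda>l. b l - k l)) \<in> nonzero_sections YY (div_mult m (qdiv r))"
    and "nonvanishing_locus YY (div_mult m (qdiv r)) (YY.R U012 (wm (\<lambda>l. b l - k l))) =
      orbit v ` {x \<in> Cp. \<forall>l<3. x ! l = 0 \<longrightarrow> b l = 0}"
proof -
  define g where "g = YY.R U012 (wm (\<lambda>l. b l - k l))"
  have c: "weight0 (\<lambda>l. b l - k l)" using bk by (simp add: left_diff_distrib sum_subtractf)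
  have g: "g \<in> nonzero_ratfuns YY" unfolding g_def by (rule wm_ratfun[OF c])
  have o: "of_int (ord_along YY {orbit v x} g) + of_nat m * qdiv r {orbit v x} =
      (of_int (\<Sum>l<3. if x ! l = 0 then b l else 0) :: rat)" if x: "x \<in> Cp" for x
  proof -
    have "of_nat m * qdiv r {orbit v x} = (\<Sum>l<3. of_int (if x ! l = 0 then k l else 0))"
      unfolding qdiv_orbit[OF x] sum_distrib_left using m by (intro sum.cong) auto
    also have "\<dots> = of_int (\<Sum>l<3. if x ! l = 0 then k l else 0)" by simp
    finally have "of_int (ord_along YY {orbit v x} g) + of_nat m * qdiv r {orbit v x} =
      (of_int (zsum x (\<lambda>l. b l - k l) + (\<Sum>l<3. if x ! l = 0 then k l else 0)) :: rat)"
      unfolding g_def ord_wm[OF x c] by simp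
    also have "zsum x (\<lambda>l. b l - k l) + (\<Sum>l<3. if x ! l = 0 then k l else 0) = (\<Sum>l<3. if x ! l = 0 then b l else 0)"
      unfolding zsum_def sum.distrib[symmetric] by (rule sum.cong) auto
    finally show ?thesis .
  qed
  have s: "(\<Sum>l<3. if x ! l = 0 then b l else 0) \<ge> 0" for x :: "'k list" using b by (intro sum_nonneg) auto
  have z: "(\<Sum>l<3. if x ! l = 0 then b l else 0) = 0 \<longleftrightarrow> (\<forall>l<3. x ! l = 0 \<longrightarrow> b l = 0)" for x :: "'k list"
    by (subst sum_nonneg_eq_0_iff) (use b in auto)
  have "g \<in> sections YY (div_mult m (qdiv r))"
    unfolding sections_iff[OF g] by (intro ballI) (simp only: o s of_int_0_le_iff)
  then show "g \<in> nonzero_sections YY (div_mult m (qdiv r))"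
    using g unfolding nonzero_sections_def nonzero_ratfuns_def by blast
  have "orbit v x \<in> nonvanishing_locus YY (div_mult m (qdiv r)) g \<longleftrightarrow> (\<forall>l<3. x ! l = 0 \<longrightarrow> b l = 0)"
    if x: "x \<in> Cp" for x
  proof -
    have "orbit v x \<in> nonvanishing_locus YY (div_mult m (qdiv r)) g \<longleftrightarrow>
        of_nat m * qdiv r {orbit v x} + of_int (ord_along YY {orbit v x} g) = 0"
      unfolding nonvanishing_locus_def prime_divisor_YY using x unfolding points_YY by auto
    then show ?thesis unfolding add.commute[of "of_nat m * qdiv r {orbit v x}"] o[OF x] of_int_eq_0_iff z .
  qed
  moreover have "nonvanishing_locus YY (div_mult m (qdiv r)) g \<subseteq> points YY" unfolding nonvanishing_locus_def by blast
  ultimately show "nonvanishing_locus YY (div_mult m (qdiv r)) g = orbit v ` {x \<in> Cp. \<forall>l<3. x ! l = 0 \<longrightarrow> b l = 0}"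
    unfolding points_YY by blast
qed

context
  fixes r :: "nat \<Rightarrow> rat" and m :: nat and k :: "nat \<Rightarrow> int"
  assumes m: "m > 0" "\<And>l. l < 3 \<Longrightarrow> of_nat m * r l = of_int (k l)"
begin

abbreviation "vv \<equiv> v ! 0 * v ! 1 * v ! 2"

lemma vv_factor: "{i, j, l} = {0, 1, 2 :: nat} \<Longrightarrow> vv = v ! i * v ! j * v ! l"
proof -
  assume p: "{i, j, l} = {0, 1, 2 :: nat}"
  obtain al be where "pham_chart a C v D i j l al be" by (rule chart_exists[OF p])
  then interpret A: pham_chart a C v D i j l al be .
  have "vv = (\<Prod>q<3. v ! q)" by (simp add: numeral_3_eq_3 numeral_2_eq_2)
  then show ?thesis by (simp add: A.prod3)
qed

lemma scaled: "l < 3 \<Longrightarrow> of_nat (m * n) * r l = of_int (int n * k l)"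
  using m(2)[of l, symmetric] by simp

lemma degree_scaled: "(\<Sum>l<3. r l * of_nat (v ! l)) * of_nat m = (of_int (\<Sum>l<3. k l * int (v ! l)) :: rat)"
proof -
  have "(\<Sum>l<3. r l * of_nat (v ! l)) * of_nat m = (\<Sum>l<3. of_nat m * r l * of_nat (v ! l))"
    unfolding sum_distrib_right by (rule sum.cong) simp_all
  also have "\<dots> = (\<Sum>l<3. of_int (k l) * of_nat (v ! l))" using m(2) by (intro sum.cong) auto
  finally show ?thesis by simp
qed

text \<open>After scaling by \<open>2 * vv\<close> the weighted degree is \<open>2 * vv * S\<close>,
  which is divisible by every weight and can be placed on coordinates of choice.\<close>

lemma axes_section:
  assumes p: "{i, j, l} = {0, 1, 2 :: nat}" and deg: "(\<Sum>l<3. r l * of_nat (v ! l)) \<ge> 0"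
  shows "\<exists>g\<in>nonzero_sections YY (div_mult (m * (2 * vv)) (qdiv r)). orbit v ` {x \<in> Cp. x ! i \<noteq> 0} \<subseteq>
    nonvanishing_locus YY (div_mult (m * (2 * vv)) (qdiv r)) g"
    and "(\<Sum>l<3. r l * of_nat (v ! l)) > 0 \<Longrightarrow> \<exists>g\<in>nonzero_sections YY (div_mult (m * (2 * vv)) (qdiv r)).
      nonvanishing_locus YY (div_mult (m * (2 * vv)) (qdiv r)) g = YD (\<lambda>x. x ! j * x ! l)"
proof -
  obtain al be where "pham_chart a C v D i j l al be" by (rule chart_exists[OF p])
  then interpret A: pham_chart a C v D i j l al be .
  define S where "S = (\<Sum>l<3. k l * int (v ! l))"
  have S0: "S \<ge> 0" using degree_scaled deg m(1) unfolding S_def[symmetric]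
    by (metis of_int_0_le_iff of_nat_0_le_iff zero_le_mult_iff)
  have sum_k: "(\<Sum>q<3. int (2 * vv) * k q * int (v ! q)) = int (2 * vv) * S"
    unfolding S_def by (simp add: sum_distrib_left mult.assoc)
  have P: "int vv = int (v ! i) * int (v ! j) * int (v ! l)" unfolding vv_factor[OF p] by simp
  \<comment> \<open>The whole degree goes to \<open>x_i\<close>: the exponent times the weight
    \<open>v_i\<close> is \<open>2 * vv * S\<close>.\<close>
  define b where "b q = (if q = i then 2 * int (v ! j) * int (v ! l) * S else 0)" for q
  have b: "b i = 2 * int (v ! j) * int (v ! l) * S" "b j = 0" "b l = 0" using A.axes_neq by (simp_all add: b_def)
  have "(\<Sum>q<3. b q * int (v ! q)) = (\<Sum>q<3. int (2 * vv) * k q * int (v ! q))"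
    unfolding sum_k A.sum3 b using P by simp
  note sec = monomial_section[OF scaled _ this]
  have bn: "b q \<ge> 0" for q using S0 by (simp add: b_def)
  show "\<exists>g\<in>nonzero_sections YY (div_mult (m * (2 * vv)) (qdiv r)). orbit v ` {x \<in> Cp. x ! i \<noteq> 0} \<subseteq>
    nonvanishing_locus YY (div_mult (m * (2 * vv)) (qdiv r)) g"
    by (rule bexI[OF _ sec(1)], subst sec(2)) (use bn in \<open>auto simp: b_def\<close>)
  assume "(\<Sum>l<3. r l * of_nat (v ! l)) > 0"
  then have S1: "S > 0" using degree_scaled m(1) unfolding S_def[symmetric]
    by (metis of_int_0_less_iff of_nat_0_less_iff mult_pos_pos)
  \<comment> \<open>Half of the degree goes to \<open>x_j\<close> and half to \<open>x_l\<close>,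
    which is what the factor 2 is for.\<close>
  define b' where "b' q = (if q = j then int (v ! i) * int (v ! l) * S else if q = l then int (v ! i) * int (v ! j) * S else 0)" for q
  have b': "b' j = int (v ! i) * int (v ! l) * S" "b' l = int (v ! i) * int (v ! j) * S" "b' i = 0"
    using A.axes_neq by (simp_all add: b'_def)
  have "(\<Sum>q<3. b' q * int (v ! q)) = (\<Sum>q<3. int (2 * vv) * k q * int (v ! q))"
    unfolding sum_k A.sum3 b' using P by simp
  note sec = monomial_section[OF scaled _ this]
  have bn: "b' q \<ge> 0" for q using S0 by (simp add: b'_def)
  have bp: "b' j > 0" "b' l > 0" unfolding b' using S1 v_pos A.axes_less by simp_all
  have "(\<forall>q<3. x ! q = 0 \<longrightarrow> b' q = 0) \<longleftrightarrow> x ! j * x ! l \<noteq> 0" for x :: "'k list"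
  proof
    assume "\<forall>q<3. x ! q = 0 \<longrightarrow> b' q = 0"
    then show "x ! j * x ! l \<noteq> 0" using bp A.axes_less by (metis less_irrefl mult_eq_0_iff)
  next
    assume "x ! j * x ! l \<noteq> 0"
    then show "\<forall>q<3. x ! q = 0 \<longrightarrow> b' q = 0" using b'(3) A.axes_cases by auto
  qed
  then show "\<exists>g\<in>nonzero_sections YY (div_mult (m * (2 * vv)) (qdiv r)).
      nonvanishing_locus YY (div_mult (m * (2 * vv)) (qdiv r)) g = YD (\<lambda>x. x ! j * x ! l)"
    unfolding YD_def using bn by (intro bexI[OF _ sec(1)], subst sec(2)) auto
qed

end

lemma vv_pos: "vv > 0" using v_pos by simp

lemma semiample_qdiv:
  assumes "(\<Sum>l<3. r l * of_nat (v ! l)) \<ge> 0" shows "semiample YY (qdiv r)"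
proof -
  obtain m :: nat and k where m: "m > 0" "\<And>l. l < 3 \<Longrightarrow> of_nat m * r l = of_int (k l)"
    by (rule common_denominator[of r]) blast
  let ?B = "div_mult (m * (2 * vv)) (qdiv r)"
  have "y \<in> (\<Union>g\<in>nonzero_sections YY ?B. nonvanishing_locus YY ?B g)" if y: "y \<in> points YY" for y
  proof -
    obtain x where x: "x \<in> Cp" "y = orbit v x" using y by (rule YY_cases)
    obtain l where "l < 3" "x ! l \<noteq> 0" using x(1) unfolding Cp_def by blast
    then have "x ! 0 \<noteq> 0 \<or> x ! 1 \<noteq> 0 \<or> x ! 2 \<noteq> 0" by (auto simp: numeral_3_eq_3 numeral_2_eq_2 less_Suc_eq)
    then have "\<exists>i j l. {i, j, l} = {0, 1, 2 :: nat} \<and> x ! i \<noteq> 0" using axes_list by blast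
    then obtain i j l where p: "{i, j, l} = {0, 1, 2 :: nat}" "x ! i \<noteq> 0" by blast
    obtain g where "g \<in> nonzero_sections YY ?B" "orbit v ` {x \<in> Cp. x ! i \<noteq> 0} \<subseteq> nonvanishing_locus YY ?B g"
      using axes_section(1)[OF m p(1) assms] by blast
    then show ?thesis using x p(2) by blast
  qed
  moreover have "nonvanishing_locus YY ?B g \<subseteq> points YY" for g unfolding nonvanishing_locus_def by blast
  ultimately have "points YY = (\<Union>g\<in>nonzero_sections YY ?B. nonvanishing_locus YY ?B g)" by blast
  then show ?thesis unfolding semiample_def using m(1) vv_pos by (intro exI[of _ "m * (2 * vv)"]) simp
qed

lemma big_qdiv:
  assumes "(\<Sum>l<3. r l * of_nat (v ! l)) > 0" shows "big YY (qdiv r)"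
proof -
  obtain m :: nat and k where m: "m > 0" "\<And>l. l < 3 \<Longrightarrow> of_nat m * r l = of_int (k l)"
    by (rule common_denominator[of r]) blast
  let ?B = "div_mult (m * (2 * vv)) (qdiv r)"
  obtain g where "g \<in> nonzero_sections YY ?B" "nonvanishing_locus YY ?B g = YD (\<lambda>x. x ! 1 * x ! 2)"
    using axes_section(2)[OF m axes_list(1) less_imp_le[OF assms] assms] by blast
  then show ?thesis unfolding big_def using m(1) vv_pos affine_open_YD[OF axes_list(1)]
    by (intro exI[of _ "m * (2 * vv)"] conjI bexI[of _ g]) simp_all
qed

end

subsection \<open>Half lines as polyhedra\<close>

lemma polyhedron_atLeast: "polyhedron {c..}"
  unfolding polyhedron_def by (rule exI[of _ "{(1, c)}"]) auto

lemma polyhedral_cone_atLeast: "polyhedral_cone {0..}"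
  unfolding polyhedral_cone_def by (rule exI[of _ "{1}"]) auto

lemma recession_cone_atLeast: "recession_cone {c..} = {0..}"
proof (intro equalityI subsetI)
  fix w assume "w \<in> recession_cone {c..}"
  then obtain p where p: "\<And>t. t \<ge> 0 \<Longrightarrow> c \<le> p + t * w" unfolding recession_cone_def by auto
  have "\<not> w < 0"
  proof
    assume w: "w < 0"
    have "c \<le> p" using p[of 0] by simp
    then have "0 \<le> (p - c + 1) / (- w)" using w by (intro divide_nonneg_nonneg) auto
    from p[OF this] show False using w by simp
  qed
  then show "w \<in> {0..}" by simp
next
  fix w :: rat assume "w \<in> {0..}"
  then show "w \<in> recession_cone {c..}" unfolding recession_cone_def by (intro CollectI exI[of _ c]) auto
qed

lemma dual_cone_atLeast: "dual_cone {0..} = {0..}"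
  unfolding dual_cone_def using mult_nonneg_nonneg by (force dest: bspec[of _ _ 1])

lemma rat_rel_interior_atLeast:
  assumes "u \<in> rat_rel_interior {0..}" shows "u > 0"
proof (rule ccontr)
  assume "\<not> u > 0"
  then have u: "u = 0" using assms unfolding rat_rel_interior_def by auto
  obtain e where e: "e > 0" "\<forall>a\<in>{0..}. \<forall>b\<in>{0..}. \<forall>t. \<bar>(1 - t) * a + t * b - u\<bar> < e \<longrightarrow> (1 - t) * a + t * b \<in> {0..}"
    using assms unfolding rat_rel_interior_def by blast
  \<comment> \<open>The affine combination of 0 and 1 with parameter \<open>- e / 2\<close> is
    closer than \<open>e\<close> to 0 but negative.\<close>
  have "(1 - - e / 2) * 0 + - e / 2 * 1 \<in> {0..}" by (rule e(2)[rule_format]) (use e(1) u in auto)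
  then show False using e(1) by simp
qed

lemma min_pairing_atLeast:
  assumes "u \<ge> 0" shows "min_pairing u {c..} = u * c"
  unfolding min_pairing_def by (rule Least_equality) (use assms in \<open>auto intro: mult_left_mono\<close>)

context pham_curve begin

definition coord_divisor :: "(nat \<Rightarrow> rat) \<Rightarrow> 'k list set polyhedral_sum" where
  "coord_divisor r = [({r 0..}, point_sum (coord_points 0)), ({r 1..}, point_sum (coord_points 1)),
     ({r 2..}, point_sum (coord_points 2))]"

lemma eval_coord_divisor:
  assumes "u \<ge> 0" shows "eval_polyhedral (coord_divisor r) u = qdiv (\<lambda>l. u * r l)"
  by (rule ext) (simp add: eval_polyhedral_def coord_divisor_def min_pairing_atLeast assms qdiv_def
      numeral_3_eq_3 numeral_2_eq_2)

text \<open>The weighted degree is linear in \<open>u\<close>, so positivity for \<open>r\<close>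
  gives nonnegativity on the dual cone and positivity in its interior.\<close>

lemma pp_divisor_coord:
  assumes deg: "(\<Sum>l<3. r l * of_nat (v ! l)) > 0" shows "pp_divisor YY {0..} (coord_divisor r)"
proof -
  have d: "(\<Sum>l<3. u * r l * of_nat (v ! l)) = u * (\<Sum>l<3. r l * of_nat (v ! l))" for u
    by (simp add: sum_distrib_left mult.assoc)
  have "polyhedral_divisor YY {0..} (coord_divisor r)"
    unfolding polyhedral_divisor_def coord_divisor_def
    using normal_variety_YY polyhedral_cone_atLeast
    by (simp add: polyhedron_atLeast recession_cone_atLeast weil_divisor_coord[unfolded One_nat_def])
  moreover have "q_cartier YY (eval_polyhedral (coord_divisor r) u)" "semiample YY (eval_polyhedral (coord_divisor r) u)"
    if "u \<in> dual_cone {0..}" for u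
  proof -
    have u: "u \<ge> 0" using that unfolding dual_cone_atLeast by simp
    then show "q_cartier YY (eval_polyhedral (coord_divisor r) u)" "semiample YY (eval_polyhedral (coord_divisor r) u)"
      unfolding eval_coord_divisor[OF u] using q_cartier_qdiv semiample_qdiv d deg by auto
  qed
  moreover have "big YY (eval_polyhedral (coord_divisor r) u)" if "u \<in> rat_rel_interior (dual_cone {0..})" for u
  proof -
    have u: "u > 0" using that unfolding dual_cone_atLeast by (rule rat_rel_interior_atLeast)
    then show ?thesis unfolding eval_coord_divisor[OF less_imp_le[OF u]] using d deg by (intro big_qdiv) simp
  qed
  ultimately show ?thesis unfolding pp_divisor_def by blast
qed

end

section \<open>The quotient map\<close>

text \<open>By \<open>f_eq\<close> the product \<open>f l * e l\<close> is \<open>v ! l\<close>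
  times one constant, so raising \<open>x_l\<close> to the power \<open>e l\<close> carries the
  action with weights \<open>f\<close> to a power of the scaling of the cone.\<close>

locale pham_quotient = pham_curve a C v D + X: pham n X
  for a :: "nat \<Rightarrow> nat" and C :: "'k::{alg_closed_field, field_char_0} list set"
    and v :: "nat list" and D :: nat and n :: "nat \<Rightarrow> nat" and X :: "'k list set" +
  fixes e f :: "nat \<Rightarrow> nat" and s :: "nat \<Rightarrow> int" and act :: "'k \<Rightarrow> 'k list \<Rightarrow> 'k list"
  assumes n_eq: "\<And>l. l < 3 \<Longrightarrow> n l = e l * a l" and e_pos: "\<And>l. l < 3 \<Longrightarrow> e l > 0"
    and f_eq: "\<And>i j k. {i, j, k} = {0, 1, 2} \<Longrightarrow> f i = v ! i * (e j * e k)"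
    and s_eq: "(\<Sum>l<3. s l * int (f l)) = 1"
    and act_eq: "\<And>t x. x \<in> X \<Longrightarrow> act t x = map2 (\<lambda>w c. t ^ w * c) [f 0, f 1, f 2] x"
begin

abbreviation "ws \<equiv> [f 0, f 1, f 2]"

lemma ws_nth: "l < 3 \<Longrightarrow> ws ! l = f l"
  by (auto simp: numeral_3_eq_3 numeral_2_eq_2 less_Suc_eq)

lemma lessThan3_cases: "l < 3 \<Longrightarrow> l = 0 \<or> l = 1 \<or> l = (2 :: nat)" by linarith

lemma third_axis: "l < 3 \<Longrightarrow> m < 3 \<Longrightarrow> l \<noteq> m \<Longrightarrow> \<exists>k. {l, m, k} = {0, 1, 2 :: nat}"
proof
  assume "l < 3" "m < 3" "l \<noteq> m"
  then show "{l, m, 3 - l - m} = {0, 1, 2}"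
    using lessThan3_cases[OF \<open>l < 3\<close>] lessThan3_cases[OF \<open>m < 3\<close>] by (elim disjE) auto
qed

definition EE :: nat where "EE = e 0 * e 1 * e 2"

lemma f_e: "l < 3 \<Longrightarrow> f l * e l = v ! l * EE"
  using lessThan3_cases[of l] f_eq[OF axes_list(1)] f_eq[OF axes_list(2)] f_eq[OF axes_list(3)]
  by (auto simp: EE_def mult_ac)

lemma EE_pos: "EE > 0" using e_pos by (simp add: EE_def)

lemma e_dvd: "l < 3 \<Longrightarrow> m < 3 \<Longrightarrow> l \<noteq> m \<Longrightarrow> e l dvd f m"
  using third_axis[of m l] f_eq by (metis dvd_triv_left dvd_mult)

text \<open>\<open>e l\<close> divides every \<open>f m\<close> with \<open>m \<noteq> l\<close>,
  hence both \<open>b l * f l\<close> and \<open>1 - s l * f l\<close>; the latter makes it prime to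
  \<open>f l\<close>, so it divides \<open>b l\<close>. Invariant Laurent monomials of the surface
  thus come from the curve.\<close>

lemma weight_char:
  assumes "(\<Sum>l<3. b l * int (f l)) = 0"
  obtains c where "weight0 c" "\<And>l. l < 3 \<Longrightarrow> b l = c l * int (e l)"
proof -
  have dv: "int (e l) dvd b l" if l: "l < 3" for l
  proof -
    have E: "int (e l) dvd int (f m)" if "m < 3" "m \<noteq> l" for m using e_dvd[OF l] that by auto
    have "(\<Sum>m<3. b m * int (f m)) = b l * int (f l) + (\<Sum>m\<in>{..<3} - {l}. b m * int (f m))"
      "(\<Sum>m<3. s m * int (f m)) = s l * int (f l) + (\<Sum>m\<in>{..<3} - {l}. s m * int (f m))"
      using l by (simp_all add: sum.remove)
    moreover have "int (e l) dvd (\<Sum>m\<in>{..<3} - {l}. b m * int (f m))" "int (e l) dvd (\<Sum>m\<in>{..<3} - {l}. s m * int (f m))"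
      by (intro dvd_sum dvd_mult E; simp)+
    ultimately have d1: "int (e l) dvd b l * int (f l)" and d2: "int (e l) dvd 1 - s l * int (f l)"
      using assms s_eq by (metis dvd_add_left_iff dvd_0_right, metis add_diff_cancel_left')
    have "b l = s l * (b l * int (f l)) + b l * (1 - s l * int (f l))" by (simp add: algebra_simps)
    then show ?thesis using d1 d2 by (metis dvd_add dvd_mult)
  qed
  define c where "c l = b l div int (e l)" for l
  have c: "b l = c l * int (e l)" if "l < 3" for l using dv[OF that] by (simp add: c_def)
  have "(\<Sum>l<3. c l * int (v ! l)) * int EE = (\<Sum>l<3. b l * int (f l))"
    unfolding sum_distrib_right
  proof (rule sum.cong)
    fix l :: nat assume "l \<in> {..<3}"
    then have "int (v ! l) * int EE = int (f l) * int (e l)" "b l = c l * int (e l)"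
      using f_e[of l] c by (simp_all flip: of_nat_mult)
    then show "c l * int (v ! l) * int EE = b l * int (f l)" by (simp add: mult_ac)
  qed simp
  then have "weight0 c" using assms EE_pos by simp
  then show ?thesis using c that by blast
qed

definition pi :: "'k list \<Rightarrow> 'k list" where "pi x = map (\<lambda>l. x ! l ^ e l) [0..<3]"

definition Xp :: "'k list set" where "Xp = {x \<in> X. \<exists>l<3. x ! l \<noteq> 0}"

definition X0 :: "'k list set" where "X0 = {x \<in> X. \<forall>l<3. x ! l \<noteq> 0}"

abbreviation pr :: "'k list \<Rightarrow> 'k list set" where "pr x \<equiv> orbit v (pi x)"

lemma pi_nth: "l < 3 \<Longrightarrow> pi x ! l = x ! l ^ e l" by (simp add: pi_def)

lemma pi_zero_iff: "l < 3 \<Longrightarrow> pi x ! l = 0 \<longleftrightarrow> x ! l = 0"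
  using e_pos by (simp add: pi_nth)

lemma X0_Xp: "X0 \<subseteq> Xp" unfolding X0_def Xp_def by (auto intro: exI[of _ 0])

lemma Xp_X: "Xp \<subseteq> X" unfolding Xp_def by blast

lemma X_len: "x \<in> X \<Longrightarrow> length x = 3" using X.C_def by simp

lemma pi_C_iff: "length x = 3 \<Longrightarrow> pi x \<in> C \<longleftrightarrow> x \<in> X"
  unfolding C_def X.C_def by (simp add: pi_nth n_eq power_mult) (simp add: pi_def)

lemma pi_Cp: "x \<in> Xp \<Longrightarrow> pi x \<in> Cp"
  unfolding Xp_def Cp_def using pi_C_iff X_len pi_zero_iff by blast

lemma pi_poly: "p \<in> poly_funs 3 \<Longrightarrow> (\<lambda>x. p (pi x)) \<in> poly_funs 3"
  unfolding pi_def by (rule poly_funs_compose) (auto intro: poly_funs_intros)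

lemma lift_exists: "y \<in> U012 \<Longrightarrow> \<exists>x\<in>X0. pr x = y"
proof -
  assume "y \<in> U012"
  then obtain w where w: "w \<in> Cp" "y = orbit v w" "\<And>l. l < 3 \<Longrightarrow> w ! l \<noteq> 0" by (rule U012_cases) blast
  define z where "z l = (SOME z. z ^ e l = w ! l)" for l
  have z: "z l ^ e l = w ! l" if "l < 3" for l
    unfolding z_def by (rule someI_ex) (rule nth_root_exists[OF e_pos[OF that]])
  define x where "x = map z [0..<3]"
  have x: "length x = 3" "\<And>l. l < 3 \<Longrightarrow> x ! l = z l" by (simp_all add: x_def)
  have "pi x = w" by (rule nth_equalityI) (use Cp_len[OF w(1)] x z pi_nth in \<open>auto simp: pi_def\<close>)
  moreover have "x \<in> X" using pi_C_iff[OF x(1)] \<open>pi x = w\<close> w(1) Cp_sub by blast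
  moreover have "x ! l \<noteq> 0" if "l < 3" for l using pi_zero_iff[OF that, of x] w(3)[OF that] \<open>pi x = w\<close> by simp
  ultimately show ?thesis using w(2) unfolding X0_def by blast
qed

text \<open>A set-theoretic section without any regularity; it serves for quotients that turn out to
  be constant on the fibres of \<open>pr\<close>.\<close>

definition lift :: "'k list set \<Rightarrow> 'k list" where "lift y = (SOME x. x \<in> X0 \<and> pr x = y)"

lemma lift: "y \<in> U012 \<Longrightarrow> lift y \<in> X0" "y \<in> U012 \<Longrightarrow> pr (lift y) = y"
  using someI_ex[of "\<lambda>x. x \<in> X0 \<and> pr x = y"] lift_exists[of y] unfolding lift_def by blast+

lemma pr_U012: "x \<in> X0 \<Longrightarrow> pr x \<in> U012"
  using U012_iff[OF pi_Cp] X0_Xp pi_zero_iff unfolding X0_def by blast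

lemma act_nth: "x \<in> X \<Longrightarrow> l < 3 \<Longrightarrow> act t x ! l = t ^ f l * x ! l"
  using X_len[of x] ws_nth[of l] by (simp add: act_eq)

lemma act_len: "x \<in> X \<Longrightarrow> length (act t x) = 3"
  using X_len[of x] by (simp add: act_eq)

lemma pi_act: "x \<in> X \<Longrightarrow> pi (act t x) = sc (t ^ EE) (pi x)"
proof (rule nth_equalityI)
  assume x: "x \<in> X"
  have l3: "length (pi z) = 3" for z by (simp add: pi_def)
  show "length (pi (act t x)) = length (sc (t ^ EE) (pi x))" by (simp add: l3)
  fix l assume "l < length (pi (act t x))"
  then have l: "l < 3" by (simp add: l3)
  show "pi (act t x) ! l = sc (t ^ EE) (pi x) ! l"
    unfolding sc_nth[OF l3 l] pi_nth[OF l] act_nth[OF x l]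
    using f_e[OF l] by (simp add: power_mult_distrib mult.commute flip: power_mult)
qed

lemma act_X: "x \<in> X \<Longrightarrow> act t x \<in> X"
  using pi_C_iff[OF act_len, of x t] pi_act[of x t] pi_C_iff[OF X_len, of x] sc_C by simp

lemma act_X0: "x \<in> X0 \<Longrightarrow> t \<noteq> 0 \<Longrightarrow> act t x \<in> X0"
  unfolding X0_def using act_X act_nth by auto

lemma pr_act: "x \<in> Xp \<Longrightarrow> t \<noteq> 0 \<Longrightarrow> pr (act t x) = pr x"
  using pi_act Xp_X orbit_eq[OF pi_Cp, of x "t ^ EE"] by auto

lemma act_1: "x \<in> X \<Longrightarrow> act 1 x = x"
  by (rule nth_equalityI) (use act_len act_nth X_len in auto)

lemma torus_action_X: "torus_action 3 X act"
  unfolding torus_action_def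
proof (intro conjI allI impI ballI)
  fix s' t :: 'k and x assume A: "s' \<noteq> 0 \<and> t \<noteq> 0 \<and> x \<in> X"
  show "act (s' * t) x = act s' (act t x)"
    by (rule nth_equalityI) (use A act_len act_nth act_X in \<open>auto simp: power_mult_distrib\<close>)
next
  fix l :: nat assume l: "l < 3"
  show "\<exists>p\<in>poly_funs (Suc 3). \<exists>k. \<forall>t x. t \<noteq> 0 \<and> x \<in> X \<longrightarrow> act t x ! l = p (t # x) / t ^ k"
  proof (intro bexI exI allI impI)
    fix t :: 'k and x assume "t \<noteq> 0 \<and> x \<in> X"
    then show "act t x ! l = ((t # x) ! 0 ^ f l * (t # x) ! Suc l) / t ^ 0" using act_nth l by simp
  qed (use l in \<open>auto intro!: poly_funs_intros\<close>)
qed (use act_1 act_X in auto)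

text \<open>The condition \<open>pr x \<in> W\<close> holds on a nonempty basic open subset of
  \<open>X\<close>, cut out by the three coordinates and a homogeneous function pulled back from the
  curve; irreducibility of \<open>X\<close> does the rest.\<close>

lemma dense_X:
  assumes W: "openin (zar YY) W" "W \<noteq> {}" and p: "p \<in> poly_funs 3" "q \<in> poly_funs 3"
    and eq: "\<And>x. x \<in> X0 \<Longrightarrow> pr x \<in> W \<Longrightarrow> p x = q x" and x: "x \<in> X"
  shows "p x = q x"
proof -
  have "W \<inter> U012 \<noteq> {}" by (rule YY.irr[OF W(1) U012_open W(2) U012_nonempty])
  then obtain y where y: "y \<in> W" "y \<in> U012" by blast
  define z where "z = lift y"
  have z: "z \<in> X0" "pr z = y" using lift[OF y(2)] by (simp_all add: z_def)
  have zp: "pi z \<in> Cp" using pi_Cp X0_Xp z(1) by blast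
  obtain g d where g: "g \<in> homogeneous_funs v d" "g (pi z) \<noteq> 0" "YD g \<subseteq> W"
    using YY_basis[OF W(1) zp] z(2) y(1) by metis
  define h where "h x = x ! 0 * x ! 1 * x ! 2 * g (pi x)" for x
  have h: "h \<in> poly_funs 3" unfolding h_def using pi_poly[OF hom_poly[OF g(1)]] by (intro poly_funs_intros) auto
  have U: "openin (zar X.XC) (X \<inter> {x. length x = 3 \<and> h x \<noteq> 0})" by (rule affine_basic_open[OF h])
  show ?thesis
  proof (rule X.XC_agree[OF p U _ _ x])
    have "z \<in> X \<inter> {x. length x = 3 \<and> h x \<noteq> 0}"
      using z(1) g(2) X_len unfolding X0_def h_def by simp
    then show "X \<inter> {x. length x = 3 \<and> h x \<noteq> 0} \<noteq> {}" by blast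
    fix x assume "x \<in> X \<inter> {x. length x = 3 \<and> h x \<noteq> 0}"
    then have x: "x \<in> X0" "g (pi x) \<noteq> 0" unfolding X0_def h_def less3 by auto
    then have "pr x \<in> YD g" unfolding YD_def using pi_Cp X0_Xp by blast
    then show "p x = q x" using eq x g(3) by blast
  qed
qed

lemma power_powi: "(z ^ k) powi c = (z :: 'k) powi (int k * c)"
  by (simp add: power_int_mult)

text \<open>The weight of \<open>chi m\<close> is \<open>m\<close> because \<open>s\<close> pairs to \<open>1\<close> with the weights \<open>f\<close> of the action.\<close>

definition chi :: "int \<Rightarrow> 'k list \<Rightarrow> 'k" where "chi m = lmono (\<lambda>l. m * s l)"

lemma chi_nonzero: "x \<in> X0 \<Longrightarrow> chi m x \<noteq> 0"
  unfolding chi_def X0_def by (rule lmono_nonzero) blast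

lemma chi_add: "x \<in> X0 \<Longrightarrow> chi (m + m') x = chi m x * chi m' x"
  unfolding chi_def X0_def distrib_right by (rule lmono_mult) blast

lemma chi_0: "chi 0 x = 1" by (simp add: chi_def lmono_def)

lemma chi_act:
  assumes "x \<in> X0" "t \<noteq> 0" shows "chi m (act t x) = t powi m * chi m x"
proof -
  have x: "x \<in> X" using assms(1) unfolding X0_def by blast
  have "chi m (act t x) = (\<Prod>l<3. t powi (m * (s l * int (f l))) * x ! l powi (m * s l))"
    unfolding chi_def lmono_def
  proof (rule prod.cong)
    fix l :: nat assume "l \<in> {..<3}"
    then have "act t x ! l = t ^ f l * x ! l" using act_nth[OF x] by simp
    then show "act t x ! l powi (m * s l) = t powi (m * (s l * int (f l))) * x ! l powi (m * s l)"
      by (simp add: power_int_mult_distrib power_powi mult_ac)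
  qed simp
  also have "\<dots> = t powi (\<Sum>l<3. m * (s l * int (f l))) * chi m x"
    unfolding prod.distrib chi_def lmono_def using assms(2) by (simp add: numeral_3_eq_3 power_int_add)
  also have "(\<Sum>l<3. m * (s l * int (f l))) = m" unfolding sum_distrib_left[symmetric] s_eq by simp
  finally show ?thesis .
qed

lemma pullback_wm:
  assumes "x \<in> X0" "weight0 c" "\<And>l. l < 3 \<Longrightarrow> b l = c l * int (e l) + m * s l"
  shows "wm c (pr x) * chi m x = lmono b x"
proof -
  have xp: "pi x \<in> Cp" using pi_Cp X0_Xp assms(1) by blast
  have "lmono c (pi x) = lmono (\<lambda>l. c l * int (e l)) x"
    unfolding lmono_def
  proof (rule prod.cong)
    fix l :: nat assume "l \<in> {..<3}"
    then have "pi x ! l = x ! l ^ e l" using pi_nth[of l x] by simp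
    then show "pi x ! l powi c l = x ! l powi (c l * int (e l))" by (simp add: power_powi mult.commute)
  qed simp
  moreover have "lmono b x = lmono (\<lambda>l. c l * int (e l) + m * s l) x"
    unfolding lmono_def using assms(3) by (intro prod.cong) auto
  moreover have "\<dots> = lmono (\<lambda>l. c l * int (e l)) x * chi m x"
    unfolding chi_def using assms(1) unfolding X0_def by (intro lmono_mult) blast
  ultimately show ?thesis unfolding wm_orbit[OF xp assms(2)] by simp
qed

end

subsection \<open>Sections and homogeneous functions\<close>

context pham_quotient begin

definition rr :: "nat \<Rightarrow> rat" where "rr l = of_int (s l) / of_nat (e l)"

definition gY :: "int \<Rightarrow> ('k list \<Rightarrow> 'k) \<Rightarrow> 'k list set \<Rightarrow> 'k" where
  "gY m h y = h (lift y) / chi m (lift y)"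

lemma length_ws: "length ws = 3" by simp

lemma weighted_degree_ws: "weighted_degree ws b = (\<Sum>l<3. f l * b l)"
  by (simp add: weighted_degree_def numeral_3_eq_3 numeral_2_eq_2)

text \<open>Each monomial of \<open>p\<close> is a curve monomial with exponents \<open>d\<close>
  times \<open>chi\<close>, where \<open>d i * e i + w * s i\<close> is the nonnegative exponent of
  \<open>x_i\<close>. Factoring out the least exponent compatible with this bound leaves functions
  without poles on the chart.\<close>

lemma hom_sections:
  assumes p: "p \<in> homogeneous_funs ws w" and ax: "{i, j, k} = {0, 1, 2 :: nat}"
  obtains c u where "weight0 c" "c i * int (e i) + int w * s i \<ge> 0"
    "u \<in> reg YY (YD (\<lambda>x. x ! j * x ! k))"
    "\<And>x. x \<in> X0 \<Longrightarrow> p x = u (pr x) * wm c (pr x) * chi (int w) x"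
proof -
  obtain al be where "pham_chart a C v D i j k al be" by (rule chart_exists[OF ax])
  then interpret A: pham_chart a C v D i j k al be .
  obtain B q where B: "finite B" "\<And>b. b \<in> B \<Longrightarrow> weighted_degree ws b = w"
    and pq: "p = (\<lambda>x. \<Sum>b\<in>B. q b * monomial_fun (length ws) b x)"
    using p unfolding homogeneous_funs_def by blast
  have ei: "int (e i) > 0" using e_pos A.axes_less by simp
  \<comment> \<open>The least integer with \<open>c i * e i + w * s i \<ge> 0\<close>, that is, the
    ceiling of \<open>- w * s i / e i\<close>.\<close>
  obtain c where c: "weight0 c" "c i = - ((int w * s i) div int (e i))" by (rule weight0_with_coord[OF ax])
  have ci: "c i * int (e i) + int w * s i \<ge> 0"
    unfolding c(2) minus_mult_left[symmetric] using div_mult_mod_eq[of "int w * s i" "int (e i)"] pos_mod_sign[OF ei, of "int w * s i"] by linarith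
  have "\<exists>d. weight0 d \<and> (\<forall>l<3. int (b l) = d l * int (e l) + int w * s l)" if b: "b \<in> B" for b
  proof -
    have "int w = (\<Sum>l<3. int (b l) * int (f l))"
      using B(2)[OF b, symmetric] unfolding weighted_degree_ws by (simp add: mult.commute)
    moreover have "(\<Sum>l<3. int w * s l * int (f l)) = int w * (\<Sum>l<3. s l * int (f l))"
      by (simp add: sum_distrib_left mult.assoc)
    ultimately have "(\<Sum>l<3. (int (b l) - int w * s l) * int (f l)) = 0"
      using s_eq by (simp add: left_diff_distrib sum_subtractf)
    then obtain d where "weight0 d" "\<And>l. l < 3 \<Longrightarrow> int (b l) - int w * s l = d l * int (e l)"
      by (rule weight_char) blast
    then show ?thesis by (intro exI[of _ d]) (auto simp: algebra_simps)
  qed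
  then obtain d where d: "\<And>b. b \<in> B \<Longrightarrow> weight0 (d b)"
    "\<And>b l. b \<in> B \<Longrightarrow> l < 3 \<Longrightarrow> int (b l) = d b l * int (e l) + int w * s l" by metis
  have dc: "weight0 (\<lambda>l. d b l - c l)" if "b \<in> B" for b
    using d(1)[OF that] c(1) by (simp add: left_diff_distrib sum_subtractf)
  define u where "u y = (\<Sum>b\<in>B. q b * wm (\<lambda>l. d b l - c l) y)" for y
  have uo: "openin (zar YY) (YD (\<lambda>x. x ! j * x ! k))" using A.U_open unfolding A.U_def .
  have "u \<in> reg YY (YD (\<lambda>x. x ! j * x ! k))"
    unfolding u_def
  proof (intro YY.reg_sum YY.reg_smult wm_reg dc uo)
    fix b x l assume b: "b \<in> B" and x: "x \<in> Cp" "orbit v x \<in> YD (\<lambda>x. x ! j * x ! k)" and l: "l < 3" "d b l - c l < 0"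
    have "d b i \<ge> c i"
    proof -
      have "0 \<le> d b i * int (e i) + int w * s i" using d(2)[OF b A.axes_less(1)] by linarith
      then have "(- d b i) * int (e i) \<le> int w * s i" by simp
      from zdiv_mono1[OF this ei] have "- d b i \<le> (int w * s i) div int (e i)"
        by (subst (asm) nonzero_mult_div_cancel_right) (use ei in simp_all)
      then show ?thesis using c(2) by simp
    qed
    then have "l \<noteq> i" using l(2) by auto
    then show "x ! l \<noteq> 0" using A.axes_cases[OF l(1)] A.U_iff[OF x(1)] x(2) unfolding A.U_def by auto
  qed
  moreover have "p x = u (pr x) * wm c (pr x) * chi (int w) x" if x: "x \<in> X0" for x
  proof -
    have U: "pr x \<in> U012" by (rule pr_U012[OF x])
    have "monomial_fun (length ws) b x = wm (\<lambda>l. d b l - c l) (pr x) * wm c (pr x) * chi (int w) x" if b: "b \<in> B" for b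
    proof -
      have "monomial_fun (length ws) b x = lmono (\<lambda>l. int (b l)) x"
        by (simp add: monomial_fun_def lmono_def numeral_3_eq_3)
      also have "\<dots> = wm (d b) (pr x) * chi (int w) x"
        by (rule pullback_wm[OF x d(1)[OF b] d(2)[OF b], symmetric])
      also have "wm (d b) (pr x) = wm (\<lambda>l. d b l - c l) (pr x) * wm c (pr x)"
        using wm_add(2)[OF dc[OF b] c(1) U] by simp
      finally show ?thesis .
    qed
    then show ?thesis unfolding pq u_def sum_distrib_right by (intro sum.cong) (auto simp: mult_ac)
  qed
  ultimately show ?thesis by (rule that[OF c(1) ci])
qed

lemma U012_sub_YD: "{i, j, k} = {0, 1, 2 :: nat} \<Longrightarrow> YD (\<lambda>x. x ! j * x ! k) \<inter> U012 = U012"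
proof -
  assume ax: "{i, j, k} = {0, 1, 2 :: nat}"
  obtain al be where "pham_chart a C v D i j k al be" by (rule chart_exists[OF ax])
  then interpret A: pham_chart a C v D i j k al be .
  have "U012 \<subseteq> A.U"
  proof
    fix y assume "y \<in> U012"
    then obtain x where "x \<in> Cp" "y = orbit v x" "\<And>l. l < 3 \<Longrightarrow> x ! l \<noteq> 0" by (rule U012_cases) blast
    then show "y \<in> A.U" using A.U_iff A.axes_less by blast
  qed
  then show ?thesis unfolding A.U_def by blast
qed

lemma gY_local:
  assumes p: "p \<in> homogeneous_funs ws w" and ax: "{i, j, k} = {0, 1, 2 :: nat}"
  obtains c u where "weight0 c" "c i * int (e i) + int w * s i \<ge> 0" "YY.germ (YD (\<lambda>x. x ! j * x ! k)) u"
    "\<forall>y\<in>U012. gY (int w) p y = u y * wm c y" "\<forall>x\<in>X0. p x = u (pr x) * wm c (pr x) * chi (int w) x"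
proof -
  obtain c u where cu: "weight0 c" "c i * int (e i) + int w * s i \<ge> 0"
    "u \<in> reg YY (YD (\<lambda>x. x ! j * x ! k))"
    "\<And>x. x \<in> X0 \<Longrightarrow> p x = u (pr x) * wm c (pr x) * chi (int w) x"
    by (rule hom_sections[OF p ax]) blast
  have "gY (int w) p y = u y * wm c y" if y: "y \<in> U012" for y
    using cu(4)[OF lift(1)[OF y]] chi_nonzero[OF lift(1)[OF y]] unfolding gY_def lift(2)[OF y] by simp
  moreover obtain al be where "pham_chart a C v D i j k al be" by (rule chart_exists[OF ax])
  then interpret A: pham_chart a C v D i j k al be .
  have "openin (zar YY) (YD (\<lambda>x. x ! j * x ! k))" using A.U_open unfolding A.U_def .
  moreover have "YD (\<lambda>x. x ! j * x ! k) \<noteq> {}" using U012_sub_YD[OF ax] U012_nonempty by blast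
  ultimately show ?thesis using that[OF cu(1,2)] cu(3,4) by blast
qed

text \<open>The local form on a chart around a point bounds the order from below by the exponent
  \<open>c i\<close> if \<open>x_i\<close> vanishes there, and \<open>c i + w * rr i \<ge> 0\<close>
  is the bound on \<open>c i\<close> divided by \<open>e i\<close>.\<close>

lemma
  assumes p: "p \<in> homogeneous_funs ws w"
  shows germ_gY: "YY.germ U012 (gY (int w) p)"
    and gY_eq: "x \<in> X0 \<Longrightarrow> p x = gY (int w) p (pr x) * chi (int w) x"
    and gY_sections: "YY.R U012 (gY (int w) p) \<in> sections YY (qdiv (\<lambda>l. of_nat w * rr l))"
proof -
  have agree: "YY.germ U012 (\<lambda>y. u y * wm c y)"
    if "YY.germ (YD (\<lambda>x. x ! j * x ! k)) u" "weight0 c" "{i, j, k} = {0, 1, 2 :: nat}" for u c i j k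
    using YY.germ_mult[OF that(1) wm_germ[OF that(2)]] unfolding U012_sub_YD[OF that(3)] .
  obtain c u where cu: "weight0 c" "YY.germ (YD (\<lambda>x. x ! 1 * x ! 2)) u"
    "\<forall>y\<in>U012. gY (int w) p y = u y * wm c y" "\<forall>x\<in>X0. p x = u (pr x) * wm c (pr x) * chi (int w) x"
    by (rule gY_local[OF p axes_list(1)])
  have g0: "YY.germ U012 (\<lambda>y. u y * wm c y)" by (rule agree[OF cu(2,1) axes_list(1)])
  have "gY (int w) p \<in> reg YY U012" by (rule YY.reg_cong[of "\<lambda>y. u y * wm c y"]) (use g0 cu(3) in auto)
  then show germ: "YY.germ U012 (gY (int w) p)" using g0 by blast
  show "x \<in> X0 \<Longrightarrow> p x = gY (int w) p (pr x) * chi (int w) x" using cu(3,4) pr_U012 by simp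
  define G where "G = YY.R U012 (gY (int w) p)"
  have "G \<in> sections YY (qdiv (\<lambda>l. of_nat w * rr l))" if nz: "G \<noteq> \<zero>\<^bsub>YY.KY\<^esub>"
  proof -
    have Gn: "G \<in> nonzero_ratfuns YY" unfolding nonzero_ratfuns_def using nz YY.R_carrier[OF germ] G_def by blast
    show ?thesis unfolding sections_iff[OF Gn]
    proof
      fix x assume x: "x \<in> Cp"
      obtain i j k where ax: "{i, j, k} = {0, 1, 2 :: nat}" and xn: "x ! j \<noteq> 0" "x ! k \<noteq> 0"
        by (rule good_axes[OF x])
      obtain c u where cu: "weight0 c" "c i * int (e i) + int w * s i \<ge> 0" "YY.germ (YD (\<lambda>x. x ! j * x ! k)) u"
        "\<forall>y\<in>U012. gY (int w) p y = u y * wm c y" by (rule gY_local[OF p ax])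
      obtain al be where "pham_chart a C v D i j k al be" by (rule chart_exists[OF ax])
      then interpret A: pham_chart a C v D i j k al be .
      have xU: "orbit v x \<in> YD (\<lambda>x. x ! j * x ! k)" using A.U_iff[OF x] xn unfolding A.U_def by blast
      have "G = YY.R U012 (\<lambda>y. u y * wm c y)"
        unfolding G_def by (rule YY.R_eqI[OF germ agree[OF cu(3,1) ax] U012_open U012_nonempty]) (use cu(4) in blast)
      then have "zsum x c \<le> ord_along YY {orbit v x} G"
        by (intro ord_ge[OF cu(1,3) xU x _ Gn]) (simp only: U012_sub_YD[OF ax])
      moreover have "0 \<le> of_int (zsum x c) + qdiv (\<lambda>l. of_nat w * rr l) {orbit v x}"
      proof -
        have "0 \<le> (of_int (c i * int (e i) + int w * s i) :: rat)" using cu(2) by (simp only: of_int_0_le_iff)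
        then have "0 \<le> (of_int (c i * int (e i) + int w * s i) :: rat) / of_nat (e i)" by simp
        also have "\<dots> = of_int (c i) + of_nat w * rr i"
          using e_pos[OF A.axes_less(1)] by (simp add: rr_def add_divide_distrib)
        finally show ?thesis unfolding qdiv_orbit[OF x] zsum_def zsum_axes[OF ax xn] by simp
      qed
      ultimately show "0 \<le> of_int (ord_along YY {orbit v x} G) + qdiv (\<lambda>l. of_nat w * rr l) {orbit v x}"
        by (meson add_mono of_int_le_iff order_refl order_trans)
    qed
  qed
  then show "YY.R U012 (gY (int w) p) \<in> sections YY (qdiv (\<lambda>l. of_nat w * rr l))"
    unfolding G_def[symmetric] using sections_def by blast
qed

text \<open>Near \<open>pr z\<close> the section is a regular function times a monomial with
  exponents \<open>c\<close>, so its product with \<open>chi\<close> pulls back to a regular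
  function times \<open>x^b\<close>. The section condition makes \<open>b l \<ge> 0\<close> wherever
  \<open>z ! l = 0\<close>, so no pole passes through \<open>z\<close>.\<close>

lemma local_fraction:
  assumes g: "g \<in> sections YY (qdiv (\<lambda>l. of_nat w * rr l))" "g \<in> nonzero_ratfuns YY"
    and h: "YY.germ V0 h" "g = YY.R V0 h" and z: "z \<in> Xp"
  obtains P Q W where "P \<in> poly_funs 3" "Q \<in> poly_funs 3" "Q z \<noteq> 0" "openin (zar YY) W" "W \<noteq> {}" "W \<subseteq> V0"
    "\<And>x. x \<in> X0 \<Longrightarrow> pr x \<in> W \<Longrightarrow> Q x \<noteq> 0 \<and> h (pr x) * chi (int w) x * Q x = P x"
proof -
  have zp: "pi z \<in> Cp" by (rule pi_Cp[OF z])
  obtain i j k where ax: "{i, j, k} = {0, 1, 2 :: nat}" and xn: "pi z ! j \<noteq> 0" "pi z ! k \<noteq> 0"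
    and i: "(\<forall>l<3. pi z ! l \<noteq> 0) \<or> pi z ! i = 0" by (rule good_axes[OF zp])
  obtain al be where "pham_chart a C v D i j k al be" by (rule chart_exists[OF ax])
  then interpret A: pham_chart a C v D i j k al be .
  have o: "0 \<le> of_int (ord_along YY {pr z} g) + (if pi z ! i = 0 then of_nat w * rr i else 0)"
    using bspec[OF g(1)[unfolded sections_iff[OF g(2)]] zp] unfolding qdiv_orbit[OF zp] zsum_axes[OF ax xn] .
  have "(\<exists>l<3. pi z ! l = 0) \<or> ord_along YY {pr z} g \<ge> 0" using o i A.axes_less(1) by auto
  then obtain c V u where c: "weight0 c" "YY.germ V u" "pr z \<in> V" "g = YY.R (V \<inter> U012) (\<lambda>y. u y * wm c y)"
    "\<And>l. l < 3 \<Longrightarrow> pi z ! l = 0 \<Longrightarrow> c l = ord_along YY {pr z} g"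
    by (rule section_local[OF g(2) zp]) blast
  define b where "b l = c l * int (e l) + int w * s l" for l
  have b: "b l \<ge> 0" if l: "l < 3" "z ! l = 0" for l
  proof -
    have "pi z ! l = 0" using l pi_zero_iff by blast
    then have li: "l = i" using A.axes_cases[OF l(1)] xn by blast
    have "0 \<le> of_int (c i) + of_nat w * rr i" using o c(5)[OF l(1)] \<open>pi z ! l = 0\<close> li by simp
    then have "0 \<le> (of_int (c i) + of_nat w * rr i) * of_nat (e i)" by simp
    also have "\<dots> = of_int (c i * int (e i) + int w * s i)"
      using e_pos[OF A.axes_less(1)] by (simp add: rr_def distrib_right)
    finally show ?thesis unfolding b_def li of_int_0_le_iff .
  qed
  have ur: "u \<in> reg YY V" using c(2) by blast
  obtain W where W: "openin (zar YY) W" "pr z \<in> W" "W \<subseteq> V" "weighted_Fr v W u"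
    by (rule YY.regE[OF ur c(3)])
  obtain d p q where pq: "p \<in> homogeneous_funs v d" "q \<in> homogeneous_funs v d" "\<forall>y\<in>W. \<forall>x\<in>y. q x \<noteq> 0 \<and> u y = p x / q x"
    using W(4) unfolding weighted_Fr_def by blast
  \<comment> \<open>Positive exponents go to the numerator and negative ones to the denominator; the
    latter belong to coordinates that are nonzero at \<open>z\<close>.\<close>
  define P where "P x = p (pi x) * (\<Prod>l<3. x ! l ^ nat (b l))" for x
  define Q where "Q x = q (pi x) * (\<Prod>l<3. x ! l ^ nat (- b l))" for x
  define W' where "W' = W \<inter> (V0 \<inter> U012)"
  have self: "pi x \<in> pr x" if "x \<in> Xp" for x using orbit_self'[OF pi_Cp[OF that]] .
  show ?thesis
  proof (rule that[of P Q W'])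
    show "P \<in> poly_funs 3" "Q \<in> poly_funs 3" unfolding P_def Q_def
      using pi_poly[OF hom_poly[OF pq(1)]] pi_poly[OF hom_poly[OF pq(2)]] by (auto intro!: poly_funs_intros)
    have "q (pi z) \<noteq> 0" using pq(3) W(2) self[OF z] by blast
    moreover have "z ! l ^ nat (- b l) \<noteq> 0" if "l < 3" for l using b[OF that] by (cases "z ! l = 0") auto
    ultimately show "Q z \<noteq> 0" unfolding Q_def by simp
    have vn: "V0 \<inter> U012 \<noteq> {}" by (rule YY.irr) (use h(1) U012_open U012_nonempty in auto)
    have vo: "openin (zar YY) (V0 \<inter> U012)" using h(1) U012_open by blast
    show "W' \<noteq> {}" unfolding W'_def by (rule YY.irr[OF W(1) vo _ vn]) (use W(2) in blast)
    show "openin (zar YY) W'" unfolding W'_def using W(1) vo by blast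
    show "W' \<subseteq> V0" unfolding W'_def by blast
    fix x assume x: "x \<in> X0" "pr x \<in> W'"
    have xp: "x \<in> Xp" using x X0_Xp by blast
    have q: "q (pi x) \<noteq> 0" "u (pr x) = p (pi x) / q (pi x)"
      using pq(3) x(2) self[OF xp] unfolding W'_def by blast+
    have nz: "x ! l \<noteq> 0" if "l < 3" for l using x(1) that unfolding X0_def by blast
    have "Q x \<noteq> 0" unfolding Q_def using q(1) nz by simp
    have gg: "YY.germ (V \<inter> U012) (\<lambda>y. u y * wm c y)" by (rule YY.germ_mult[OF c(2) wm_germ[OF c(1)]])
    have "\<forall>y\<in>V0 \<inter> (V \<inter> U012). h y = u y * wm c y" using YY.R_eq_iff[OF h(1) gg] h(2) c(4) by blast
    then have hx: "h (pr x) = u (pr x) * wm c (pr x)" using x(2) W(3) unfolding W'_def by blast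
    have "lmono b x * (\<Prod>l<3. x ! l ^ nat (- b l)) = (\<Prod>l<3. x ! l ^ nat (b l))"
      unfolding lmono_def prod.distrib[symmetric]
    proof (rule prod.cong)
      fix l :: nat assume "l \<in> {..<3}"
      then have "x ! l \<noteq> 0" using nz by blast
      then show "x ! l powi b l * x ! l ^ nat (- b l) = x ! l ^ nat (b l)"
        by (cases "b l \<ge> 0") (simp_all add: power_int_def power_inverse)
    qed simp
    moreover have "h (pr x) * chi (int w) x = u (pr x) * lmono b x"
      unfolding hx using pullback_wm[OF x(1) c(1) b_def] by simp
    ultimately have "h (pr x) * chi (int w) x * Q x = P x"
      unfolding P_def Q_def using q by simp
    with \<open>Q x \<noteq> 0\<close> show "Q x \<noteq> 0 \<and> h (pr x) * chi (int w) x * Q x = P x" by blast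
  qed
qed

lemma X0_nonempty: "\<exists>x. x \<in> X0" using lift U012_nonempty by blast

lemma weight_space_X: "weight_space 3 X act (int w) = (\<lambda>p. restrict p X) ` homogeneous_funs ws w"
proof -
  have "weight_space (length ws) X act (int w) = (\<lambda>p. restrict p X) ` homogeneous_funs ws w"
    by (rule weight_space_nonneg) (use X_len act_eq act_X in auto)
  then show ?thesis unfolding length_ws .
qed

text \<open>The fractions at all points of the punctured surface represent one function, which
  therefore extends to a polynomial \<open>r\<close>. On a dense set \<open>r\<close> is the section
  times \<open>chi\<close>, of weight \<open>w\<close>, so density puts \<open>r\<close> into the
  weight space, and its homogeneous representative is the required \<open>p\<close>.\<close>

lemma sections_gY:
  assumes g: "g \<in> sections YY (qdiv (\<lambda>l. of_nat w * rr l))"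
  obtains p where "p \<in> homogeneous_funs ws w" "g = YY.R U012 (gY (int w) p)"
proof (cases "g = \<zero>\<^bsub>YY.KY\<^esub>")
  case True
  have "YY.R U012 (gY (int w) (\<lambda>x. 0)) = \<zero>\<^bsub>YY.KY\<^esub>"
    using YY.R_eq_zero_iff[OF germ_gY[OF homogeneous_funs_zero]] by (simp add: gY_def)
  then show ?thesis using that[OF homogeneous_funs_zero] True by simp
next
  case False
  then have gn: "g \<in> nonzero_ratfuns YY" using g unfolding sections_def by blast
  then obtain V0 h where h: "YY.germ V0 h" "g = YY.R V0 h"
    using YY.KY_cases unfolding nonzero_ratfuns_def by (metis DiffD1)
  obtain z0 where z0: "z0 \<in> X0" using X0_nonempty by blast
  then have z0p: "z0 \<in> Xp" using X0_Xp by blast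
  \<comment> \<open>One fixed fraction, taken at a point without zero coordinates, with which the
    local ones are compared.\<close>
  obtain P Q W where PQ: "P \<in> poly_funs 3" "Q \<in> poly_funs 3" "Q z0 \<noteq> 0" and W: "openin (zar YY) W" "W \<noteq> {}" "W \<subseteq> V0"
    and eq: "\<And>x. x \<in> X0 \<Longrightarrow> pr x \<in> W \<Longrightarrow> Q x \<noteq> 0 \<and> h (pr x) * chi (int w) x * Q x = P x"
    by (rule local_fraction[OF g gn h z0p]) blast
  have "\<exists>r\<in>poly_funs 3. \<forall>x\<in>X. P x = Q x * r x"
  proof (rule X.hartogs[OF PQ(1,2)])
    show "\<exists>x\<in>X. Q x \<noteq> 0" using z0 PQ(3) unfolding X0_def by blast
    fix z assume "z \<in> X" "\<exists>l<3. z ! l \<noteq> 0"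
    then have z: "z \<in> Xp" unfolding Xp_def by blast
    obtain P' Q' W' where PQ': "P' \<in> poly_funs 3" "Q' \<in> poly_funs 3" "Q' z \<noteq> 0" and W': "openin (zar YY) W'" "W' \<noteq> {}" "W' \<subseteq> V0"
      and eq': "\<And>x. x \<in> X0 \<Longrightarrow> pr x \<in> W' \<Longrightarrow> Q' x \<noteq> 0 \<and> h (pr x) * chi (int w) x * Q' x = P' x"
      by (rule local_fraction[OF g gn h z]) blast
    have "P x * Q' x = P' x * Q x" if "x \<in> X" for x
    proof (rule dense_X[of "W \<inter> W'", OF _ _ _ _ _ that])
      show "openin (zar YY) (W \<inter> W')" using W(1) W'(1) by blast
      show "W \<inter> W' \<noteq> {}" by (rule YY.irr[OF W(1) W'(1) W(2) W'(2)])
      show "(\<lambda>x. P x * Q' x) \<in> poly_funs 3" "(\<lambda>x. P' x * Q x) \<in> poly_funs 3"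
        using PQ PQ' by (auto intro!: poly_funs_intros)
      fix x assume x: "x \<in> X0" "pr x \<in> W \<inter> W'"
      then have "P x = h (pr x) * chi (int w) x * Q x" "P' x = h (pr x) * chi (int w) x * Q' x"
        using eq eq' by simp_all
      then show "P x * Q' x = P' x * Q x" by simp
    qed
    then show "\<exists>p'\<in>poly_funs 3. \<exists>q'\<in>poly_funs 3. q' z \<noteq> 0 \<and> (\<forall>y\<in>X. P y * q' y = p' y * Q y)"
      using PQ' by blast
  qed
  then obtain r where r: "r \<in> poly_funs 3" "\<And>x. x \<in> X \<Longrightarrow> P x = Q x * r x" by blast
  have rx: "r x = h (pr x) * chi (int w) x" if "x \<in> X0" "pr x \<in> W" for x
    using eq[OF that] r(2)[of x] that(1) unfolding X0_def by (auto simp: mult.commute)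
  have "restrict r X (act t x) = t powi int w * restrict r X x" if t: "t \<noteq> 0" "x \<in> X" for t x
  proof -
    have "r (map (\<lambda>l. t ^ f l * x ! l) [0..<3]) = t ^ w * r x"
    proof (rule dense_X[OF W(1,2) _ _ _ t(2)])
      show "(\<lambda>x. r (map (\<lambda>l. t ^ f l * x ! l) [0..<3])) \<in> poly_funs 3"
        by (rule poly_funs_compose[OF r(1)]) (auto intro!: poly_funs_intros)
      show "(\<lambda>x. t ^ w * r x) \<in> poly_funs 3" using r(1) by (auto intro!: poly_funs_intros)
      fix x assume x: "x \<in> X0" "pr x \<in> W"
      then have xx: "x \<in> X" "x \<in> Xp" using X0_Xp unfolding X0_def by auto
      have "map (\<lambda>l. t ^ f l * x ! l) [0..<3] = act t x"
        by (rule nth_equalityI) (use act_len[OF xx(1)] act_nth[OF xx(1)] in auto)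
      moreover have "r (act t x) = h (pr x) * (t powi int w * chi (int w) x)"
        using rx[OF act_X0[OF x(1) t(1)]] pr_act[OF xx(2) t(1)] x(2) chi_act[OF x(1) t(1)] by simp
      ultimately show "r (map (\<lambda>l. t ^ f l * x ! l) [0..<3]) = t ^ w * r x"
        using rx[OF x] by simp
    qed
    moreover have "map (\<lambda>l. t ^ f l * x ! l) [0..<3] = act t x"
      by (rule nth_equalityI) (use act_len[OF t(2)] act_nth[OF t(2)] in auto)
    ultimately show ?thesis using t act_X by simp
  qed
  then have "restrict r X \<in> weight_space 3 X act (int w)"
    unfolding weight_space_def coordinate_ring_def using r(1) by auto
  then obtain p where p: "p \<in> homogeneous_funs ws w" "restrict r X = restrict p X"
    unfolding weight_space_X by blast
  have pr': "p x = r x" if "x \<in> X" for x using fun_cong[OF p(2), of x] that by simp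
  have "YY.R V0 h = YY.R U012 (gY (int w) p)"
  proof (rule YY.R_eqI[OF h(1) germ_gY[OF p(1)] W(1,2)])
    fix y assume y: "y \<in> W" "y \<in> V0" "y \<in> U012"
    have l: "lift y \<in> X0" "pr (lift y) = y" using lift[OF y(3)] by auto
    then have "p (lift y) = h y * chi (int w) (lift y)" using rx[OF l(1)] pr'[of "lift y"] y(1) unfolding X0_def by simp
    then show "h y = gY (int w) p y" unfolding gY_def using chi_nonzero[OF l(1)] by simp
  qed
  then show ?thesis using that[OF p(1)] h(2) by simp
qed

lemma gY_inj:
  assumes "p \<in> homogeneous_funs ws w" "q \<in> homogeneous_funs ws w"
    and eq: "YY.R U012 (gY (int w) p) = YY.R U012 (gY (int w) q)" and x: "x \<in> X"
  shows "p x = q x"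
proof (rule dense_X[OF U012_open U012_nonempty _ _ _ x])
  have sub: "homogeneous_funs ws w \<subseteq> poly_funs 3" using homogeneous_funs_subset[of ws w] unfolding length_ws .
  show "p \<in> poly_funs 3" "q \<in> poly_funs 3" using assms(1,2) sub by auto
  fix x assume "x \<in> X0" "pr x \<in> U012"
  then show "p x = q x"
    using gY_eq[OF assms(1)] gY_eq[OF assms(2)] eq YY.R_eq_iff[OF germ_gY[OF assms(1)] germ_gY[OF assms(2)]] by simp
qed

end

subsection \<open>The graded isomorphism\<close>

text \<open>Multiplying by the variable makes both sides agree at 0 as well.\<close>

lemma poly_eq_off_zero:
  fixes P Q :: "'a::field_char_0 poly"
  assumes "\<And>t. t \<noteq> 0 \<Longrightarrow> poly P t = poly Q t" shows "P = Q"
proof -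
  have "poly ([:0, 1:] * P) t = poly ([:0, 1:] * Q) t" for t using assms[of t] by (cases "t = 0") auto
  then have "poly ([:0, 1:] * P) = poly ([:0, 1:] * Q)" by (rule ext)
  then have "[:0, 1:] * P = [:0, 1:] * Q" by (simp only: poly_eq_poly_eq_iff)
  then show ?thesis by simp
qed

context pham_quotient begin

abbreviation "KX \<equiv> coordinate_ring 3 X"
abbreviation "SA \<equiv> section_algebra YY {0..} (coord_divisor rr)"

text \<open>Along an orbit a function is a polynomial in \<open>t\<close>, whose coefficients are its homogeneous
  components.\<close>

definition trace :: "('k list \<Rightarrow> 'k) \<Rightarrow> 'k list \<Rightarrow> 'k poly" where
  "trace h x = (THE P. \<forall>t. t \<noteq> 0 \<longrightarrow> poly P t = h (act t x))"

lemma trace_eq: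
  assumes "\<And>t. t \<noteq> 0 \<Longrightarrow> poly P t = h (act t x)" shows "trace h x = P"
  unfolding trace_def by (rule the_equality) (use assms poly_eq_off_zero[of _ P] in auto)

text \<open>A polynomial representing \<open>h\<close> is not unique, but the values of
  \<open>h\<close> along orbits are; hence components are read off from the trace.\<close>

definition comp :: "('k list \<Rightarrow> 'k) \<Rightarrow> nat \<Rightarrow> 'k list \<Rightarrow> 'k" where
  "comp h k = (\<lambda>x\<in>X. coeff (trace h x) k)"

lemma trace_decomp:
  assumes "h \<in> carrier KX"
  obtains N p where "\<And>k. p k \<in> homogeneous_funs ws k" "\<And>k x. k \<ge> N \<Longrightarrow> p k x = 0"
    "\<And>x. x \<in> X \<Longrightarrow> trace h x = (\<Sum>k<N. monom (p k x) k)"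
    "\<And>x t. x \<in> X \<Longrightarrow> t \<noteq> 0 \<Longrightarrow> h (act t x) = poly (\<Sum>k<N. monom (p k x) k) t"
proof -
  obtain M q where M: "finite M" and h: "h = restrict (\<lambda>x. \<Sum>b\<in>M. q b * monomial_fun (length ws) b x) X"
    using assms unfolding coordinate_ring_def poly_funs_def length_ws by auto
  \<comment> \<open>Exceeds every degree that occurs, since each is at most the sum of all.\<close>
  define N where "N = Suc (\<Sum>b\<in>M. weighted_degree ws b)"
  define p where "p k x = (\<Sum>b\<in>{b \<in> M. weighted_degree ws b = k}. q b * monomial_fun (length ws) b x)" for k x
  have N: "weighted_degree ws b < N" if "b \<in> M" for b
    unfolding N_def using member_le_sum[OF that, of "weighted_degree ws"] M by simp
  have eq: "poly (\<Sum>k<N. monom (p k x) k) t = h (act t x)" if x: "x \<in> X" for x t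
  proof -
    have "poly (\<Sum>k<N. monom (p k x) k) t =
        (\<Sum>k<N. \<Sum>b\<in>{b \<in> M. weighted_degree ws b = k}. q b * monomial_fun (length ws) b x * t ^ weighted_degree ws b)"
      by (simp add: poly_sum poly_monom p_def sum_distrib_right)
    also have "\<dots> = (\<Sum>b\<in>M. q b * monomial_fun (length ws) b x * t ^ weighted_degree ws b)"
      by (rule sum.group) (use M N in auto)
    also have "\<dots> = h (act t x)"
    proof -
      have "monomial_fun (length ws) b (act t x) = t ^ weighted_degree ws b * monomial_fun (length ws) b x" for b
        unfolding act_eq[OF x] by (rule monomial_fun_scale) (use X_len[OF x] in simp)
      then show ?thesis unfolding h using act_X[OF x] by (simp add: mult_ac)
    qed
    finally show ?thesis .
  qed
  show ?thesis
  proof (rule that[of p N])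
    show "p k \<in> homogeneous_funs ws k" for k unfolding p_def using M by (intro homogeneous_funsI) auto
    fix k x assume "k \<ge> N"
    then have "{b \<in> M. weighted_degree ws b = k} = {}" using N by fastforce
    then show "p k x = 0" unfolding p_def by (simp only: sum.empty)
  next
    fix x assume "x \<in> X"
    then show "trace h x = (\<Sum>k<N. monom (p k x) k)" by (intro trace_eq eq)
  next
    fix x t assume "x \<in> X" "t \<noteq> (0 :: 'k)"
    then show "h (act t x) = poly (\<Sum>k<N. monom (p k x) k) t" by (intro eq[symmetric])
  qed
qed

lemma coeff_sum_monom: "coeff (\<Sum>k<N. monom (p k) k) i = (if i < N then p i else (0 :: 'k))"
  by (simp add: coeff_sum sum.delta)

lemma trace_poly:
  assumes "h \<in> carrier KX" "x \<in> X" "t \<noteq> 0" shows "poly (trace h x) t = h (act t x)"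
  using trace_decomp[OF assms(1)] assms(2,3) by metis

lemma comp_restrict: "h \<in> carrier KX \<Longrightarrow> \<exists>p\<in>homogeneous_funs ws k. comp h k = restrict p X"
proof -
  assume h: "h \<in> carrier KX"
  obtain N p where p: "\<And>k. p k \<in> homogeneous_funs ws k" "\<And>k x. k \<ge> N \<Longrightarrow> p k x = 0"
    "\<And>x. x \<in> X \<Longrightarrow> trace h x = (\<Sum>k<N. monom (p k x) k)"
    by (rule trace_decomp[OF h]) blast
  have "comp h k = restrict (p k) X"
    unfolding comp_def by (rule restrict_ext) (use p(2)[of k] in \<open>auto simp: p(3) coeff_sum_monom\<close>)
  then show ?thesis using p(1) by blast
qed

lemma comp_finite: "h \<in> carrier KX \<Longrightarrow> \<exists>N. \<forall>k\<ge>N. \<forall>x\<in>X. comp h k x = 0"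
proof -
  assume h: "h \<in> carrier KX"
  obtain N p where p: "\<And>k x. k \<ge> N \<Longrightarrow> p k x = 0" "\<And>x. x \<in> X \<Longrightarrow> trace h x = (\<Sum>k<N. monom (p k x) k)"
    by (rule trace_decomp[OF h]) blast
  then show ?thesis by (intro exI[of _ N]) (simp add: comp_def coeff_sum_monom)
qed

lemma KX_D: "h \<in> carrier KX \<Longrightarrow> x \<notin> X \<Longrightarrow> h x = undefined"
  unfolding coordinate_ring_def by auto

lemma KX_eqI:
  assumes "h \<in> carrier KX" "g \<in> carrier KX" "\<And>k x. x \<in> X \<Longrightarrow> comp h k x = comp g k x"
  shows "h = g"
proof
  fix x show "h x = g x"
  proof (cases "x \<in> X")
    case True
    have "trace h x = trace g x" by (rule poly_eqI) (use assms(3)[OF True] True in \<open>simp add: comp_def\<close>)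
    then show ?thesis using trace_poly[OF assms(1) True, of 1] trace_poly[OF assms(2) True, of 1] act_1[OF True] by simp
  qed (use KX_D assms(1,2) in metis)
qed

text \<open>The value zero at negative \<open>m\<close> matches the dual cone; no nonzero function
  on \<open>X\<close> has negative weight.\<close>

definition Psi :: "('k list \<Rightarrow> 'k) \<Rightarrow> int \<Rightarrow> ('k list set, 'k) ratfun" where
  "Psi h m = (if m < 0 then \<zero>\<^bsub>YY.KY\<^esub> else YY.R U012 (gY m (comp h (nat m))))"

lemma gY_restrict: "y \<in> U012 \<Longrightarrow> gY m (restrict p X) y = gY m p y"
  using lift(1) unfolding gY_def X0_def by simp

lemma germ_gY_restrict:
  assumes "p \<in> homogeneous_funs ws w"
  shows "YY.germ U012 (gY (int w) (restrict p X))" "YY.R U012 (gY (int w) (restrict p X)) = YY.R U012 (gY (int w) p)"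
proof -
  have g: "YY.germ U012 (gY (int w) p)" by (rule germ_gY[OF assms])
  have "gY (int w) (restrict p X) \<in> reg YY U012"
    by (rule YY.reg_cong[of "gY (int w) p"]) (use g gY_restrict in auto)
  then show g': "YY.germ U012 (gY (int w) (restrict p X))" using g by blast
  show "YY.R U012 (gY (int w) (restrict p X)) = YY.R U012 (gY (int w) p)"
    by (rule YY.R_eqI[OF g' g U012_open U012_nonempty]) (rule gY_restrict)
qed

lemma germ_comp:
  assumes "h \<in> carrier KX" "m \<ge> 0" shows "YY.germ U012 (gY m (comp h (nat m)))"
proof -
  obtain p where p: "p \<in> homogeneous_funs ws (nat m)" "comp h (nat m) = restrict p X" using comp_restrict[OF assms(1)] by blast
  show ?thesis using germ_gY_restrict(1)[OF p(1)] assms(2) unfolding p(2) by simp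
qed

lemma Psi_sections:
  assumes "h \<in> carrier KX" shows "Psi h (int w) \<in> sections YY (qdiv (\<lambda>l. of_nat w * rr l))"
proof -
  obtain p where p: "p \<in> homogeneous_funs ws w" "comp h w = restrict p X" using comp_restrict[OF assms(1)] by blast
  show ?thesis unfolding Psi_def using gY_sections[OF p(1)] germ_gY_restrict(2)[OF p(1)] p(2) by simp
qed

lemma Psi_zero_iff:
  assumes "h \<in> carrier KX" "m \<ge> 0" shows "Psi h m = \<zero>\<^bsub>YY.KY\<^esub> \<longleftrightarrow> (\<forall>y\<in>U012. gY m (comp h (nat m)) y = 0)"
  using YY.R_eq_zero_iff[OF germ_comp[OF assms]] assms(2) unfolding Psi_def by simp

lemma carrier_SA: "F \<in> carrier SA \<longleftrightarrow> finite {m. F m \<noteq> \<zero>\<^bsub>YY.KY\<^esub>} \<and>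
    (\<forall>w. F (int w) \<in> sections YY (qdiv (\<lambda>l. of_nat w * rr l))) \<and> (\<forall>m<0. F m = \<zero>\<^bsub>YY.KY\<^esub>)"
proof -
  have "(\<forall>m. if of_int m \<in> dual_cone {0..} then F m \<in> sections YY (eval_polyhedral (coord_divisor rr) (of_int m))
      else F m = \<zero>\<^bsub>YY.KY\<^esub>) \<longleftrightarrow>
    (\<forall>w. F (int w) \<in> sections YY (qdiv (\<lambda>l. of_nat w * rr l))) \<and> (\<forall>m<0. F m = \<zero>\<^bsub>YY.KY\<^esub>)" (is "?L \<longleftrightarrow> ?R")
  proof
    assume L: ?L
    show ?R
    proof (intro conjI allI impI)
      fix w show "F (int w) \<in> sections YY (qdiv (\<lambda>l. of_nat w * rr l))"
        using L[rule_format, of "int w"] by (simp add: dual_cone_atLeast eval_coord_divisor)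
    next
      fix m :: int assume "m < 0"
      then show "F m = \<zero>\<^bsub>YY.KY\<^esub>" using L[rule_format, of m] by (simp add: dual_cone_atLeast)
    qed
  next
    assume R: ?R
    show ?L
    proof
      fix m show "if of_int m \<in> dual_cone {0..} then F m \<in> sections YY (eval_polyhedral (coord_divisor rr) (of_int m))
        else F m = \<zero>\<^bsub>YY.KY\<^esub>"
      proof (cases "m \<ge> 0")
        case True
        then have "m = int (nat m)" by simp
        then obtain w where m: "m = int w" by blast
        show ?thesis using R unfolding m by (simp add: dual_cone_atLeast eval_coord_divisor)
      qed (use R in \<open>simp add: dual_cone_atLeast\<close>)
    qed
  qed
  then show ?thesis unfolding section_algebra_def Let_def by simp
qed

lemma Psi_carrier:
  assumes "h \<in> carrier KX" shows "Psi h \<in> carrier SA"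
  unfolding carrier_SA
proof (intro conjI allI impI Psi_sections[OF assms])
  obtain N where N: "\<And>k x. k \<ge> N \<Longrightarrow> x \<in> X \<Longrightarrow> comp h k x = 0" using comp_finite[OF assms] by blast
  have sup: "m \<in> {0..<int N}" if "Psi h m \<noteq> \<zero>\<^bsub>YY.KY\<^esub>" for m
  proof (rule ccontr)
    assume m: "m \<notin> {0..<int N}"
    have m0: "m \<ge> 0" using that unfolding Psi_def by (auto split: if_splits)
    have "gY m (comp h (nat m)) y = 0" if "y \<in> U012" for y
      using N[of "nat m"] m m0 lift(1)[OF that] unfolding gY_def X0_def by simp
    then show False using that Psi_zero_iff[OF assms m0] by blast
  qed
  have "{m. Psi h m \<noteq> \<zero>\<^bsub>YY.KY\<^esub>} \<subseteq> {0..<int N}" by (intro subsetI sup) (rule CollectD)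
  then show "finite {m. Psi h m \<noteq> \<zero>\<^bsub>YY.KY\<^esub>}" by (rule finite_subset) simp
  show "Psi h m = \<zero>\<^bsub>YY.KY\<^esub>" if "m < 0" for m using that by (simp add: Psi_def)
qed

text \<open>The components lift one by one and only finitely many are nonzero; the trace of the sum
  of the lifts has exactly these lifts as coefficients.\<close>

lemma Psi_surj:
  assumes F: "F \<in> carrier SA" shows "\<exists>h\<in>carrier KX. Psi h = F"
proof -
  have "\<forall>w. \<exists>p. p \<in> homogeneous_funs ws w \<and> F (int w) = YY.R U012 (gY (int w) p)"
    using sections_gY F unfolding carrier_SA by metis
  then obtain p where p: "\<And>w. p w \<in> homogeneous_funs ws w" "\<And>w. F (int w) = YY.R U012 (gY (int w) (p w))" by metis
  define A where "A = {w. F (int w) \<noteq> \<zero>\<^bsub>YY.KY\<^esub>}"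
  have "finite (int -` {m. F m \<noteq> \<zero>\<^bsub>YY.KY\<^esub>})" using F unfolding carrier_SA by (intro finite_vimageI) auto
  then have A: "finite A" unfolding A_def vimage_def by simp
  define h where "h = (\<lambda>x\<in>X. \<Sum>w\<in>A. p w x)"
  have "p w \<in> poly_funs 3" for w using p(1) homogeneous_funs_subset[of ws w] unfolding length_ws by blast
  then have hK: "h \<in> carrier KX" unfolding h_def coordinate_ring_def by (auto intro!: imageI poly_funs_sum)
  have tr: "trace h x = (\<Sum>w\<in>A. monom (p w x) w)" if x: "x \<in> X" for x
  proof (rule trace_eq)
    fix t :: 'k assume "t \<noteq> 0"
    have "p w (act t x) = t ^ w * p w x" for w
      unfolding act_eq[OF x] by (rule homogeneous_funs_scale[OF p(1)]) (use X_len[OF x] in simp)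
    then show "poly (\<Sum>w\<in>A. monom (p w x) w) t = h (act t x)"
      using act_X[OF x] by (simp add: h_def poly_sum poly_monom mult.commute)
  qed
  have cm: "comp h w x = (if w \<in> A then p w x else 0)" if "x \<in> X" for w x
    using that A by (simp add: comp_def tr coeff_sum sum.delta)
  have "Psi h m = F m" for m
  proof (cases "m < 0")
    case True then show ?thesis using F unfolding carrier_SA Psi_def by simp
  next
    case False
    then have "m = int (nat m)" by simp
    then obtain w where m: "m = int w" by blast
    have g: "YY.germ U012 (gY (int w) (comp h w))" using germ_comp[OF hK, of "int w"] by simp
    have e: "gY (int w) (comp h w) y = (if w \<in> A then gY (int w) (p w) y else 0)" if "y \<in> U012" for y
      using cm[of "lift y" w] lift(1)[OF that] unfolding gY_def X0_def by simp
    have Psi: "Psi h (int w) = YY.R U012 (gY (int w) (comp h w))" by (simp add: Psi_def)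
    show ?thesis
    proof (cases "w \<in> A")
      case True
      show ?thesis unfolding m Psi p(2)
        by (rule YY.R_eqI[OF g germ_gY[OF p(1)] U012_open U012_nonempty]) (use e True in simp)
    next
      case False
      then have "F (int w) = \<zero>\<^bsub>YY.KY\<^esub>" unfolding A_def by simp
      then show ?thesis unfolding m Psi using YY.R_eq_zero_iff[OF g] e False by simp
    qed
  qed
  then show ?thesis using hK by blast
qed

lemma comp_determined:
  assumes h: "h \<in> carrier KX" "g \<in> carrier KX" and eq: "Psi h (int k) = Psi g (int k)" and x: "x \<in> X"
  shows "comp h k x = comp g k x"
proof -
  obtain p where p: "p \<in> homogeneous_funs ws k" "comp h k = restrict p X" using comp_restrict[OF h(1)] by blast
  obtain q where q: "q \<in> homogeneous_funs ws k" "comp g k = restrict q X" using comp_restrict[OF h(2)] by blast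
  have "YY.R U012 (gY (int k) p) = YY.R U012 (gY (int k) q)"
    using eq germ_gY_restrict(2)[OF p(1)] germ_gY_restrict(2)[OF q(1)] p(2) q(2) by (simp add: Psi_def)
  then show ?thesis using gY_inj[OF p(1) q(1) _ x] p(2) q(2) x by simp
qed

lemma Psi_inj: "h \<in> carrier KX \<Longrightarrow> g \<in> carrier KX \<Longrightarrow> Psi h = Psi g \<Longrightarrow> h = g"
  by (rule KX_eqI) (auto intro: comp_determined)

lemma Psi_comp:
  assumes "m \<ge> 0" "h \<in> carrier KX" "g \<in> carrier KX" "h' \<in> carrier KX"
    and "\<And>y. y \<in> U012 \<Longrightarrow> gY m (comp h' (nat m)) y = F (gY m (comp h (nat m)) y) (gY m (comp g (nat m)) y)"
    and "YY.germ U012 (\<lambda>y. F (gY m (comp h (nat m)) y) (gY m (comp g (nat m)) y))"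
  shows "Psi h' m = YY.R U012 (\<lambda>y. F (gY m (comp h (nat m)) y) (gY m (comp g (nat m)) y))"
  unfolding Psi_def using assms(1)
  by (simp, intro YY.R_eqI[OF germ_comp[OF assms(4,1)] assms(6) U012_open U012_nonempty] assms(5)) auto

lemma KX_mult_closed: "h \<in> carrier KX \<Longrightarrow> g \<in> carrier KX \<Longrightarrow> h \<otimes>\<^bsub>KX\<^esub> g \<in> carrier KX"
proof -
  assume "h \<in> carrier KX" "g \<in> carrier KX"
  then obtain p q where p: "p \<in> poly_funs 3" "q \<in> poly_funs 3" "h = restrict p X" "g = restrict q X"
    unfolding coordinate_ring_def by auto
  have "h \<otimes>\<^bsub>KX\<^esub> g = restrict (\<lambda>x. p x * q x) X" unfolding p(3,4) coordinate_ring_def by (auto simp: restrict_def)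
  then show ?thesis using poly_funs_mult[OF p(1,2)] unfolding coordinate_ring_def by auto
qed

lemma KX_add_closed: "h \<in> carrier KX \<Longrightarrow> g \<in> carrier KX \<Longrightarrow> h \<oplus>\<^bsub>KX\<^esub> g \<in> carrier KX"
proof -
  assume "h \<in> carrier KX" "g \<in> carrier KX"
  then obtain p q where p: "p \<in> poly_funs 3" "q \<in> poly_funs 3" "h = restrict p X" "g = restrict q X"
    unfolding coordinate_ring_def by auto
  have "h \<oplus>\<^bsub>KX\<^esub> g = restrict (\<lambda>x. p x + q x) X" unfolding p(3,4) coordinate_ring_def by (auto simp: restrict_def)
  then show ?thesis using poly_funs_add[OF p(1,2)] unfolding coordinate_ring_def by auto
qed

lemma KX_smult_closed: "h \<in> carrier KX \<Longrightarrow> c \<odot>\<^bsub>KX\<^esub> h \<in> carrier KX"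
proof -
  assume "h \<in> carrier KX"
  then obtain p where p: "p \<in> poly_funs 3" "h = restrict p X"
    unfolding coordinate_ring_def by auto
  have "c \<odot>\<^bsub>KX\<^esub> h = restrict (\<lambda>x. c * p x) X" unfolding p(2) coordinate_ring_def by (auto simp: restrict_def)
  then show ?thesis using poly_funs_smult[OF p(1)] unfolding coordinate_ring_def by auto
qed

lemma KX_one_closed: "\<one>\<^bsub>KX\<^esub> \<in> carrier KX"
  unfolding coordinate_ring_def using poly_funs_const[of 1 3] by auto

lemma comp_ops:
  assumes x: "x \<in> X" and h: "h \<in> carrier KX" and g: "g \<in> carrier KX"
  shows "comp (h \<otimes>\<^bsub>KX\<^esub> g) k x = (\<Sum>i\<le>k. comp h i x * comp g (k - i) x)"
    and "comp (h \<oplus>\<^bsub>KX\<^esub> g) k x = comp h k x + comp g k x"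
    and "comp (c \<odot>\<^bsub>KX\<^esub> h) k x = c * comp h k x"
    and "comp \<one>\<^bsub>KX\<^esub> k x = (if k = 0 then 1 else 0)"
proof -
  have a: "act t x \<in> X" for t by (rule act_X[OF x])
  have "trace (h \<otimes>\<^bsub>KX\<^esub> g) x = trace h x * trace g x" "trace (h \<oplus>\<^bsub>KX\<^esub> g) x = trace h x + trace g x"
    "trace (c \<odot>\<^bsub>KX\<^esub> h) x = Polynomial.smult c (trace h x)" "trace \<one>\<^bsub>KX\<^esub> x = 1"
    by (rule trace_eq, use a trace_poly[OF h x] trace_poly[OF g x] in \<open>simp add: coordinate_ring_def\<close>)+
  then show "comp (h \<otimes>\<^bsub>KX\<^esub> g) k x = (\<Sum>i\<le>k. comp h i x * comp g (k - i) x)"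
    "comp (h \<oplus>\<^bsub>KX\<^esub> g) k x = comp h k x + comp g k x"
    "comp (c \<odot>\<^bsub>KX\<^esub> h) k x = c * comp h k x"
    "comp \<one>\<^bsub>KX\<^esub> k x = (if k = 0 then 1 else 0)"
    using x by (simp_all add: comp_def coeff_mult)
qed

lemma lift_X: "y \<in> U012 \<Longrightarrow> lift y \<in> X" using lift(1) unfolding X0_def by blast

lemma SA_ops: "(F \<otimes>\<^bsub>SA\<^esub> G) m = (\<Oplus>\<^bsub>YY.KY\<^esub>i\<in>{i. F i \<noteq> \<zero>\<^bsub>YY.KY\<^esub> \<and> G (m - i) \<noteq> \<zero>\<^bsub>YY.KY\<^esub>}. F i \<otimes>\<^bsub>YY.KY\<^esub> G (m - i))"
  "(F \<oplus>\<^bsub>SA\<^esub> G) m = F m \<oplus>\<^bsub>YY.KY\<^esub> G m" "(c \<odot>\<^bsub>SA\<^esub> F) m = const_ratfun YY c \<otimes>\<^bsub>YY.KY\<^esub> F m"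
  "\<one>\<^bsub>SA\<^esub> m = (if m = 0 then \<one>\<^bsub>YY.KY\<^esub> else \<zero>\<^bsub>YY.KY\<^esub>)"
  unfolding section_algebra_def Let_def by simp_all

text \<open>The product in the section algebra runs over pairs with both factors nonzero, the
  coefficient of a product of traces over all indices up to \<open>m\<close>; the extra pairs
  contribute zero, and additivity of \<open>chi\<close> in its weight matches the
  denominators.\<close>

lemma Psi_mult:
  assumes h: "h \<in> carrier KX" and g: "g \<in> carrier KX"
  shows "Psi (h \<otimes>\<^bsub>KX\<^esub> g) = Psi h \<otimes>\<^bsub>SA\<^esub> Psi g"
proof
  fix m
  define S where "S = {i. Psi h i \<noteq> \<zero>\<^bsub>YY.KY\<^esub> \<and> Psi g (m - i) \<noteq> \<zero>\<^bsub>YY.KY\<^esub>}"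
  have S: "S \<subseteq> {0..m}" unfolding S_def Psi_def by (auto split: if_splits)
  then have Sf: "finite S" by (rule finite_subset) simp
  define \<phi> where "\<phi> i y = gY i (comp h (nat i)) y * gY (m - i) (comp g (nat (m - i))) y" for i y
  have gh: "YY.germ U012 (gY i (comp h (nat i)))" if "i \<in> {0..m}" for i
    by (rule germ_comp[OF h]) (use that in simp)
  have gg: "YY.germ U012 (gY (m - i) (comp g (nat (m - i))))" if "i \<in> {0..m}" for i
    by (rule germ_comp[OF g]) (use that in simp)
  have g\<phi>: "YY.germ U012 (\<phi> i)" if "i \<in> {0..m}" for i
    unfolding \<phi>_def by (rule YY.germ_same(2)[OF gh[OF that] gg[OF that]])
  have term_eq: "Psi h i \<otimes>\<^bsub>YY.KY\<^esub> Psi g (m - i) = YY.R U012 (\<phi> i)" if "i \<in> {0..m}" for i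
    using YY.R_mult_same[OF gh[OF that] gg[OF that]] that unfolding Psi_def \<phi>_def by simp
  have "(Psi h \<otimes>\<^bsub>SA\<^esub> Psi g) m = (\<Oplus>\<^bsub>YY.KY\<^esub>i\<in>S. Psi h i \<otimes>\<^bsub>YY.KY\<^esub> Psi g (m - i))"
    unfolding SA_ops S_def ..
  also have "\<dots> = (\<Oplus>\<^bsub>YY.KY\<^esub>i\<in>S. YY.R U012 (\<phi> i))"
    by (rule YY.KY.finsum_cong') (use S term_eq YY.R_carrier[OF g\<phi>] in auto)
  also have "\<dots> = YY.R U012 (\<lambda>y. \<Sum>i\<in>S. \<phi> i y)"
    by (rule YY.R_finsum[OF Sf U012_open U012_nonempty]) (use g\<phi> S in blast)
  also have "\<dots> = Psi (h \<otimes>\<^bsub>KX\<^esub> g) m"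
  proof (cases "m < 0")
    case True
    then have "S = {}" using S by auto
    then show ?thesis using YY.const_same(1)[OF U012_open U012_nonempty] True by (simp add: Psi_def)
  next
    case False
    then have m0: "m \<ge> 0" by simp
    have hg: "h \<otimes>\<^bsub>KX\<^esub> g \<in> carrier KX" by (rule KX_mult_closed[OF h g])
    have "(\<Sum>i\<in>S. \<phi> i y) = gY m (comp (h \<otimes>\<^bsub>KX\<^esub> g) (nat m)) y" if y: "y \<in> U012" for y
    proof -
      have "\<phi> i y = 0" if i: "i \<in> {0..m} - S" for i
      proof -
        have "Psi h i = \<zero>\<^bsub>YY.KY\<^esub> \<or> Psi g (m - i) = \<zero>\<^bsub>YY.KY\<^esub>" using i unfolding S_def by blast
        then show ?thesis using Psi_zero_iff[OF h, of i] Psi_zero_iff[OF g, of "m - i"] i y unfolding \<phi>_def by auto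
      qed
      then have "(\<Sum>i\<in>S. \<phi> i y) = (\<Sum>i\<in>{0..m}. \<phi> i y)"
        by (intro sum.mono_neutral_left) (use S in auto)
      also have "\<dots> = (\<Sum>i\<le>nat m. \<phi> (int i) y)"
        by (rule sum.reindex_bij_witness[of _ int nat]) (use m0 in auto)
      also have "\<dots> = (\<Sum>i\<le>nat m. comp h i (lift y) * comp g (nat m - i) (lift y) / chi m (lift y))"
      proof (rule sum.cong)
        fix i assume i: "i \<in> {..nat m}"
        have "chi m (lift y) = chi (int i) (lift y) * chi (m - int i) (lift y)"
          using chi_add[OF lift(1)[OF y], of "int i" "m - int i"] by simp
        moreover have "nat (m - int i) = nat m - i" using i m0 by auto
        ultimately show "\<phi> (int i) y = comp h i (lift y) * comp g (nat m - i) (lift y) / chi m (lift y)"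
          unfolding \<phi>_def gY_def by simp
      qed simp
      also have "\<dots> = gY m (comp (h \<otimes>\<^bsub>KX\<^esub> g) (nat m)) y"
        unfolding gY_def comp_ops(1)[OF lift_X[OF y] h g] sum_divide_distrib ..
      finally show ?thesis .
    qed
    then have "YY.R U012 (\<lambda>y. \<Sum>i\<in>S. \<phi> i y) = YY.R U012 (gY m (comp (h \<otimes>\<^bsub>KX\<^esub> g) (nat m)))"
      by (intro YY.R_eqI[OF _ germ_comp[OF hg m0] U012_open U012_nonempty] conjI U012_open U012_nonempty YY.reg_sum)
        (use g\<phi> S in blast)+
    then show ?thesis using m0 by (simp add: Psi_def)
  qed
  finally show "Psi (h \<otimes>\<^bsub>KX\<^esub> g) m = (Psi h \<otimes>\<^bsub>SA\<^esub> Psi g) m" ..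
qed

lemma Psi_add:
  assumes h: "h \<in> carrier KX" and g: "g \<in> carrier KX"
  shows "Psi (h \<oplus>\<^bsub>KX\<^esub> g) = Psi h \<oplus>\<^bsub>SA\<^esub> Psi g"
proof
  fix m show "Psi (h \<oplus>\<^bsub>KX\<^esub> g) m = (Psi h \<oplus>\<^bsub>SA\<^esub> Psi g) m"
  proof (cases "m < 0")
    case True then show ?thesis unfolding SA_ops Psi_def by simp
  next
    case False
    then have m: "m \<ge> 0" by simp
    note gh = germ_comp[OF h m] and gg = germ_comp[OF g m]
    have "Psi (h \<oplus>\<^bsub>KX\<^esub> g) m = YY.R U012 (\<lambda>y. gY m (comp h (nat m)) y + gY m (comp g (nat m)) y)"
      by (rule Psi_comp[where F = "(+)", OF m h g KX_add_closed[OF h g] _ YY.germ_same(1)[OF gh gg]])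
        (simp add: gY_def comp_ops(2)[OF lift_X h g] add_divide_distrib)
    then show ?thesis unfolding SA_ops using YY.R_add_same[OF gh gg] m by (simp add: Psi_def)
  qed
qed

lemma germ_const_U012: "YY.germ U012 (\<lambda>y. c)"
  using U012_open U012_nonempty YY.reg_const[OF U012_open] by blast

lemma const_ratfun_U012: "const_ratfun YY c = YY.R U012 (\<lambda>y. c)"
  unfolding const_ratfun_def
  by (rule YY.R_eqI[OF YY.germ_const germ_const_U012 U012_open U012_nonempty]) simp

lemma Psi_smult:
  assumes h: "h \<in> carrier KX" shows "Psi (c \<odot>\<^bsub>KX\<^esub> h) = c \<odot>\<^bsub>SA\<^esub> Psi h"
proof
  fix m show "Psi (c \<odot>\<^bsub>KX\<^esub> h) m = (c \<odot>\<^bsub>SA\<^esub> Psi h) m"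
  proof (cases "m < 0")
    case True
    have "const_ratfun YY c \<in> carrier YY.KY" unfolding const_ratfun_U012 by (rule YY.R_carrier[OF germ_const_U012])
    then show ?thesis using True unfolding SA_ops Psi_def by simp
  next
    case False
    then have m: "m \<ge> 0" by simp
    note gh = germ_comp[OF h m]
    have "Psi (c \<odot>\<^bsub>KX\<^esub> h) m = YY.R U012 (\<lambda>y. c * gY m (comp h (nat m)) y)"
      by (rule Psi_comp[where F = "\<lambda>a b. c * a", OF m h h KX_smult_closed[OF h] _ YY.germ_same(2)[OF germ_const_U012 gh]])
        (simp add: gY_def comp_ops(3)[OF lift_X h h])
    then show ?thesis unfolding SA_ops const_ratfun_U012 using YY.R_mult_same[OF germ_const_U012 gh] m by (simp add: Psi_def)
  qed
qed

lemma Psi_one: "Psi \<one>\<^bsub>KX\<^esub> = \<one>\<^bsub>SA\<^esub>"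
proof
  fix m show "Psi \<one>\<^bsub>KX\<^esub> m = \<one>\<^bsub>SA\<^esub> m"
  proof (cases "m < 0")
    case False
    then have m: "m \<ge> 0" by simp
    have e: "gY m (comp \<one>\<^bsub>KX\<^esub> (nat m)) y = (if m = 0 then 1 else 0)" if "y \<in> U012" for y
      using m by (simp add: gY_def comp_ops(4)[OF lift_X[OF that] KX_one_closed KX_one_closed] chi_0)
    note g1 = germ_comp[OF KX_one_closed m]
    show ?thesis
    proof (cases "m = 0")
      case True
      have "YY.R U012 (gY m (comp \<one>\<^bsub>KX\<^esub> (nat m))) = \<one>\<^bsub>YY.KY\<^esub>"
        unfolding YY.R_eq_one_iff[OF g1] using e True by simp
      then show ?thesis unfolding SA_ops Psi_def using True by simp
    next
      case False
      have "YY.R U012 (gY m (comp \<one>\<^bsub>KX\<^esub> (nat m))) = \<zero>\<^bsub>YY.KY\<^esub>"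
        unfolding YY.R_eq_zero_iff[OF g1] using e False by simp
      then show ?thesis unfolding SA_ops Psi_def using False m by simp
    qed
  qed (simp add: SA_ops Psi_def)
qed

text \<open>For a nonnegative weight the trace of a function of weight \<open>m\<close> is a
  monomial of degree \<open>m\<close>, and a trace with this one coefficient gives back the scaling
  law; for \<open>m < 0\<close> both conditions force \<open>h\<close> to be zero.\<close>

lemma weight_iff:
  assumes h: "h \<in> carrier KX"
  shows "h \<in> weight_space 3 X act m \<longleftrightarrow> (\<forall>j. j \<noteq> m \<longrightarrow> Psi h j = \<zero>\<^bsub>YY.KY\<^esub>)"
proof
  assume w: "h \<in> weight_space 3 X act m"
  show "\<forall>j. j \<noteq> m \<longrightarrow> Psi h j = \<zero>\<^bsub>YY.KY\<^esub>"
  proof (intro allI impI)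
    fix j assume j: "j \<noteq> m"
    show "Psi h j = \<zero>\<^bsub>YY.KY\<^esub>"
    proof (cases "j < 0")
      case False
      then have j0: "j \<ge> 0" by simp
      have "comp h (nat j) x = 0" if x: "x \<in> X" for x
      proof (cases "m < 0")
        case True
        then have "h = (\<lambda>x\<in>X. 0)" using weight_space_neg[of X ws act m] w X_len act_eq act_X unfolding length_ws by auto
        then have "trace h x = 0" by (intro trace_eq) (use act_X[OF x] in simp)
        then show ?thesis using x by (simp add: comp_def)
      next
        case False
        have "trace h x = monom (h x) (nat m)"
        proof (rule trace_eq)
          fix t :: 'k assume "t \<noteq> 0"
          then have "h (act t x) = t powi m * h x" using w x unfolding weight_space_def by blast
          then show "poly (monom (h x) (nat m)) t = h (act t x)" using False by (simp add: poly_monom power_int_def)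
        qed
        then show ?thesis using x j j0 False by (simp add: comp_def)
      qed
      then show ?thesis unfolding Psi_zero_iff[OF h j0] by (auto simp: gY_def lift_X)
    qed (simp add: Psi_def)
  qed
next
  assume z: "\<forall>j. j \<noteq> m \<longrightarrow> Psi h j = \<zero>\<^bsub>YY.KY\<^esub>"
  \<comment> \<open>The zero function, written as a scalar multiple of \<open>h\<close>; comparison
    with it turns vanishing of \<open>Psi h j\<close> into vanishing of a component.\<close>
  define z0 where "z0 = (0 :: 'k) \<odot>\<^bsub>KX\<^esub> h"
  have z0: "z0 \<in> carrier KX" unfolding z0_def by (rule KX_smult_closed[OF h])
  have co: "comp z0 k x = 0" if "x \<in> X" for k x unfolding z0_def comp_ops(3)[OF that h h] by simp
  have "Psi z0 j = \<zero>\<^bsub>YY.KY\<^esub>" if "j \<ge> 0" for j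
    unfolding Psi_zero_iff[OF z0 that] by (auto simp: gY_def lift_X co)
  then have ch: "comp h k x = 0" if "x \<in> X" "int k \<noteq> m" for k x
    using comp_determined[OF h z0 _ that(1), of k] z that co by simp
  have "h (act t x) = t powi m * h x" if "t \<noteq> 0" "x \<in> X" for t x
  proof (cases "m < 0")
    case True
    then have "trace h x = 0" by (intro poly_eqI) (use ch[OF that(2)] that(2) in \<open>simp add: comp_def\<close>)
    then have "h (act t x) = 0" if "t \<noteq> 0" for t using trace_poly[OF h \<open>x \<in> X\<close> that] by simp
    from this[of t] this[of 1] show ?thesis using act_1 that by simp
  next
    case False
    then have m: "m = int (nat m)" by simp
    have tr: "trace h x = monom (comp h (nat m) x) (nat m)"
    proof (rule poly_eqI)
      fix k show "coeff (trace h x) k = coeff (monom (comp h (nat m) x) (nat m)) k"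
        using ch[OF that(2), of k] m that(2) by (cases "nat m = k") (auto simp: comp_def)
    qed
    have "h (act t x) = t ^ nat m * comp h (nat m) x" if "t \<noteq> 0" for t
      using trace_poly[OF h \<open>x \<in> X\<close> that] unfolding tr by (simp add: poly_monom mult.commute)
    from this[of t] this[of 1] show ?thesis using act_1 that False by (simp add: power_int_def)
  qed
  then show "h \<in> weight_space 3 X act m" unfolding weight_space_def using h by blast
qed

lemma graded_iso: "graded_algebra_iso KX (weight_space 3 X act) SA (section_piece YY {0..} (coord_divisor rr)) Psi"
  unfolding graded_algebra_iso_def
proof (intro conjI allI ballI)
  have "Psi \<in> Ring.ring_hom KX SA"
    by (rule ring_hom_memI) (simp_all only: Psi_carrier Psi_mult Psi_add Psi_one)
  moreover have "bij_betw Psi (carrier KX) (carrier SA)"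
    unfolding bij_betw_def inj_on_def using Psi_inj Psi_surj Psi_carrier by blast
  ultimately show "Psi \<in> ring_iso KX SA" unfolding ring_iso_def by blast
  show "Psi (c \<odot>\<^bsub>KX\<^esub> h) = c \<odot>\<^bsub>SA\<^esub> Psi h" if "h \<in> carrier KX" for c h by (rule Psi_smult[OF that])
  fix m
  show "Psi ` weight_space 3 X act m = section_piece YY {0..} (coord_divisor rr) m"
  proof (intro equalityI subsetI)
    fix F assume "F \<in> Psi ` weight_space 3 X act m"
    then obtain h where h: "h \<in> weight_space 3 X act m" "F = Psi h" by blast
    then have "h \<in> carrier KX" unfolding weight_space_def by blast
    then show "F \<in> section_piece YY {0..} (coord_divisor rr) m"
      unfolding section_piece_def using h weight_iff Psi_carrier by blast
  next
    fix F assume F: "F \<in> section_piece YY {0..} (coord_divisor rr) m"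
    then obtain h where "h \<in> carrier KX" "Psi h = F" using Psi_surj unfolding section_piece_def by blast
    then show "F \<in> Psi ` weight_space 3 X act m" using weight_iff F unfolding section_piece_def by blast
  qed
qed

text \<open>Multiplied by \<open>EE\<close>, the degree becomes the pairing of \<open>s\<close> with
  \<open>f\<close>, which is 1; so the degree is \<open>1 / EE\<close>.\<close>

lemma degree_rr: "(\<Sum>l<3. rr l * of_nat (v ! l)) > 0"
proof -
  have "(\<Sum>l<3. rr l * of_nat (v ! l)) * of_nat EE = (\<Sum>l<3. of_int (s l * int (f l)))"
    unfolding sum_distrib_right
  proof (rule sum.cong)
    fix l :: nat assume "l \<in> {..<3}"
    then have l: "l < 3" by simp
    have "rr l * of_nat (v ! l) * of_nat EE = rr l * of_nat (v ! l * EE)" by simp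
    also have "\<dots> = of_int (s l * int (f l))"
      unfolding f_e[OF l, symmetric] using e_pos[OF l] by (simp add: rr_def)
    finally show "rr l * of_nat (v ! l) * of_nat EE = of_int (s l * int (f l))" .
  qed simp
  also have "\<dots> = of_int 1" unfolding s_eq[symmetric] by simp
  finally have "0 < (\<Sum>l<3. rr l * of_nat (v ! l)) * of_nat EE" by simp
  then show ?thesis by (rule zero_less_mult_pos2) (use EE_pos in simp)
qed

theorem quotient_pp_divisor:
  "pp_divisor YY {0..} (coord_divisor rr) \<and> corresponds_to_action YY {0..} (coord_divisor rr) 3 X act"
  unfolding corresponds_to_action_def
  by (intro conjI exI[of _ Psi] pp_divisor_coord[OF degree_rr] projective_variety_YY normal_variety_YY
      X.closedin_C X.normal_variety_XC torus_action_X graded_iso)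

end

section \<open>The arithmetic of the exponents\<close>

text \<open>Divided by \<open>d\<close>, the three numbers have no common divisor, so the pairwise
  gcds are coprime to each other and the two that involve a given number both split off from it. The
  remaining factors have coprime cross terms, from which the lcm is assembled.\<close>

lemma exponent_factorisation:
  fixes d0 d1 d2 :: nat
  assumes pos: "d0 > 0" "d1 > 0" "d2 > 0"
    and d: "d = gcd d0 (gcd d1 d2)"
    and d01: "d01 = gcd (d0 div d) (d1 div d)"
    and d02: "d02 = gcd (d0 div d) (d2 div d)"
    and d12: "d12 = gcd (d1 div d) (d2 div d)"
  obtains e0 e1 e2 where "d0 = e0 * (d * d01 * d02)" "d1 = e1 * (d * d01 * d12)" "d2 = e2 * (d * d02 * d12)"
    "lcm d0 (lcm d1 d2) = d * d01 * d02 * d12 * e0 * e1 * e2"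
    "algebraic_semidom_class.coprime d01 d02" "algebraic_semidom_class.coprime d01 d12" "algebraic_semidom_class.coprime d02 d12"
proof -
  define c0 c1 c2 where "c0 = d0 div d" and "c1 = d1 div d" and "c2 = d2 div d"
  note D = d01[folded c0_def c1_def] d02[folded c0_def c2_def] d12[folded c1_def c2_def]
  have dpos: "d > 0" using pos d by simp
  have "d dvd d0" "d dvd d1" "d dvd d2" unfolding d by (auto intro: dvd_trans[OF gcd_dvd2])
  then have dc: "d0 = d * c0" "d1 = d * c1" "d2 = d * c2" unfolding c0_def c1_def c2_def by simp_all
  have "gcd (d * c0) (gcd (d * c1) (d * c2)) = d" unfolding dc[symmetric] by (rule d[symmetric])
  then have "d * gcd c0 (gcd c1 c2) = d" by (simp only: gcd_mult_distrib_nat)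
  then have g: "gcd c0 (gcd c1 c2) = 1" using dpos by simp
  have pw: "algebraic_semidom_class.coprime d01 d02" "algebraic_semidom_class.coprime d01 d12" "algebraic_semidom_class.coprime d02 d12"
  proof -
    have "is_unit x" if "x dvd c0" "x dvd c1" "x dvd c2" for x
      using that g by (metis gcd_greatest)
    then show "algebraic_semidom_class.coprime d01 d02" "algebraic_semidom_class.coprime d01 d12" "algebraic_semidom_class.coprime d02 d12"
      unfolding D by (auto intro!: algebraic_semidom_class.coprimeI)
  qed
  have "d01 * d02 dvd c0" using pw(1) D by (intro divides_mult) auto
  then obtain e0 where e0: "c0 = d01 * d02 * e0" by (rule dvdE)
  have "d01 * d12 dvd c1" using pw(2) D by (intro divides_mult) auto
  then obtain e1 where e1: "c1 = d01 * d12 * e1" by (rule dvdE)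
  have "d02 * d12 dvd c2" using pw(3) D by (intro divides_mult) auto
  then obtain e2 where e2: "c2 = d02 * d12 * e2" by (rule dvdE)
  have cpos: "c0 > 0" "c1 > 0" "c2 > 0" using dc pos by auto
  then have dd: "d01 > 0" "d02 > 0" "d12 > 0" unfolding D by simp_all
  \<comment> \<open>Two numbers divided by their gcd become coprime.\<close>
  have red: "algebraic_semidom_class.coprime x y" if "c = z * x" "c' = z * y" "gcd c c' = z" "z > 0" for c c' x y z :: nat
  proof -
    have "z * gcd x y = z" using that(3) unfolding that(1,2) by (simp only: gcd_mult_distrib_nat)
    then show ?thesis using that(4) by (simp add: coprime_iff_gcd_eq_1)
  qed
  have c01: "algebraic_semidom_class.coprime (d02 * e0) (d12 * e1)"
    by (rule red[OF _ _ D(1)[symmetric] dd(1)]) (simp_all only: e0 e1 mult_ac)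
  have c02: "algebraic_semidom_class.coprime (d01 * e0) (d12 * e2)"
    by (rule red[OF _ _ D(2)[symmetric] dd(2)]) (simp_all only: e0 e2 mult_ac)
  have c12: "algebraic_semidom_class.coprime (d01 * e1) (d02 * e2)"
    by (rule red[OF _ _ D(3)[symmetric] dd(3)]) (simp_all only: e1 e2 mult_ac)
  have "lcm c1 c2 = d12 * lcm (d01 * e1) (d02 * e2)"
    unfolding e1 e2 by (simp add: lcm_mult_distrib_nat mult_ac)
  also have "\<dots> = d12 * d02 * d01 * (e1 * e2)" using lcm_coprime[OF c12] by (simp add: mult_ac)
  finally have l12: "lcm c1 c2 = d12 * d02 * d01 * (e1 * e2)" .
  have "lcm c0 (lcm c1 c2) = d01 * d02 * lcm e0 (d12 * (e1 * e2))"
    unfolding l12 e0 by (simp add: lcm_mult_distrib_nat mult_ac)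
  moreover have "algebraic_semidom_class.coprime e0 (d12 * (e1 * e2))"
    using c01 c02 by (simp add: coprime_mult_left_iff coprime_mult_right_iff)
  ultimately have "lcm c0 (lcm c1 c2) = d01 * d02 * d12 * e0 * e1 * e2"
    using lcm_coprime[of e0 "d12 * (e1 * e2)"] by (simp add: mult_ac)
  then have "lcm d0 (lcm d1 d2) = d * d01 * d02 * d12 * e0 * e1 * e2"
    unfolding dc lcm_mult_distrib_nat[symmetric] by (simp add: mult_ac)
  then show ?thesis using that[of e0 e1 e2] dc e0 e1 e2 pw by (simp add: mult_ac)
qed

lemma axes_cases3:
  assumes "{i, j, k} = {0, 1, 2 :: nat}"
    and "P 0 1 2" "P 0 2 1" "P 1 0 2" "P 1 2 0" "P 2 0 1" "P 2 1 0"
  shows "P i j k"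
proof -
  have "i \<in> {0, 1, 2}" "j \<in> {0, 1, 2}" "k \<in> {0, 1, 2}" unfolding assms(1)[symmetric] by blast+
  moreover have "card {i, j, k} = 3" unfolding assms(1) by simp
  then have "i \<noteq> j" "i \<noteq> k" "j \<noteq> k" by (auto simp: card_insert_if split: if_splits)
  ultimately show ?thesis using assms(2-) by auto
qed

theorem proposition5p9:
  fixes d0 d1 d2 d d01 d02 d12 dt db :: nat
    and s0 s1 s2 :: int
    and X :: "'k::{alg_closed_field, field_char_0} list set"
    and act :: "'k \<Rightarrow> 'k list \<Rightarrow> 'k list"
    and Y :: "('k list set, 'k) fun_space"
    and D0 D1 D2 :: "'k list set set \<Rightarrow> int"
    and \<Delta>0 \<Delta>1 \<Delta>2 \<sigma> :: "rat set"
  assumes "d0 \<ge> 2" and "d1 \<ge> 2" and "d2 \<ge> 2"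
    and "X = {[x0, x1, x2] | x0 x1 x2. x0 ^ d0 + x1 ^ d1 + x2 ^ d2 = 0}"
    and "d = gcd d0 (gcd d1 d2)"
    and "d01 = gcd (d0 div d) (d1 div d)"
    and "d02 = gcd (d0 div d) (d2 div d)"
    and "d12 = gcd (d1 div d) (d2 div d)"
    and "dt = d * d01 * d02 * d12"
    and "db = lcm d0 (lcm d1 d2)"
    and "s0 * int (db div d0) + s1 * int (db div d1) + s2 * int (db div d2) = 1"
    and "\<And>t x0 x1 x2. act t [x0, x1, x2] =
           [t ^ (db div d0) * x0, t ^ (db div d1) * x1, t ^ (db div d2) * x2]"
    and "Y = wproj_space_on [d12, d02, d01]
           (wproj_zero_set [d12, d02, d01]
             (\<lambda>w. (w ! 0) ^ (dt div d12) + (w ! 1) ^ (dt div d02) + (w ! 2) ^ (dt div d01)))"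
    and "D0 = point_sum (points Y \<inter> wproj_zero_set [d12, d02, d01] (\<lambda>w. w ! 0))"
    and "D1 = point_sum (points Y \<inter> wproj_zero_set [d12, d02, d01] (\<lambda>w. w ! 1))"
    and "D2 = point_sum (points Y \<inter> wproj_zero_set [d12, d02, d01] (\<lambda>w. w ! 2))"
    and "\<Delta>0 = {of_int s0 * of_nat (d * d01 * d02) / of_nat d0 ..}"
    and "\<Delta>1 = {of_int s1 * of_nat (d * d01 * d12) / of_nat d1 ..}"
    and "\<Delta>2 = {of_int s2 * of_nat (d * d02 * d12) / of_nat d2 ..}"
    and "\<sigma> = {0 ..}"
  shows "pp_divisor Y \<sigma> [(\<Delta>0, D0), (\<Delta>1, D1), (\<Delta>2, D2)]
    \<and> corresponds_to_action Y \<sigma> [(\<Delta>0, D0), (\<Delta>1, D1), (\<Delta>2, D2)] 3 X act"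
proof -
  have pos: "d0 > 0" "d1 > 0" "d2 > 0" using assms(1-3) by simp_all
  obtain e0 e1 e2 where e: "d0 = e0 * (d * d01 * d02)" "d1 = e1 * (d * d01 * d12)" "d2 = e2 * (d * d02 * d12)"
    and l: "lcm d0 (lcm d1 d2) = d * d01 * d02 * d12 * e0 * e1 * e2"
    and co: "algebraic_semidom_class.coprime d01 d02" "algebraic_semidom_class.coprime d01 d12" "algebraic_semidom_class.coprime d02 d12"
    by (rule exponent_factorisation[OF pos assms(5-8)])
  have P: "d > 0" "d01 > 0" "d02 > 0" "d12 > 0" "e0 > 0" "e1 > 0" "e2 > 0"
    using pos unfolding e by (auto intro: Nat.gr0I)
  \<comment> \<open>The quotients of the lcm by the exponents are the weights of the action; written
    out they have the shape \<open>v_i e_j e_k\<close> required of \<open>f\<close>.\<close>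
  have db: "db = d0 * (d12 * (e1 * e2))" "db = d1 * (d02 * (e0 * e2))" "db = d2 * (d01 * (e0 * e1))"
    unfolding assms(10) l unfolding e by (simp_all only: mult_ac)
  have F: "db div d0 = d12 * (e1 * e2)" "db div d1 = d02 * (e0 * e2)" "db div d2 = d01 * (e0 * e1)"
    using pos db by (metis nonzero_mult_div_cancel_left less_numeral_extra(3))+
  have A: "dt div d12 = d * d01 * d02" "dt div d02 = d * d01 * d12" "dt div d01 = d * d02 * d12"
    unfolding assms(9) using P by (simp_all add: mult_ac)
  define a where "a l = (if l = 0 then d * d01 * d02 else if l = 1 then d * d01 * d12 else d * d02 * d12)" for l :: nat
  define n where "n l = (if l = 0 then d0 else if l = 1 then d1 else d2)" for l :: nat
  define ee where "ee l = (if l = 0 then e0 else if l = 1 then e1 else e2)" for l :: nat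
  define ff where "ff l = (if l = 0 then d12 * (e1 * e2) else if l = 1 then d02 * (e0 * e2) else d01 * (e0 * e1))" for l :: nat
  define s where "s l = (if l = 0 then s0 else if l = 1 then s1 else s2)" for l :: nat
  define v where "v = [d12, d02, d01]"
  define C :: "'k list set" where "C = {x. length x = 3 \<and> x ! 0 ^ a 0 + x ! 1 ^ a 1 + x ! 2 ^ a 2 = 0}"
  have sum3: "(\<Sum>l<3. g l) = g 0 + g 1 + g (2 :: nat)" for g :: "nat \<Rightarrow> int"
    by (simp add: numeral_3_eq_3 numeral_2_eq_2)
  have less3: "l = 0 \<or> l = 1 \<or> l = 2" if "l < 3" for l :: nat using that by linarith
  have Xn: "X = {x. length x = 3 \<and> x ! 0 ^ n 0 + x ! 1 ^ n 1 + x ! 2 ^ n 2 = 0}"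
  proof (intro equalityI subsetI)
    fix x assume "x \<in> X" then show "x \<in> {x. length x = 3 \<and> x ! 0 ^ n 0 + x ! 1 ^ n 1 + x ! 2 ^ n 2 = 0}"
      unfolding assms(4) by (auto simp: n_def)
  next
    fix x :: "'k list" assume x: "x \<in> {x. length x = 3 \<and> x ! 0 ^ n 0 + x ! 1 ^ n 1 + x ! 2 ^ n 2 = 0}"
    then obtain x0 x1 x2 where "x = [x0, x1, x2]" by (auto simp: numeral_3_eq_3 length_Suc_conv)
    then show "x \<in> X" using x unfolding assms(4) by (auto simp: n_def)
  qed
  interpret Q: pham_quotient a C v d n X ee ff s act
  proof
    show "a l > 0" if "l < 3" for l using P by (simp add: a_def)
    show "n l > 0" if "l < 3" for l using pos by (simp add: n_def)
    show "C = {x. length x = 3 \<and> x ! 0 ^ a 0 + x ! 1 ^ a 1 + x ! 2 ^ a 2 = 0}" by (rule C_def)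
    show "X = {x. length x = 3 \<and> x ! 0 ^ n 0 + x ! 1 ^ n 1 + x ! 2 ^ n 2 = 0}" by (rule Xn)
    show "length v = 3" by (simp add: v_def)
    show "v ! l > 0" if "l < 3" for l using less3[OF that] P by (auto simp: v_def)
    show "gcd (v ! l) (v ! m) = 1" if "l < 3" "m < 3" "l \<noteq> m" for l m
      using less3[OF that(1)] less3[OF that(2)] that(3) co
      by (elim disjE) (simp_all add: v_def coprime_iff_gcd_eq_1 gcd.commute)
    show "d > 0" by (rule P)
    show "a l * v ! l = d * v ! 0 * v ! 1 * v ! 2" if "l < 3" for l
      using less3[OF that] by (elim disjE) (simp_all add: a_def v_def mult_ac)
    show "n l = ee l * a l" if "l < 3" for l
      using less3[OF that] e by (elim disjE) (simp_all add: a_def n_def ee_def)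
    show "ee l > 0" if "l < 3" for l using P by (simp add: ee_def)
    show "ff i = v ! i * (ee j * ee k)" if "{i, j, k} = {0, 1, 2}" for i j k
      by (rule axes_cases3[OF that]) (simp_all add: ff_def v_def ee_def mult_ac)
    show "(\<Sum>l<3. s l * int (ff l)) = 1"
      using assms(11) unfolding F sum3 by (simp add: s_def ff_def)
    show "act t x = map2 (\<lambda>w c. t ^ w * c) [ff 0, ff 1, ff 2] x" if "x \<in> X" for t x
      using that unfolding assms(4) by (auto simp: assms(12) F ff_def)
  qed
  have Fe: "Q.Feq = (\<lambda>w. w ! 0 ^ (dt div d12) + w ! 1 ^ (dt div d02) + w ! 2 ^ (dt div d01))"
    unfolding Q.Feq_def A by (simp add: a_def)
  have Y: "Y = Q.YY" unfolding assms(13) v_def[symmetric] Q.YY_def Fe ..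
  \<comment> \<open>The divisors of the statement are cut out in the ambient punctured space, those
    of the locale on the cone; they agree because vanishing of a coordinate does not depend on the
    representative of an orbit.\<close>
  have cp: "points Y \<inter> wproj_zero_set v (\<lambda>w. w ! l) = Q.coord_points l" if "l < 3" for l
  proof -
    have "Q.Cp \<subseteq> punctured v" using Q.Cp_punctured by blast
    moreover have "x' ! l = 0" if "x' \<in> Q.Cp" "x \<in> punctured v" "x ! l = 0" "orbit v x' = orbit v x" for x x'
    proof -
      have "x \<in> orbit v x'" using orbit_self[of x v] that punctured_length by metis
      then obtain t where "t \<noteq> 0" "x = Q.sc t x'" using Q.orbit_iff by blast
      then show ?thesis using Q.sc_nth[OF Q.Cp_len[OF that(1)] \<open>l < 3\<close>, of t] that(3) by simp
    qed
    ultimately show ?thesis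
      unfolding Y Q.points_YY wproj_zero_set_def Q.coord_points_def by blast
  qed
  have rr: "Q.rr 0 = of_int s0 * of_nat (d * d01 * d02) / of_nat d0" "Q.rr 1 = of_int s1 * of_nat (d * d01 * d12) / of_nat d1"
    "Q.rr 2 = of_int s2 * of_nat (d * d02 * d12) / of_nat d2"
    unfolding e using P by (simp_all add: Q.rr_def s_def ee_def)
  have "[(\<Delta>0, D0), (\<Delta>1, D1), (\<Delta>2, D2)] = Q.coord_divisor Q.rr"
    unfolding Q.coord_divisor_def rr assms(14-19) v_def[symmetric] by (simp add: cp)
  then show ?thesis using Q.quotient_pp_divisor unfolding Y assms(20) by simp
qed

end
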